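(* Let $f,g_1,\dots,g_m\in\mathbb{R}[x]$, $g=(g_1,\dots,g_m)$ and $f^\star:=\inf_{x\in S(g)}f(x)$. Assume that the problem $\inf_{x\in S(g)}f(x)$ has at least one global minimizer, and that $f(C(g))$ is finite (possibly empty). Then: (i) there exists $k\in\mathbb{N}$ such that $\rho_k(f,\Pi g,h_{\mathrm{FJ}})=f^\star$; (ii) if $S(g)$ satisfies the Archimedean condition, there exists $k\in\mathbb{N}$ such that $\rho_k(f,g,h_{\mathrm{FJ}})=f^\star$; (iii) if there exists $R>0$ such that $g_m=R-x_1^2-\dots-x_n^2$, then for all sufficiently large $k\in\mathbb{N}$ the Slater condition holds for the SOS relaxation of order $k$ associated with $f$, $g$ and $h=h_{\mathrm{FJ}}$.
   Context: Let $n,m\ge 1$, $x=(x_1,\dots,x_n)$, $\bar\lambda:=(\lambda_0,\dots,\lambda_m)$; polynomials in $x$ are also regarded as polynomials in $z:=(x,\bar\lambda)$. $\nabla p$ is the (column) gradient with respect to $x$. $S(g):=\{x\in\mathbb{R}^n : g_j(x)\ge 0,\ j=1,\dots,m\}$. For $x\in\mathbb{R}^n$, $\varphi^g(x)$ is the real $(n+m)\times m$ matrix whose $j$-th column is $\nabla g_j(x)$ followed by $g_j(x)e_j$, $e_j$ being the $j$-th standard basis vector of $\mathbb{R}^m$; $C(g):=\{x\in\mathbb{R}^n : \mathrm{rank}(\varphi^g(x))<m\}$. $S(g)$ satisfies the Archimedean condition if there is $R>0$ with $R-x_1^2-\dots-x_n^2\in\Sigma^2[x]+\sum_{j=1}^m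 g_j\Sigma^2[x]$, where $\Sigma^2[\cdot]$ denotes the cone of sums of squares of polynomials. $\Pi g:=(g^\alpha)_{\alpha\in\{0,1\}^m\setminus\{0\}}$ with $g^\alpha:=g_1^{\alpha_1}\cdots g_m^{\alpha_m}$. The tuple $h_{\mathrm{FJ}}$ of $n+m+1$ polynomials in $\mathbb{R}[z]$ is $$h_{\mathrm{FJ}}:=\Big(\lambda_0\nabla f-\sum_{j=1}^m\lambda_j\nabla g_j,\ \lambda_1g_1,\dots,\lambda_mg_m,\ 1-\sum_{j=0}^m\lambda_j^2\Big).$$ For a tuple $G=(G_1,\dots,G_s)$ and a tuple $h=(h_1,\dots,h_l)$ of polynomials in $\mathbb{R}[z]$ and $k\in\mathbb{N}$, $$Q_k(G)[z]:=\Big\{\sigma_0+\sum_{j=1}^s\sigma_jG_j : \sigma_j\in\Sigma^2[z],\ \deg\sigma_0\le 2k,\ \deg(\sigma_jG_j)\le 2k\Big\},$$ $$I_k(h)[z]:=\Big\{\sum_{t=1}^l\psi_th_t : \psi_t\in\mathbb{R}[z],\ \deg(\psi_th_t)\le 2k\Big\},$$ $$\rho_k(f,G,h):=\sup\{\xi\in\mathbb{R} : f-\xi\in Q_k(G)[z]+I_k(h)[z]\}.$$ The SOS relaxation of order $k$ associated with $f,G,h$ is the semidefinite program of maximizing $\xi$ over $\xi\in\mathbb{R}$, positive semidefinite real symmetric matrices $A_0,\dots,A_s$ and real vectors $u_1,\dots,u_l$ subject to $$f-\xi=v_k^\top A_0v_k+\sum_{j=1}^sG_j\,v_{k-d_j}^\top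 A_jv_{k-d_j}+\sum_{t=1}^lh_t\,u_t^\top v_{2(k-r_t)},$$ where $v_d$ is the vector of all monomials in $z$ of degree at most $d$, $d_j=\lceil\deg(G_j)/2\rceil$ and $r_t=\lceil\deg(h_t)/2\rceil$. The Slater condition holds for this program if it has a feasible point with all $A_0,\dots,A_s$ positive definite. *)

theory Defs
  imports
    "HOL-Library.Poly_Mapping"
    "HOL-Library.Extended_Real"
    "Jordan_Normal_Form.DL_Rank"
begin

section \<open>Real multivariate polynomials\<close>

text \<open>
  Polynomials over countably many indeterminates \<open>Var 0, Var 1, \<dots>\<close>. The ring in the first
  \<open>N\<close> of them is the subset \<open>polys N\<close>, so that \<open>polys n \<subseteq> polys (n + m + 1)\<close>: a polynomial
  in \<open>x\<close> is literally also a polynomial in \<open>z = (x, \<lambda>\<^sub>0, \<dots>, \<lambda>\<^sub>m)\<close>. The indeterminate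
  \<open>x\<^sub>i\<close> (\<open>1 \<le> i \<le> n\<close>) is \<open>Var (i - 1)\<close> and \<open>\<lambda>\<^sub>j\<close> (\<open>0 \<le> j \<le> m\<close>) is \<open>Var (n + j)\<close>.
\<close>

type_synonym mono = "nat \<Rightarrow>\<^sub>0 nat"
type_synonym rpoly = "mono \<Rightarrow>\<^sub>0 real"

definition Const :: "real \<Rightarrow> rpoly" where
  "Const c = Poly_Mapping.single 0 c"

definition Var :: "nat \<Rightarrow> rpoly" where
  "Var i = Poly_Mapping.single (Poly_Mapping.single i 1) 1"

definition polys :: "nat \<Rightarrow> rpoly set" where
  "polys N = {p. \<forall>t\<in>Poly_Mapping.keys p. Poly_Mapping.keys t \<subseteq> {..<N}}"

definition mono_deg :: "mono \<Rightarrow> nat" where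
  "mono_deg t = (\<Sum>i\<in>Poly_Mapping.keys t. Poly_Mapping.lookup t i)"

text \<open>Total degree; the zero polynomial has degree 0.\<close>

definition deg :: "rpoly \<Rightarrow> nat" where
  "deg p = Max (insert 0 (mono_deg ` Poly_Mapping.keys p))"

definition peval :: "rpoly \<Rightarrow> real vec \<Rightarrow> real" where
  "peval p x = (\<Sum>t\<in>Poly_Mapping.keys p.
     Poly_Mapping.lookup p t * (\<Prod>i\<in>Poly_Mapping.keys t. (x $ i) ^ Poly_Mapping.lookup t i))"

text \<open>
  Formal partial derivative. Subtraction of monomials truncates, but only in terms whose
  coefficient is 0.
\<close>

definition partial :: "nat \<Rightarrow> rpoly \<Rightarrow> rpoly" where
  "partial i p = (\<Sum>t\<in>Poly_Mapping.keys p.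
     Poly_Mapping.single (t - Poly_Mapping.single i 1)
       (Poly_Mapping.lookup p t * real (Poly_Mapping.lookup t i)))"

definition SOS :: "nat \<Rightarrow> rpoly set" where
  "SOS N = {(\<Sum>p\<leftarrow>ps. p\<^sup>2) | ps. set ps \<subseteq> polys N}"


section \<open>The feasible set and its critical locus\<close>

text \<open>Tuples are lists, so \<open>g\<^sub>j\<close> is \<open>g ! (j - 1)\<close>.\<close>

definition feasible_set :: "nat \<Rightarrow> rpoly list \<Rightarrow> real vec set" where
  "feasible_set n g = {x \<in> carrier_vec n. \<forall>j<length g. peval (g ! j) x \<ge> 0}"

definition phi :: "nat \<Rightarrow> rpoly list \<Rightarrow> real vec \<Rightarrow> real mat" where
  "phi n g x = mat (n + length g) (length g) (\<lambda>(i, j).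
     if i < n then peval (partial i (g ! j)) x
     else if i = n + j then peval (g ! j) x else 0)"

definition critical_set :: "nat \<Rightarrow> rpoly list \<Rightarrow> real vec set" where
  "critical_set n g = {x \<in> carrier_vec n. vec_space.rank (n + length g) (phi n g x) < length g}"

definition archimedean :: "nat \<Rightarrow> rpoly list \<Rightarrow> bool" where
  "archimedean n g \<longleftrightarrow>
     (\<exists>R>0. \<exists>\<sigma>0\<in>SOS n. \<exists>\<sigma>. (\<forall>j<length g. \<sigma> j \<in> SOS n) \<and>
        Const R - (\<Sum>i<n. (Var i)\<^sup>2) = \<sigma>0 + (\<Sum>j<length g. g ! j * \<sigma> j))"

definition opt_value :: "nat \<Rightarrow> rpoly \<Rightarrow> rpoly list \<Rightarrow> ereal" where
  "opt_value n f g = (INF x\<in>feasible_set n g. ereal (peval f x))"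

definition products :: "rpoly list \<Rightarrow> rpoly list" where
  "products g = [\<Prod>j<length g. (g ! j) ^ (\<alpha> ! j).
     \<alpha> \<leftarrow> List.n_lists (length g) [0, 1], \<alpha> \<noteq> replicate (length g) 0]"

definition h_FJ :: "nat \<Rightarrow> rpoly \<Rightarrow> rpoly list \<Rightarrow> rpoly list" where
  "h_FJ n f g =
     [Var n * partial i f - (\<Sum>j<length g. Var (n + (j + 1)) * partial i (g ! j)). i \<leftarrow> [0..<n]]
   @ [Var (n + (j + 1)) * g ! j. j \<leftarrow> [0..<length g]]
   @ [1 - (\<Sum>j\<le>length g. (Var (n + j))\<^sup>2)]"


section \<open>Truncated quadratic modules, truncated ideals and the relaxation values\<close>

text \<open>In the following \<open>N\<close> is the number of indeterminates, i.e. the length of \<open>z\<close>.\<close>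

definition qmodule :: "nat \<Rightarrow> nat \<Rightarrow> rpoly list \<Rightarrow> rpoly set" where
  "qmodule N k G = {\<sigma>0 + (\<Sum>j<length G. \<sigma> j * G ! j) | \<sigma>0 \<sigma>.
     \<sigma>0 \<in> SOS N \<and> deg \<sigma>0 \<le> 2 * k \<and>
     (\<forall>j<length G. \<sigma> j \<in> SOS N \<and> deg (\<sigma> j * G ! j) \<le> 2 * k)}"

definition tideal :: "nat \<Rightarrow> nat \<Rightarrow> rpoly list \<Rightarrow> rpoly set" where
  "tideal N k h = {(\<Sum>t<length h. \<psi> t * h ! t) | \<psi>.
     \<forall>t<length h. \<psi> t \<in> polys N \<and> deg (\<psi> t * h ! t) \<le> 2 * k}"

text \<open>The supremum is taken in the extended reals, since the set may be empty or unbounded.\<close>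

definition rho :: "nat \<Rightarrow> nat \<Rightarrow> rpoly \<Rightarrow> rpoly list \<Rightarrow> rpoly list \<Rightarrow> ereal" where
  "rho N k f G h =
     (SUP \<xi>\<in>{\<xi>. \<exists>q\<in>qmodule N k G. \<exists>p\<in>tideal N k h. f - Const \<xi> = q + p}. ereal \<xi>)"


section \<open>The SOS relaxation as a semidefinite program\<close>

text \<open>
  Degree bounds are integers, so that \<open>k - d\<close> is not truncated: for a negative bound there
  are no monomials and the vector is empty.
\<close>

definition monomials :: "nat \<Rightarrow> int \<Rightarrow> mono set" where
  "monomials N d = {t. Poly_Mapping.keys t \<subseteq> {..<N} \<and> int (mono_deg t) \<le> d}"

lemma finite_monomials: "finite (monomials N d)"
proof -
  define F :: "(nat \<Rightarrow> nat) set" where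
    "F = {f. \<forall>i. (i \<in> {..<N} \<longrightarrow> f i \<in> {..nat d}) \<and> (i \<notin> {..<N} \<longrightarrow> f i = 0)}"
  have "Poly_Mapping.lookup ` monomials N d \<subseteq> F"
  proof
    fix f assume "f \<in> Poly_Mapping.lookup ` monomials N d"
    then obtain t where f: "f = Poly_Mapping.lookup t"
      and t: "Poly_Mapping.keys t \<subseteq> {..<N}" "int (mono_deg t) \<le> d"
      by (auto simp: monomials_def)
    have "Poly_Mapping.lookup t i \<le> nat d" for i
    proof (cases "i \<in> Poly_Mapping.keys t")
      case True
      then have "Poly_Mapping.lookup t i \<le> mono_deg t"
        unfolding mono_deg_def by (intro member_le_sum) auto
      with t(2) show ?thesis by linarith
    qed (simp add: in_keys_iff)
    moreover have "Poly_Mapping.lookup t i = 0" if "i \<notin> {..<N}" for i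
      using t(1) that by (metis in_keys_iff subsetD)
    ultimately show "f \<in> F" unfolding F_def f by auto
  qed
  moreover have "finite F"
    unfolding F_def by (rule finite_set_of_finite_funs) auto
  ultimately have "finite (Poly_Mapping.lookup ` monomials N d)"
    by (rule finite_subset)
  moreover have "inj_on Poly_Mapping.lookup (monomials N d)"
    by (auto intro: inj_onI poly_mapping_eqI)
  ultimately show ?thesis
    by (simp add: finite_image_iff)
qed

text \<open>
  The vector of all monomials of degree at most \<open>d\<close>, listed in the linear order that the
  library provides on finitely supported functions (the order plays no role).
\<close>

definition mono_vec :: "nat \<Rightarrow> int \<Rightarrow> rpoly vec" where
  "mono_vec N d = vec_of_list
     (map (\<lambda>t. Poly_Mapping.single t 1) (sorted_list_of_set (monomials N d)))"

definition half_deg :: "rpoly \<Rightarrow> int" where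
  "half_deg p = \<lceil>real (deg p) / 2\<rceil>"

definition gram_poly :: "rpoly vec \<Rightarrow> real mat \<Rightarrow> rpoly" where
  "gram_poly v A = v \<bullet> (map_mat Const A *\<^sub>v v)"

definition sym_mat :: "nat \<Rightarrow> real mat \<Rightarrow> bool" where
  "sym_mat d A \<longleftrightarrow> A \<in> carrier_mat d d \<and> transpose_mat A = A"

definition psd :: "nat \<Rightarrow> real mat \<Rightarrow> bool" where
  "psd d A \<longleftrightarrow> sym_mat d A \<and> (\<forall>v\<in>carrier_vec d. v \<bullet> (A *\<^sub>v v) \<ge> 0)"

definition pos_def :: "nat \<Rightarrow> real mat \<Rightarrow> bool" where
  "pos_def d A \<longleftrightarrow> sym_mat d A \<and> (\<forall>v\<in>carrier_vec d. v \<noteq> 0\<^sub>v d \<longrightarrow> v \<bullet> (A *\<^sub>v v) > 0)"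

text \<open>
  \<open>A0\<close> is the matrix of \<open>\<sigma>\<^sub>0\<close>; \<open>A j\<close> and \<open>u t\<close> belong to \<open>G ! j\<close> and \<open>h ! t\<close> (counted from 0).
\<close>

definition sos_feasible ::
  "nat \<Rightarrow> nat \<Rightarrow> rpoly \<Rightarrow> rpoly list \<Rightarrow> rpoly list \<Rightarrow>
   real \<Rightarrow> real mat \<Rightarrow> (nat \<Rightarrow> real mat) \<Rightarrow> (nat \<Rightarrow> real vec) \<Rightarrow> bool" where
  "sos_feasible N k f G h \<xi> A0 A u \<longleftrightarrow>
     psd (dim_vec (mono_vec N (int k))) A0 \<and>
     (\<forall>j<length G. psd (dim_vec (mono_vec N (int k - half_deg (G ! j)))) (A j)) \<and>
     (\<forall>t<length h. u t \<in> carrier_vec (dim_vec (mono_vec N (2 * (int k - half_deg (h ! t)))))) \<and>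
     f - Const \<xi> =
       gram_poly (mono_vec N (int k)) A0
       + (\<Sum>j<length G. G ! j * gram_poly (mono_vec N (int k - half_deg (G ! j))) (A j))
       + (\<Sum>t<length h. h ! t *
            (map_vec Const (u t) \<bullet> mono_vec N (2 * (int k - half_deg (h ! t)))))"

definition slater :: "nat \<Rightarrow> nat \<Rightarrow> rpoly \<Rightarrow> rpoly list \<Rightarrow> rpoly list \<Rightarrow> bool" where
  "slater N k f G h \<longleftrightarrow>
     (\<exists>\<xi> A0 A u. sos_feasible N k f G h \<xi> A0 A u \<and>
        pos_def (dim_vec (mono_vec N (int k))) A0 \<and>
        (\<forall>j<length G. pos_def (dim_vec (mono_vec N (int k - half_deg (G ! j)))) (A j)))"

end

theory Submission
  imports
    Defs
    "HOL-Computational_Algebra.Fraction_Field"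
    "HOL-Algebra.Algebraic_Closure_Type"
    "Jordan_Normal_Form.Char_Poly"
begin

hide_const (open) Polynomials.degree Polynomials.lead_coeff up_ring.coeff up_ring.monom UnivPoly.deg

text \<open>
  Consider a point of the real spectrum of the polynomial ring in \<open>z\<close> at which all entries of
  \<open>h\<^sub>F\<^sub>J\<close> vanish, that is, a prime cone whose support contains them. If \<open>\<lambda>\<^sub>0\<close> is nonzero in the
  residue field and the value of \<open>f\<close> were transcendental over the reals, a derivation of the
  residue field with \<open>D f = 1\<close> would contradict the Lagrange conditions; hence \<open>f\<close> takes a real
  value. If \<open>\<lambda>\<^sub>0 = 0\<close>, then the Artin-Lang theorem yields points of the critical locus with the
  same sign conditions, so that the value of \<open>f\<close> lies in the finite set \<open>f(C(g))\<close>. If the cone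
  contains the \<open>g\<^sub>j\<close> as well, the value is at least \<open>f\<^sup>\<star>\<close>, again by Artin-Lang. By the abstract
  Positivstellensatz \<open>- s\<^sup>2\<close> belongs to the preorder for a product \<open>s\<close> of factors \<open>f - t\<close> with
  \<open>t \<ge> f\<^sup>\<star>\<close>. In the Archimedean case one applies this to the equations alone, which leaves factors
  with \<open>t < f\<^sup>\<star>\<close>; these are positive on the feasible set and are removed by Putinar's argument.
  Now \<open>f - f\<^sup>\<star> + \<epsilon>\<close> is a univariate sum of squares in \<open>f\<close> plus a positive multiple of
  \<open>- (f - f\<^sup>\<star>)\<^sup>2 s\<^sup>2\<close>, with degrees that do not depend on \<open>\<epsilon>\<close>. The converse inequality is the Fritz
  John theorem at a minimizer.

  For the Slater condition, the equations for the ball and for the sphere of multipliers bound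
  every monomial of degree at most \<open>2 k\<close> within the truncated cone; so identity matrices can be
  added to all Gram matrices at the expense of a constant.
\<close>

section \<open>Real closed fields\<close>

text \<open>A representation of \<open>f - f\<^sup>\<star>\<close> itself may not exist; finite
  convergence only asks for one order \<open>k\<close> that serves
  \<open>f - f\<^sup>\<star> + \<epsilon>\<close> for every \<open>\<epsilon> > 0\<close>. This is
  why the certificate concerns \<open>- s\<^sup>2\<close>: it is fixed once, and
  \<open>\<epsilon>\<close> enters only through a positive coefficient and through univariate
  squares of bounded degree. A prime cone is a set of polynomials, whereas signs are compared
  between two real closed fields given as types: the reals and the real closure of the residue
  field. No map between the two is at hand, so sign conditions are carried across by eliminating one
  variable at a time in both fields simultaneously. The real closure is obtained as a maximal
  ordered subring of the algebraic closure; its intermediate value property comes from the same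
  abstract Positivstellensatz that later produces the certificate.\<close>

class rcf = linordered_field +
  assumes horner_ivt: "a < b \<Longrightarrow> foldr (\<lambda>c y. c + a * y) cs 0 < 0 \<Longrightarrow>
    0 < foldr (\<lambda>c y. c + b * y) cs 0 \<Longrightarrow>
    \<exists>x. a < x \<and> x < b \<and> foldr (\<lambda>c y. c + x * y) cs 0 = 0"

text \<open>The axiom of \<open>rcf\<close> evaluates a coefficient list by Horner's rule, so that
  it mentions field operations only; this equation turns it into the intermediate value property of
  \<open>poly\<close>.\<close>

lemma poly_Poly_foldr: "poly (Poly cs) x = foldr (\<lambda>c y. c + x * y) cs 0"
  by (induction cs) auto

instance real :: rcf
proof
  fix a b :: real and cs
  assume "a < b" "foldr (\<lambda>c y. c + a * y) cs 0 < 0" "0 < foldr (\<lambda>c y. c + b * y) cs 0"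
  then show "\<exists>x. a < x \<and> x < b \<and> foldr (\<lambda>c y. c + x * y) cs 0 = 0"
    using poly_IVT_pos[of a b "Poly cs"] unfolding poly_Poly_foldr by blast
qed

lemma poly_ivt:
  fixes p :: "'a::rcf poly"
  assumes "a < b" "poly p a < 0" "0 < poly p b"
  shows "\<exists>c. a < c \<and> c < b \<and> poly p c = 0"
  using horner_ivt[of a b "coeffs p"] assms by (simp flip: poly_Poly_foldr)

lemma poly_ivt_neg:
  fixes p :: "'a::rcf poly"
  assumes "a < b" "0 < poly p a" "poly p b < 0"
  shows "\<exists>c. a < c \<and> c < b \<and> poly p c = 0"
  using poly_ivt[of a b "- p"] assms by auto

text \<open>Split off all factors at both ends: \<open>p = (x - a)^m (x - b)^n q\<close>. Then
  \<open>pderiv p\<close> is \<open>(x - a)^(m - 1) (x - b)^(n - 1) g\<close>, and \<open>g\<close>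
  takes opposite signs at \<open>a\<close> and \<open>b\<close> because \<open>q\<close> has the
  same sign at both. This takes the place of the compactness argument over the reals.\<close>

lemma poly_rolle_consecutive:
  fixes p :: "'a::rcf poly"
  assumes "a < b" "poly p a = 0" "poly p b = 0" "p \<noteq> 0"
    and nz: "\<And>x. a < x \<Longrightarrow> x < b \<Longrightarrow> poly p x \<noteq> 0"
  shows "\<exists>c. a < c \<and> c < b \<and> poly (pderiv p) c = 0"
proof -
  define m where "m = Polynomial.order a p"
  obtain q1 where q1: "p = [:- a, 1:] ^ m * q1" "\<not> [:- a, 1:] dvd q1"
    using order_decomp[OF \<open>p \<noteq> 0\<close>] m_def by blast
  have "q1 \<noteq> 0" using q1 by auto
  define n where "n = Polynomial.order b q1"
  obtain q where q: "q1 = [:- b, 1:] ^ n * q" "\<not> [:- b, 1:] dvd q"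
    using order_decomp[OF \<open>q1 \<noteq> 0\<close>] n_def by blast
  have m0: "m > 0" using assms(2) q1 by (cases m) (auto simp: poly_eq_0_iff_dvd)
  have q1a: "poly q1 a \<noteq> 0" using q1(2) by (simp add: poly_eq_0_iff_dvd)
  have qb: "poly q b \<noteq> 0" using q(2) by (simp add: poly_eq_0_iff_dvd)
  have qa: "poly q a \<noteq> 0" using q1a unfolding q(1) by auto
  have "poly q1 b = 0" using assms(1,3) by (simp add: q1(1))
  then have n0: "n > 0" using q(1) qb by (cases n) auto
  have pq: "p = [:- a, 1:] ^ m * [:- b, 1:] ^ n * q" using q q1 by (simp add: mult.assoc)
  have nzq: "poly q x \<noteq> 0" if "a < x" "x < b" for x using nz[OF that] by (auto simp: pq)
  \<comment> \<open>The polynomial \<open>q\<close> has no root in the closed interval, so the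
    intermediate value property forbids a change of sign.\<close>
  have sq: "(poly q a < 0) = (poly q b < 0)"
    using nzq poly_ivt[OF assms(1), of q] poly_ivt_neg[OF assms(1), of q] qa qb
    by (metis linorder_neqE_linordered_idom)
  define g where "g = of_nat m * ([:- b, 1:] * q) + of_nat n * ([:- a, 1:] * q) + [:- a, 1:] * [:- b, 1:] * pderiv q"
  obtain m' n' where mn: "m = Suc m'" "n = Suc n'" using m0 n0 by (metis Suc_pred)
  have d: "pderiv (A ^ Suc k) = of_nat (Suc k) * A ^ k" if "pderiv A = 1" for A :: "'a poly" and k
    unfolding pderiv_power_Suc that by (simp add: of_nat_poly)
  have "pderiv (A ^ Suc m' * B ^ Suc n' * q) =
      A ^ m' * B ^ n' * (of_nat (Suc m') * (B * q) + of_nat (Suc n') * (A * q) + A * B * pderiv q)"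
    if "pderiv A = 1" "pderiv B = 1" for A B
    unfolding pderiv_mult d[OF that(1)] d[OF that(2)] by (simp add: algebra_simps del: of_nat_Suc)
  moreover have "pderiv [:- c, 1:] = 1" for c :: 'a by (simp add: pderiv_pCons pCons_one)
  ultimately have "pderiv p = [:- a, 1:] ^ m' * [:- b, 1:] ^ n' * g"
    unfolding pq g_def mn by metis
  moreover have "\<exists>c. a < c \<and> c < b \<and> poly g c = 0"
  proof -
    have ga: "poly g a = of_nat m * ((a - b) * poly q a)" and gb: "poly g b = of_nat n * ((b - a) * poly q b)"
      by (simp_all only: g_def poly_add poly_mult) (simp_all add: of_nat_poly)
    show ?thesis
    proof (cases "poly q a < 0")
      case True
      then have "poly g a > 0" "poly g b < 0"
        using sq m0 n0 assms(1) by (auto simp: ga gb mult_less_0_iff zero_less_mult_iff)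
      then show ?thesis using poly_ivt_neg assms(1) by blast
    next
      case False
      then have "poly g a < 0" "poly g b > 0"
        using sq m0 n0 assms(1) qa qb by (auto simp: ga gb mult_less_0_iff zero_less_mult_iff)
      then show ?thesis using poly_ivt assms(1) by blast
    qed
  qed
  ultimately show ?thesis by auto
qed

text \<open>There are finitely many roots, so \<open>a\<close> has a next root to its right, and the
  consecutive case applies.\<close>

lemma poly_rolle:
  fixes p :: "'a::rcf poly"
  assumes "a < b" "poly p a = 0" "poly p b = 0"
  shows "\<exists>c. a < c \<and> c < b \<and> poly (pderiv p) c = 0"
proof (cases "p = 0")
  case True
  then show ?thesis using dense[OF assms(1)] by auto
next
  case False
  define S where "S = {x. poly p x = 0 \<and> a < x}"
  have fin: "finite S" unfolding S_def by (rule finite_subset[OF _ poly_roots_finite[OF False]]) auto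
  have b: "b \<in> S" using assms by (simp add: S_def)
  define b' where "b' = Min S"
  have b': "b' \<in> S" "b' \<le> b" using fin b unfolding b'_def by (auto intro: Min_in)
  have "poly p x \<noteq> 0" if "a < x" "x < b'" for x
    using Min_le[OF fin, of x] that unfolding b'_def[symmetric] by (auto simp: S_def)
  from poly_rolle_consecutive[OF _ assms(2) _ False this] b' show ?thesis
    unfolding S_def by (smt (verit) mem_Collect_eq order_less_le_trans)
qed

lemma poly_mvt:
  fixes p :: "'a::rcf poly"
  assumes "a < b"
  shows "\<exists>c. a < c \<and> c < b \<and> poly p b - poly p a = (b - a) * poly (pderiv p) c"
proof -
  define s where "s = (poly p b - poly p a) / (b - a)"
  define r where "r = p - [:poly p a:] - smult s [:- a, 1:]"
  have s: "(b - a) * s = poly p b - poly p a" using assms by (simp add: s_def)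
  have "poly r b = poly p b - poly p a - (b - a) * s" by (simp add: r_def algebra_simps)
  then have "poly r a = 0" "poly r b = 0" using s by (simp_all add: r_def)
  from poly_rolle[OF assms this] obtain c where c: "a < c" "c < b" "poly (pderiv r) c = 0" by blast
  have "poly (pderiv r) c = poly (pderiv p) c - s"
    by (simp add: r_def pderiv_diff pderiv_smult pderiv_pCons)
  then have "poly (pderiv p) c = s" using c by simp
  then show ?thesis using c(1,2) s by metis
qed

lemma poly_increasing:
  fixes p :: "'a::rcf poly"
  assumes "a < b" "\<And>c. a < c \<Longrightarrow> c < b \<Longrightarrow> poly (pderiv p) c > 0"
  shows "poly p a < poly p b"
proof -
  obtain c where "a < c" "c < b" "poly p b - poly p a = (b - a) * poly (pderiv p) c"
    using poly_mvt[OF assms(1)] by blast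
  moreover from this assms have "(b - a) * poly (pderiv p) c > 0" by simp
  ultimately show ?thesis by simp
qed

section \<open>Signs of polynomials near infinity\<close>

lemma poly_eventually_sgn:
  fixes p :: "'a::linordered_field poly"
  assumes "p \<noteq> 0"
  shows "\<exists>M. \<forall>x\<ge>M. sgn (poly p x) = sgn (lead_coeff p)"
proof -
  \<comment> \<open>The induction carries the lower bound \<open>d\<close> along: once
    \<open>\<bar>poly p x\<bar> \<ge> d\<close>, the term \<open>x * poly p x\<close> outweighs the
    constant coefficient for large \<open>x\<close>.\<close>
  have "\<exists>M d. d > 0 \<and> (\<forall>x\<ge>M. sgn (poly p x) = sgn (lead_coeff p) \<and> \<bar>poly p x\<bar> \<ge> d)"
    using assms
  proof (induction p)
    case (pCons a p)
    show ?case
    proof (cases "p = 0")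
      case True
      then show ?thesis using pCons by (intro exI[of _ 0] exI[of _ "\<bar>a\<bar>"]) auto
    next
      case False
      with pCons obtain M d where d: "d > 0"
        and M: "\<And>x. x \<ge> M \<Longrightarrow> sgn (poly p x) = sgn (lead_coeff p) \<and> \<bar>poly p x\<bar> \<ge> d" by blast
      define M' where "M' = max M ((\<bar>a\<bar> + 1) / d)"
      have "sgn (poly (pCons a p) x) = sgn (lead_coeff (pCons a p)) \<and> \<bar>poly (pCons a p) x\<bar> \<ge> 1"
        if x: "x \<ge> M'" for x
      proof -
        have 1: "sgn (poly p x) = sgn (lead_coeff p)" "\<bar>poly p x\<bar> \<ge> d" using M x by (auto simp: M'_def)
        have x1: "x \<ge> (\<bar>a\<bar> + 1) / d" using x by (simp add: M'_def)
        moreover have "(\<bar>a\<bar> + 1) / d > 0" using d by (simp add: add_nonneg_pos)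
        ultimately have x0: "x > 0" by (rule less_le_trans[rotated])
        have "\<bar>a\<bar> + 1 \<le> x * d" using x1 d by (simp add: field_simps)
        also have "\<dots> \<le> x * \<bar>poly p x\<bar>" using x0 1 by simp
        also have "\<dots> = \<bar>x * poly p x\<bar>" using x0 by (simp add: abs_mult)
        finally have 2: "\<bar>a\<bar> + 1 \<le> \<bar>x * poly p x\<bar>" .
        have "sgn (a + y) = sgn y \<and> \<bar>a + y\<bar> \<ge> 1" if "\<bar>a\<bar> + 1 \<le> \<bar>y\<bar>" for y
          using that by (cases "y > 0"; cases "a > 0") (auto simp: sgn_if)
        from this[OF 2] show ?thesis using 1 x0 False by (simp add: sgn_mult)
      qed
      then show ?thesis by (intro exI[of _ M'] exI[of _ 1]) auto
    qed
  qed simp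
  then show ?thesis by blast
qed

lemma poly_eventually_sgn_bot:
  fixes p :: "'a::linordered_field poly"
  assumes "p \<noteq> 0"
  shows "\<exists>M. \<forall>x\<le>M. sgn (poly p x) = sgn (lead_coeff p * (- 1) ^ degree p)"
proof -
  define r where "r = pcompose p [:0, - 1:]"
  have lc: "lead_coeff r = lead_coeff p * (- 1) ^ degree p"
    unfolding r_def by (subst lead_coeff_comp) auto
  then have "lead_coeff r \<noteq> 0" using assms by simp
  then have "r \<noteq> 0" by auto
  from poly_eventually_sgn[OF this]
  obtain M where M: "\<forall>x\<ge>M. sgn (poly r x) = sgn (lead_coeff p * (- 1) ^ degree p)"
    unfolding lc by blast
  have r: "poly r (- x) = poly p x" for x by (simp add: r_def poly_pcompose)
  show ?thesis
  proof (intro exI allI impI)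
    fix x assume "x \<le> - M"
    then have "M \<le> - x" by (simp add: le_minus_iff)
    then have "sgn (poly r (- x)) = sgn (lead_coeff p * (- 1) ^ degree p)" using M by blast
    then show "sgn (poly p x) = sgn (lead_coeff p * (- 1) ^ degree p)" by (simp only: r)
  qed
qed

section \<open>Sign determination\<close>

definition same_sign :: "'a::linordered_idom \<Rightarrow> 'b::linordered_idom \<Rightarrow> bool" where
  "same_sign a b \<longleftrightarrow> (a < 0 \<longleftrightarrow> b < 0) \<and> (a = 0 \<longleftrightarrow> b = 0)"

lemma same_sign_alt:
  fixes a :: "'a::linordered_idom" and b :: "'b::linordered_idom"
  shows "same_sign a b \<longleftrightarrow> (a < 0 \<longleftrightarrow> b < 0) \<and> (0 < a \<longleftrightarrow> 0 < b)"
  unfolding same_sign_def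
  by (cases a "0 :: 'a" rule: linorder_cases; cases b "0 :: 'b" rule: linorder_cases) auto

lemma same_sign_pos: "same_sign a b \<Longrightarrow> 0 < a \<longleftrightarrow> 0 < b"
  by (simp add: same_sign_alt)

lemma same_sign_0 [simp]: "same_sign 0 0"
  by (simp add: same_sign_def)

lemma same_sign_commute: "same_sign a b \<Longrightarrow> same_sign b a"
  by (auto simp: same_sign_def)

lemma same_sign_minus [simp]: "same_sign (- a) (- b) \<longleftrightarrow> same_sign a b"
  by (auto simp: same_sign_alt)

lemma same_sign_mult: "same_sign a b \<Longrightarrow> same_sign c d \<Longrightarrow> same_sign (a * c) (b * d)"
  by (auto simp: same_sign_alt mult_less_0_iff zero_less_mult_iff)

lemma same_sign_power: "same_sign a b \<Longrightarrow> same_sign (a ^ k) (b ^ k)"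
  by (induction k) (simp_all add: same_sign_mult, simp add: same_sign_def)

lemma same_sign_diff: "same_sign (x - u) (y - v) \<longleftrightarrow> (x < u \<longleftrightarrow> y < v) \<and> (u < x \<longleftrightarrow> v < y)"
  by (auto simp: same_sign_alt)

lemma same_sign_swap: "same_sign (x - u) (y - v) \<longleftrightarrow> same_sign (u - x) (v - y)"
  by (auto simp: same_sign_diff)

definition compat :: "('a::linordered_idom \<times> 'b::linordered_idom) set \<Rightarrow> 'a \<Rightarrow> 'b \<Rightarrow> bool" where
  "compat Z x y \<longleftrightarrow> (\<forall>(u, v)\<in>Z. same_sign (x - u) (y - v))"

text \<open>Two ordered fields are compared without a map between them. The finite set
  \<open>Z\<close> pairs breakpoints of one line with breakpoints of the other, in the same order;
  \<open>compat Z x y\<close> says that \<open>x\<close> and \<open>y\<close> lie in corresponding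
  cells, and the last condition says that paired polynomials have equal signs on corresponding
  cells.\<close>

definition matched :: "('a::linordered_idom \<times> 'b::linordered_idom) set \<Rightarrow> ('a poly \<times> 'b poly) set \<Rightarrow> bool" where
  "matched Z I \<longleftrightarrow> finite Z \<and> (\<forall>(u, v)\<in>Z. compat Z u v) \<and>
     (\<forall>x y. compat Z x y \<longrightarrow> (\<forall>(p, q)\<in>I. same_sign (poly p x) (poly q y)))"

lemma compatD: "compat Z x y \<Longrightarrow> (u, v) \<in> Z \<Longrightarrow> (x < u \<longleftrightarrow> y < v) \<and> (u < x \<longleftrightarrow> v < y)"
  unfolding compat_def same_sign_diff by auto

lemma compat_converse: "compat (Z\<inverse>) y x \<longleftrightarrow> compat Z x y"
  unfolding compat_def same_sign_diff by auto

lemma compat_mono: "Z \<subseteq> Z' \<Longrightarrow> compat Z' x y \<Longrightarrow> compat Z x y"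
  unfolding compat_def by auto

lemma exists_between_finite:
  fixes L U :: "'a::linordered_field set"
  assumes "finite L" "finite U" "\<And>l u. l \<in> L \<Longrightarrow> u \<in> U \<Longrightarrow> l < u"
  shows "\<exists>x. (\<forall>l\<in>L. l < x) \<and> (\<forall>u\<in>U. x < u)"
proof (cases "L = {} \<or> U = {}")
  case True
  show ?thesis
  proof (cases "L = {}")
    case True
    show ?thesis
    proof (cases "U = {}")
      case False
      obtain x where "x < Min U" using lt_ex by blast
      then show ?thesis using assms True False by auto
    qed (use True in auto)
  next
    case False
    obtain x where "Max L < x" using gt_ex by blast
    then show ?thesis using assms False True by auto
  qed
next
  case False
  then have "Max L < Min U" using assms by (meson Max_in Min_in)
  then obtain x where "Max L < x" "x < Min U" using dense by blast
  then show ?thesis using assms False by (auto simp: Max_less_iff)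
qed

text \<open>This produces a point of the first field from a point of the second: a breakpoint has
  its partner, and between finitely many breakpoints the density and unboundedness of the order
  suffice.\<close>

lemma compat_exists:
  fixes Z :: "('a::linordered_field \<times> 'b::linordered_field) set"
  assumes "finite Z" "\<forall>(u, v)\<in>Z. compat Z u v"
  shows "\<exists>x. compat Z x y"
proof (cases "\<exists>u. (u, y) \<in> Z")
  case True
  then show ?thesis using assms by auto
next
  case False
  define L where "L = fst ` {w\<in>Z. snd w < y}"
  define U where "U = fst ` {w\<in>Z. y < snd w}"
  have "\<exists>x. (\<forall>l\<in>L. l < x) \<and> (\<forall>u\<in>U. x < u)"
  proof (rule exists_between_finite)
    fix l u assume "l \<in> L" "u \<in> U"
    then obtain v w where "(l, v) \<in> Z" "v < y" "(u, w) \<in> Z" "y < w"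
      by (auto simp: L_def U_def)
    then show "l < u" using assms(2) compatD[of Z l v u w] by auto
  qed (use assms in \<open>auto simp: L_def U_def\<close>)
  then obtain x where x: "\<forall>l\<in>L. l < x" "\<forall>u\<in>U. x < u" by blast
  have "same_sign (x - u) (y - v)" if uv: "(u, v) \<in> Z" for u v
  proof -
    have "v < y \<or> y < v" using False uv by (metis linorder_neqE)
    then have "v < y \<and> u < x \<or> y < v \<and> x < u"
      using x uv by (auto simp: L_def U_def)
    then show ?thesis by (auto simp: same_sign_diff)
  qed
  then show ?thesis unfolding compat_def by auto
qed

text \<open>The situation in which a new pair of polynomials is adjoined to a matched family that already
  contains the pair of derivatives.\<close>

definition extendable ::
  "('a::linordered_idom \<times> 'b::linordered_idom) set \<Rightarrow> 'a poly \<Rightarrow> 'b poly \<Rightarrow> bool" where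
  "extendable Z p q \<longleftrightarrow> finite Z \<and> (\<forall>(u, v)\<in>Z. compat Z u v) \<and>
     (\<forall>x y. compat Z x y \<longrightarrow> same_sign (poly (pderiv p) x) (poly (pderiv q) y)) \<and>
     (\<forall>(u, v)\<in>Z. same_sign (poly p u) (poly q v)) \<and>
     degree p = degree q \<and> same_sign (lead_coeff p) (lead_coeff q)"

lemma extendable_converse: "extendable Z p q \<Longrightarrow> extendable (Z\<inverse>) q p"
  unfolding extendable_def compat_converse
  by (auto simp: compat_converse intro: same_sign_commute)

lemma extendable_uminus: "extendable Z p q \<Longrightarrow> extendable Z (- p) (- q)"
  unfolding extendable_def by (auto simp: pderiv_minus)

lemma compat_between:
  assumes "compat Z x1 y" "compat Z x2 y" "x1 < c" "c < x2"
  shows "compat Z c y"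
  unfolding compat_def same_sign_diff
proof (intro ballI, clarify)
  fix u v assume "(u, v) \<in> Z"
  from compatD[OF assms(1) this] compatD[OF assms(2) this] assms(3,4)
  show "(c < u \<longleftrightarrow> y < v) \<and> (u < c \<longleftrightarrow> v < y)"
    by (cases y v rule: linorder_cases) auto
qed

lemma compat_right_cell:
  assumes "compat Z x y" "\<And>u. (u, y) \<notin> Z" "finite Z"
    and none: "\<And>u v. (u, v) \<in> Z \<Longrightarrow> y < v \<Longrightarrow> b \<le> u" and "x < c" "c < b"
  shows "compat Z c y"
  unfolding compat_def same_sign_diff
proof (intro ballI, clarify)
  fix u v assume uv: "(u, v) \<in> Z"
  have "v \<noteq> y" using assms(2) uv by auto
  then have "v < y \<and> u < x \<or> y < v \<and> b \<le> u" using compatD[OF assms(1) uv] none[OF uv] by auto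
  then show "(c < u \<longleftrightarrow> y < v) \<and> (u < c \<longleftrightarrow> v < y)"
    using assms(5,6) by auto
qed

lemma compat_left_cell:
  assumes "compat Z x y" "\<And>u. (u, y) \<notin> Z" "finite Z"
    and none: "\<And>u v. (u, v) \<in> Z \<Longrightarrow> v < y \<Longrightarrow> u \<le> b" and "c < x" "b < c"
  shows "compat Z c y"
  unfolding compat_def same_sign_diff
proof (intro ballI, clarify)
  fix u v assume uv: "(u, v) \<in> Z"
  have "v \<noteq> y" using assms(2) uv by auto
  then have "v < y \<and> u \<le> b \<or> y < v \<and> x < u" using compatD[OF assms(1) uv] none[OF uv] by auto
  then show "(c < u \<longleftrightarrow> y < v) \<and> (u < c \<longleftrightarrow> v < y)"
    using assms(5,6) by auto
qed

lemma compat_open: "compat Z x y \<Longrightarrow> (\<And>u. (u, y) \<notin> Z) \<Longrightarrow> (x, v) \<notin> Z"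
  using compatD[of Z x y x v] by (metis less_irrefl not_less_iff_gr_or_eq)

lemma increasing_on_cell:
  fixes p :: "'a::rcf poly" and q :: "'b::linordered_field poly"
  assumes "extendable Z p q" "poly (pderiv q) y > 0" "a < b"
    and cell: "\<And>c. a < c \<Longrightarrow> c < b \<Longrightarrow> compat Z c y"
  shows "poly p a < poly p b"
proof (rule poly_increasing[OF assms(3)])
  fix c assume "a < c" "c < b"
  then have "same_sign (poly (pderiv p) c) (poly (pderiv q) y)"
    using assms(1) cell unfolding extendable_def by blast
  then show "poly (pderiv p) c > 0" using assms(2) same_sign_pos by blast
qed

text \<open>Since \<open>q\<close> increases on the cell and \<open>poly q y \<le> 0\<close>, it is
  negative at the left end of the cell. There \<open>p\<close> and \<open>q\<close> have the same
  sign, by \<open>extendable\<close> at a paired point and by the leading coefficients at minus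
  infinity. So \<open>p\<close> is negative there, and the intermediate value property gives the
  root.\<close>

lemma root_on_left:
  fixes p :: "'a::rcf poly" and q :: "'b::rcf poly"
  assumes ext: "extendable Z p q" and xy: "compat Z x y" and op: "\<And>u. (u, y) \<notin> Z"
    and d: "poly (pderiv p) x > 0" "poly (pderiv q) y > 0"
    and px: "poly p x > 0" and qy: "poly q y \<le> 0"
  shows "\<exists>x0<x. compat Z x0 y \<and> poly p x0 = 0"
proof -
  have fin: "finite Z" using ext by (simp add: extendable_def)
  have op': "\<And>v. (x, v) \<notin> Z" using compat_open[OF xy op] .
  have ext': "extendable (Z\<inverse>) q p" and xy': "compat (Z\<inverse>) y x"
    using extendable_converse[OF ext] xy by (simp_all add: compat_converse)
  define L where "L = {w\<in>Z. snd w < y}"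
  have "\<exists>b<x. poly p b < 0 \<and> (\<forall>c. b < c \<longrightarrow> c < x \<longrightarrow> compat Z c y)"
  \<comment> \<open>Without a paired point on the left the cell is unbounded: far out the sign is
    that of the leading coefficient times the parity of the degree, which is common to
    \<open>p\<close> and \<open>q\<close>.\<close>
  proof (cases "L = {}")
    case True
    have left: "compat Z c y" if "c < x" for c
      using compat_left_cell[OF xy op fin _ that, of "c - 1"] True by (auto simp: L_def)
    have left': "compat (Z\<inverse>) d x" if "d < y" for d
      using compat_left_cell[OF xy' _ _ _ that, of "d - 1"] True fin op' compatD[OF xy] by (auto simp: L_def)
    have nz: "p \<noteq> 0" "q \<noteq> 0" using d by auto
    obtain M1 where M1: "\<And>x. x \<le> M1 \<Longrightarrow> sgn (poly p x) = sgn (lead_coeff p * (- 1) ^ degree p)"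
      using poly_eventually_sgn_bot[OF nz(1)] by blast
    obtain M2 where M2: "\<And>x. x \<le> M2 \<Longrightarrow> sgn (poly q x) = sgn (lead_coeff q * (- 1) ^ degree q)"
      using poly_eventually_sgn_bot[OF nz(2)] by blast
    define b where "b = min M1 (x - 1)"
    define e where "e = min M2 (y - 1)"
    have "poly q e < poly q y"
      by (rule increasing_on_cell[OF ext' d(1)]) (use left' in \<open>auto simp: e_def\<close>)
    then have "sgn (poly q e) = - 1" using qy by (simp only: sgn_1_neg)
    then have "sgn (lead_coeff q * (- 1) ^ degree q) = - 1"
      using M2[of e] by (simp only: e_def min.cobounded1)
    then have "lead_coeff q * (- 1) ^ degree q < 0" by (simp only: sgn_1_neg)
    moreover have "same_sign (lead_coeff p * (- 1) ^ degree p) (lead_coeff q * (- 1) ^ degree q)"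
    proof (rule same_sign_mult)
      show "same_sign (lead_coeff p) (lead_coeff q)" using ext unfolding extendable_def by blast
      have "degree p = degree q" using ext unfolding extendable_def by blast
      moreover have "same_sign (- 1 :: 'a) (- 1 :: 'b)" by (simp add: same_sign_def)
      ultimately show "same_sign ((- 1 :: 'a) ^ degree p) ((- 1 :: 'b) ^ degree q)"
        by (metis same_sign_power)
    qed
    ultimately have "lead_coeff p * (- 1) ^ degree p < 0" by (simp add: same_sign_def)
    then have "sgn (poly p b) = - 1" using M1[of b] by (simp only: b_def min.cobounded1 sgn_1_neg)
    then have "poly p b < 0" by (simp only: sgn_1_neg)
    moreover have "b \<le> x - 1" by (simp add: b_def)
    then have "b < x" by (rule le_less_trans) simp
    ultimately show ?thesis using left by blast
  next
    case False
    have finL: "finite L" using fin by (simp add: L_def)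
    \<comment> \<open>The nearest paired point on the left bounds the cell in both fields, because
      paired points are ordered alike.\<close>
    obtain v0 where v0: "v0 = Max (snd ` L)" by blast
    then have "v0 \<in> snd ` L" using False finL by auto
    then obtain u0 where u0: "(u0, v0) \<in> L" by auto
    have Z0: "(u0, v0) \<in> Z" "v0 < y" using u0 by (auto simp: L_def)
    have u0x: "u0 < x" using compatD[OF xy Z0(1)] Z0(2) by auto
    have le: "v \<le> v0 \<and> u \<le> u0" if "(u, v) \<in> Z" "v < y" for u v
    proof -
      have "v \<le> v0" using that finL v0 by (auto simp: L_def intro!: Max_ge image_eqI[of _ snd "(u, v)"])
      moreover have "compat Z u0 v0" using ext Z0 by (auto simp: extendable_def)
      ultimately show ?thesis using compatD[OF _ that(1)] by (metis linorder_not_less)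
    qed
    have cell: "compat Z c y" if "u0 < c" "c < x" for c
      using compat_left_cell[OF xy op fin _ that(2,1)] le by blast
    have cell': "compat (Z\<inverse>) c x" if "v0 < c" "c < y" for c
      using compat_left_cell[OF xy' _ _ _ that(2,1)] le fin op' compatD[OF xy] by auto
    have "poly q v0 < poly q y"
      by (rule increasing_on_cell[OF ext' d(1) Z0(2) cell'])
    then have "poly q v0 < 0" using qy by simp
    moreover have "same_sign (poly p u0) (poly q v0)" using ext Z0 by (auto simp: extendable_def)
    ultimately have "poly p u0 < 0" by (simp add: same_sign_def)
    then show ?thesis using u0x cell by blast
  qed
  then obtain b where b: "b < x" "poly p b < 0" "\<And>c. b < c \<Longrightarrow> c < x \<Longrightarrow> compat Z c y" by blast
  from poly_ivt[OF b(1,2) px] b(3) show ?thesis by blast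
qed

text \<open>The mirror image of \<open>root_on_left\<close>; at plus infinity the leading
  coefficients alone decide the sign.\<close>

lemma root_on_right:
  fixes p :: "'a::rcf poly" and q :: "'b::rcf poly"
  assumes ext: "extendable Z p q" and xy: "compat Z x y" and op: "\<And>u. (u, y) \<notin> Z"
    and d: "poly (pderiv p) x > 0" "poly (pderiv q) y > 0"
    and px: "poly p x < 0" and qy: "poly q y \<ge> 0"
  shows "\<exists>x0>x. compat Z x0 y \<and> poly p x0 = 0"
proof -
  have fin: "finite Z" using ext by (simp add: extendable_def)
  have op': "\<And>v. (x, v) \<notin> Z" using compat_open[OF xy op] .
  have ext': "extendable (Z\<inverse>) q p" and xy': "compat (Z\<inverse>) y x"
    using extendable_converse[OF ext] xy by (simp_all add: compat_converse)
  define U where "U = {w\<in>Z. y < snd w}"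
  have "\<exists>b>x. poly p b > 0 \<and> (\<forall>c. x < c \<longrightarrow> c < b \<longrightarrow> compat Z c y)"
  proof (cases "U = {}")
    case True
    have right: "compat Z c y" if "x < c" for c
      using compat_right_cell[OF xy op fin _ that, of "c + 1"] True by (auto simp: U_def)
    have right': "compat (Z\<inverse>) d x" if "y < d" for d
      using compat_right_cell[OF xy' _ _ _ that, of "d + 1"] True fin op' compatD[OF xy] by (auto simp: U_def)
    have nz: "p \<noteq> 0" "q \<noteq> 0" using d by auto
    obtain M1 where M1: "\<And>x. x \<ge> M1 \<Longrightarrow> sgn (poly p x) = sgn (lead_coeff p)"
      using poly_eventually_sgn[OF nz(1)] by blast
    obtain M2 where M2: "\<And>x. x \<ge> M2 \<Longrightarrow> sgn (poly q x) = sgn (lead_coeff q)"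
      using poly_eventually_sgn[OF nz(2)] by blast
    define b where "b = max M1 (x + 1)"
    define e where "e = max M2 (y + 1)"
    have "poly q y < poly q e"
      by (rule increasing_on_cell[OF ext' d(1)]) (use right' in \<open>auto simp: e_def\<close>)
    then have "sgn (poly q e) = 1" using qy by (simp only: sgn_1_pos)
    then have "sgn (lead_coeff q) = 1"
      using M2[of e] by (simp only: e_def max.cobounded1)
    then have "lead_coeff q > 0" by (simp only: sgn_1_pos)
    moreover have "same_sign (lead_coeff p) (lead_coeff q)" using ext unfolding extendable_def by blast
    ultimately have "lead_coeff p > 0" by (simp only: same_sign_pos)
    then have "sgn (poly p b) = 1" using M1[of b] by (simp only: b_def max.cobounded1 sgn_1_pos)
    then have "poly p b > 0" by (simp only: sgn_1_pos)
    moreover have "x + 1 \<le> b" by (simp add: b_def)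
    then have "x < b" by (rule less_le_trans[rotated]) simp
    ultimately show ?thesis using right by blast
  next
    case False
    have finU: "finite U" using fin by (simp add: U_def)
    obtain v0 where v0: "v0 = Min (snd ` U)" by blast
    then have "v0 \<in> snd ` U" using False finU by auto
    then obtain u0 where u0: "(u0, v0) \<in> U" by auto
    have Z0: "(u0, v0) \<in> Z" "y < v0" using u0 by (auto simp: U_def)
    have u0x: "x < u0" using compatD[OF xy Z0(1)] Z0(2) by auto
    have le: "v0 \<le> v \<and> u0 \<le> u" if "(u, v) \<in> Z" "y < v" for u v
    proof -
      have "v0 \<le> v" using that finU v0 by (auto simp: U_def intro!: Min_le image_eqI[of _ snd "(u, v)"])
      moreover have "compat Z u0 v0" using ext Z0 by (auto simp: extendable_def)
      ultimately show ?thesis using compatD[OF _ that(1)] by (metis linorder_not_less)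
    qed
    have cell: "compat Z c y" if "x < c" "c < u0" for c
      using compat_right_cell[OF xy op fin _ that] le by blast
    have cell': "compat (Z\<inverse>) c x" if "y < c" "c < v0" for c
      using compat_right_cell[OF xy' _ _ _ that] le fin op' compatD[OF xy] by auto
    have "poly q y < poly q v0"
      by (rule increasing_on_cell[OF ext' d(1) Z0(2) cell'])
    then have "poly q v0 > 0" using qy by simp
    moreover have "same_sign (poly p u0) (poly q v0)" using ext Z0 by (auto simp: extendable_def)
    ultimately have "poly p u0 > 0" using same_sign_pos by blast
    then show ?thesis using u0x cell by blast
  qed
  then obtain b where b: "x < b" "poly p b > 0" "\<And>c. x < c \<Longrightarrow> c < b \<Longrightarrow> compat Z c y" by blast
  from poly_ivt[OF b(1) px b(2)] b(3) show ?thesis by blast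
qed

text \<open>If \<open>p\<close> is nonnegative at \<open>x\<close> and \<open>q\<close> nonpositive
  at \<open>y\<close>, then the cell contains a root \<open>x0 \<le> x\<close> of \<open>p\<close>
  and a root \<open>y0 \<ge> y\<close> of \<open>q\<close>. By \<open>roots\<close> the points
  \<open>x\<close> and \<open>y\<close> lie on the same side of these, which forces
  \<open>x = x0\<close> and \<open>y = y0\<close>.\<close>

lemma same_sign_increasing_cell:
  fixes p :: "'a::rcf poly" and q :: "'b::rcf poly"
  assumes ext: "extendable Z p q" and xy: "compat Z x y" and op: "\<And>u. (u, y) \<notin> Z"
    and d: "poly (pderiv p) x > 0" "poly (pderiv q) y > 0"
    and roots: "\<And>u v. compat Z u v \<Longrightarrow> poly p u = 0 \<Longrightarrow> poly q v = 0 \<Longrightarrow> same_sign (x - u) (y - v)"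
    and px: "poly p x \<ge> 0" and qy: "poly q y \<le> 0"
  shows "poly p x = 0 \<and> poly q y = 0"
proof -
  have ext': "extendable (Z\<inverse>) q p" and xy': "compat (Z\<inverse>) y x"
    using extendable_converse[OF ext] xy by (simp_all add: compat_converse)
  have "\<exists>x0\<le>x. compat Z x0 y \<and> poly p x0 = 0"
  proof (cases "poly p x = 0")
    case False
    then have "poly p x > 0" using px by simp
    from root_on_left[OF ext xy op d this qy] show ?thesis by (auto intro: less_imp_le)
  qed (use xy in blast)
  then obtain x0 where x0: "x0 \<le> x" "compat Z x0 y" "poly p x0 = 0" by blast
  have "\<exists>y0\<ge>y. compat (Z\<inverse>) y0 x \<and> poly q y0 = 0"
  proof (cases "poly q y = 0")
    case False
    then have "poly q y < 0" using qy by simp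
    moreover have "(u, x) \<notin> Z\<inverse>" for u using compat_open[OF xy op, of u] by simp
    ultimately obtain y0 where "y < y0" "compat (Z\<inverse>) y0 x" "poly q y0 = 0"
      using root_on_right[OF ext' xy' _ d(2,1) _ px] by blast
    then show ?thesis using less_imp_le by blast
  qed (use xy' in blast)
  then obtain y0 where y0: "y0 \<ge> y" "compat Z x y0" "poly q y0 = 0" by (auto simp: compat_converse)
  have "compat Z x0 y0"
    unfolding compat_def same_sign_diff
    using compatD[OF x0(2)] compatD[OF y0(2)] compatD[OF xy] by fastforce
  then have "same_sign (x - x0) (y - y0)" using roots x0 y0 by blast
  then have "x0 = x" "y0 = y" using x0(1) y0(1) by (auto simp: same_sign_diff)
  then show ?thesis using x0 y0 by simp
qed

section \<open>Orderings of rings\<close>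

text \<open>Rings are subsets of a type, because the same results are applied to
  \<open>polys N\<close>, to polynomials with coefficients there, and to the ring generated by a
  root in an algebraic closure.\<close>

definition subring_on :: "'a::comm_ring_1 set \<Rightarrow> bool" where
  "subring_on B \<longleftrightarrow> 0 \<in> B \<and> 1 \<in> B \<and> (\<forall>a\<in>B. \<forall>b\<in>B. a + b \<in> B \<and> a * b \<in> B) \<and> (\<forall>a\<in>B. - a \<in> B)"

lemma subring_onD:
  assumes "subring_on B"
  shows "0 \<in> B" "1 \<in> B" "a \<in> B \<Longrightarrow> b \<in> B \<Longrightarrow> a + b \<in> B" "a \<in> B \<Longrightarrow> b \<in> B \<Longrightarrow> a * b \<in> B"
    "a \<in> B \<Longrightarrow> - a \<in> B" "a \<in> B \<Longrightarrow> b \<in> B \<Longrightarrow> a - b \<in> B" "a \<in> B \<Longrightarrow> a ^ k \<in> B" "of_nat k \<in> B"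
proof -
  show "a \<in> B \<Longrightarrow> b \<in> B \<Longrightarrow> a - b \<in> B"
    using assms unfolding subring_on_def by (metis diff_conv_add_uminus)
  show "a \<in> B \<Longrightarrow> a ^ k \<in> B" using assms unfolding subring_on_def by (induction k) auto
  show "of_nat k \<in> B" using assms unfolding subring_on_def by (induction k) auto
qed (use assms in \<open>auto simp: subring_on_def\<close>)

lemma subring_on_sum:
  assumes "subring_on B" "\<And>i. i \<in> A \<Longrightarrow> f i \<in> B"
  shows "sum f A \<in> B"
  using assms by (induction A rule: infinite_finite_induct) (auto simp: subring_onD)

lemma subring_on_prod:
  assumes "subring_on B" "\<And>i. i \<in> A \<Longrightarrow> f i \<in> B"
  shows "prod f A \<in> B"
  using assms by (induction A rule: infinite_finite_induct) (auto simp: subring_onD)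

definition preorder_on :: "'a::comm_ring_1 set \<Rightarrow> 'a set \<Rightarrow> bool" where
  "preorder_on B T \<longleftrightarrow> T \<subseteq> B \<and> (\<forall>a\<in>B. a * a \<in> T) \<and> (\<forall>a\<in>T. \<forall>b\<in>T. a + b \<in> T \<and> a * b \<in> T)"

text \<open>A point of the real spectrum of \<open>B\<close>: the last condition says that the
  support, the set of all \<open>a\<close> with \<open>a \<in> P\<close> and
  \<open>- a \<in> P\<close>, is a prime ideal.\<close>

definition prime_cone_on :: "'a::comm_ring_1 set \<Rightarrow> 'a set \<Rightarrow> bool" where
  "prime_cone_on B P \<longleftrightarrow> preorder_on B P \<and> - 1 \<notin> P \<and> (\<forall>a\<in>B. a \<in> P \<or> - a \<in> P) \<and>
     (\<forall>a\<in>B. \<forall>b\<in>B. a * b \<in> P \<longrightarrow> - (a * b) \<in> P \<longrightarrow> (a \<in> P \<and> - a \<in> P) \<or> (b \<in> P \<and> - b \<in> P))"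

lemma preorder_onD:
  assumes "preorder_on B T"
  shows "a \<in> T \<Longrightarrow> a \<in> B" "a \<in> B \<Longrightarrow> a * a \<in> T" "a \<in> T \<Longrightarrow> b \<in> T \<Longrightarrow> a + b \<in> T"
    "a \<in> T \<Longrightarrow> b \<in> T \<Longrightarrow> a * b \<in> T"
  using assms by (auto simp: preorder_on_def)

lemma preorder_on_adjoin:
  assumes B: "subring_on B" and P: "preorder_on B P" and a: "a \<in> B"
  shows "preorder_on B {p + q * a |p q. p \<in> P \<and> q \<in> P}" (is "preorder_on B ?Q")
    and "P \<subseteq> {p + q * a |p q. p \<in> P \<and> q \<in> P}" "a \<in> {p + q * a |p q. p \<in> P \<and> q \<in> P}"
proof -
  note PD = preorder_onD[OF P]
  have 0: "0 \<in> P" using PD(2)[of 0] subring_onD[OF B] by simp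
  have 1: "1 \<in> P" using PD(2)[of 1] subring_onD[OF B] by simp
  have "p = p + 0 * a" for p by simp
  then show sub: "P \<subseteq> ?Q" using 0 by blast
  have "a = 0 + 1 * a" by simp
  then show "a \<in> ?Q" using 0 1 by blast
  have closed: "x * y \<in> ?Q" "x + y \<in> ?Q" if h: "x \<in> ?Q" "y \<in> ?Q" for x y
  proof -
    obtain p q p' q' where *: "x = p + q * a" "y = p' + q' * a" "p \<in> P" "q \<in> P" "p' \<in> P" "q' \<in> P"
      using h by blast
    have "x * y = (p * p' + (q * q') * (a * a)) + (p * q' + q * p') * a"
      "x + y = (p + p') + (q + q') * a" using * by (simp_all add: algebra_simps)
    moreover have "p * p' + (q * q') * (a * a) \<in> P" "p * q' + q * p' \<in> P" "p + p' \<in> P" "q + q' \<in> P"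
      using * PD(2)[OF a] by (simp_all add: PD(3,4))
    ultimately show "x * y \<in> ?Q" "x + y \<in> ?Q" by blast+
  qed
  have inB: "?Q \<subseteq> B" using PD(1) a subring_onD(3,4)[OF B] by blast
  have sq: "b * b \<in> ?Q" if "b \<in> B" for b using PD(2)[OF that] sub by (rule subsetD[rotated])
  show "preorder_on B ?Q" unfolding preorder_on_def
    by (intro conjI ballI inB sq closed)
qed

text \<open>A preorder \<open>P\<close> above \<open>T\<close>, maximal among those without any
  \<open>- (s * s)\<close>, is a prime cone. For \<open>a\<close> and \<open>b\<close> outside of
  it, \<open>- s^2 = p + q a\<close> and \<open>- t^2 = p' + q' b\<close>; multiplying these puts
  \<open>- (s t)^2\<close> into \<open>P\<close> as soon as \<open>- (a b)\<close> is there. The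
  choice \<open>b = - a\<close> yields totality, and \<open>a b\<close> in the support yields
  primality.\<close>

theorem abstract_positivstellensatz:
  fixes B :: "'a::comm_ring_1 set"
  assumes B: "subring_on B" and T: "preorder_on B T"
    and S: "S \<subseteq> B" "1 \<in> S" "\<And>s t. s \<in> S \<Longrightarrow> t \<in> S \<Longrightarrow> s * t \<in> S"
    and disj: "\<And>s. s \<in> S \<Longrightarrow> - (s * s) \<notin> T"
  shows "\<exists>P. T \<subseteq> P \<and> prime_cone_on B P \<and> (\<forall>s\<in>S. \<not> (s \<in> P \<and> - s \<in> P))"
proof -
  define A where "A = {P. T \<subseteq> P \<and> preorder_on B P \<and> (\<forall>s\<in>S. - (s * s) \<notin> P)}"
  have "\<exists>M\<in>A. \<forall>W\<in>A. M \<subseteq> W \<longrightarrow> W = M"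
  proof (rule subset_Zorn_nonempty)
    show "A \<noteq> {}" using T disj by (auto simp: A_def)
    fix C assume C: "C \<noteq> {}" "subset.chain A C"
    then have CA: "C \<subseteq> A" and ch: "\<And>W Y. W \<in> C \<Longrightarrow> Y \<in> C \<Longrightarrow> W \<subseteq> Y \<or> Y \<subseteq> W"
      by (auto simp: subset.chain_def)
    have pre: "preorder_on B P" if "P \<in> C" for P using that CA by (auto simp: A_def)
    have "a + b \<in> \<Union>C \<and> a * b \<in> \<Union>C" if ab: "a \<in> \<Union>C" "b \<in> \<Union>C" for a b
    proof -
      obtain W Y where "W \<in> C" "Y \<in> C" "a \<in> W" "b \<in> Y" using ab by blast
      then obtain Z where "Z \<in> C" "a \<in> Z" "b \<in> Z" using ch by blast
      then show ?thesis using preorder_onD[OF pre] by blast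
    qed
    note closed = this
    obtain W0 where W0: "W0 \<in> C" using C(1) by blast
    have "preorder_on B (\<Union>C)"
      unfolding preorder_on_def
    proof (intro conjI ballI)
      show "\<Union>C \<subseteq> B" using preorder_onD(1)[OF pre] by blast
      show "a * a \<in> \<Union>C" if "a \<in> B" for a using preorder_onD(2)[OF pre[OF W0] that] W0 by blast
    qed (use closed in blast)+
    moreover have "T \<subseteq> \<Union>C" using C(1) CA by (auto simp: A_def)
    ultimately show "\<Union>C \<in> A" using CA unfolding A_def by blast
  qed
  then obtain P where PA: "P \<in> A" and max: "\<And>W. W \<in> A \<Longrightarrow> P \<subseteq> W \<Longrightarrow> W = P" by blast
  then have P: "T \<subseteq> P" "preorder_on B P" "\<And>s. s \<in> S \<Longrightarrow> - (s * s) \<notin> P" by (auto simp: A_def)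
  note PD = preorder_onD[OF P(2)] and BD = subring_onD[OF B]
  \<comment> \<open>By maximality, adjoining \<open>a\<close> creates some
    \<open>- (s * s)\<close>.\<close>
  have ext: "\<exists>s\<in>S. \<exists>p\<in>P. \<exists>q\<in>P. - (s * s) = p + q * a" if a: "a \<in> B" "a \<notin> P" for a
  proof (rule ccontr)
    assume n: "\<not> ?thesis"
    let ?Q = "{p + q * a |p q. p \<in> P \<and> q \<in> P}"
    have "- (s * s) \<notin> ?Q" if "s \<in> S" for s using n that by blast
    then have "?Q \<in> A" using preorder_on_adjoin[OF B P(2) a(1)] P(1) unfolding A_def by blast
    then show False using max preorder_on_adjoin(2,3)[OF B P(2) a(1)] a(2) by blast
  qed
  have ext2: "a * b \<in> P \<Longrightarrow> - (a * b) \<in> P \<Longrightarrow> False" and ext3: "a = - b \<Longrightarrow> False"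
    if ab: "a \<in> B" "a \<notin> P" "b \<in> B" "b \<notin> P" for a b
  proof -
    obtain s p q where s: "s \<in> S" "p \<in> P" "q \<in> P" "- (s * s) = p + q * a" using ext ab by blast
    obtain t p' q' where t: "t \<in> S" "p' \<in> P" "q' \<in> P" "- (t * t) = p' + q' * b" using ext ab by blast
    have qa: "q * a = - (s * s) - p" and qb: "q' * b = - (t * t) - p'" using s t by (simp_all add: algebra_simps)
    have "(q * q') * (a * b) = (q * a) * (q' * b)" by (simp add: mult_ac)
    also have "\<dots> = (s * t) * (s * t) + (p * (t * t) + p' * (s * s) + p * p')"
      unfolding qa qb by (simp add: algebra_simps)
    finally have eq: "- ((s * t) * (s * t)) = (q * q') * (- (a * b)) + (p * (t * t) + p' * (s * s) + p * p')"
      by (simp add: algebra_simps)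
    have st: "s \<in> B" "t \<in> B" using s t S by auto
    have r: "p * (t * t) + p' * (s * s) + p * p' \<in> P" 
      by (intro PD(3) PD(4) PD(2) st s t)
    have no: "- ((s * t) * (s * t)) \<notin> P" using P(3) S(3) s t by blast
    have fin: False if "- (a * b) \<in> P"
    proof -
      have "- ((s * t) * (s * t)) \<in> P" unfolding eq by (intro PD(3) PD(4) r s t that)
      then show False using no by blast
    qed
    show False if "a * b \<in> P" "- (a * b) \<in> P" by (rule fin[OF that(2)])
    show False if "a = - b" using fin that PD(2)[OF ab(3)] by simp
  qed
  have total: "a \<in> P \<or> - a \<in> P" if "a \<in> B" for a
    using ext3[of a "- a"] that BD(5) by auto
  have "(a \<in> P \<and> - a \<in> P) \<or> (b \<in> P \<and> - b \<in> P)"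
    if ab: "a \<in> B" "b \<in> B" "a * b \<in> P" "- (a * b) \<in> P" for a b
  proof (rule ccontr)
    assume n: "\<not> ?thesis"
    then have "a \<notin> P \<or> - a \<notin> P" by simp
    then obtain a' where a': "a' = a \<or> a' = - a" "a' \<notin> P" by metis
    from n have "b \<notin> P \<or> - b \<notin> P" by simp
    then obtain b' where b': "b' = b \<or> b' = - b" "b' \<notin> P" by metis
    have "a' * b' \<in> P" "- (a' * b') \<in> P" "a' \<in> B" "b' \<in> B" 
      using a'(1) b'(1) ab BD(5) by (elim disjE; simp)+
    then show False by (intro ext2[of a' b'] a'(2) b'(2))
  qed
  moreover have "- 1 \<notin> P" using P(3)[OF S(2)] by simp
  ultimately have "prime_cone_on B P" unfolding prime_cone_on_def
    by (intro conjI ballI impI P(2) total)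
  \<comment> \<open>For \<open>s\<close> in the support, \<open>- (s * s)\<close> would be a product
    of two elements of \<open>P\<close>.\<close>
  moreover have "\<not> (s \<in> P \<and> - s \<in> P)" if "s \<in> S" for s
    using PD(4)[of s "- s"] P(3)[OF that] by auto
  ultimately show ?thesis using P(1) by blast
qed

lemma idom_hom_map_poly:
  assumes "idom_hom \<phi>"
  shows "poly (map_poly \<phi> (p + q)) x = poly (map_poly \<phi> p) x + poly (map_poly \<phi> q) x"
    "poly (map_poly \<phi> (p * q)) x = poly (map_poly \<phi> p) x * poly (map_poly \<phi> q) x"
    "poly (map_poly \<phi> (smult c p)) x = \<phi> c * poly (map_poly \<phi> p) x"
    "map_poly \<phi> (pderiv p) = pderiv (map_poly \<phi> p)"
    "\<phi> 0 = 0" "\<phi> (c ^ k) = \<phi> c ^ k" "map_poly \<phi> (p - q) = map_poly \<phi> p - map_poly \<phi> q"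
    "map_poly \<phi> [:c:] = [:\<phi> c:]"
proof -
  interpret idom_hom \<phi> by fact
  interpret mp: map_poly_idom_hom \<phi> ..
  show "poly (map_poly \<phi> (p + q)) x = poly (map_poly \<phi> p) x + poly (map_poly \<phi> q) x"
    "poly (map_poly \<phi> (p * q)) x = poly (map_poly \<phi> p) x * poly (map_poly \<phi> q) x"
    "poly (map_poly \<phi> (smult c p)) x = \<phi> c * poly (map_poly \<phi> p) x"
    "map_poly \<phi> (pderiv p) = pderiv (map_poly \<phi> p)"
    "\<phi> 0 = 0" "\<phi> (c ^ k) = \<phi> c ^ k" "map_poly \<phi> (p - q) = map_poly \<phi> p - map_poly \<phi> q"
    "map_poly \<phi> [:c:] = [:\<phi> c:]"
    by (simp_all add: hom_distribs map_poly_pderiv)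
qed

section \<open>Elimination of one variable\<close>

text \<open>The sign of the derivative is constant on an open cell. If it were zero,
  \<open>pderiv p\<close> would vanish on an interval and \<open>p\<close> would be
  constant.\<close>

lemma pderiv_same_cell_root:
  fixes p :: "'a::rcf poly" and q :: "'b::rcf poly"
  assumes ext: "extendable Z p q" and xy: "compat Z x y" and op: "\<And>u. (u, y) \<notin> Z"
    and deg: "degree p > 0"
  shows "poly (pderiv q) y \<noteq> 0"
proof
  assume 0: "poly (pderiv q) y = 0"
  have fin: "finite Z" using ext by (simp add: extendable_def)
  have "\<exists>b>x. \<forall>u v. (u, v) \<in> Z \<longrightarrow> y < v \<longrightarrow> b \<le> u"
  proof (cases "{w\<in>Z. y < snd w} = {}")
    case True
    then show ?thesis by (intro exI[of _ "x + 1"]) auto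
  next
    case False
    define U where "U = fst ` {w\<in>Z. y < snd w}"
    have U: "finite U" "U \<noteq> {}" using fin False by (auto simp: U_def)
    have "\<forall>u\<in>U. x < u" using compatD[OF xy] by (auto simp: U_def)
    then have "x < Min U" using U by simp
    moreover have "Min U \<le> u" if "(u, v) \<in> Z" "y < v" for u v
      using that U by (intro Min_le) (auto simp: U_def image_iff)
    ultimately show ?thesis by blast
  qed
  then obtain b where b: "x < b" "\<And>u v. (u, v) \<in> Z \<Longrightarrow> y < v \<Longrightarrow> b \<le> u" by blast
  have "poly (pderiv p) c = 0" if "x < c" "c < b" for c
  proof -
    have "compat Z c y" by (rule compat_right_cell[OF xy op fin b(2) that])
    then have "same_sign (poly (pderiv p) c) (poly (pderiv q) y)" using ext by (simp add: extendable_def)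
    then show ?thesis using 0 by (simp add: same_sign_def)
  qed
  then have "{x<..<b} \<subseteq> {c. poly (pderiv p) c = 0}" by auto
  moreover have "infinite {x<..<b}" using b(1) by (rule infinite_Ioo)
  ultimately have "pderiv p = 0" using poly_roots_finite finite_subset by blast
  then show False using deg by (simp add: pderiv_eq_0_iff)
qed

lemma same_signI:
  fixes a :: "'a::linordered_idom" and b :: "'b::linordered_idom"
  assumes "0 \<le> a \<Longrightarrow> b \<le> 0 \<Longrightarrow> a = 0 \<and> b = 0" "0 \<le> b \<Longrightarrow> a \<le> 0 \<Longrightarrow> b = 0 \<and> a = 0"
  shows "same_sign a b"
  using assms unfolding same_sign_alt
  by (cases a "0 :: 'a" rule: linorder_cases; cases b "0 :: 'b" rule: linorder_cases) auto

text \<open>The new paired points are the pairs of roots of \<open>p\<close> and \<open>q\<close> in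
  corresponding cells. The derivatives have constant nonzero sign on each open cell, so each
  polynomial has at most one root there; hence the pairing still respects the order, and
  \<open>p\<close> and \<open>q\<close> agree in sign on the finer cells.\<close>

lemma matched_extend:
  fixes p :: "'a::rcf poly" and q :: "'b::rcf poly"
  assumes m: "matched Z I" and ext: "extendable Z p q"
  shows "\<exists>Z'. Z \<subseteq> Z' \<and> matched Z' (insert (p, q) I) \<and>
    (\<forall>(u, v)\<in>Z'. (u, v) \<in> Z \<or> (degree p > 0 \<and> poly p u = 0 \<and> poly q v = 0))"
proof (cases "degree p = 0")
  case True
  moreover have "degree q = 0" "same_sign (lead_coeff p) (lead_coeff q)"
    using ext True unfolding extendable_def by auto
  ultimately have "same_sign (poly p x) (poly q y)" for x y
    by (metis poly_const_conv degree_eq_zeroE coeff_pCons_0 degree_pCons_0)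
  then show ?thesis using m unfolding matched_def by (intro exI[of _ Z]) auto
next
  case False
  then have deg: "degree p > 0" "degree q > 0" using ext unfolding extendable_def by auto
  define N where "N = {(x, y). compat Z x y \<and> poly p x = 0 \<and> poly q y = 0}"
  define Z' where "Z' = Z \<union> N"
  have Zc: "compat Z u v" if "(u, v) \<in> Z'" for u v
    using that m unfolding Z'_def N_def matched_def by auto
  have ext2: "extendable Z (- p) (- q)" using extendable_uminus[OF ext] .
  have nz: "p \<noteq> 0" "q \<noteq> 0" using deg by auto
  have "N \<subseteq> {x. poly p x = 0} \<times> {y. poly q y = 0}" by (auto simp: N_def)
  then have "finite N" by (rule finite_subset) (intro finite_cartesian_product poly_roots_finite nz)
  then have fin: "finite Z'" using m by (simp add: Z'_def matched_def)
  have finZ: "finite Z" using m by (simp add: matched_def)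
  have ptZ: "same_sign (x - u) (y - v)" if "compat Z x y" "(u, v) \<in> Z" for x y u v
    using compatD[OF that] by (simp add: same_sign_diff)
  \<comment> \<open>Two new pairs that meet in one cell coincide, by Rolle's theorem and the
    nonvanishing derivatives.\<close>
  have same_cell: "x = x' \<and> y = y'" if N: "(x, y) \<in> N" "(x', y') \<in> N" and c: "compat Z x y'" for x y x' y'
  proof (cases "\<exists>u. (u, y) \<in> Z")
    case True
    then obtain u where u: "(u, y) \<in> Z" by blast
    have 1: "compat Z x y" "compat Z x' y'" using N by (auto simp: N_def)
    show ?thesis using compatD[OF 1(1) u] compatD[OF 1(2) u] compatD[OF c u] by auto
  next
    case False
    have 1: "compat Z x y" "compat Z x' y'" "poly p x = 0" "poly p x' = 0" "poly q y = 0" "poly q y' = 0"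
      using N by (auto simp: N_def)
    have c': "compat Z x' y" unfolding compat_def same_sign_diff
      using compatD[OF 1(1)] compatD[OF 1(2)] compatD[OF c] by auto
    have op: "\<And>u. (u, y) \<notin> Z" using False by blast
    have op': "\<And>v. (x, v) \<notin> Z" using compat_open[OF 1(1) op] by blast
    have dq: "poly (pderiv q) y \<noteq> 0" using pderiv_same_cell_root[OF ext 1(1) op deg(1)] .
    have dp: "poly (pderiv p) x \<noteq> 0"
      using pderiv_same_cell_root[OF extendable_converse[OF ext], of y x] op' 1 deg
      by (simp add: compat_converse)
    have *: "a = b" if "compat Z a y" "compat Z b y" "poly p a = 0" "poly p b = 0" for a b
    proof (rule ccontr)
      have H: False if h: "compat Z a y" "compat Z b y" "poly p a = 0" "poly p b = 0" "a < b" for a b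
      proof -
        obtain c where c: "a < c" "c < b" "poly (pderiv p) c = 0" using poly_rolle[OF h(5,3,4)] by blast
        have "compat Z c y" by (rule compat_between[OF h(1,2) c(1,2)])
        then have "same_sign (poly (pderiv p) c) (poly (pderiv q) y)" using ext by (simp add: extendable_def)
        then show False using dq c by (simp add: same_sign_def)
      qed
      assume "a \<noteq> b"
      then show False using H[of a b] H[of b a] that by (meson linorder_neqE)
    qed
    have **: "a = b" if "compat Z x a" "compat Z x b" "poly q a = 0" "poly q b = 0" for a b
    proof (rule ccontr)
      have H: False if h: "compat Z x a" "compat Z x b" "poly q a = 0" "poly q b = 0" "a < b" for a b
      proof -
        obtain c where c: "a < c" "c < b" "poly (pderiv q) c = 0" using poly_rolle[OF h(5,3,4)] by blast
        have "compat (Z\<inverse>) c x" by (rule compat_between[OF _ _ c(1,2)]) (use h in \<open>auto simp: compat_converse\<close>)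
        then have "same_sign (poly (pderiv p) x) (poly (pderiv q) c)" using ext by (simp add: extendable_def compat_converse)
        then show False using dp c by (simp add: same_sign_def)
      qed
      assume "a \<noteq> b"
      then show False using H[of a b] H[of b a] that by (meson linorder_neqE)
    qed
    show ?thesis using *[OF 1(1) c'] **[OF 1(1) c] 1 by auto
  qed
  have NN: "same_sign (x - x') (y - y')" if N: "(x, y) \<in> N" "(x', y') \<in> N" for x y x' y'
  proof (cases "compat Z x y'")
    case True
    then show ?thesis using same_cell[OF N] by simp
  next
    case False
    then obtain u v where uv: "(u, v) \<in> Z" "\<not> same_sign (x - u) (y' - v)" unfolding compat_def by auto
    have 1: "compat Z x y" "compat Z x' y'" using N by (auto simp: N_def)
    show ?thesis using uv(2) compatD[OF 1(1) uv(1)] compatD[OF 1(2) uv(1)]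
      unfolding same_sign_diff by (cases y v rule: linorder_cases; cases y' v rule: linorder_cases) auto
  qed
  have Z'c: "compat Z' x y" if "(x, y) \<in> Z'" for x y
  proof -
    have "same_sign (x - u) (y - v)" if "(u, v) \<in> Z'" for u v
    proof (cases "(u, v) \<in> Z")
      case True
      then show ?thesis using ptZ[OF Zc[OF \<open>(x, y) \<in> Z'\<close>]] by simp
    next
      case F: False
      show ?thesis
      proof (cases "(x, y) \<in> Z")
        case True
        then show ?thesis using ptZ[OF Zc[OF that] True] by (subst same_sign_swap)
      next
        case False
        then show ?thesis using F that \<open>(x, y) \<in> Z'\<close> NN by (auto simp: Z'_def)
      qed
    qed
    then show ?thesis unfolding compat_def by auto
  qed
  have main: "same_sign (poly p x) (poly q y)" if xy: "compat Z' x y" for x y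
  proof (cases "\<exists>u. (u, y) \<in> Z")
    case True
    then obtain u where u: "(u, y) \<in> Z" by blast
    then have "u = x" using xy compatD[OF xy, of u y] by (auto simp: Z'_def)
    then show ?thesis using u ext by (auto simp: extendable_def)
  next
    case False
    then have op: "\<And>u. (u, y) \<notin> Z" by blast
    have xyZ: "compat Z x y" using compat_mono[OF _ xy] by (simp add: Z'_def)
    have op': "\<And>v. (x, v) \<notin> Z" using compat_open[OF xyZ op] by blast
    have dq: "poly (pderiv q) y \<noteq> 0" using pderiv_same_cell_root[OF ext xyZ op deg(1)] .
    have dpq: "same_sign (poly (pderiv p) x) (poly (pderiv q) y)" using ext xyZ by (simp add: extendable_def)
    have roots: "same_sign (x - u) (y - v)" if "compat Z u v" "poly p u = 0" "poly q v = 0" for u v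
    proof -
      have "(u, v) \<in> Z'" using that by (auto simp: Z'_def N_def)
      then show ?thesis using compatD[OF xy] by (simp add: same_sign_diff)
    qed
    have roots': "same_sign (y - v) (x - u)" if "compat (Z\<inverse>) v u" "poly q v = 0" "poly p u = 0" for u v
      using same_sign_commute[OF roots[of u v]] that by (simp add: compat_converse)
    have xy': "compat (Z\<inverse>) y x" using xyZ by (simp add: compat_converse)
    have opc: "\<And>v. (v, x) \<notin> Z\<inverse>" using op' by simp
    show ?thesis
    proof (cases "poly (pderiv q) y > 0")
      case True
      then have dp: "poly (pderiv p) x > 0" using dpq same_sign_pos by blast
      show ?thesis
      proof (rule same_signI)
        assume "0 \<le> poly p x" "poly q y \<le> 0"
        then show "poly p x = 0 \<and> poly q y = 0"
          by (intro same_sign_increasing_cell[OF ext xyZ op dp True roots])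
      next
        assume "0 \<le> poly q y" "poly p x \<le> 0"
        then show "poly q y = 0 \<and> poly p x = 0"
          by (intro same_sign_increasing_cell[OF extendable_converse[OF ext] xy' opc True dp roots'])
      qed
    next
      \<comment> \<open>A decreasing pair is reduced to an increasing one by changing the signs of
        both polynomials.\<close>
      case False
      then have dq': "poly (pderiv (- q)) y > 0" using dq by (simp add: pderiv_minus)
      then have "poly (pderiv q) y < 0" by (simp add: pderiv_minus)
      then have dp': "poly (pderiv (- p)) x > 0" using dpq by (simp add: same_sign_def pderiv_minus)
      have "same_sign (poly (- p) x) (poly (- q) y)"
      proof (rule same_signI)
        assume "0 \<le> poly (- p) x" "poly (- q) y \<le> 0"
        then show "poly (- p) x = 0 \<and> poly (- q) y = 0"
          by (intro same_sign_increasing_cell[OF ext2 xyZ op dp' dq' roots]) simp_all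
      next
        assume "0 \<le> poly (- q) y" "poly (- p) x \<le> 0"
        then show "poly (- q) y = 0 \<and> poly (- p) x = 0"
          by (intro same_sign_increasing_cell[OF extendable_converse[OF ext2] xy' opc dq' dp' roots']) simp_all
      qed
      then show ?thesis by simp
    qed
  qed
  have "matched Z' (insert (p, q) I)"
    unfolding matched_def
  proof (intro conjI allI impI)
    show "\<forall>(u, v)\<in>Z'. compat Z' u v" using Z'c by auto
    fix x y assume xy: "compat Z' x y"
    have "compat Z x y" using compat_mono[OF _ xy] by (simp add: Z'_def)
    then show "\<forall>(p, q)\<in>insert (p, q) I. same_sign (poly p x) (poly q y)"
      using m main[OF xy] by (auto simp: matched_def)
  qed (rule fin)
  then show ?thesis using deg by (intro exI[of _ Z']) (auto simp: Z'_def N_def)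
qed

section \<open>Pseudo-division and families of polynomials closed under it\<close>

definition coeffs_in :: "'a::comm_ring_1 set \<Rightarrow> 'a poly set" where
  "coeffs_in B = {p. \<forall>i. coeff p i \<in> B}"

lemma subring_on_coeffs_in: "subring_on B \<Longrightarrow> subring_on (coeffs_in B)"
  unfolding subring_on_def[where B = "coeffs_in B"] unfolding coeffs_in_def
  by (auto simp: coeff_mult subring_onD intro!: subring_on_sum)

lemma coeffs_in_smult: "subring_on B \<Longrightarrow> c \<in> B \<Longrightarrow> p \<in> coeffs_in B \<Longrightarrow> smult c p \<in> coeffs_in B"
  by (auto simp: coeffs_in_def subring_onD)

lemma coeffs_in_monom: "subring_on B \<Longrightarrow> c \<in> B \<Longrightarrow> monom c k \<in> coeffs_in B"
  by (auto simp: coeffs_in_def subring_onD)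

lemma coeffs_in_pderiv: "subring_on B \<Longrightarrow> p \<in> coeffs_in B \<Longrightarrow> pderiv p \<in> coeffs_in B"
  unfolding coeffs_in_def coeff_pderiv mem_Collect_eq
  using subring_onD(4,8)[of B] by blast

text \<open>The exponent of the leading coefficient is even, so that evaluating at a root of \<open>q\<close> gives
  \<open>p\<close> and the remainder the same sign.\<close>

definition pseudo_rem :: "'a::comm_ring_1 set \<Rightarrow> 'a poly \<Rightarrow> 'a poly \<Rightarrow> 'a poly \<Rightarrow> bool" where
  "pseudo_rem B p q r \<longleftrightarrow> r \<in> coeffs_in B \<and> degree r < degree q \<and>
     (\<exists>s k. smult (lead_coeff q ^ (2 * k)) p = s * q + r)"

lemma degree_less_if_coeff_zero:
  assumes "degree p \<le> d" "coeff p d = 0" "d > 0"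
  shows "degree p < d"
  using assms by (metis leading_coeff_0_iff degree_0 le_neq_implies_less)

lemma pseudo_rem_exists:
  fixes p q :: "'a::idom poly"
  assumes B: "subring_on B" and "p \<in> coeffs_in B" "q \<in> coeffs_in B" "degree q > 0"
  shows "\<exists>r. pseudo_rem B p q r"
  using assms(2)
proof (induction "degree p" arbitrary: p rule: less_induct)
  case less
  show ?case
  proof (cases "degree p < degree q")
    case True
    moreover have "smult (lead_coeff q ^ (2 * 0)) p = 0 * q + p" by simp
    ultimately have "pseudo_rem B p q p" unfolding pseudo_rem_def
      using less.prems by blast
    then show ?thesis ..
  next
    case False
    define d e where "d = degree p" and "e = degree q"
    define p1 where "p1 = smult (lead_coeff q) p - monom (lead_coeff p) (d - e) * q"
    have lc: "lead_coeff p \<in> B" "lead_coeff q \<in> B" using assms(3) less.prems by (auto simp: coeffs_in_def)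
    note CB = subring_on_coeffs_in[OF B]
    have p1: "p1 \<in> coeffs_in B" unfolding p1_def
      by (intro subring_onD(6)[OF CB] subring_onD(4)[OF CB] coeffs_in_smult[OF B] coeffs_in_monom[OF B]
            lc less.prems assms(3))
    have "degree (monom (lead_coeff p) (d - e) * q) \<le> d"
      using False degree_mult_le[of "monom (lead_coeff p) (d - e)" q] degree_monom_le[of "lead_coeff p" "d - e"]
      by (simp add: d_def e_def)
    then have "degree p1 \<le> d" unfolding p1_def
      by (intro degree_diff_le) (auto simp: d_def)
    moreover have "coeff p1 d = 0"
      using False by (simp add: p1_def coeff_monom_mult d_def e_def)
    moreover have "d > 0" using False assms(4) by (simp add: d_def)
    ultimately have "degree p1 < degree p" using degree_less_if_coeff_zero d_def by blast
    from less.hyps[OF this p1] obtain r s k where r: "r \<in> coeffs_in B" "degree r < degree q"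
      and eq: "smult (lead_coeff q ^ (2 * k)) p1 = s * q + r" unfolding pseudo_rem_def by blast
    \<comment> \<open>One reduction step uses \<open>lead_coeff q\<close> once; the additional
      factor keeps the exponent even.\<close>
    define r' where "r' = smult (lead_coeff q) r"
    define c where "c = lead_coeff q"
    define M where "M = monom (lead_coeff p) (d - e)"
    have gen: "smult c (t * q + r) = smult c t * q + r'" for t
      by (simp add: r'_def c_def smult_add_right)
    have "smult (c ^ (2 * Suc k)) p = smult c (smult (c ^ (2 * k)) (smult c p))"
      by (simp add: mult_ac)
    also have "smult c p = p1 + M * q" by (simp add: p1_def c_def M_def)
    also have "smult (c ^ (2 * k)) (p1 + M * q) = (s + smult (c ^ (2 * k)) M) * q + r"
      using eq by (simp add: c_def smult_add_right distrib_right)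
    also have "smult c \<dots> = smult c (s + smult (c ^ (2 * k)) M) * q + r'"
      by (rule gen)
    finally have "\<exists>s k. smult (lead_coeff q ^ (2 * k)) p = s * q + r'"
      unfolding c_def by blast
    moreover have "r' \<in> coeffs_in B" unfolding r'_def by (rule coeffs_in_smult[OF B lc(2) r(1)])
    moreover have "degree r' < degree q"
      using r(2) degree_smult_le[of "lead_coeff q" r] unfolding r'_def by (rule le_less_trans[rotated])
    ultimately have "pseudo_rem B p q r'" unfolding pseudo_rem_def by blast
    then show ?thesis ..
  qed
qed

text \<open>Takes the place of \<open>p\<close> under a homomorphism that kills the leading
  coefficient.\<close>

definition truncate :: "'a::comm_ring_1 poly \<Rightarrow> 'a poly" where
  "truncate p = p - monom (lead_coeff p) (degree p)"

lemma degree_truncate: "degree p > 0 \<Longrightarrow> degree (truncate p) < degree p"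
  unfolding truncate_def
  by (intro degree_less_if_coeff_zero degree_diff_le) (auto simp: degree_monom_le)

text \<open>Closure under the operations of Hoermander's sign determination, restricted to polynomials of
  degree more than \<open>e\<close>.\<close>

definition closed_above :: "'a::idom set \<Rightarrow> nat \<Rightarrow> 'a poly set \<Rightarrow> bool" where
  "closed_above B e G \<longleftrightarrow> (\<forall>p\<in>G. degree p > e \<longrightarrow> pderiv p \<in> G \<and> truncate p \<in> G) \<and>
     (\<forall>p\<in>G. \<forall>q\<in>G. degree q > e \<longrightarrow> degree q \<le> degree p \<longrightarrow> (\<exists>r\<in>G. pseudo_rem B p q r))"

text \<open>The family is enlarged from the top degree downwards. Whatever is added on account of
  polynomials of degree \<open>Suc e\<close> has degree at most \<open>e\<close>, so closure in
  higher degrees is not disturbed and every stage is finite.\<close>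

lemma closed_above_exists:
  fixes F :: "'a::{idom,ring_char_0} poly set"
  assumes B: "subring_on B" and "finite F" "F \<subseteq> coeffs_in B" "closed_above B e F"
  shows "\<exists>G. F \<subseteq> G \<and> finite G \<and> G \<subseteq> coeffs_in B \<and> closed_above B 0 G"
  using assms(2-)
proof (induction e arbitrary: F)
  case (Suc e)
  have "\<exists>r. pseudo_rem B p q r" if "p \<in> F" "q \<in> F" "degree q > 0" for p q
    using pseudo_rem_exists[OF B] that Suc.prems(2) by blast
  then obtain R where R: "\<And>p q. p \<in> F \<Longrightarrow> q \<in> F \<Longrightarrow> degree q > 0 \<Longrightarrow> pseudo_rem B p q (R p q)" by metis
  define N where "N = pderiv ` {p\<in>F. degree p = Suc e} \<union> truncate ` {p\<in>F. degree p = Suc e} \<union>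
      (\<lambda>(p, q). R p q) ` {(p, q). p \<in> F \<and> q \<in> F \<and> degree q = Suc e}"
  note CB = subring_on_coeffs_in[OF B]
  have "{(p, q). p \<in> F \<and> q \<in> F \<and> degree q = Suc e} \<subseteq> F \<times> F" by auto
  then have fin: "finite (F \<union> N)" unfolding N_def using Suc.prems(1) finite_subset
    by (intro finite_UnI finite_imageI) auto
  have "degree (pderiv p) \<le> e" "degree (truncate p) \<le> e" if "degree p = Suc e" for p :: "'a poly"
    using that degree_truncate[of p] degree_pderiv[of p] by auto
  moreover have "degree (R p q) \<le> e" if "p \<in> F" "q \<in> F" "degree q = Suc e" for p q
    using R[OF that(1,2)] that(3) by (simp add: pseudo_rem_def)
  ultimately have dN: "degree p \<le> e" if "p \<in> N" for p
    using that by (auto simp: N_def)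
  have "N \<subseteq> coeffs_in B"
    using R Suc.prems(2) unfolding N_def pseudo_rem_def truncate_def
    by (auto intro!: coeffs_in_pderiv[OF B] subring_onD(6)[OF CB] coeffs_in_monom[OF B]) (auto simp: coeffs_in_def)
  moreover have "closed_above B e (F \<union> N)"
    unfolding closed_above_def
  proof (intro conjI ballI impI)
    fix p assume p: "p \<in> F \<union> N" "e < degree p"
    then have "p \<in> F" using dN[of p] by auto
    have "pderiv p \<in> F \<union> N \<and> truncate p \<in> F \<union> N"
    proof (cases "degree p = Suc e")
      case True
      then show ?thesis using \<open>p \<in> F\<close> by (auto simp: N_def)
    next
      case False
      then have "degree p > Suc e" using p by simp
      then show ?thesis using Suc.prems(3) \<open>p \<in> F\<close> unfolding closed_above_def by blast
    qed
    then show "pderiv p \<in> F \<union> N" "truncate p \<in> F \<union> N" by blast+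
  next
    fix p q assume p: "p \<in> F \<union> N" "q \<in> F \<union> N" "e < degree q" "degree q \<le> degree p"
    then have F: "p \<in> F" "q \<in> F" using dN[of p] dN[of q] by auto
    show "\<exists>r\<in>F \<union> N. pseudo_rem B p q r"
    proof (cases "degree q = Suc e")
      case True
      then have "R p q \<in> N" using F by (auto simp: N_def)
      then show ?thesis using R[OF F] True by auto
    next
      case False
      then have "degree q > Suc e" using p by simp
      then show ?thesis using Suc.prems(3) F p(4) unfolding closed_above_def by blast
    qed
  qed
  ultimately obtain G where "F \<union> N \<subseteq> G" "finite G" "G \<subseteq> coeffs_in B" "closed_above B 0 G"
    using Suc.IH[OF fin] Suc.prems(2) by blast
  then show ?case by blast
qed blast


text \<open>A paired point is a root of some \<open>q\<close> in the family, of positive degree at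
  most \<open>e\<close>. There \<open>p\<close> has the sign of its pseudo-remainder modulo
  \<open>q\<close>, which has smaller degree and therefore belongs to \<open>I\<close>, as does
  \<open>pderiv p\<close>. So the images of \<open>p\<close> form an extendable pair. If the leading
  coefficient is mapped to zero, \<open>p\<close> and \<open>truncate p\<close> have the same
  images.\<close>

lemma matched_adjoin:
  fixes \<phi> :: "'c::{idom,ring_char_0} \<Rightarrow> 'a::rcf" and \<psi> :: "'c \<Rightarrow> 'b::rcf"
  assumes hom: "idom_hom \<phi>" "idom_hom \<psi>" and G: "closed_above B 0 G"
    and sgn: "\<And>p. p \<in> G \<Longrightarrow> same_sign (\<phi> (lead_coeff p)) (\<psi> (lead_coeff p))"
    and I: "\<And>p. p \<in> G \<Longrightarrow> degree p < e \<Longrightarrow> p \<in> I"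
    and m: "matched Z ((\<lambda>p. (map_poly \<phi> p, map_poly \<psi> p)) ` I)"
    and Z: "\<forall>(u, v)\<in>Z. \<exists>q\<in>G. 0 < degree q \<and> degree q \<le> e \<and> \<phi> (lead_coeff q) \<noteq> 0 \<and>
              poly (map_poly \<phi> q) u = 0 \<and> poly (map_poly \<psi> q) v = 0"
    and p: "p \<in> G" "degree p = e"
  shows "\<exists>Z. matched Z ((\<lambda>p. (map_poly \<phi> p, map_poly \<psi> p)) ` insert p I) \<and>
      (\<forall>(u, v)\<in>Z. \<exists>q\<in>G. 0 < degree q \<and> degree q \<le> e \<and> \<phi> (lead_coeff q) \<noteq> 0 \<and>
              poly (map_poly \<phi> q) u = 0 \<and> poly (map_poly \<psi> q) v = 0)"
proof -
  let ?P = "map_poly \<phi>" and ?Q = "map_poly \<psi>"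
  note H = idom_hom_map_poly[OF hom(1)] idom_hom_map_poly[OF hom(2)]
  have Ips: "same_sign (poly (?P r) x) (poly (?Q r) y)" if "r \<in> I" "compat Z x y" for r x y
    using m that by (auto simp: matched_def)
  have trivial: ?thesis if "\<And>x y. compat Z x y \<Longrightarrow> same_sign (poly (?P p) x) (poly (?Q p) y)"
    using m Z that by (intro exI[of _ Z]) (auto simp: matched_def)
  have z: "\<phi> (lead_coeff p) = 0 \<longleftrightarrow> \<psi> (lead_coeff p) = 0" using sgn[OF p(1)] by (simp add: same_sign_def)
  show ?thesis
  proof (cases "e = 0")
    case True
    then obtain c where "p = [:c:]" using p degree_eq_zeroE by blast
    moreover from this have "same_sign (\<phi> c) (\<psi> c)" using sgn[OF p(1)] by simp
    ultimately show ?thesis by (intro trivial) (simp add: H)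
  next
    case e: False
    show ?thesis
    proof (cases "\<phi> (lead_coeff p) = 0")
      case True
      have "truncate p \<in> G" "degree (truncate p) < e"
        using G p e degree_truncate[of p] unfolding closed_above_def by auto
      then have "truncate p \<in> I" using I by blast
      have "?P (monom (lead_coeff p) (degree p)) = 0" "?Q (monom (lead_coeff p) (degree p)) = 0"
        using True z by (simp_all add: map_poly_monom H)
      then have eq: "?P (truncate p) = ?P p" "?Q (truncate p) = ?Q p"
        unfolding truncate_def by (simp_all add: H)
      show ?thesis by (rule trivial) (use Ips[OF \<open>truncate p \<in> I\<close>] in \<open>simp only: eq\<close>)
    next
      case False
      have deg: "degree (?P p) = degree p" "degree (?Q p) = degree p"
        using False z by (auto intro: map_poly_degree_eq simp: degree_map_poly)
      have "pderiv p \<in> G" "degree (pderiv p) < e" using G p e degree_pderiv[of p] unfolding closed_above_def by auto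
      then have "pderiv p \<in> I" using I by blast
      then have dp: "same_sign (poly (pderiv (?P p)) x) (poly (pderiv (?Q p)) y)" if "compat Z x y" for x y
        using Ips[OF _ that] by (metis H)
      have "same_sign (poly (?P p) u) (poly (?Q p) v)" if uv: "(u, v) \<in> Z" for u v
      proof -
        obtain q where q: "q \<in> G" "0 < degree q" "degree q \<le> e" "\<phi> (lead_coeff q) \<noteq> 0"
          "poly (?P q) u = 0" "poly (?Q q) v = 0" using Z uv by auto
        then obtain r where r: "r \<in> G" "pseudo_rem B p q r" using G p unfolding closed_above_def by blast
        then obtain s k where sk: "smult (lead_coeff q ^ (2 * k)) p = s * q + r" and "degree r < degree q"
          unfolding pseudo_rem_def by blast
        then have "r \<in> I" using I r q by auto
        moreover have "compat Z u v" using m uv by (auto simp: matched_def)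
        ultimately have ss: "same_sign (poly (?P r) u) (poly (?Q r) v)" by (rule Ips)
        have q0: "\<psi> (lead_coeff q) \<noteq> 0" using sgn[OF q(1)] q(4) by (simp add: same_sign_def)
        have "poly (?P (smult (lead_coeff q ^ (2 * k)) p)) u = poly (?P r) u"
          "poly (?Q (smult (lead_coeff q ^ (2 * k)) p)) v = poly (?Q r) v"
          unfolding sk using q by (simp_all add: H)
        then have e: "poly (?P r) u = (\<phi> (lead_coeff q) ^ k)\<^sup>2 * poly (?P p) u"
           "poly (?Q r) v = (\<psi> (lead_coeff q) ^ k)\<^sup>2 * poly (?Q p) v"
          by (simp_all add: H power_mult[symmetric] mult.commute)
        have pos: "(\<phi> (lead_coeff q) ^ k)\<^sup>2 > 0" "(\<psi> (lead_coeff q) ^ k)\<^sup>2 > 0" using q0 q(4) by simp_all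
        show ?thesis using ss pos q0 q(4) unfolding e same_sign_def
          by (auto simp: mult_less_0_iff)
      qed
      then have Zs: "\<forall>(u, v)\<in>Z. same_sign (poly (?P p) u) (poly (?Q p) v)" by blast
      have lc: "lead_coeff (?P p) = \<phi> (lead_coeff p)" "lead_coeff (?Q p) = \<psi> (lead_coeff p)"
        unfolding deg by (simp_all add: coeff_map_poly H)
      have "extendable Z (?P p) (?Q p)"
        unfolding extendable_def lc
      proof (intro conjI)
        show "finite Z" "\<forall>(u, v)\<in>Z. compat Z u v" using m unfolding matched_def by blast+
        show "\<forall>x y. compat Z x y \<longrightarrow> same_sign (poly (pderiv (?P p)) x) (poly (pderiv (?Q p)) y)"
          using dp by blast
      qed (use Zs deg sgn[OF p(1)] in simp_all)
      from matched_extend[OF m this] obtain Z' where Z': "matched Z' (insert (?P p, ?Q p) ((\<lambda>p. (?P p, ?Q p)) ` I))"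
        "\<forall>(u, v)\<in>Z'. (u, v) \<in> Z \<or> (degree (?P p) > 0 \<and> poly (?P p) u = 0 \<and> poly (?Q p) v = 0)" by blast
      have "\<exists>q\<in>G. 0 < degree q \<and> degree q \<le> e \<and> \<phi> (lead_coeff q) \<noteq> 0 \<and> poly (?P q) u = 0 \<and> poly (?Q q) v = 0"
        if "(u, v) \<in> Z'" for u v
      proof (cases "(u, v) \<in> Z")
        case False
        then have "poly (?P p) u = 0 \<and> poly (?Q p) v = 0" using Z'(2) that by auto
        then show ?thesis using p e \<open>\<phi> (lead_coeff p) \<noteq> 0\<close> by blast
      qed (use Z in auto)
      then show ?thesis using Z'(1) by (intro exI[of _ Z']) auto
    qed
  qed
qed

text \<open>Induction on the degree bound; polynomials of equal degree are adjoined one after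
  another, since \<open>matched_adjoin\<close> consults only those of lower degree.\<close>

lemma matched_closed_family:
  fixes \<phi> :: "'c::{idom,ring_char_0} \<Rightarrow> 'a::rcf" and \<psi> :: "'c \<Rightarrow> 'b::rcf"
  assumes hom: "idom_hom \<phi>" "idom_hom \<psi>" and G: "closed_above B 0 G" and fin: "finite G"
    and sgn: "\<And>p. p \<in> G \<Longrightarrow> same_sign (\<phi> (lead_coeff p)) (\<psi> (lead_coeff p))"
  shows "\<exists>Z. matched Z ((\<lambda>p. (map_poly \<phi> p, map_poly \<psi> p)) ` {p\<in>G. degree p < e}) \<and>
      (\<forall>(u, v)\<in>Z. \<exists>q\<in>G. 0 < degree q \<and> degree q < e \<and> \<phi> (lead_coeff q) \<noteq> 0 \<and>
              poly (map_poly \<phi> q) u = 0 \<and> poly (map_poly \<psi> q) v = 0)"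
proof (induction e)
  case 0
  show ?case by (intro exI[of _ "{}"]) (simp add: matched_def)
next
  case (Suc e)
  let ?L = "{p\<in>G. degree p < e}"
  have "\<exists>Z. matched Z ((\<lambda>p. (map_poly \<phi> p, map_poly \<psi> p)) ` (?L \<union> H)) \<and>
      (\<forall>(u, v)\<in>Z. \<exists>q\<in>G. 0 < degree q \<and> degree q \<le> e \<and> \<phi> (lead_coeff q) \<noteq> 0 \<and>
              poly (map_poly \<phi> q) u = 0 \<and> poly (map_poly \<psi> q) v = 0)"
    if "finite H" "H \<subseteq> {p\<in>G. degree p = e}" for H
    using that
  proof (induction H rule: finite_induct)
    case empty
    show ?case using Suc by (fastforce simp: less_imp_le)
  next
    case (insert p H)
    then obtain Z where Z: "matched Z ((\<lambda>p. (map_poly \<phi> p, map_poly \<psi> p)) ` (?L \<union> H))"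
      "\<forall>(u, v)\<in>Z. \<exists>q\<in>G. 0 < degree q \<and> degree q \<le> e \<and> \<phi> (lead_coeff q) \<noteq> 0 \<and>
              poly (map_poly \<phi> q) u = 0 \<and> poly (map_poly \<psi> q) v = 0" by auto
    have "\<And>p. p \<in> G \<Longrightarrow> degree p < e \<Longrightarrow> p \<in> ?L \<union> H" by simp
    from matched_adjoin[OF hom G sgn this Z, of p] insert.prems show ?case by simp
  qed
  from this[of "{p\<in>G. degree p = e}"] fin
  have "\<exists>Z. matched Z ((\<lambda>p. (map_poly \<phi> p, map_poly \<psi> p)) ` (?L \<union> {p\<in>G. degree p = e})) \<and>
      (\<forall>(u, v)\<in>Z. \<exists>q\<in>G. 0 < degree q \<and> degree q \<le> e \<and> \<phi> (lead_coeff q) \<noteq> 0 \<and>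
              poly (map_poly \<phi> q) u = 0 \<and> poly (map_poly \<psi> q) v = 0)"
    by simp
  moreover have "?L \<union> {p\<in>G. degree p = e} = {p\<in>G. degree p < Suc e}" by auto
  ultimately show ?case unfolding less_Suc_eq_le by simp
qed

text \<open>Elimination of one existential quantifier: \<open>F'\<close> consists of the leading
  coefficients of a closed family around \<open>F\<close> and depends neither on the homomorphisms
  nor on \<open>y\<close>.\<close>

lemma sign_elimination:
  fixes F :: "'c::{idom,ring_char_0} poly set"
  assumes "subring_on B" "finite F" "F \<subseteq> coeffs_in B"
  shows "\<exists>F'. finite F' \<and> F' \<subseteq> B \<and>
    (\<forall>(\<phi> :: 'c \<Rightarrow> 'a::rcf) (\<psi> :: 'c \<Rightarrow> 'b::rcf). idom_hom \<phi> \<longrightarrow> idom_hom \<psi> \<longrightarrow>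
       (\<forall>c\<in>F'. same_sign (\<phi> c) (\<psi> c)) \<longrightarrow>
       (\<forall>y. \<exists>x. \<forall>p\<in>F. same_sign (poly (map_poly \<phi> p) x) (poly (map_poly \<psi> p) y)))"
proof -
  obtain d where d: "\<And>p. p \<in> F \<Longrightarrow> degree p \<le> d"
    using assms(2) by (meson finite_nat_set_iff_bounded_le finite_imageI imageI)
  have "closed_above B d F" unfolding closed_above_def using d by (auto simp: leD)
  from closed_above_exists[OF assms this] obtain G where G: "F \<subseteq> G" "finite G" "G \<subseteq> coeffs_in B" "closed_above B 0 G"
    by blast
  obtain e where e: "\<And>p. p \<in> G \<Longrightarrow> degree p < e"
    using G(2) by (meson finite_nat_set_iff_bounded finite_imageI imageI)
  then have eG: "{p\<in>G. degree p < e} = G" by auto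
  have "\<exists>x. \<forall>p\<in>F. same_sign (poly (map_poly \<phi> p) x) (poly (map_poly \<psi> p) y)"
    if hom: "idom_hom \<phi>" "idom_hom \<psi>" and s: "\<forall>c\<in>lead_coeff ` G. same_sign (\<phi> c) (\<psi> c)"
    for \<phi> :: "'c \<Rightarrow> 'a" and \<psi> :: "'c \<Rightarrow> 'b" and y
  proof -
    obtain Z where Z: "matched Z ((\<lambda>p. (map_poly \<phi> p, map_poly \<psi> p)) ` G)"
      using matched_closed_family[OF hom G(4,2), of e] s eG by auto
    then obtain x where "compat Z x y" using compat_exists[of Z y] unfolding matched_def by blast
    then show ?thesis using Z G(1) unfolding matched_def by (intro exI[of _ x]) auto
  qed
  moreover have "lead_coeff ` G \<subseteq> B" using G(3) by (auto simp: coeffs_in_def)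
  ultimately show ?thesis using G(2) by (intro exI[of _ "lead_coeff ` G"]) simp
qed

section \<open>The real closure of an ordered field\<close>

text \<open>This makes \<open>P - P\<close> an ordered subring with positive cone \<open>P\<close>.\<close>

definition ordered_cone :: "'a::linordered_field alg_closure set \<Rightarrow> bool" where
  "ordered_cone P \<longleftrightarrow> (\<forall>a\<ge>0. to_ac a \<in> P) \<and>
     (\<forall>x\<in>P. \<forall>y\<in>P. x + y \<in> P \<and> x * y \<in> P \<and> (x - y \<in> P \<or> y - x \<in> P)) \<and>
     (\<forall>x. x \<in> P \<longrightarrow> - x \<in> P \<longrightarrow> x = 0)"

lemma ordered_coneD:
  assumes "ordered_cone P"
  shows "0 \<le> a \<Longrightarrow> to_ac a \<in> P" "x \<in> P \<Longrightarrow> y \<in> P \<Longrightarrow> x + y \<in> P" "x \<in> P \<Longrightarrow> y \<in> P \<Longrightarrow> x * y \<in> P"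
    "x \<in> P \<Longrightarrow> y \<in> P \<Longrightarrow> x - y \<in> P \<or> y - x \<in> P" "x \<in> P \<Longrightarrow> - x \<in> P \<Longrightarrow> x = 0"
  using assms unfolding ordered_cone_def by blast+

lemma ordered_coneI:
  assumes "\<And>a. 0 \<le> a \<Longrightarrow> to_ac a \<in> P" "\<And>x y. x \<in> P \<Longrightarrow> y \<in> P \<Longrightarrow> x + y \<in> P"
    "\<And>x y. x \<in> P \<Longrightarrow> y \<in> P \<Longrightarrow> x * y \<in> P"
    "\<And>x y. x \<in> P \<Longrightarrow> y \<in> P \<Longrightarrow> x - y \<in> P \<or> y - x \<in> P" "\<And>x. x \<in> P \<Longrightarrow> - x \<in> P \<Longrightarrow> x = 0"
  shows "ordered_cone P"
  unfolding ordered_cone_def by (intro conjI allI impI ballI assms)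

lemma maximal_ordered_cone_exists:
  "\<exists>P :: 'a::linordered_field alg_closure set. ordered_cone P \<and> (\<forall>Q. ordered_cone Q \<longrightarrow> P \<subseteq> Q \<longrightarrow> Q = P)"
proof -
  have "\<exists>M\<in>Collect ordered_cone. \<forall>W\<in>Collect ordered_cone. M \<subseteq> W \<longrightarrow> W = (M :: 'a alg_closure set)"
  proof (rule subset_Zorn_nonempty)
    have "ordered_cone (to_ac ` {0 :: 'a..})"
    proof (rule ordered_coneI)
      fix x y :: "'a alg_closure" assume "x \<in> to_ac ` {0..}" "y \<in> to_ac ` {0..}"
      then obtain a b where ab: "x = to_ac a" "y = to_ac b" "a \<ge> 0" "b \<ge> 0" by auto
      then have eq: "x + y = to_ac (a + b)" "x * y = to_ac (a * b)" "x - y = to_ac (a - b)" "y - x = to_ac (b - a)" by simp_all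
      have I: "to_ac c \<in> to_ac ` {0..}" if "c \<ge> 0" for c :: 'a using that by blast
      show "x + y \<in> to_ac ` {0..}" "x * y \<in> to_ac ` {0..}" unfolding eq using ab by (intro I; simp)+
      have "a - b \<ge> 0 \<or> b - a \<ge> 0" by auto
      then show "x - y \<in> to_ac ` {0..} \<or> y - x \<in> to_ac ` {0..}" unfolding eq using I by blast
    next
      fix x :: "'a alg_closure" assume "x \<in> to_ac ` {0..}" "- x \<in> to_ac ` {0..}"
      then obtain a b where ab: "x = to_ac a" "- x = to_ac b" "a \<ge> 0" "b \<ge> 0" by auto
      then have "to_ac (a + b) = 0" by (simp flip: ab(1,2))
      then have "a + b = 0" by (simp only: to_ac_eq_0_iff)
      then show "x = 0" using ab by (simp add: add_nonneg_eq_0_iff)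
    qed auto
    then show "Collect (ordered_cone :: 'a alg_closure set \<Rightarrow> bool) \<noteq> {}" by blast
    fix C :: "'a alg_closure set set" assume C: "C \<noteq> {}" "subset.chain (Collect ordered_cone) C"
    have oc: "ordered_cone P" if "P \<in> C" for P using C that by (auto simp: subset.chain_def)
    have two: "\<exists>W\<in>C. x \<in> W \<and> y \<in> W" if "x \<in> \<Union>C" "y \<in> \<Union>C" for x y
      using that C unfolding subset.chain_def by blast
    have "ordered_cone (\<Union>C)"
    proof (rule ordered_coneI)
      fix x y assume "x \<in> \<Union>C" "y \<in> \<Union>C"
      then obtain W where W: "W \<in> C" "x \<in> W" "y \<in> W" using two by blast
      note D = ordered_coneD[OF oc[OF W(1)]]
      show "x + y \<in> \<Union>C" "x * y \<in> \<Union>C" "x - y \<in> \<Union>C \<or> y - x \<in> \<Union>C"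
        using D(2-4)[OF W(2,3)] W(1) by blast+
    next
      fix x assume "x \<in> \<Union>C" "- x \<in> \<Union>C"
      then obtain W where W: "W \<in> C" "x \<in> W" "- x \<in> W" using two by blast
      show "x = 0" by (rule ordered_coneD(5)[OF oc[OF W(1)] W(2,3)])
    next
      fix a :: 'a assume "0 \<le> a"
      obtain W where "W \<in> C" using C(1) by blast
      then show "to_ac a \<in> \<Union>C" using ordered_coneD(1)[OF oc \<open>0 \<le> a\<close>] by blast
    qed
    then show "\<Union>C \<in> Collect ordered_cone" by simp
  qed
  then show ?thesis by blast
qed

definition rc_cone :: "'a::linordered_field alg_closure set" where
  "rc_cone = (SOME P. ordered_cone P \<and> (\<forall>Q. ordered_cone Q \<longrightarrow> P \<subseteq> Q \<longrightarrow> Q = P))"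

lemma rc_cone: "ordered_cone rc_cone" and rc_cone_maximal: "ordered_cone Q \<Longrightarrow> rc_cone \<subseteq> Q \<Longrightarrow> Q = rc_cone"
  using someI_ex[OF maximal_ordered_cone_exists] unfolding rc_cone_def by blast+

lemmas rc_coneD = ordered_coneD[OF rc_cone]

lemma rc_cone_0_1: "0 \<in> rc_cone" "1 \<in> rc_cone"
  using rc_coneD(1)[of 0] rc_coneD(1)[of 1] by simp_all

text \<open>The elements that enter the cone after multiplication by a nonzero \<open>d\<close> of
  the cone form an ordered cone again, that of the fraction field. Maximality identifies it with
  \<open>rc_cone\<close>.\<close>

lemma rc_cone_inverse:
  assumes "x \<in> rc_cone"
  shows "inverse x \<in> rc_cone"
proof (cases "x = 0")
  case False
  define Q :: "'a alg_closure set" where "Q = {y. \<exists>d\<in>rc_cone. d \<noteq> 0 \<and> d * y \<in> rc_cone}"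
  have QI: "d \<in> rc_cone \<Longrightarrow> d \<noteq> 0 \<Longrightarrow> d * y \<in> rc_cone \<Longrightarrow> y \<in> Q" for d y unfolding Q_def by blast
  have sub: "y \<in> Q" if "y \<in> rc_cone" for y using that rc_cone_0_1 unfolding Q_def by (auto intro!: bexI[of _ 1])
  have "ordered_cone Q"
  proof (rule ordered_coneI)
    fix y z assume "y \<in> Q" "z \<in> Q"
    then obtain d e where de: "d \<in> rc_cone" "d \<noteq> 0" "d * y \<in> rc_cone" "e \<in> rc_cone" "e \<noteq> 0" "e * z \<in> rc_cone"
      by (auto simp: Q_def)
    have 1: "(d * e) * (y + z) = e * (d * y) + d * (e * z)" "(d * e) * (y * z) = (d * y) * (e * z)"
      "(d * e) * (y - z) = e * (d * y) - d * (e * z)" "(d * e) * (z - y) = d * (e * z) - e * (d * y)"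
      by (simp_all add: algebra_simps)
    have 2: "d * e \<in> rc_cone" "d * e \<noteq> 0" "e * (d * y) \<in> rc_cone" "d * (e * z) \<in> rc_cone"
      using de by (simp_all add: rc_coneD)
    show "y + z \<in> Q" by (rule QI[OF 2(1,2)]) (simp only: 1(1) rc_coneD(2)[OF 2(3,4)])
    show "y * z \<in> Q" by (rule QI[OF 2(1,2)]) (simp only: 1(2) rc_coneD(3)[OF de(3,6)])
    have "(d * e) * (y - z) \<in> rc_cone \<or> (d * e) * (z - y) \<in> rc_cone"
      unfolding 1(3,4) by (rule rc_coneD(4)[OF 2(3,4)])
    then show "y - z \<in> Q \<or> z - y \<in> Q" using QI[OF 2(1,2)] by blast
  next
    fix y assume "y \<in> Q" "- y \<in> Q"
    then obtain d e where de: "d \<in> rc_cone" "d \<noteq> 0" "d * y \<in> rc_cone" "e \<in> rc_cone" "e \<noteq> 0" "e * (- y) \<in> rc_cone"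
      unfolding Q_def mem_Collect_eq by blast
    have "e * (d * y) \<in> rc_cone" "d * (e * (- y)) \<in> rc_cone" using de by (simp_all only: rc_coneD(3))
    moreover have "d * (e * (- y)) = - (e * (d * y))" by simp
    ultimately have "e * (d * y) = 0" using rc_coneD(5) by metis
    then show "y = 0" using de by simp
  qed (use sub rc_coneD(1) in blast)
  then have "Q = rc_cone" using rc_cone_maximal sub by blast
  moreover have "x * inverse x = 1" using False by simp
  then have "inverse x \<in> Q" using assms False rc_cone_0_1 unfolding Q_def by (auto intro!: bexI[of _ x])
  ultimately show ?thesis by simp
qed (use rc_cone_0_1 in simp)

definition rc_set :: "'a::linordered_field alg_closure set" where
  "rc_set = {x. x \<in> rc_cone \<or> - x \<in> rc_cone}"

lemma rc_set_uminus: "x \<in> rc_set \<Longrightarrow> - x \<in> rc_set"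
  by (auto simp: rc_set_def)

lemma rc_set_0_1: "0 \<in> rc_set" "1 \<in> rc_set"
  using rc_cone_0_1 by (auto simp: rc_set_def)

lemma rc_cone_subset: "x \<in> rc_cone \<Longrightarrow> x \<in> rc_set"
  by (simp add: rc_set_def)

lemma rc_set_add:
  assumes "x \<in> rc_set" "y \<in> rc_set"
  shows "x + y \<in> rc_set"
proof -
  have mixed: "u + v \<in> rc_set" if "u \<in> rc_cone" "- v \<in> rc_cone" for u v :: "'a alg_closure"
  proof -
    have "u - (- v) \<in> rc_cone \<or> (- v) - u \<in> rc_cone" by (rule rc_coneD(4)[OF that])
    moreover have "u - (- v) = u + v" "(- v) - u = - (u + v)" by simp_all
    ultimately show ?thesis unfolding rc_set_def by (simp only: mem_Collect_eq)
  qed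
  have same: "u + v \<in> rc_set" if "- u \<in> rc_cone" "- v \<in> rc_cone" for u v :: "'a alg_closure"
  proof -
    have "- (u + v) = - u + - v" by simp
    then show ?thesis using rc_coneD(2)[OF that] unfolding rc_set_def by (simp only: mem_Collect_eq simp_thms)
  qed
  show ?thesis
    using assms mixed[of x y] mixed[of y x] same[of x y] rc_cone_subset[OF rc_coneD(2)[of x y]]
    unfolding rc_set_def[where 'a = 'a] by (auto simp: add.commute)
qed

lemma rc_set_mult:
  assumes "x \<in> rc_set" "y \<in> rc_set"
  shows "x * y \<in> rc_set"
proof -
  have "\<exists>x'\<in>rc_cone. x' = x \<or> x' = - x" "\<exists>y'\<in>rc_cone. y' = y \<or> y' = - y"
    using assms by (auto simp: rc_set_def)
  then obtain x' y' where "x' \<in> rc_cone" "y' \<in> rc_cone" "x' = x \<or> x' = - x" "y' = y \<or> y' = - y" by blast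
  then have "x' * y' \<in> rc_cone" "x' * y' = x * y \<or> x' * y' = - (x * y)" by (auto simp: rc_coneD)
  then show ?thesis by (auto simp: rc_set_def)
qed

lemma rc_set_inverse: "x \<in> rc_set \<Longrightarrow> inverse x \<in> rc_set"
  using rc_cone_inverse[of x] rc_cone_inverse[of "- x"] by (auto simp: rc_set_def)

lemma rc_set_diff: "x \<in> rc_set \<Longrightarrow> y \<in> rc_set \<Longrightarrow> x - y \<in> rc_set"
  using rc_set_add[of x "- y"] rc_set_uminus[of y] by simp

lemma rc_set_divide: "x \<in> rc_set \<Longrightarrow> y \<in> rc_set \<Longrightarrow> x / y \<in> rc_set"
  using rc_set_mult[of x "inverse y"] rc_set_inverse[of y] by (simp add: field_class.field_divide_inverse)

section \<open>The real closure as an ordered field\<close>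

typedef (overloaded) ('a::linordered_field) real_closure = "rc_set :: 'a alg_closure set"
  using rc_set_0_1 by blast

setup_lifting type_definition_real_closure

instantiation real_closure :: (linordered_field) linordered_field
begin

lift_definition zero_real_closure :: "'a real_closure" is 0 by (rule rc_set_0_1)
lift_definition one_real_closure :: "'a real_closure" is 1 by (rule rc_set_0_1)
lift_definition plus_real_closure :: "'a real_closure \<Rightarrow> 'a real_closure \<Rightarrow> 'a real_closure" is "(+)"
  by (rule rc_set_add)
lift_definition minus_real_closure :: "'a real_closure \<Rightarrow> 'a real_closure \<Rightarrow> 'a real_closure" is "(-)"
  by (rule rc_set_diff)
lift_definition times_real_closure :: "'a real_closure \<Rightarrow> 'a real_closure \<Rightarrow> 'a real_closure" is "(*)"
  by (rule rc_set_mult)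
lift_definition divide_real_closure :: "'a real_closure \<Rightarrow> 'a real_closure \<Rightarrow> 'a real_closure" is "(/)"
  by (rule rc_set_divide)
lift_definition uminus_real_closure :: "'a real_closure \<Rightarrow> 'a real_closure" is uminus
  by (rule rc_set_uminus)
lift_definition inverse_real_closure :: "'a real_closure \<Rightarrow> 'a real_closure" is inverse
  by (rule rc_set_inverse)
lift_definition less_eq_real_closure :: "'a real_closure \<Rightarrow> 'a real_closure \<Rightarrow> bool" is "\<lambda>x y. y - x \<in> rc_cone" .

definition "less_real_closure x (y :: 'a real_closure) \<longleftrightarrow> x \<le> y \<and> \<not> y \<le> x"
definition "abs_real_closure (x :: 'a real_closure) = (if x < 0 then - x else x)"
definition sgn_real_closure :: "'a real_closure \<Rightarrow> 'a real_closure" where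
  "sgn_real_closure x = (if x = 0 then 0 else if 0 < x then 1 else - 1)"

lemma real_closure_antisym:
  fixes x y :: "'a real_closure"
  assumes "x \<le> y" "y \<le> x"
  shows "x = y"
  using assms
proof transfer
  fix x y :: "'a alg_closure" assume "y - x \<in> rc_cone" "x - y \<in> rc_cone"
  then have "y - x = 0" using rc_coneD(5)[of "y - x"] by simp
  then show "x = y" by simp
qed

instance
proof
  fix x y z :: "'a real_closure"
  show "x + y + z = x + (y + z)" by transfer (rule add.assoc)
  show "x + y = y + x" by transfer (rule add.commute)
  show "0 + x = x" by transfer simp
  show "- x + x = 0" by transfer simp
  show "x - y = x + - y" by transfer simp
  show "x * y * z = x * (y * z)" by transfer (rule mult.assoc)
  show "x * y = y * x" by transfer (rule mult.commute)
  show "1 * x = x" by transfer simp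
  show "(x + y) * z = x * z + y * z" by transfer (rule distrib_right)
  show "(0 :: 'a real_closure) \<noteq> 1" by transfer simp
  show "x \<noteq> 0 \<Longrightarrow> inverse x * x = 1" by transfer simp
  show "x + y - x = y" "x - y - z = x - (y + z)" "0 * x = 0" "x * 0 = 0" by (transfer; simp)+
  show "x div y = x * inverse y" by transfer (simp add: field_class.field_divide_inverse)
  show "inverse (0 :: 'a real_closure) = 0" by transfer simp
  show "(x < y) = (x \<le> y \<and> \<not> y \<le> x)" by (rule less_real_closure_def)
  show "x \<le> x" by transfer (simp add: rc_cone_0_1)
  show "x \<le> y \<Longrightarrow> y \<le> z \<Longrightarrow> x \<le> z"
  proof transfer
    fix x y z :: "'a alg_closure" assume "y - x \<in> rc_cone" "z - y \<in> rc_cone"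
    from rc_coneD(2)[OF this] show "z - x \<in> rc_cone" by simp
  qed
  show "x \<le> y \<Longrightarrow> y \<le> x \<Longrightarrow> x = y" by (rule real_closure_antisym)
  show "x \<le> y \<or> y \<le> x"
  proof transfer
    fix x y :: "'a alg_closure" assume "x \<in> rc_set" "y \<in> rc_set"
    from rc_set_diff[OF this] show "y - x \<in> rc_cone \<or> x - y \<in> rc_cone" by (auto simp: rc_set_def)
  qed
  show "x \<le> y \<Longrightarrow> z + x \<le> z + y" by transfer simp
  show "x < y \<Longrightarrow> 0 < z \<Longrightarrow> z * x < z * y"
  proof -
    assume "x < y" "0 < z"
    then have *: "x \<le> y" "x \<noteq> y" "0 \<le> z" "z \<noteq> 0" by (auto simp: less_real_closure_def)
    have "z * x \<le> z * y" using *(1,3)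
    proof transfer
      fix x y z :: "'a alg_closure" assume "y - x \<in> rc_cone" "z - 0 \<in> rc_cone"
      then have "z * (y - x) \<in> rc_cone" by (simp add: rc_coneD)
      then show "z * y - z * x \<in> rc_cone" by (simp add: algebra_simps)
    qed
    moreover have "z * x \<noteq> z * y" using *(2,4) by transfer simp
    ultimately show "z * x < z * y" unfolding less_real_closure_def using real_closure_antisym by blast
  qed
  show "\<bar>x\<bar> = (if x < 0 then - x else x)" by (rule abs_real_closure_def)
  show "sgn x = (if x = 0 then 0 else if 0 < x then 1 else - 1)" by (rule sgn_real_closure_def)
qed

end

lemma idom_hom_Rep_real_closure: "idom_hom (Rep_real_closure :: 'a::linordered_field real_closure \<Rightarrow> _)"
  by unfold_locales (transfer; simp)+

lift_definition to_real_closure :: "'a::linordered_field \<Rightarrow> 'a real_closure" is to_ac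
  by (metis rc_cone_subset rc_coneD(1) rc_set_uminus to_ac_minus minus_minus neg_0_le_iff_le linorder_linear)

lemma idom_hom_to_real_closure: "idom_hom (to_real_closure :: 'a::linordered_field \<Rightarrow> _)"
  by unfold_locales (transfer; simp)+

lemma to_real_closure_nonneg: "0 \<le> a \<Longrightarrow> 0 \<le> to_real_closure a"
  by transfer (simp add: rc_coneD)

lemma to_real_closure_eq_0_iff: "to_real_closure a = 0 \<longleftrightarrow> a = 0"
  by transfer simp

lemma Rep_real_closure_nonneg: "0 \<le> x \<longleftrightarrow> Rep_real_closure x \<in> rc_cone"
  by transfer simp

text \<open>Sums of squares with nonnegative weights: the ordering can be extended to
  \<open>B\<close> once \<open>- 1\<close> is not among them.\<close>

inductive_set weighted_squares :: "'a::linordered_field alg_closure set \<Rightarrow> 'a alg_closure set"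
  for B where
    "c \<in> rc_cone \<Longrightarrow> b \<in> B \<Longrightarrow> c * (b * b) \<in> weighted_squares B"
  | "x \<in> weighted_squares B \<Longrightarrow> y \<in> weighted_squares B \<Longrightarrow> x + y \<in> weighted_squares B"

lemma weighted_squares_mult:
  assumes B: "subring_on B" and "x \<in> weighted_squares B" "y \<in> weighted_squares B"
  shows "x * y \<in> weighted_squares B"
  using assms(2)
proof induction
  case (1 c b)
  show ?case using assms(3)
  proof induction
    case (1 d e)
    have "(c * d) * ((b * e) * (b * e)) \<in> weighted_squares B"
      using 1 \<open>c \<in> rc_cone\<close> \<open>b \<in> B\<close> by (intro weighted_squares.intros rc_coneD subring_onD[OF B])
    then show ?case by (simp add: mult_ac)
  qed (simp add: distrib_left weighted_squares.intros)
qed (simp add: distrib_right weighted_squares.intros)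

text \<open>A counterexample to the intermediate value property of minimal degree would allow the
  maximal ordered subring to be enlarged by one of the roots of that polynomial.\<close>

lemma real_closure_ivt_minimal:
  fixes p :: "'a::linordered_field real_closure poly"
  assumes ab: "a < b" "poly p a < 0" "0 < poly p b" and no_root: "\<And>c. a < c \<Longrightarrow> c < b \<Longrightarrow> poly p c \<noteq> 0"
    and min: "\<And>(q :: 'a real_closure poly) a b. degree q < degree p \<Longrightarrow> a < b \<Longrightarrow> poly q a * poly q b < 0 \<Longrightarrow>
      \<exists>c. a < c \<and> c < b \<and> poly q c = 0"
  shows False
proof -
  let ?R = "Rep_real_closure :: 'a real_closure \<Rightarrow> 'a alg_closure"
  note H = idom_hom_map_poly[OF idom_hom_Rep_real_closure[where 'a = 'a]]
  \<comment> \<open>In a proper factorisation one factor would change sign between \<open>a\<close>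
    and \<open>b\<close> and, having smaller degree, would have a root there.\<close>
  have factor: False if "p = q * h" "degree q < degree p" "degree h < degree p" for q h
  proof -
    have "poly q a * poly q b < 0 \<or> poly h a * poly h b < 0"
      using ab(2,3) unfolding that(1) poly_mult
      by (auto simp: mult_less_0_iff zero_less_mult_iff)
    then have "\<exists>c. a < c \<and> c < b \<and> (poly q c = 0 \<or> poly h c = 0)"
      using min[OF that(2) ab(1)] min[OF that(3) ab(1)] by blast
    then show False using no_root unfolding that(1) poly_mult by auto
  qed
  have deg: "degree p > 0"
  proof (rule ccontr)
    assume "\<not> ?thesis"
    then obtain c where "p = [:c:]" using degree_eq_zeroE by blast
    then show False using ab by auto
  qed
  have nz: "p \<noteq> 0" using deg by auto
  have R0: "?R c = 0 \<longleftrightarrow> c = 0" for c by transfer simp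
  have degR: "degree (map_poly ?R q) = degree q" for q
    by (cases "q = 0") (auto intro!: map_poly_degree_eq simp: R0)
  have "degree (map_poly ?R p) > 0" by (simp only: degR deg)
  from alg_closed_imp_poly_has_root[OF this] obtain \<gamma> where \<gamma>: "poly (map_poly ?R p) \<gamma> = 0" ..
  define ev where "ev q = poly (map_poly ?R q) \<gamma>" for q
  have ev: "ev (q + r) = ev q + ev r" "ev (q * r) = ev q * ev r" "ev (smult c q) = ?R c * ev q"
    "ev (q - r) = ev q - ev r" "ev [:c:] = ?R c" "ev p = 0" for q r c
    using \<gamma> by (simp_all add: ev_def H)
  have ev1: "ev 0 = 0" "ev 1 = 1" using ev(5)[of 0] ev(5)[of 1]
    by (simp_all add: zero_real_closure.rep_eq one_real_closure.rep_eq pCons_one)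
  have ev_mod: "ev (q mod r) = ev q" if "ev r = 0" for q r
    using ev(1)[of "q div r * r" "q mod r"] ev(2)[of "q div r" r] that by simp
  \<comment> \<open>So \<open>p\<close> is a minimal polynomial of \<open>\<gamma>\<close>: an
    annihilating polynomial of least degree divides \<open>p\<close>, and \<open>p\<close> has no
    proper factorisation.\<close>
  have least: "degree p \<le> degree q" if "q \<noteq> 0" "ev q = 0" for q
    using that
  proof (induction "degree q" arbitrary: q rule: less_induct)
    case less
    show ?case
    proof (rule ccontr)
      assume n: "\<not> degree p \<le> degree q"
      have dq: "degree q > 0"
      proof (rule ccontr)
        assume "\<not> ?thesis"
        then obtain c where "q = [:c:]" using degree_eq_zeroE by blast
        then show False using less.prems ev(5)[of c] Rep_real_closure_inject[of c 0]
          by (simp add: zero_real_closure.rep_eq)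
      qed
      have "p mod q = 0"
      proof (rule ccontr)
        assume m: "p mod q \<noteq> 0"
        then have "degree (p mod q) < degree q" using degree_mod_less'[OF less.prems(1)] by blast
        moreover from this have "degree p \<le> degree (p mod q)"
          using ev_mod[OF less.prems(2), of p] ev(6) by (intro less.hyps m) simp_all
        ultimately show False using n by simp
      qed
      then obtain h where h: "p = q * h" by (metis dvd_imp_mod_0 mod_0_imp_dvd dvdE)
      then have "degree p = degree q + degree h" using nz by (auto intro: degree_mult_eq)
      then show False using factor[OF h] n dq by simp
    qed
  qed
  define B where "B = range ev"
  have B: "subring_on B" unfolding subring_on_def B_def
  proof (intro conjI ballI)
    show "0 \<in> range ev" "1 \<in> range ev" using rangeI[of ev 0] rangeI[of ev 1] ev1 by simp_all
    fix x assume x: "x \<in> range ev"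
    then obtain q where q: "x = ev q" by blast
    have "- x = ev (0 - q)" using ev(4)[of 0 q] ev1 q by simp
    then show "- x \<in> range ev" by blast
    fix y assume y: "y \<in> range ev"
    then obtain s where s: "y = ev s" by blast
    show "x + y \<in> range ev" "x * y \<in> range ev"
      using rangeI[of ev "q + s"] rangeI[of ev "q * s"] ev(1)[of q s] ev(2)[of q s] q s by simp_all
  qed
  have RB: "?R c \<in> B" for c unfolding B_def using rangeI[of ev "[:c:]"] ev(5)[of c] by simp
  have coneR: "\<exists>c. x = ?R c \<and> c \<ge> 0" if "x \<in> rc_cone" for x
  proof -
    note x = that
    obtain c where c: "x = ?R c" using Rep_real_closure_cases[OF rc_cone_subset[OF x]] by blast
    then have "0 \<le> c" using x by (simp add: Rep_real_closure_nonneg)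
    then show ?thesis using c by blast
  qed
  define T where "T = weighted_squares B"
  have T: "preorder_on B T" unfolding preorder_on_def
  proof (intro conjI ballI)
    show "T \<subseteq> B"
    proof
      fix x assume "x \<in> T"
      then show "x \<in> B" unfolding T_def
      proof induction
        case (1 c b)
        then show ?case using coneR[of c] RB by (auto intro!: subring_onD[OF B])
      qed (rule subring_onD[OF B])
    qed
    show "b * b \<in> T" if "b \<in> B" for b
      using weighted_squares.intros(1)[OF rc_cone_0_1(2) that] by (simp add: T_def)
  qed (simp_all add: T_def weighted_squares.intros(2) weighted_squares_mult[OF B])
  \<comment> \<open>Reduction modulo \<open>p\<close> represents each square by one of a polynomial
    of degree below \<open>degree p\<close>. The resulting bound on \<open>degree t\<close> makes
    the cofactor \<open>h\<close> below small enough for \<open>min\<close>.\<close>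
  have repr: "\<exists>t. x = ev t \<and> (\<forall>r. poly t r \<ge> 0) \<and> degree t \<le> 2 * (degree p - 1)" if "x \<in> T" for x
    using that unfolding T_def
  proof induction
    case (1 c b)
    obtain d where d: "c = ?R d" "d \<ge> 0" using coneR 1 by blast
    obtain s where s: "b = ev s" using 1 by (auto simp: B_def)
    define s' where "s' = s mod p"
    have s': "b = ev s'" unfolding s'_def s by (rule ev_mod[OF ev(6), symmetric])
    have "degree s' \<le> degree p - 1"
      using degree_mod_less'[OF nz, of s] deg unfolding s'_def by (cases "s mod p = 0") auto
    moreover have "degree (smult d (s' * s')) \<le> degree s' + degree s'"
      using degree_smult_le[of d "s' * s'"] degree_mult_le[of s' s'] by (rule order_trans)
    ultimately have "degree (smult d (s' * s')) \<le> 2 * (degree p - 1)" by simp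
    moreover have "poly (smult d (s' * s')) r \<ge> 0" for r using d(2) by simp
    moreover have "c * (b * b) = ev (smult d (s' * s'))" by (simp add: ev d s')
    ultimately show ?case by blast
  next
    case (2 x y)
    then obtain t u where "x = ev t" "\<forall>r. poly t r \<ge> 0" "degree t \<le> 2 * (degree p - 1)"
      "y = ev u" "\<forall>r. poly u r \<ge> 0" "degree u \<le> 2 * (degree p - 1)" by blast
    then have "x + y = ev (t + u)" "\<forall>r. poly (t + u) r \<ge> 0" "degree (t + u) \<le> 2 * (degree p - 1)"
      by (simp_all add: ev degree_add_le)
    then show ?case by blast
  qed
  \<comment> \<open>Otherwise \<open>1 + t\<close> would be positive everywhere and divisible by
    \<open>p\<close>. The cofactor has smaller degree than \<open>p\<close> and changes sign between
    \<open>a\<close> and \<open>b\<close> together with \<open>p\<close>, so it has a root, at which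
    \<open>1 + t\<close> vanishes.\<close>
  have "- 1 \<notin> T"
  proof
    assume "- 1 \<in> T"
    then obtain t where t: "- 1 = ev t" "\<And>r. poly t r \<ge> 0" "degree t \<le> 2 * (degree p - 1)" using repr by blast
    define F where "F = 1 + t"
    have F: "ev F = 0" unfolding F_def using ev(1)[of 1 t] ev1 t(1)[symmetric] by simp
    have Fpos: "poly F r > 0" for r unfolding F_def using t(2)[of r] by (simp add: add_pos_nonneg)
    then have F0: "F \<noteq> 0" by auto
    have degF: "degree F \<le> 2 * (degree p - 1)" unfolding F_def using t(3) by (intro degree_add_le) auto
    have "F mod p = 0"
    proof (rule ccontr)
      assume m: "F mod p \<noteq> 0"
      then have "degree (F mod p) < degree p" using degree_mod_less'[OF nz] by blast
      moreover have "ev (F mod p) = 0" using ev_mod[OF ev(6), of F] F by simp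
      then have "degree p \<le> degree (F mod p)" by (rule least[OF m])
      ultimately show False by linarith
    qed
    then obtain h where h: "F = p * h" by (metis mod_0_imp_dvd dvdE)
    then have "degree F = degree p + degree h" using F0 by (auto intro: degree_mult_eq)
    then have dh: "degree h < degree p" using degF deg by simp
    have "poly h a < 0" "poly h b > 0"
      using Fpos[of a] Fpos[of b] ab(2,3) unfolding h poly_mult by (auto simp: zero_less_mult_iff)
    then have "poly h a * poly h b < 0" by (simp add: mult_neg_pos)
    then obtain c where "poly h c = 0" using min[OF dh ab(1)] by blast
    then have "poly F c = 0" unfolding h by simp
    then show False using Fpos[of c] by simp
  qed
  then obtain P where P: "T \<subseteq> P" "prime_cone_on B P"
    using abstract_positivstellensatz[OF B T, of "{1}"] subring_onD(2)[OF B] by auto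
  then have pre: "preorder_on B P" and total: "\<And>x. x \<in> B \<Longrightarrow> x \<in> P \<or> - x \<in> P" and m1: "- 1 \<notin> P"
    unfolding prime_cone_on_def by blast+
  note PD = preorder_onD[OF pre]
  have coneP: "x \<in> P" if "x \<in> rc_cone" for x
    using weighted_squares.intros(1)[OF that subring_onD(2)[OF B]] P(1) by (auto simp: T_def)
  \<comment> \<open>All elements are algebraic over the base field: an equation with nonzero
    constant term makes \<open>- 1\<close> a multiple of \<open>x\<close>.\<close>
  have supp: "x = 0" if x: "x \<in> P" "- x \<in> P" for x
  proof (rule ccontr)
    assume "x \<noteq> 0"
    have ideal: "y * x \<in> P" if y: "y \<in> B" for y
      using total[OF y] PD(4)[OF _ x(1), of y] PD(4)[OF _ x(2), of "- y"] by auto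
    obtain q0 :: "'a poly" where q0: "q0 \<noteq> 0" "poly (map_poly to_ac q0) x = 0" by (rule alg_closure_algebraic)
    have "\<exists>q :: 'a poly. coeff q 0 \<noteq> 0 \<and> poly (map_poly to_ac q) x = 0" using q0
    proof (induction q0)
      case (pCons c q)
      show ?case
      proof (cases "c = 0")
        case True
        then have "poly (map_poly to_ac q) x = 0" "q \<noteq> 0"
          using pCons \<open>x \<noteq> 0\<close> by (auto simp: map_poly_pCons)
        then show ?thesis using pCons by blast
      next
        case False
        then show ?thesis using pCons by (intro exI[of _ "pCons c q"]) auto
      qed
    qed simp
    then obtain c and q :: "'a poly" where c: "c \<noteq> 0" "poly (map_poly to_ac (pCons c q)) x = 0"
      by (metis pCons_cases coeff_pCons_0)
    have "map_poly to_ac (pCons c q) = pCons (to_ac c) (map_poly to_ac q)"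
      using c(1) by (simp add: map_poly_pCons)
    then have "to_ac c + x * poly (map_poly to_ac q) x = 0" using c(2) by simp
    then have eq: "to_ac c = - (poly (map_poly to_ac q) x * x)" by (simp add: add_eq_0_iff mult.commute)
    have toB: "to_ac e \<in> B" for e :: 'a
      using RB[of "to_real_closure e"] by (simp add: to_real_closure.rep_eq)
    have "poly (map_poly to_ac q) x \<in> B" using PD(1)[OF x(1)] toB
      by (induction q) (auto simp: map_poly_pCons intro!: subring_onD[OF B])
    define w where "w = poly (map_poly to_ac q) x"
    have w: "w \<in> B" unfolding w_def by fact
    define v where "v = inverse (to_ac c)"
    have v: "v \<in> B" unfolding v_def using toB[of "inverse c"] by simp
    have "- 1 = - (v * to_ac c)" using c(1) by (simp add: v_def)
    also have "\<dots> = (v * w) * x" unfolding eq w_def by simp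
    finally have "- 1 = (v * w) * x" .
    then show False using m1 ideal[OF subring_onD(4)[OF B v w]] by simp
  qed
  have "ordered_cone P"
  proof (rule ordered_coneI)
    show "to_ac e \<in> P" if "0 \<le> e" for e using coneP rc_coneD(1)[OF that] by blast
    show "x - y \<in> P \<or> y - x \<in> P" if "x \<in> P" "y \<in> P" for x y
      using total[of "x - y"] subring_onD(6)[OF B PD(1)[OF that(1)] PD(1)[OF that(2)]] by simp
  qed (use PD(3,4) supp in blast)+
  \<comment> \<open>Maximality places \<open>\<gamma>\<close> in the real closure itself; hence
    \<open>p\<close> is linear and its root is found explicitly.\<close>
  then have "P = rc_cone" using rc_cone_maximal coneP by blast
  moreover have "ev [:0, 1:] = \<gamma>" by (simp add: ev_def map_poly_pCons zero_real_closure.rep_eq one_real_closure.rep_eq)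
  then have "\<gamma> \<in> B" unfolding B_def using rangeI[of ev "[:0, 1:]"] by simp
  ultimately have "\<gamma> \<in> rc_set" using total[of \<gamma>] unfolding rc_set_def by blast
  then obtain c where c: "\<gamma> = ?R c" using Rep_real_closure_cases by blast
  have "ev [:- c, 1:] = 0" by (simp add: ev_def map_poly_pCons uminus_real_closure.rep_eq one_real_closure.rep_eq c)
  then have "degree p \<le> 1" using least[of "[:- c, 1:]"] by simp
  then have d1: "degree p = 1" using deg by simp
  define u v where "u = coeff p 0" and "v = coeff p 1"
  have uv: "poly p x = u + v * x" for x by (simp add: poly_altdef d1 u_def v_def)
  have "u + v * a < 0" "u + v * b > 0" using ab(2,3) uv by simp_all
  then have "v * (b - a) > 0" by (simp add: algebra_simps)
  then have "v > 0" using ab(1) by (simp add: zero_less_mult_iff)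
  define r where "r = - u / v"
  have "a < r" "r < b" "poly p r = 0"
    using \<open>u + v * a < 0\<close> \<open>u + v * b > 0\<close> \<open>v > 0\<close> unfolding r_def uv
    by (simp_all add: field_simps)
  then show False using no_root by blast
qed

lemma real_closure_ivt:
  fixes p :: "'a::linordered_field real_closure poly"
  assumes "a < b" "poly p a * poly p b < 0"
  shows "\<exists>c. a < c \<and> c < b \<and> poly p c = 0"
  using assms
proof (induction "degree p" arbitrary: p a b rule: less_induct)
  case less
  show ?case
  proof (rule ccontr)
    assume n: "\<not> ?case"
    show False
    proof (cases "poly p a < 0")
      case True
      then have "0 < poly p b" using less.prems(2) by (simp add: mult_less_0_iff)
      from real_closure_ivt_minimal[OF less.prems(1) True this _ less.hyps] n show False by blast
    next
      case False
      then have "poly (- p) a < 0" "0 < poly (- p) b" using less.prems(2) by (auto simp: mult_less_0_iff)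
      note p = this
      show False
      proof (rule real_closure_ivt_minimal[OF less.prems(1) p])
        show "poly (- p) c \<noteq> 0" if "a < c" "c < b" for c using n that by auto
        show "\<exists>c. a < c \<and> c < b \<and> poly q c = 0"
          if "degree q < degree (- p)" "a < b" "poly q a * poly q b < 0" for q :: "'a real_closure poly" and a b
          using that by (intro less.hyps) simp_all
      qed
    qed
  qed
qed

instance real_closure :: (linordered_field) rcf
proof
  fix a b :: "'a real_closure" and cs
  assume "a < b" "foldr (\<lambda>c y. c + a * y) cs 0 < 0" "0 < foldr (\<lambda>c y. c + b * y) cs 0"
  then show "\<exists>x. a < x \<and> x < b \<and> foldr (\<lambda>c y. c + x * y) cs 0 = 0"
    using real_closure_ivt[of a b "Poly cs"] unfolding poly_Poly_foldr by (simp add: mult_neg_pos)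
qed

section \<open>Polynomials in several variables and the Artin-Lang theorem\<close>

lemma poly_mapping_sum_monomials:
  "(\<Sum>t\<in>Poly_Mapping.keys p. Poly_Mapping.single t (Poly_Mapping.lookup p t)) = p"
  by (rule poly_mapping_eqI)
     (auto simp: lookup_sum lookup_single when_def sum.delta in_keys_iff)

definition mono_ev :: "(nat \<Rightarrow> 'a::comm_ring_1) \<Rightarrow> mono \<Rightarrow> 'a" where
  "mono_ev a t = (\<Prod>i\<in>Poly_Mapping.keys t. a i ^ Poly_Mapping.lookup t i)"

text \<open>The map \<open>k\<close> on coefficients is arbitrary, so that one definition serves
  real points, restriction to a line and substitution of polynomials.\<close>

definition insertion :: "(real \<Rightarrow> 'a::comm_ring_1) \<Rightarrow> (nat \<Rightarrow> 'a) \<Rightarrow> rpoly \<Rightarrow> 'a" where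
  "insertion k a p = (\<Sum>t\<in>Poly_Mapping.keys p. k (Poly_Mapping.lookup p t) * mono_ev a t)"

lemma mono_ev_superset:
  assumes "finite A" "Poly_Mapping.keys t \<subseteq> A"
  shows "mono_ev a t = (\<Prod>i\<in>A. a i ^ Poly_Mapping.lookup t i)"
  unfolding mono_ev_def using assms
  by (intro prod.mono_neutral_left) (auto simp: in_keys_iff)

lemma mono_ev_add: "mono_ev a (s + t) = mono_ev a s * mono_ev a t"
proof -
  let ?A = "Poly_Mapping.keys s \<union> Poly_Mapping.keys t"
  have "mono_ev a (s + t) = (\<Prod>i\<in>?A. a i ^ Poly_Mapping.lookup (s + t) i)"
    by (rule mono_ev_superset) (auto simp: Poly_Mapping.keys_add)
  then show ?thesis
    by (simp add: mono_ev_superset[of ?A] lookup_add power_add prod.distrib)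
qed

lemma mono_ev_0 [simp]: "mono_ev a 0 = 1"
  by (simp add: mono_ev_def)

lemma mono_ev_single [simp]: "mono_ev a (Poly_Mapping.single i k) = a i ^ k"
  by (cases "k = 0") (simp_all add: mono_ev_def)

lemma insertion_superset:
  assumes "k 0 = 0" "finite A" "Poly_Mapping.keys p \<subseteq> A"
  shows "insertion k a p = (\<Sum>t\<in>A. k (Poly_Mapping.lookup p t) * mono_ev a t)"
  unfolding insertion_def using assms
  by (intro sum.mono_neutral_left) (auto simp: in_keys_iff)

context
  fixes k :: "real \<Rightarrow> 'a::comm_ring_1"
  assumes k: "comm_ring_hom k"
begin

interpretation k: comm_ring_hom k by (rule k)

lemma insertion_add: "insertion k a (p + q) = insertion k a p + insertion k a q"
proof -
  let ?A = "Poly_Mapping.keys p \<union> Poly_Mapping.keys q"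
  have "insertion k a (p + q) = (\<Sum>t\<in>?A. k (Poly_Mapping.lookup (p + q) t) * mono_ev a t)"
    by (rule insertion_superset) (auto simp: Poly_Mapping.keys_add)
  then show ?thesis
    by (simp add: insertion_superset[of k ?A] lookup_add k.hom_add distrib_right sum.distrib)
qed

lemma insertion_single: "insertion k a (Poly_Mapping.single t c) = k c * mono_ev a t"
  by (cases "c = 0") (simp_all add: insertion_def)

lemma insertion_0: "insertion k a 0 = 0"
  by (simp add: insertion_def)

lemma insertion_sum: "insertion k a (\<Sum>i\<in>A. p i) = (\<Sum>i\<in>A. insertion k a (p i))"
  by (induction A rule: infinite_finite_induct) (simp_all add: insertion_0 insertion_add)

lemma insertion_mult: "insertion k a (p * q) = insertion k a p * insertion k a q"
proof -
  let ?s = "\<lambda>p t. Poly_Mapping.single t (Poly_Mapping.lookup p t)"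
  have "p * q = (\<Sum>s\<in>Poly_Mapping.keys p. ?s p s) * (\<Sum>t\<in>Poly_Mapping.keys q. ?s q t)"
    by (simp only: poly_mapping_sum_monomials)
  also have "\<dots> = (\<Sum>s\<in>Poly_Mapping.keys p. \<Sum>t\<in>Poly_Mapping.keys q. ?s p s * ?s q t)"
    by (rule sum_product)
  finally have "insertion k a (p * q) =
      (\<Sum>s\<in>Poly_Mapping.keys p. \<Sum>t\<in>Poly_Mapping.keys q. insertion k a (?s p s * ?s q t))"
    by (simp only: insertion_sum)
  moreover have "insertion k a (?s p s * ?s q t) = insertion k a (?s p s) * insertion k a (?s q t)" for s t
    by (simp add: mult_single insertion_single mono_ev_add k.hom_mult mult_ac)
  ultimately have "insertion k a (p * q) =
      insertion k a (\<Sum>s\<in>Poly_Mapping.keys p. ?s p s) * insertion k a (\<Sum>t\<in>Poly_Mapping.keys q. ?s q t)"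
    by (simp only: insertion_sum sum_product)
  then show ?thesis by (simp only: poly_mapping_sum_monomials)
qed

lemma insertion_Const [simp]: "insertion k a (Const c) = k c"
  by (simp add: Const_def insertion_single)

lemma insertion_Var [simp]: "insertion k a (Var i) = a i"
  by (simp add: Var_def insertion_single)

lemma comm_ring_hom_insertion: "comm_ring_hom (insertion k a)"
proof -
  have "(1 :: rpoly) = Const 1" by (simp add: Const_def)
  then have "insertion k a 1 = 1" using insertion_Const[of a 1] by simp
  then show ?thesis
    by unfold_locales (simp_all add: insertion_add insertion_mult insertion_0)
qed

end

lemma Const_0 [simp]: "Const 0 = 0" and Const_1 [simp]: "Const 1 = 1"
  and Const_add: "Const (a + b) = Const a + Const b" and Const_mult: "Const (a * b) = Const a * Const b"
  and Const_uminus: "Const (- a) = - Const a" and Const_diff: "Const (a - b) = Const a - Const b"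
  by (simp_all add: Const_def single_add mult_single single_uminus single_diff)

lemma idom_hom_Const: "idom_hom Const"
  by unfold_locales (simp_all add: Const_add Const_mult)

lemma single_eq_Const_mult:
  "Poly_Mapping.single t c = Const c * (\<Prod>i\<in>Poly_Mapping.keys t. Var i ^ Poly_Mapping.lookup t i)"
proof -
  have "Var i ^ k = Poly_Mapping.single (Poly_Mapping.single i k) 1" for i k
    by (induction k) (simp_all add: Var_def mult_single single_add[symmetric])
  moreover have "(\<Prod>i\<in>A. Poly_Mapping.single (g i) (1 :: real)) = Poly_Mapping.single (\<Sum>i\<in>A. g i) 1"
    for A and g :: "nat \<Rightarrow> mono"
    by (induction A rule: infinite_finite_induct) (simp_all add: mult_single)
  ultimately show ?thesis by (simp add: Const_def mult_single poly_mapping_sum_monomials)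
qed

lemma polys_subset: "N \<le> M \<Longrightarrow> polys N \<subseteq> polys M"
  unfolding polys_def by fastforce

lemma Const_in_polys [simp]: "Const c \<in> polys N"
  by (auto simp: polys_def Const_def)

lemma Var_in_polys: "i < N \<Longrightarrow> Var i \<in> polys N"
  by (auto simp: polys_def Var_def)

lemma polys_add: "p \<in> polys N \<Longrightarrow> q \<in> polys N \<Longrightarrow> p + q \<in> polys N"
  using Poly_Mapping.keys_add[of p q] unfolding polys_def by blast

lemma polys_mult:
  assumes "p \<in> polys N" "q \<in> polys N"
  shows "p * q \<in> polys N"
proof -
  have "Poly_Mapping.keys u \<subseteq> {..<N}" if u: "u \<in> Poly_Mapping.keys (p * q)" for u
  proof -
    obtain s t where st: "u = s + t" "s \<in> Poly_Mapping.keys p" "t \<in> Poly_Mapping.keys q"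
      using u Poly_Mapping.keys_mult[of p q] by blast
    then have "Poly_Mapping.keys s \<subseteq> {..<N}" "Poly_Mapping.keys t \<subseteq> {..<N}" using assms by (auto simp: polys_def)
    then show ?thesis using Poly_Mapping.keys_add[of s t] unfolding st(1) by blast
  qed
  then show "p * q \<in> polys N" by (simp add: polys_def)
qed

lemma subring_on_polys: "subring_on (polys N)"
  unfolding subring_on_def
proof (intro conjI ballI)
  show "0 \<in> polys N" "1 \<in> polys N" using Const_in_polys[of 0 N] Const_in_polys[of 1 N] by simp_all
  fix p assume p: "p \<in> polys N"
  have "- p = Const (- 1) * p" by (simp add: Const_uminus)
  then show "- p \<in> polys N" using polys_mult[OF Const_in_polys p] by simp
qed (rule polys_add polys_mult; assumption)+

lemmas polysD = subring_onD[OF subring_on_polys]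

lemma polys_induct [consumes 1, case_names Const Var add mult]:
  assumes p: "p \<in> polys N"
    and C: "\<And>c. P (Const c)" and V: "\<And>i. i < N \<Longrightarrow> P (Var i)"
    and A: "\<And>p q. p \<in> polys N \<Longrightarrow> q \<in> polys N \<Longrightarrow> P p \<Longrightarrow> P q \<Longrightarrow> P (p + q)"
    and M: "\<And>p q. p \<in> polys N \<Longrightarrow> q \<in> polys N \<Longrightarrow> P p \<Longrightarrow> P q \<Longrightarrow> P (p * q)"
  shows "P p"
proof -
  define Q where "Q p \<longleftrightarrow> p \<in> polys N \<and> P p" for p
  have QC: "Q (Const c)" for c using C by (simp add: Q_def)
  have QV: "Q (Var i)" if "i < N" for i using V[OF that] Var_in_polys[OF that] by (simp add: Q_def)
  have QA: "Q (p + q)" if "Q p" "Q q" for p q using that A[of p q] polys_add by (simp add: Q_def)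
  have QM: "Q (p * q)" if "Q p" "Q q" for p q using that M[of p q] polys_mult by (simp add: Q_def)
  have Q01: "Q 0" "Q 1" using QC[of 0] QC[of 1] by simp_all
  have pow: "Q (p ^ k)" if "Q p" for p k
    using that Q01 QM by (induction k) simp_all
  have prod: "Q (prod f B)" if "\<And>i. i \<in> B \<Longrightarrow> Q (f i)" for f and B :: "nat set"
    using that Q01 QM by (induction B rule: infinite_finite_induct) simp_all
  have sum: "Q (sum f B)" if "\<And>i. i \<in> B \<Longrightarrow> Q (f i)" for f and B :: "mono set"
    using that Q01 QA by (induction B rule: infinite_finite_induct) simp_all
  have "Q (\<Sum>t\<in>Poly_Mapping.keys p. Poly_Mapping.single t (Poly_Mapping.lookup p t))"
  proof (rule sum)
    fix t assume t: "t \<in> Poly_Mapping.keys p"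
    have "Q (\<Prod>i\<in>Poly_Mapping.keys t. Var i ^ Poly_Mapping.lookup t i)"
      using p t by (intro prod pow QV) (auto simp: polys_def)
    then show "Q (Poly_Mapping.single t (Poly_Mapping.lookup p t))"
      unfolding single_eq_Const_mult by (rule QM[OF QC])
  qed
  then show ?thesis by (simp add: poly_mapping_sum_monomials Q_def)
qed

lemma in_polys: "\<exists>N. p \<in> polys N"
proof -
  define U where "U = (\<Union>t\<in>Poly_Mapping.keys p. Poly_Mapping.keys t)"
  have "finite U" by (simp add: U_def)
  then obtain N where "\<forall>i\<in>U. i < N" using finite_nat_set_iff_bounded by blast
  then have "p \<in> polys N" by (auto simp: polys_def U_def)
  then show ?thesis ..
qed

lemma insertion_cong:
  assumes "p \<in> polys N" "\<And>i. i < N \<Longrightarrow> a i = b i"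
  shows "insertion k a p = insertion k b p"
  unfolding insertion_def mono_ev_def using assms
  by (intro sum.cong prod.cong arg_cong2[where f = "(*)"] refl) (auto simp: polys_def subset_iff)

lemma peval_eq_insertion: "peval p x = insertion (\<lambda>c. c) (\<lambda>i. x $ i) p"
  by (simp add: peval_def insertion_def mono_ev_def)

lemma comm_ring_hom_real_id: "comm_ring_hom (\<lambda>c :: real. c)"
  by unfold_locales auto

lemma idom_hom_insertion_real: "idom_hom (insertion (\<lambda>c :: real. c) a)"
proof -
  interpret comm_ring_hom "insertion (\<lambda>c :: real. c) a" by (rule comm_ring_hom_insertion[OF comm_ring_hom_real_id])
  show ?thesis ..
qed

lemma idom_hom_peval: "idom_hom (\<lambda>p. peval p x)"
  unfolding peval_eq_insertion by (rule idom_hom_insertion_real)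

text \<open>The last variable becomes that of a univariate polynomial with coefficients in
  \<open>polys N\<close>. The coefficient type remains \<open>rpoly\<close>, so an induction on the
  number of variables does not change types.\<close>

lemma poly_coeffs_in_subset:
  assumes "p \<in> polys (Suc N)"
  shows "\<exists>q\<in>coeffs_in (polys N). p = poly q (Var N)"
  using assms
proof (induction rule: polys_induct)
  case (Const c)
  show ?case by (rule bexI[of _ "[:Const c:]"]) (auto simp: coeffs_in_def coeff_pCons polysD split: nat.split)
next
  case (Var i)
  then have "i < N \<or> i = N" by auto
  moreover have "[:0, 1:] \<in> coeffs_in (polys N)" by (auto simp: coeffs_in_def coeff_pCons polysD split: nat.split)
  moreover have "[:Var i:] \<in> coeffs_in (polys N)" if "i < N"
    using that by (auto simp: coeffs_in_def coeff_pCons polysD Var_in_polys split: nat.split)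
  ultimately show ?case by (auto intro: bexI[of _ "[:0, 1:]"] bexI[of _ "[:Var i:]"])
next
  case (add p q)
  then show ?case using subring_onD(3)[OF subring_on_coeffs_in[OF subring_on_polys]] by (metis poly_add)
next
  case (mult p q)
  then show ?case using subring_onD(4)[OF subring_on_coeffs_in[OF subring_on_polys]] by (metis poly_mult)
qed

text \<open>Positive reals are squares of units, and a homomorphism preserves both
  properties.\<close>

lemma sign_hom_Const:
  fixes \<psi> :: "rpoly \<Rightarrow> 'b::linordered_idom"
  assumes "idom_hom \<psi>"
  shows "same_sign c (\<psi> (Const c))"
proof -
  interpret idom_hom \<psi> by fact
  have pos: "\<psi> (Const c) > 0" if "c > 0" for c
  proof -
    have "Const c = Const (sqrt c) * Const (sqrt c)" using that by (simp flip: Const_mult)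
    then have "\<psi> (Const c) = \<psi> (Const (sqrt c)) * \<psi> (Const (sqrt c))" by (metis hom_mult)
    then have "\<psi> (Const c) \<ge> 0" by simp
    moreover have "\<psi> (Const c) * \<psi> (Const (1 / c)) = 1"
      using that by (simp flip: hom_mult Const_mult)
    then have "\<psi> (Const c) \<noteq> 0" by auto
    ultimately show ?thesis by simp
  qed
  show ?thesis
  proof (cases c "0 :: real" rule: linorder_cases)
    case less
    then have "\<psi> (Const (- c)) > 0" using pos[of "- c"] by simp
    then have "\<psi> (Const c) < 0" by (simp add: Const_uminus hom_uminus)
    then show ?thesis using less by (simp add: same_sign_def)
  next
    case greater
    then show ?thesis using pos[of c] by (simp add: same_sign_alt)
  qed simp
qed

text \<open>Induction on the number of variables. Eliminating the last one replaces \<open>F\<close>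
  by finitely many polynomials in the others; the induction hypothesis realises their signs at a
  real point, and \<open>sign_elimination\<close>, applied to the value
  \<open>\<psi> (Var N)\<close>, supplies the last coordinate.\<close>

theorem artin_lang:
  fixes \<psi> :: "rpoly \<Rightarrow> 'b::rcf"
  assumes \<psi>: "idom_hom \<psi>" and "finite F" "F \<subseteq> polys N"
  shows "\<exists>a. \<forall>p\<in>F. same_sign (insertion (\<lambda>c. c) a p) (\<psi> p)"
  using assms(2,3)
proof (induction N arbitrary: F)
  case 0
  have "same_sign (insertion (\<lambda>c. c) a p) (\<psi> p)" if "p \<in> F" for a p
  proof -
    have "p \<in> polys 0" using 0 that by blast
    then have "\<exists>c. p = Const c"
      by (induction rule: polys_induct) (auto simp: Const_add[symmetric] Const_mult[symmetric])
    then show ?thesis using sign_hom_Const[OF \<psi>] insertion_Const[OF comm_ring_hom_real_id] by auto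
  qed
  then show ?case by blast
next
  case (Suc N)
  interpret \<psi>: idom_hom \<psi> by (rule \<psi>)
  obtain Q where Q: "\<And>p. p \<in> F \<Longrightarrow> Q p \<in> coeffs_in (polys N) \<and> p = poly (Q p) (Var N)"
  proof -
    have "\<exists>q. q \<in> coeffs_in (polys N) \<and> p = poly q (Var N)" if "p \<in> F" for p
      using poly_coeffs_in_subset[of p N] that Suc.prems(2) by blast
    then have "\<exists>Q. \<forall>p\<in>F. Q p \<in> coeffs_in (polys N) \<and> p = poly (Q p) (Var N)" by (intro bchoice) blast
    then show ?thesis using that by blast
  qed
  obtain F' where F': "finite F'" "F' \<subseteq> polys N"
    "\<And>(\<phi> :: rpoly \<Rightarrow> real) (\<psi> :: rpoly \<Rightarrow> 'b) y. idom_hom \<phi> \<Longrightarrow> idom_hom \<psi> \<Longrightarrow> \<forall>c\<in>F'. same_sign (\<phi> c) (\<psi> c) \<Longrightarrow>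
       \<exists>x. \<forall>p\<in>Q ` F. same_sign (poly (map_poly \<phi> p) x) (poly (map_poly \<psi> p) y)"
  proof -
    have "finite (Q ` F)" "Q ` F \<subseteq> coeffs_in (polys N)" using Suc.prems(1) Q by auto
    from sign_elimination[OF subring_on_polys[of N] this, where 'a = real and 'b = 'b] that
    show ?thesis by metis
  qed
  obtain a where a: "\<forall>p\<in>F'. same_sign (insertion (\<lambda>c. c) a p) (\<psi> p)" using Suc.IH[OF F'(1,2)] by blast
  from F'(3)[OF idom_hom_insertion_real \<psi> a, of "\<psi> (Var N)"] obtain x where
    x: "\<And>p. p \<in> F \<Longrightarrow> same_sign (poly (map_poly (insertion (\<lambda>c. c) a) (Q p)) x) (poly (map_poly \<psi> (Q p)) (\<psi> (Var N)))"
    by blast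
  define b where "b = a(N := x)"
  interpret b: idom_hom "insertion (\<lambda>c. c) b" by (rule idom_hom_insertion_real)
  have "poly (map_poly (insertion (\<lambda>c. c) a) q) x = insertion (\<lambda>c. c) b (poly q (Var N))"
    if "q \<in> coeffs_in (polys N)" for q
  proof -
    have "map_poly (insertion (\<lambda>c. c) a) q = map_poly (insertion (\<lambda>c. c) b) q"
    proof (rule poly_eqI)
      fix i
      have "coeff q i \<in> polys N" using that by (simp add: coeffs_in_def)
      then have "insertion (\<lambda>c. c) a (coeff q i) = insertion (\<lambda>c. c) b (coeff q i)"
        by (rule insertion_cong) (simp add: b_def)
      then show "coeff (map_poly (insertion (\<lambda>c. c) a) q) i = coeff (map_poly (insertion (\<lambda>c. c) b) q) i"
        by (simp add: coeff_map_poly insertion_0[OF comm_ring_hom_real_id])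
    qed
    moreover have "insertion (\<lambda>c. c) b (Var N) = x"
      by (simp add: insertion_Var[OF comm_ring_hom_real_id] b_def)
    ultimately show ?thesis by (metis b.poly_map_poly)
  qed
  then have "same_sign (insertion (\<lambda>c. c) b p) (\<psi> p)" if "p \<in> F" for p
    using x[OF that] Q[OF that] \<psi>.poly_map_poly by metis
  then show ?case by blast
qed

section \<open>Derivations\<close>

lemma partial_superset:
  assumes "finite A" "Poly_Mapping.keys p \<subseteq> A"
  shows "partial i p = (\<Sum>t\<in>A. Poly_Mapping.single (t - Poly_Mapping.single i 1)
       (Poly_Mapping.lookup p t * real (Poly_Mapping.lookup t i)))"
  unfolding partial_def using assms
  by (intro sum.mono_neutral_left) (auto simp: in_keys_iff)

lemma partial_add: "partial i (p + q) = partial i p + partial i q"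
proof -
  let ?A = "Poly_Mapping.keys p \<union> Poly_Mapping.keys q"
  have "Poly_Mapping.keys (p + q) \<subseteq> ?A" by (rule Poly_Mapping.keys_add)
  then show ?thesis
    by (simp add: partial_superset[of ?A] lookup_add distrib_right single_add sum.distrib)
qed

lemma partial_0 [simp]: "partial i 0 = 0"
  by (simp add: partial_def)

lemma partial_sum: "partial i (\<Sum>j\<in>A. p j) = (\<Sum>j\<in>A. partial i (p j))"
  by (induction A rule: infinite_finite_induct) (simp_all add: partial_add)

lemma partial_single:
  "partial i (Poly_Mapping.single t c) =
    Poly_Mapping.single (t - Poly_Mapping.single i 1) (c * real (Poly_Mapping.lookup t i))"
  by (cases "c = 0") (simp_all add: partial_def)

lemma partial_Const [simp]: "partial i (Const c) = 0"
  by (simp add: Const_def partial_single)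

lemma partial_Var: "partial i (Var j) = (if i = j then 1 else 0)"
  by (auto simp: Var_def partial_single lookup_single)

lemma partial_single_mult:
  "partial i (Poly_Mapping.single s a * Poly_Mapping.single t b) =
    Poly_Mapping.single s a * partial i (Poly_Mapping.single t b) + partial i (Poly_Mapping.single s a) * Poly_Mapping.single t b"
proof -
  have minus: "(u + Poly_Mapping.single i 1) - Poly_Mapping.single i 1 = u" for u :: mono by simp
  have shift: "Poly_Mapping.single (s + t - Poly_Mapping.single i 1) (c * real (Poly_Mapping.lookup t i))
      = Poly_Mapping.single (s + (t - Poly_Mapping.single i 1)) (c * real (Poly_Mapping.lookup t i))"
    for s t :: mono and c :: real
  proof (cases "Poly_Mapping.lookup t i = 0")
    case False
    have "s + t - Poly_Mapping.single i 1 = s + (t - Poly_Mapping.single i 1)"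
      by (rule poly_mapping_eqI) (use False in \<open>auto simp: lookup_add lookup_minus lookup_single when_def\<close>)
    then show ?thesis by simp
  qed simp
  have "partial i (Poly_Mapping.single s a * Poly_Mapping.single t b) =
      Poly_Mapping.single (s + t - Poly_Mapping.single i 1) ((a * b) * real (Poly_Mapping.lookup t i)) +
      Poly_Mapping.single (t + s - Poly_Mapping.single i 1) ((a * b) * real (Poly_Mapping.lookup s i))"
    by (simp add: mult_single partial_single lookup_add distrib_left single_add add.commute)
  also have "\<dots> = Poly_Mapping.single s a * partial i (Poly_Mapping.single t b) + partial i (Poly_Mapping.single s a) * Poly_Mapping.single t b"
    unfolding shift by (simp add: mult_single partial_single mult_ac add.commute)
  finally show ?thesis .
qed

lemma partial_mult: "partial i (p * q) = p * partial i q + partial i p * q"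
proof -
  let ?s = "\<lambda>p t. Poly_Mapping.single t (Poly_Mapping.lookup p t)"
  let ?S = "\<lambda>p :: rpoly. (\<Sum>t\<in>Poly_Mapping.keys p. ?s p t)"
  have "partial i (?S p * ?S q) = ?S p * partial i (?S q) + partial i (?S p) * ?S q"
    by (simp add: sum_product partial_sum partial_single_mult sum.distrib)
  then show ?thesis by (simp only: poly_mapping_sum_monomials)
qed

text \<open>Here \<open>D\<close> is a derivation along the homomorphism \<open>\<psi>\<close>. The
  two uses are a derivation of a field after evaluation, and differentiation in the parameter of a
  line.\<close>

lemma derivation_chain_rule:
  assumes \<psi>: "comm_ring_hom \<psi>"
    and D: "\<And>p q. D (p + q) = D p + D q" "\<And>p q. D (p * q) = \<psi> p * D q + D p * \<psi> q" "\<And>c. D (Const c) = 0"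
    and "p \<in> polys N"
  shows "D p = (\<Sum>i<N. \<psi> (partial i p) * D (Var i))"
  using assms(5)
proof (induction rule: polys_induct)
  case (Const c)
  interpret comm_ring_hom \<psi> by fact
  show ?case by (simp add: D)
next
  case (Var j)
  interpret comm_ring_hom \<psi> by fact
  have "(\<Sum>i<N. \<psi> (partial i (Var j)) * D (Var i)) = (\<Sum>i<N. if i = j then D (Var i) else 0)"
    by (rule sum.cong) (auto simp: partial_Var)
  then show ?case using Var by simp
next
  case (add p q)
  interpret comm_ring_hom \<psi> by fact
  show ?case using add by (simp add: D partial_add hom_add distrib_right sum.distrib)
next
  case (mult p q)
  interpret comm_ring_hom \<psi> by fact
  show ?case using mult
    by (simp add: D partial_mult hom_add hom_mult sum.distrib sum_distrib_left sum_distrib_right algebra_simps)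
qed

text \<open>Derivations are represented by their graphs, that is by subrings of the ring of dual numbers.\<close>

definition dual_subring :: "('k::comm_ring_1 \<times> 'k) set \<Rightarrow> bool" where
  "dual_subring G \<longleftrightarrow> (0, 0) \<in> G \<and> (1, 0) \<in> G \<and> (- 1, 0) \<in> G \<and>
     (\<forall>(x, x')\<in>G. \<forall>(y, y')\<in>G. (x + y, x' + y') \<in> G \<and> (x * y, x * y' + x' * y) \<in> G)"

lemma dual_subringD:
  assumes "dual_subring G"
  shows "(0, 0) \<in> G" "(1, 0) \<in> G" "(x, x') \<in> G \<Longrightarrow> (y, y') \<in> G \<Longrightarrow> (x + y, x' + y') \<in> G"
    "(x, x') \<in> G \<Longrightarrow> (y, y') \<in> G \<Longrightarrow> (x * y, x * y' + x' * y) \<in> G"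
    "(x, x') \<in> G \<Longrightarrow> (- x, - x') \<in> G" "(of_nat k, 0) \<in> G"
proof -
  show mult: "(x, x') \<in> G \<Longrightarrow> (y, y') \<in> G \<Longrightarrow> (x * y, x * y' + x' * y) \<in> G" for x x' y y'
    using assms unfolding dual_subring_def by blast
  show add: "(x, x') \<in> G \<Longrightarrow> (y, y') \<in> G \<Longrightarrow> (x + y, x' + y') \<in> G" for x x' y y'
    using assms unfolding dual_subring_def by blast
  show 0: "(0, 0) \<in> G" and 1: "(1, 0) \<in> G" using assms unfolding dual_subring_def by blast+
  have "(- 1, 0) \<in> G" using assms unfolding dual_subring_def by blast
  then show "(x, x') \<in> G \<Longrightarrow> (- x, - x') \<in> G" using mult[of "- 1" 0 x x'] by simp
  show "(of_nat k, 0) \<in> G" using 0 add[OF 1] by (induction k) auto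
qed

text \<open>Polynomials over the dual numbers with coefficients in \<open>G\<close>, stored as
  pairs.\<close>

definition dual_polys :: "('k::comm_ring_1 \<times> 'k) set \<Rightarrow> ('k poly \<times> 'k poly) set" where
  "dual_polys G = {(p, p'). \<forall>i. (coeff p i, coeff p' i) \<in> G}"

lemma dual_subring_sum:
  assumes "dual_subring G" "\<And>i. i \<in> A \<Longrightarrow> (f i, f' i) \<in> G"
  shows "(sum f A, sum f' A) \<in> G"
  using assms(2) by (induction A rule: infinite_finite_induct) (auto intro: dual_subringD[OF assms(1)])

lemma dual_polys_closed:
  assumes G: "dual_subring G" and pq: "(p, p') \<in> dual_polys G" "(q, q') \<in> dual_polys G"
  shows "(p + q, p' + q') \<in> dual_polys G" "(p * q, p * q' + p' * q) \<in> dual_polys G"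
    "(- p, - p') \<in> dual_polys G" "(pderiv p, pderiv p') \<in> dual_polys G"
    "(monom (coeff p k) n, monom (coeff p' k) n) \<in> dual_polys G"
proof -
  note GD = dual_subringD[OF G]
  have c: "(coeff p i, coeff p' i) \<in> G" "(coeff q i, coeff q' i) \<in> G" for i using pq by (auto simp: dual_polys_def)
  show "(p + q, p' + q') \<in> dual_polys G" "(- p, - p') \<in> dual_polys G"
    "(monom (coeff p k) n, monom (coeff p' k) n) \<in> dual_polys G"
    using c GD(1) by (auto simp: dual_polys_def intro: GD)
  have "(coeff (p * q) i, coeff (p * q' + p' * q) i) \<in> G" for i
    unfolding coeff_add coeff_mult sum.distrib[symmetric]
    by (rule dual_subring_sum[OF G]) (rule GD(4)[OF c])
  then show "(p * q, p * q' + p' * q) \<in> dual_polys G" by (simp add: dual_polys_def)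
  have "(coeff (pderiv p) i, coeff (pderiv p') i) \<in> G" for i
    using GD(4)[OF GD(6)[of "Suc i"] c(1)[of "Suc i"]] by (simp add: coeff_pderiv)
  then show "(pderiv p, pderiv p') \<in> dual_polys G" by (simp add: dual_polys_def)
qed

text \<open>The infinitesimal part of the value of \<open>p + \<epsilon> p'\<close> at
  \<open>y + \<epsilon> d\<close>.\<close>

definition dual_eval :: "'k::field_char_0 \<Rightarrow> 'k \<Rightarrow> 'k poly \<times> 'k poly \<Rightarrow> 'k" where
  "dual_eval y d = (\<lambda>(p, p'). poly p' y + d * poly (pderiv p) y)"

lemma dual_eval_mult:
  "dual_eval y d (p * q, p * q' + p' * q) = poly p y * dual_eval y d (q, q') + dual_eval y d (p, p') * poly q y"
  by (simp add: dual_eval_def pderiv_mult algebra_simps)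

lemma dual_eval_add: "dual_eval y d (p + q, p' + q') = dual_eval y d (p, p') + dual_eval y d (q, q')"
  by (simp add: dual_eval_def pderiv_add algebra_simps)

lemma dual_eval_minus: "dual_eval y d (- p, - p') = - dual_eval y d (p, p')"
  by (simp add: dual_eval_def pderiv_minus)

text \<open>If \<open>y\<close> is transcendental over the domain of \<open>G\<close>, any
  \<open>d\<close> will do and 0 is taken. Otherwise let \<open>m\<close> be a nonzero polynomial of
  least degree over the domain with root \<open>y\<close>. The requirement on \<open>m\<close>
  determines \<open>d\<close>, as \<open>pderiv m\<close> does not vanish at \<open>y\<close> in
  characteristic 0, and pseudo-division by \<open>m\<close> carries the requirement over to all
  other polynomials.\<close>

lemma derivative_at_new_element:
  fixes y :: "'k::field_char_0"
  assumes G: "dual_subring G" and sv: "\<And>d. (0, d) \<in> G \<Longrightarrow> d = 0"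
  shows "\<exists>d. \<forall>(p, p')\<in>dual_polys G. poly p y = 0 \<longrightarrow> dual_eval y d (p, p') = 0"
proof (cases "\<exists>(p, p')\<in>dual_polys G. p \<noteq> 0 \<and> poly p y = 0")
  case False
  have "dual_eval y 0 (p, p') = 0" if "(p, p') \<in> dual_polys G" "poly p y = 0" for p p'
  proof -
    have "p = 0" using False that by blast
    then have "coeff p' i = 0" for i using that(1) sv by (auto simp: dual_polys_def)
    then have "p' = 0" by (simp add: poly_eq_iff)
    then show ?thesis by (simp add: dual_eval_def)
  qed
  then show ?thesis by blast
next
  case True
  define A where "A = {w\<in>dual_polys G. fst w \<noteq> 0 \<and> poly (fst w) y = 0}"
  have "A \<noteq> {}" using True by (auto simp: A_def)
  then obtain w where w: "w \<in> A" "\<And>v. v \<in> A \<Longrightarrow> degree (fst w) \<le> degree (fst v)"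
    using ex_has_least_nat[of "\<lambda>w. w \<in> A" _ "\<lambda>w. degree (fst w)"] by blast
  obtain m m' where wm: "w = (m, m')" by (cases w)
  have m: "(m, m') \<in> dual_polys G" "m \<noteq> 0" "poly m y = 0" using w(1) by (auto simp: A_def wm)
  have least: "degree m \<le> degree p" if "(p, p') \<in> dual_polys G" "p \<noteq> 0" "poly p y = 0" for p p'
    using w(2)[of "(p, p')"] that by (simp add: A_def wm)
  have dm: "degree m > 0"
  proof (rule ccontr)
    assume "\<not> ?thesis"
    then obtain c where "m = [:c:]" using degree_eq_zeroE by blast
    then show False using m by simp
  qed
  have "pderiv m \<noteq> 0" "degree (pderiv m) < degree m" using dm by (auto simp: pderiv_eq_0_iff degree_pderiv)
  then have dmy: "poly (pderiv m) y \<noteq> 0"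
    using least[OF dual_polys_closed(4)[OF G m(1) m(1)]] by auto
  define d where "d = - poly m' y / poly (pderiv m) y"
  have Vm: "dual_eval y d (m, m') = 0" using dmy by (simp add: dual_eval_def d_def)
  have "dual_eval y d (p, p') = 0" if "(p, p') \<in> dual_polys G" "poly p y = 0" for p p'
    using that
  proof (induction "degree p" arbitrary: p p' rule: less_induct)
    case less
    show ?case
    proof (cases "p = 0")
      case True
      then have "coeff p' i = 0" for i using less.prems(1) sv by (auto simp: dual_polys_def)
      then have "p' = 0" by (simp add: poly_eq_iff)
      then show ?thesis using True by (simp add: dual_eval_def)
    next
      case False
      then have le: "degree m \<le> degree p" using least less.prems by blast
      define c c' where "c = monom (lead_coeff m) 0" and "c' = monom (coeff m' (degree m)) 0"
      define e e' where "e = monom (lead_coeff p) (degree p - degree m)"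
        and "e' = monom (coeff p' (degree p)) (degree p - degree m)"
      have ce: "(c, c') \<in> dual_polys G" "(e, e') \<in> dual_polys G"
        unfolding c_def c'_def e_def e'_def
        by (rule dual_polys_closed(5)[OF G m(1) m(1)], rule dual_polys_closed(5)[OF G less.prems(1) less.prems(1)])
      \<comment> \<open>One step of the division, performed over the dual numbers so that
        \<open>q'\<close> remains the companion of \<open>q\<close>.\<close>
      define q q' where "q = c * p + - (e * m)" and "q' = (c * p' + c' * p) + - (e * m' + e' * m)"
      have q: "(q, q') \<in> dual_polys G" unfolding q_def q'_def
        by (intro dual_polys_closed(1-3)[OF G] ce less.prems m dual_polys_closed(3)[OF G _ m(1)])
      have qy: "poly q y = 0" using less.prems m by (simp add: q_def)
      have "degree (e * m) \<le> degree p"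
        using le degree_mult_le[of e m] degree_monom_le[of "lead_coeff p" "degree p - degree m"] by (simp add: e_def)
      moreover have "degree (c * p) \<le> degree p" by (simp add: c_def monom_0)
      ultimately have "degree q \<le> degree p" unfolding q_def by (intro degree_add_le) simp_all
      moreover have "coeff q (degree p) = 0" using le by (simp add: q_def c_def e_def monom_0 coeff_monom_mult)
      moreover have "degree p > 0" using dm le by simp
      ultimately have "degree q < degree p" by (rule degree_less_if_coeff_zero)
      then have "dual_eval y d (q, q') = 0" using less.hyps q qy by blast
      moreover have "dual_eval y d (q, q') = poly c y * dual_eval y d (p, p')"
        unfolding q_def q'_def dual_eval_add dual_eval_minus dual_eval_mult
        using Vm m less.prems by simp
      moreover have "poly c y \<noteq> 0" using m by (simp add: c_def monom_0)
      ultimately show ?thesis by simp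
    qed
  qed
  then show ?thesis by blast
qed


text \<open>Evaluation at the dual number with parts \<open>y\<close> and \<open>d\<close> gives a
  graph on the ring generated by \<open>y\<close> over the domain; the choice of \<open>d\<close>
  keeps it single-valued.\<close>

lemma dual_subring_extend:
  fixes y :: "'k::field_char_0"
  assumes G: "dual_subring G" and sv: "\<And>d. (0, d) \<in> G \<Longrightarrow> d = 0"
  shows "\<exists>G' d. dual_subring G' \<and> (\<forall>e. (0, e) \<in> G' \<longrightarrow> e = 0) \<and> G \<subseteq> G' \<and> (y, d) \<in> G'"
proof -
  obtain d where d: "\<And>p p'. (p, p') \<in> dual_polys G \<Longrightarrow> poly p y = 0 \<Longrightarrow> dual_eval y d (p, p') = 0"
    using derivative_at_new_element[OF G sv] by blast
  define E where "E = (\<lambda>(p, p'). (poly p y, dual_eval y d (p, p')))"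
  define G' where "G' = E ` dual_polys G"
  have E: "(poly p y, dual_eval y d (p, p')) \<in> G'" if "(p, p') \<in> dual_polys G" for p p'
    using imageI[OF that, of E] by (simp add: G'_def E_def)
  have const: "([:a:], [:a':]) \<in> dual_polys G" if "(a, a') \<in> G" for a a'
    using that dual_subringD(1)[OF G] by (auto simp: dual_polys_def coeff_pCons split: nat.split)
  have sub: "(a, a') \<in> G'" if "(a, a') \<in> G" for a a'
    using E[OF const[OF that]] by (simp add: dual_eval_def)
  have "dual_subring G'" unfolding dual_subring_def
  proof (intro conjI)
    show "(0, 0) \<in> G'" "(1, 0) \<in> G'" "(- 1, 0) \<in> G'"
      using dual_subringD(1,2)[OF G] dual_subringD(5)[OF G, of 1 0] by (auto intro: sub)
    show "\<forall>(u, u')\<in>G'. \<forall>(v, v')\<in>G'. (u + v, u' + v') \<in> G' \<and> (u * v, u * v' + u' * v) \<in> G'"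
    proof clarify
      fix u u' v v' assume "(u, u') \<in> G'" "(v, v') \<in> G'"
      then obtain p p' q q' where pq: "(p, p') \<in> dual_polys G" "(q, q') \<in> dual_polys G"
        and u: "u = poly p y" "u' = dual_eval y d (p, p')" and v: "v = poly q y" "v' = dual_eval y d (q, q')"
        by (auto simp: G'_def E_def)
      show "(u + v, u' + v') \<in> G' \<and> (u * v, u * v' + u' * v) \<in> G'"
        using E[OF dual_polys_closed(1)[OF G pq]] E[OF dual_polys_closed(2)[OF G pq]]
        unfolding dual_eval_add dual_eval_mult u v by simp
    qed
  qed
  moreover have "\<forall>e. (0, e) \<in> G' \<longrightarrow> e = 0" using d by (auto simp: G'_def E_def)
  moreover have "G \<subseteq> G'" using sub by auto
  moreover have "([:0, 1:], 0) \<in> dual_polys G"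
    using dual_subringD(1,2)[OF G] by (auto simp: dual_polys_def coeff_pCons split: nat.split)
  from E[OF this] have "(y, d) \<in> G'" by (simp add: dual_eval_def pderiv_pCons)
  ultimately show ?thesis by blast
qed

text \<open>On polynomials in \<open>f\<close> with constant coefficients, differentiation by
  \<open>f\<close> is well defined because \<open>f\<close> is transcendental. A maximal
  single-valued graph above this one is total, since any element can be adjoined.\<close>

theorem derivation_exists:
  fixes k :: "real \<Rightarrow> 'k::field_char_0"
  assumes k: "idom_hom k" and tr: "\<And>q. q \<noteq> 0 \<Longrightarrow> poly (map_poly k q) f \<noteq> 0"
  shows "\<exists>D. (\<forall>x y. D (x + y) = D x + D y) \<and> (\<forall>x y. D (x * y) = x * D y + D x * y) \<and> (\<forall>c. D (k c) = 0) \<and> D f = 1"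
proof -
  note H = idom_hom_map_poly[OF k]
  interpret k: idom_hom k by (rule k)
  have k1: "k 1 = 1" by (rule k.hom_one)
  define ev where "ev q = poly (map_poly k q) f" for q
  have ev: "ev (p + q) = ev p + ev q" "ev (p * q) = ev p * ev q" "ev [:c:] = k c" for p q c
    by (simp_all add: ev_def H)
  define G0 where "G0 = range (\<lambda>q. (ev q, ev (pderiv q)))"
  have G0I: "(ev q, ev (pderiv q)) \<in> G0" for q by (auto simp: G0_def)
  have G0: "dual_subring G0" unfolding dual_subring_def
  proof (intro conjI)
    have "k (- 1) = - 1" by (simp add: k.hom_uminus)
    then show "(0, 0) \<in> G0" "(1, 0) \<in> G0" "(- 1, 0) \<in> G0"
      using G0I[of 0] G0I[of "[:1:]"] G0I[of "[:- 1:]"] ev(3)[of 0] ev(3)[of 1] ev(3)[of "- 1"] k1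
      by (simp_all add: pderiv_pCons H(5))
    show "\<forall>(x, x')\<in>G0. \<forall>(y, y')\<in>G0. (x + y, x' + y') \<in> G0 \<and> (x * y, x * y' + x' * y) \<in> G0"
    proof clarify
      fix x x' y y' assume "(x, x') \<in> G0" "(y, y') \<in> G0"
      then obtain p q where pq: "x = ev p" "x' = ev (pderiv p)" "y = ev q" "y' = ev (pderiv q)" by (auto simp: G0_def)
      show "(x + y, x' + y') \<in> G0 \<and> (x * y, x * y' + x' * y) \<in> G0"
        using G0I[of "p + q"] G0I[of "p * q"] unfolding pq pderiv_add pderiv_mult ev by (simp add: mult_ac)
    qed
  qed
  define A where "A = {G. dual_subring G \<and> (\<forall>d. (0, d) \<in> G \<longrightarrow> d = 0) \<and> G0 \<subseteq> G}"
  have "G0 \<in> A"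
  proof -
    have "ev (pderiv q) = 0" if "ev q = 0" for q
    proof -
      have "q = 0" using tr[of q] that by (auto simp: ev_def)
      then show ?thesis by (simp add: ev_def)
    qed
    then show ?thesis using G0 by (auto simp: A_def G0_def)
  qed
  have "\<exists>M\<in>A. \<forall>W\<in>A. M \<subseteq> W \<longrightarrow> W = M"
  proof (rule subset_Zorn_nonempty)
    show "A \<noteq> {}" using \<open>G0 \<in> A\<close> by blast
    fix C assume C: "C \<noteq> {}" "subset.chain A C"
    have CA: "W \<in> A" if "W \<in> C" for W using C that by (auto simp: subset.chain_def)
    have two: "\<exists>W\<in>C. x \<in> W \<and> y \<in> W" if "x \<in> \<Union>C" "y \<in> \<Union>C" for x y
      using that C unfolding subset.chain_def by blast
    obtain W0 where W0: "W0 \<in> C" using C by blast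
    have "dual_subring (\<Union>C)" unfolding dual_subring_def
    proof (intro conjI)
      show "(0, 0) \<in> \<Union>C" "(1, 0) \<in> \<Union>C" "(- 1, 0) \<in> \<Union>C"
        using CA[OF W0] W0 unfolding A_def dual_subring_def by blast+
      show "\<forall>(x, x')\<in>\<Union>C. \<forall>(y, y')\<in>\<Union>C. (x + y, x' + y') \<in> \<Union>C \<and> (x * y, x * y' + x' * y) \<in> \<Union>C"
      proof (clarify, goal_cases)
        case (1 x x' V y y' W)
        then obtain U where U: "U \<in> C" "(x, x') \<in> U" "(y, y') \<in> U" using two[of "(x, x')" "(y, y')"] by blast
        then have "dual_subring U" using CA by (simp add: A_def)
        then show ?case using dual_subringD(3,4)[OF _ U(2,3)] U(1) by blast
      qed
    qed
    moreover have "\<forall>d. (0, d) \<in> \<Union>C \<longrightarrow> d = 0" using CA unfolding A_def by blast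
    moreover have "G0 \<subseteq> \<Union>C" using CA[OF W0] W0 unfolding A_def by blast
    ultimately show "\<Union>C \<in> A" unfolding A_def by blast
  qed
  then obtain G where GA: "G \<in> A" and max: "\<And>W. W \<in> A \<Longrightarrow> G \<subseteq> W \<Longrightarrow> W = G" by blast
  have G: "dual_subring G" "\<And>d. (0, d) \<in> G \<Longrightarrow> d = 0" "G0 \<subseteq> G" using GA by (auto simp: A_def)
  have ex: "\<exists>d. (y, d) \<in> G" for y
  proof -
    obtain G' d where G': "dual_subring G'" "\<forall>e. (0, e) \<in> G' \<longrightarrow> e = 0" "G \<subseteq> G'" "(y, d) \<in> G'"
      using dual_subring_extend[OF G(1,2)] by blast
    then have "G' \<in> A" using G(3) by (auto simp: A_def)
    then have "G' = G" using max G'(3) by blast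
    then show ?thesis using G'(4) by blast
  qed
  have uniq: "d = e" if "(y, d) \<in> G" "(y, e) \<in> G" for y d e
    using G(2)[of "d - e"] dual_subringD(3)[OF G(1) that(1) dual_subringD(5)[OF G(1) that(2)]] by simp
  obtain D where D: "\<And>y. (y, D y) \<in> G" using ex by metis
  have "D (x + y) = D x + D y" "D (x * y) = x * D y + D x * y" for x y
    using uniq[OF D] dual_subringD(3,4)[OF G(1) D D] by blast+
  moreover have "D (k c) = 0" for c
    using uniq[OF D[of "k c"], of 0] G0I[of "[:c:]"] G(3) ev(3)[of c] ev(3)[of 0] by (auto simp: pderiv_pCons H(5))
  moreover have "ev [:0, 1:] = f" "ev (pderiv [:0, 1:]) = 1"
    by (simp_all add: ev_def map_poly_pCons H(5) k1 pderiv_pCons)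
  then have "(f, 1) \<in> G" using G0I[of "[:0, 1:]"] G(3) by auto
  then have "D f = 1" using uniq[OF D] by blast
  ultimately show ?thesis by blast
qed

section \<open>Points of the real spectrum\<close>

abbreviation prime_cone :: "rpoly set \<Rightarrow> bool" where
  "prime_cone \<equiv> prime_cone_on UNIV"

abbreviation reval :: "(nat \<Rightarrow> real) \<Rightarrow> rpoly \<Rightarrow> real" where
  "reval \<equiv> insertion (\<lambda>c. c)"

definition supp :: "rpoly set \<Rightarrow> rpoly set" where
  "supp P = {p. p \<in> P \<and> - p \<in> P}"

text \<open>The conclusion of the Artin-Lang theorem as a property of the cone alone, without
  reference to a field.\<close>

definition realizable :: "rpoly set \<Rightarrow> bool" where
  "realizable P \<longleftrightarrow> (\<forall>N F. finite F \<longrightarrow> F \<subseteq> polys N \<longrightarrow>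
     (\<exists>a. \<forall>p\<in>F. (0 \<le> reval a p \<longleftrightarrow> p \<in> P) \<and> (reval a p \<le> 0 \<longleftrightarrow> - p \<in> P)))"

text \<open>The premises are the Lagrange conditions, \<open>l 0\<close> being the multiplier of the objective \<open>f\<close>.\<close>

definition critical_values_real :: "rpoly set \<Rightarrow> bool" where
  "critical_values_real P \<longleftrightarrow> (\<forall>N m f g l. f \<in> polys N \<longrightarrow> (\<forall>j<m. g j \<in> polys N) \<longrightarrow>
     l 0 \<notin> supp P \<longrightarrow> (\<forall>i<N. l 0 * partial i f - (\<Sum>j<m. l (Suc j) * partial i (g j)) \<in> supp P) \<longrightarrow>
     (\<forall>j<(m::nat). l (Suc j) * g j \<in> supp P) \<longrightarrow> (\<exists>t. f - Const t \<in> supp P))"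

lemma supp_nonneg_cone: "idom_hom (\<psi> :: rpoly \<Rightarrow> 'b::linordered_idom) \<Longrightarrow> supp {p. 0 \<le> \<psi> p} = {p. \<psi> p = 0}"
proof -
  assume "idom_hom \<psi>"
  then interpret idom_hom \<psi> .
  show ?thesis by (auto simp: supp_def hom_uminus)
qed

lemma realizable_hom:
  fixes \<psi> :: "rpoly \<Rightarrow> 'b::rcf"
  assumes \<psi>: "idom_hom \<psi>"
  shows "realizable {p. 0 \<le> \<psi> p}"
  unfolding realizable_def
proof (intro allI impI)
  fix N and F :: "rpoly set" assume F: "finite F" "F \<subseteq> polys N"
  interpret idom_hom \<psi> by (rule \<psi>)
  obtain a where a: "\<And>p. p \<in> F \<Longrightarrow> same_sign (reval a p) (\<psi> p)" using artin_lang[OF \<psi> F] by blast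
  have "(0 \<le> reval a p \<longleftrightarrow> 0 \<le> \<psi> p) \<and> (reval a p \<le> 0 \<longleftrightarrow> \<psi> p \<le> 0)" if "p \<in> F" for p
    using a[OF that] unfolding same_sign_alt by (simp add: linorder_not_less[symmetric])
  then show "\<exists>a. \<forall>p\<in>F. (0 \<le> reval a p \<longleftrightarrow> p \<in> {p. 0 \<le> \<psi> p}) \<and> (reval a p \<le> 0 \<longleftrightarrow> - p \<in> {p. 0 \<le> \<psi> p})"
    by (auto simp: hom_uminus)
qed

text \<open>If \<open>q\<close> annihilates the value of \<open>f\<close>, realise at a real point
  the signs of \<open>q(f)\<close> and of all \<open>f - r\<close> with \<open>r\<close> a root of
  \<open>q\<close>. There \<open>f\<close> equals some root \<open>r\<close>, so
  \<open>f - r\<close> has value 0 under \<open>\<psi>\<close> as well, contrary to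
  assumption.\<close>

lemma transcendental_hom_value:
  fixes \<psi> :: "rpoly \<Rightarrow> 'b::rcf"
  assumes \<psi>: "idom_hom \<psi>" and t: "\<And>t. \<psi> (f - Const t) \<noteq> 0" and "q \<noteq> 0"
  shows "poly (map_poly (\<lambda>c. \<psi> (Const c)) q) (\<psi> f) \<noteq> 0"
proof
  interpret \<psi>: idom_hom \<psi> by (rule \<psi>)
  interpret C: idom_hom Const by (rule idom_hom_Const)
  assume 0: "poly (map_poly (\<lambda>c. \<psi> (Const c)) q) (\<psi> f) = 0"
  define h where "h = poly (map_poly Const q) f"
  have "\<psi> h = poly (map_poly \<psi> (map_poly Const q)) (\<psi> f)" unfolding h_def by (rule \<psi>.poly_map_poly[symmetric])
  also have "map_poly \<psi> (map_poly Const q) = map_poly (\<lambda>c. \<psi> (Const c)) q"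
    by (subst map_poly_map_poly) (simp_all add: o_def)
  finally have h: "\<psi> h = 0" using 0 by simp
  define F where "F = insert h ((\<lambda>r. f - Const r) ` {r. poly q r = 0})"
  have "finite F" using poly_roots_finite[OF \<open>q \<noteq> 0\<close>] by (simp add: F_def)
  obtain N1 N2 where N: "h \<in> polys N1" "f \<in> polys N2" using in_polys by metis
  then have "h \<in> polys (max N1 N2)" "f \<in> polys (max N1 N2)" using polys_subset by (metis max.cobounded1 max.cobounded2 subsetD)+
  then have "F \<subseteq> polys (max N1 N2)" by (auto simp: F_def intro: polysD)
  then obtain a where a: "\<And>p. p \<in> F \<Longrightarrow> same_sign (reval a p) (\<psi> p)" using artin_lang[OF \<psi> \<open>finite F\<close>] by blast
  interpret a: idom_hom "reval a" by (rule idom_hom_insertion_real)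
  have C: "reval a (Const c) = c" for c by (rule insertion_Const[OF comm_ring_hom_real_id])
  have "reval a h = 0" using a[of h] h by (simp add: F_def same_sign_def)
  moreover have "reval a h = poly (map_poly (reval a) (map_poly Const q)) (reval a f)"
    unfolding h_def by (rule a.poly_map_poly[symmetric])
  moreover have "map_poly (reval a) (map_poly Const q) = q"
    by (subst map_poly_map_poly) (simp_all add: o_def C map_poly_id')
  ultimately have "poly q (reval a f) = 0" by simp
  then have "f - Const (reval a f) \<in> F" by (auto simp: F_def)
  from a[OF this] t[of "reval a f"] show False by (simp add: a.hom_minus C same_sign_def)
qed

text \<open>Under \<open>\<psi>\<close>, the gradient equations and the chain rule make
  \<open>l 0 * D f\<close> the sum of the terms \<open>l (Suc j) * D (g j)\<close>. Each term is 0: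
  since \<open>l (Suc j) * g j\<close> has value 0, one factor has value 0, and
  \<open>D 0 = 0\<close>. With \<open>D f = 1\<close> this gives \<open>l 0\<close> the value
  0.\<close>

lemma critical_values_real_hom:
  fixes \<psi> :: "rpoly \<Rightarrow> 'b::rcf"
  assumes \<psi>: "idom_hom \<psi>"
  shows "critical_values_real {p. 0 \<le> \<psi> p}"
  unfolding critical_values_real_def supp_nonneg_cone[OF \<psi>] mem_Collect_eq
proof (intro allI impI)
  fix N m f and g l :: "nat \<Rightarrow> rpoly"
  assume f: "f \<in> polys N" and g: "\<forall>j<m. g j \<in> polys N" and l0: "\<psi> (l 0) \<noteq> 0"
    and grad: "\<forall>i<N. \<psi> (l 0 * partial i f - (\<Sum>j<m. l (Suc j) * partial i (g j))) = 0"
    and compl: "\<forall>j<m. \<psi> (l (Suc j) * g j) = 0"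
  interpret \<psi>: idom_hom \<psi> by (rule \<psi>)
  interpret C: idom_hom Const by (rule idom_hom_Const)
  show "\<exists>t. \<psi> (f - Const t) = 0"
  proof (rule ccontr)
    assume "\<nexists>t. \<psi> (f - Const t) = 0"
    then have tr: "poly (map_poly (\<lambda>c. \<psi> (Const c)) q) (\<psi> f) \<noteq> 0" if "q \<noteq> 0" for q
      using transcendental_hom_value[OF \<psi> _ that, of f] by blast
    have k: "idom_hom (\<lambda>c. \<psi> (Const c))" by unfold_locales (simp_all add: C.hom_add C.hom_mult \<psi>.hom_add \<psi>.hom_mult)
    obtain D where D: "\<And>x y. D (x + y) = D x + D y" "\<And>x y. D (x * y) = x * D y + D x * y"
      "\<And>c. D (\<psi> (Const c)) = 0" "D (\<psi> f) = 1"
      using derivation_exists[OF k tr] by blast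
    have chain: "D (\<psi> p) = (\<Sum>i<N. \<psi> (partial i p) * D (\<psi> (Var i)))" if "p \<in> polys N" for p
      by (rule derivation_chain_rule[where D = "\<lambda>p. D (\<psi> p)", OF \<psi>.comm_ring_hom_axioms _ _ _ that])
         (simp_all add: \<psi>.hom_add \<psi>.hom_mult D)
    have D0: "D 0 = 0" using D(1)[of 0 0] by simp
    have "\<psi> (l 0) = \<psi> (l 0) * D (\<psi> f)" by (simp add: D(4))
    also have "\<dots> = (\<Sum>i<N. \<psi> (l 0 * partial i f) * D (\<psi> (Var i)))"
      unfolding chain[OF f] by (simp add: sum_distrib_left \<psi>.hom_mult mult.assoc)
    also have "\<dots> = (\<Sum>i<N. (\<Sum>j<m. \<psi> (l (Suc j)) * \<psi> (partial i (g j))) * D (\<psi> (Var i)))"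
      using grad by (intro sum.cong refl) (simp add: \<psi>.hom_minus \<psi>.hom_sum \<psi>.hom_mult)
    also have "\<dots> = (\<Sum>j<m. \<psi> (l (Suc j)) * (\<Sum>i<N. \<psi> (partial i (g j)) * D (\<psi> (Var i))))"
      unfolding sum_distrib_left sum_distrib_right mult.assoc by (rule sum.swap)
    also have "\<dots> = 0"
    proof (rule sum.neutral, rule ballI)
      fix j assume "j \<in> {..<m}"
      then have j: "\<psi> (l (Suc j)) * \<psi> (g j) = 0" "g j \<in> polys N" using compl g by (auto simp: \<psi>.hom_mult)
      then have "\<psi> (l (Suc j)) = 0 \<or> D (\<psi> (g j)) = 0" using D0 by auto
      then show "\<psi> (l (Suc j)) * (\<Sum>i<N. \<psi> (partial i (g j)) * D (\<psi> (Var i))) = 0"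
        unfolding chain[OF j(2), symmetric] by auto
    qed
    finally show False using l0 by simp
  qed
qed

text \<open>To realise the residue field of an arbitrary prime cone as a type, it suffices to do so for one
  fixed prime cone, chosen to be a counterexample to the desired properties if there is any.\<close>

definition chosen_cone :: "rpoly set" where
  "chosen_cone = (SOME P. prime_cone P \<and>
     ((\<exists>Q. prime_cone Q \<and> \<not> (realizable Q \<and> critical_values_real Q)) \<longrightarrow> \<not> (realizable P \<and> critical_values_real P)))"

lemma prime_cone_nonneg:
  fixes \<psi> :: "rpoly \<Rightarrow> 'b::linordered_idom"
  assumes "idom_hom \<psi>"
  shows "prime_cone {p. 0 \<le> \<psi> p}"
proof -
  interpret idom_hom \<psi> by fact
  show ?thesis unfolding prime_cone_on_def preorder_on_def
    by (auto simp: hom_add hom_mult hom_uminus)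
qed

lemma chosen_cone:
  "prime_cone chosen_cone"
  "prime_cone Q \<Longrightarrow> \<not> (realizable Q \<and> critical_values_real Q) \<Longrightarrow> \<not> (realizable chosen_cone \<and> critical_values_real chosen_cone)"
proof -
  \<comment> \<open>Nonnegativity at the origin shows that prime cones exist, so that
    \<open>SOME\<close> picks one.\<close>
  have "prime_cone {p. 0 \<le> reval (\<lambda>_. 0) p}" by (rule prime_cone_nonneg[OF idom_hom_insertion_real])
  then have "\<exists>P. prime_cone P \<and>
     ((\<exists>Q. prime_cone Q \<and> \<not> (realizable Q \<and> critical_values_real Q)) \<longrightarrow> \<not> (realizable P \<and> critical_values_real P))"
    by blast
  from someI_ex[OF this] show "prime_cone chosen_cone"
    "prime_cone Q \<Longrightarrow> \<not> (realizable Q \<and> critical_values_real Q) \<Longrightarrow> \<not> (realizable chosen_cone \<and> critical_values_real chosen_cone)"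
    unfolding chosen_cone_def[symmetric] by blast+
qed

section \<open>The ordered residue ring of the chosen cone\<close>

lemma chosen_coneD:
  "p * p \<in> chosen_cone" "p \<in> chosen_cone \<Longrightarrow> q \<in> chosen_cone \<Longrightarrow> p + q \<in> chosen_cone"
  "p \<in> chosen_cone \<Longrightarrow> q \<in> chosen_cone \<Longrightarrow> p * q \<in> chosen_cone"
  "- 1 \<notin> chosen_cone" "p \<in> chosen_cone \<or> - p \<in> chosen_cone"
  "p * q \<in> supp chosen_cone \<Longrightarrow> p \<in> supp chosen_cone \<or> q \<in> supp chosen_cone"
  "0 \<in> chosen_cone"
proof -
  have pre: "preorder_on UNIV chosen_cone" using chosen_cone(1) unfolding prime_cone_on_def by blast
  show "p * p \<in> chosen_cone" "p \<in> chosen_cone \<Longrightarrow> q \<in> chosen_cone \<Longrightarrow> p + q \<in> chosen_cone"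
  "p \<in> chosen_cone \<Longrightarrow> q \<in> chosen_cone \<Longrightarrow> p * q \<in> chosen_cone"
    using preorder_onD[OF pre] by simp_all
  show "- 1 \<notin> chosen_cone" "p \<in> chosen_cone \<or> - p \<in> chosen_cone"
    "p * q \<in> supp chosen_cone \<Longrightarrow> p \<in> supp chosen_cone \<or> q \<in> supp chosen_cone"
    using chosen_cone(1) unfolding prime_cone_on_def supp_def by blast+
  show "0 \<in> chosen_cone" using preorder_onD(2)[OF pre, of 0] by simp
qed

lemma supp_chosen_cone_ideal:
  "0 \<in> supp chosen_cone" "p \<in> supp chosen_cone \<Longrightarrow> q \<in> supp chosen_cone \<Longrightarrow> p + q \<in> supp chosen_cone"
  "p \<in> supp chosen_cone \<Longrightarrow> - p \<in> supp chosen_cone" "p \<in> supp chosen_cone \<Longrightarrow> q * p \<in> supp chosen_cone"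
proof -
  show "0 \<in> supp chosen_cone" using chosen_coneD(7) by (simp add: supp_def)
  show "p \<in> supp chosen_cone \<Longrightarrow> q \<in> supp chosen_cone \<Longrightarrow> p + q \<in> supp chosen_cone"
    using chosen_coneD(2)[of p q] chosen_coneD(2)[of "- p" "- q"] by (simp add: supp_def)
  show "p \<in> supp chosen_cone \<Longrightarrow> - p \<in> supp chosen_cone" by (simp add: supp_def)
  show "p \<in> supp chosen_cone \<Longrightarrow> q * p \<in> supp chosen_cone"
    using chosen_coneD(5)[of q] chosen_coneD(3)[of q p] chosen_coneD(3)[of q "- p"]
      chosen_coneD(3)[of "- q" p] chosen_coneD(3)[of "- q" "- p"] by (auto simp: supp_def)
qed

quotient_type residue_ring = rpoly / "\<lambda>p q. p - q \<in> supp chosen_cone"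
  morphisms residue_rep residue_class
proof (rule equivpI)
  show "reflp (\<lambda>p q. p - q \<in> supp chosen_cone)" by (simp add: reflp_def supp_chosen_cone_ideal)
  show "symp (\<lambda>p q. p - q \<in> supp chosen_cone)" using supp_chosen_cone_ideal(3) by (fastforce simp: symp_def)
  show "transp (\<lambda>p q. p - q \<in> supp chosen_cone)" using supp_chosen_cone_ideal(2) by (fastforce simp: transp_def)
qed

lemma supp_cong_mult:
  assumes "p - p' \<in> supp chosen_cone" "q - q' \<in> supp chosen_cone"
  shows "p * q - p' * q' \<in> supp chosen_cone"
proof -
  have "p * q - p' * q' = q * (p - p') + p' * (q - q')" by (simp add: algebra_simps)
  then show ?thesis using assms by (simp add: supp_chosen_cone_ideal)
qed

lemma supp_cong_add:
  assumes "p - p' \<in> supp chosen_cone" "q - q' \<in> supp chosen_cone"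
  shows "(p + q) - (p' + q') \<in> supp chosen_cone" "(p - q) - (p' - q') \<in> supp chosen_cone"
proof -
  have "(p + q) - (p' + q') = (p - p') + (q - q')" "(p - q) - (p' - q') = (p - p') + - (q - q')" by simp_all
  then show "(p + q) - (p' + q') \<in> supp chosen_cone" "(p - q) - (p' - q') \<in> supp chosen_cone"
    using assms supp_chosen_cone_ideal(2,3) by metis+
qed

lemma supp_cong_cone:
  assumes "p - p' \<in> supp chosen_cone"
  shows "p \<in> chosen_cone \<longleftrightarrow> p' \<in> chosen_cone"
proof -
  have "p - p' \<in> chosen_cone" "- (p - p') \<in> chosen_cone" using assms by (simp_all only: supp_def mem_Collect_eq)
  then show ?thesis using chosen_coneD(2)[of p' "p - p'"] chosen_coneD(2)[of p "- (p - p')"] by auto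
qed

instantiation residue_ring :: linordered_idom
begin

lift_definition zero_residue_ring :: residue_ring is 0 .
lift_definition one_residue_ring :: residue_ring is 1 .
lift_definition plus_residue_ring :: "residue_ring \<Rightarrow> residue_ring \<Rightarrow> residue_ring" is "(+)"
  by (rule supp_cong_add)
lift_definition minus_residue_ring :: "residue_ring \<Rightarrow> residue_ring \<Rightarrow> residue_ring" is "(-)"
  by (rule supp_cong_add)
lift_definition times_residue_ring :: "residue_ring \<Rightarrow> residue_ring \<Rightarrow> residue_ring" is "(*)"
  by (rule supp_cong_mult)
lift_definition uminus_residue_ring :: "residue_ring \<Rightarrow> residue_ring" is uminus
  using supp_chosen_cone_ideal(3) by fastforce
lift_definition less_eq_residue_ring :: "residue_ring \<Rightarrow> residue_ring \<Rightarrow> bool" is "\<lambda>p q. q - p \<in> chosen_cone"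
  by (rule supp_cong_cone, rule supp_cong_add)

definition less_residue_ring :: "residue_ring \<Rightarrow> residue_ring \<Rightarrow> bool" where
  "less_residue_ring x y \<longleftrightarrow> x \<le> y \<and> \<not> y \<le> x"
definition abs_residue_ring :: "residue_ring \<Rightarrow> residue_ring" where
  "abs_residue_ring x = (if x < 0 then - x else x)"
definition sgn_residue_ring :: "residue_ring \<Rightarrow> residue_ring" where
  "sgn_residue_ring x = (if x = 0 then 0 else if 0 < x then 1 else - 1)"

instance
proof
  fix x y z :: residue_ring
  show "x + y + z = x + (y + z)" "x + y = y + x" "0 + x = x" "- x + x = 0" "x - y = x + - y"
    "x * y * z = x * (y * z)" "x * y = y * x" "1 * x = x" "(x + y) * z = x * z + y * z"
    "x + y - x = y" "x - y - z = x - (y + z)" "0 * x = 0" "x * 0 = 0"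
    by (transfer; simp add: algebra_simps supp_chosen_cone_ideal)+
  show "(0 :: residue_ring) \<noteq> 1" by transfer (use chosen_coneD(4) in \<open>simp add: supp_def\<close>)
  show "(x < y) = (x \<le> y \<and> \<not> y \<le> x)" by (rule less_residue_ring_def)
  show "x \<le> x" by transfer (simp add: chosen_coneD)
  show "x \<le> y \<Longrightarrow> y \<le> z \<Longrightarrow> x \<le> z"
  proof transfer
    fix x y z :: rpoly assume "y - x \<in> chosen_cone" "z - y \<in> chosen_cone"
    from chosen_coneD(2)[OF this] show "z - x \<in> chosen_cone" by simp
  qed
  show "x \<le> y \<Longrightarrow> y \<le> x \<Longrightarrow> x = y" by transfer (simp add: supp_def)
  show "x \<le> y \<or> y \<le> x"
  proof transfer
    fix x y :: rpoly
    show "y - x \<in> chosen_cone \<or> x - y \<in> chosen_cone" using chosen_coneD(5)[of "y - x"] by simp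
  qed
  show "x \<le> y \<Longrightarrow> z + x \<le> z + y" by transfer simp
  show "x < y \<Longrightarrow> 0 < z \<Longrightarrow> z * x < z * y"
    unfolding less_residue_ring_def
  proof transfer
    fix x y z :: rpoly
    assume xy: "y - x \<in> chosen_cone \<and> x - y \<notin> chosen_cone" and z: "z - 0 \<in> chosen_cone \<and> 0 - z \<notin> chosen_cone"
    have "z * (y - x) \<in> chosen_cone" using xy z by (simp add: chosen_coneD(3))
    moreover have "z \<notin> supp chosen_cone" "y - x \<notin> supp chosen_cone" using xy z by (auto simp: supp_def)
    then have "z * (y - x) \<notin> supp chosen_cone" using chosen_coneD(6) by blast
    ultimately show "z * y - z * x \<in> chosen_cone \<and> z * x - z * y \<notin> chosen_cone"
      by (simp add: supp_def algebra_simps)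
  qed
  show "\<bar>x\<bar> = (if x < 0 then - x else x)" by (rule abs_residue_ring_def)
  show "sgn x = (if x = 0 then 0 else if 0 < x then 1 else - 1)" by (rule sgn_residue_ring_def)
qed

end

lemma idom_hom_residue: "idom_hom residue_class"
  by unfold_locales
     (simp_all add: plus_residue_ring.abs_eq times_residue_ring.abs_eq zero_residue_ring_def one_residue_ring_def)

lemma residue_nonneg: "0 \<le> residue_class p \<longleftrightarrow> p \<in> chosen_cone"
  by (simp add: zero_residue_ring_def less_eq_residue_ring.abs_eq)

definition residue_real_closure :: "rpoly \<Rightarrow> residue_ring fract real_closure" where
  "residue_real_closure p = to_real_closure (Fract (residue_class p) 1)"

lemma idom_hom_residue_real_closure: "idom_hom residue_real_closure"
proof -
  interpret r: idom_hom residue_class by (rule idom_hom_residue)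
  interpret t: idom_hom "to_real_closure :: residue_ring fract \<Rightarrow> _" by (rule idom_hom_to_real_closure)
  have 01: "Fract 0 1 = (0 :: residue_ring fract)" "Fract 1 1 = (1 :: residue_ring fract)"
    by (simp_all add: Zero_fract_def One_fract_def)
  show ?thesis
    by unfold_locales (simp_all add: residue_real_closure_def 01 r.hom_add r.hom_mult
      add_fract[symmetric] mult_fract[symmetric] t.hom_add[symmetric] t.hom_mult[symmetric])
qed

lemma residue_real_closure_nonneg: "0 \<le> residue_real_closure p \<longleftrightarrow> p \<in> chosen_cone"
proof -
  interpret r: idom_hom residue_class by (rule idom_hom_residue)
  interpret t: idom_hom "to_real_closure :: residue_ring fract \<Rightarrow> _" by (rule idom_hom_to_real_closure)
  have "0 \<le> to_real_closure y \<longleftrightarrow> 0 \<le> y" for y :: "residue_ring fract"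
  proof
    assume *: "0 \<le> to_real_closure y"
    show "0 \<le> y"
    proof (rule ccontr)
      assume "\<not> 0 \<le> y"
      then have "0 \<le> - y" "y \<noteq> 0" by auto
      then have "0 \<le> - to_real_closure y" "to_real_closure y \<noteq> 0"
        using to_real_closure_nonneg[of "- y"] by (simp_all add: t.hom_uminus to_real_closure_eq_0_iff)
      then show False using * by simp
    qed
  qed (rule to_real_closure_nonneg)
  moreover have "0 \<le> Fract (residue_class p) 1 \<longleftrightarrow> 0 \<le> residue_class p" by (simp add: zero_le_Fract_iff)
  ultimately show ?thesis by (simp add: residue_real_closure_def residue_nonneg)
qed

text \<open>The chosen cone is the nonnegativity set of a homomorphism into a real closed field and
  thus has both properties. As it would be a counterexample if there were any, every prime cone has
  them.\<close>

theorem prime_cone_realizable: "prime_cone P \<Longrightarrow> realizable P"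
  and prime_cone_critical_values_real: "prime_cone P \<Longrightarrow> critical_values_real P"
proof -
  have "chosen_cone = {p. 0 \<le> residue_real_closure p}" using residue_real_closure_nonneg by blast
  then have "realizable chosen_cone \<and> critical_values_real chosen_cone"
    using realizable_hom[OF idom_hom_residue_real_closure] critical_values_real_hom[OF idom_hom_residue_real_closure]
    by simp
  then show "prime_cone P \<Longrightarrow> realizable P" "prime_cone P \<Longrightarrow> critical_values_real P"
    using chosen_cone(2) by blast+
qed

section \<open>Archimedean quadratic modules\<close>

definition qmod_on :: "'a::comm_ring_1 set \<Rightarrow> 'a set \<Rightarrow> bool" where
  "qmod_on B Q \<longleftrightarrow> Q \<subseteq> B \<and> 1 \<in> Q \<and> (\<forall>a\<in>Q. \<forall>b\<in>Q. a + b \<in> Q) \<and> (\<forall>a\<in>B. \<forall>q\<in>Q. a * a * q \<in> Q)"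

lemma qmod_onD:
  assumes "qmod_on B Q"
  shows "q \<in> Q \<Longrightarrow> q \<in> B" "1 \<in> Q" "p \<in> Q \<Longrightarrow> q \<in> Q \<Longrightarrow> p + q \<in> Q" "a \<in> B \<Longrightarrow> q \<in> Q \<Longrightarrow> a * a * q \<in> Q"
    "a \<in> B \<Longrightarrow> a * a \<in> Q"
proof -
  show *: "a \<in> B \<Longrightarrow> q \<in> Q \<Longrightarrow> a * a * q \<in> Q" for q using assms by (simp add: qmod_on_def)
  show 1: "1 \<in> Q" using assms by (simp add: qmod_on_def)
  show "a \<in> B \<Longrightarrow> a * a \<in> Q" using *[OF _ 1] by simp
qed (use assms in \<open>auto simp: qmod_on_def\<close>)

inductive_set sq_sums :: "'a::comm_ring_1 set \<Rightarrow> 'a set" for B where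
  "0 \<in> sq_sums B"
| "b \<in> B \<Longrightarrow> s \<in> sq_sums B \<Longrightarrow> b * b + s \<in> sq_sums B"

lemma sq_sums_add: "s \<in> sq_sums B \<Longrightarrow> t \<in> sq_sums B \<Longrightarrow> s + t \<in> sq_sums B"
  by (induction rule: sq_sums.induct) (auto simp: add.assoc intro: sq_sums.intros)

lemma sq_sums_in: "s \<in> sq_sums B \<Longrightarrow> subring_on B \<Longrightarrow> s \<in> B"
  by (induction rule: sq_sums.induct) (simp_all add: subring_onD)

lemma sq_sums_mult_square:
  "s \<in> sq_sums B \<Longrightarrow> subring_on B \<Longrightarrow> a \<in> B \<Longrightarrow> a * a * s \<in> sq_sums B"
proof (induction rule: sq_sums.induct)
  case (2 b s)
  have "(a * b) * (a * b) + a * a * s \<in> sq_sums B" 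
    by (intro sq_sums.intros(2) subring_onD(4)[OF "2.prems"(1)] "2.IH"[OF "2.prems"] "2.prems"(2) "2.hyps"(1))
  then show ?case by (simp add: algebra_simps)
qed (simp add: sq_sums.intros)

lemma qmod_sq_sums_mult:
  assumes B: "subring_on B" and Q: "qmod_on B Q" and "0 \<in> Q"
  shows "s \<in> sq_sums B \<Longrightarrow> q \<in> Q \<Longrightarrow> s * q \<in> Q"
proof (induction rule: sq_sums.induct)
  case (2 b s)
  then show ?case using qmod_onD[OF Q] by (simp add: distrib_right)
qed (use assms in simp)

lemma qmod_adjoin:
  assumes B: "subring_on B" and Q: "qmod_on B Q" and a: "a \<in> B" and 0: "0 \<in> Q"
  shows "qmod_on B {q + s * a |q s. q \<in> Q \<and> s \<in> sq_sums B}" (is "qmod_on B ?R")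
    and "Q \<subseteq> {q + s * a |q s. q \<in> Q \<and> s \<in> sq_sums B}" "a \<in> {q + s * a |q s. q \<in> Q \<and> s \<in> sq_sums B}"
proof -
  note QD = qmod_onD[OF Q]
  have RI: "q + s * a \<in> ?R" if "q \<in> Q" "s \<in> sq_sums B" for q s using that by blast
  show sub: "Q \<subseteq> ?R" using RI[OF _ sq_sums.intros(1)] by auto
  have "1 * 1 + 0 \<in> sq_sums B" by (intro sq_sums.intros subring_onD[OF B])
  then show "a \<in> ?R" using RI[OF 0, of 1] by simp
  show "qmod_on B ?R" unfolding qmod_on_def
  proof (intro conjI ballI)
    show "?R \<subseteq> B" using QD(1) sq_sums_in[OF _ B] a subring_onD(3,4)[OF B] by blast
    show "1 \<in> ?R" using sub QD(2) by blast
  next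
    fix x y assume "x \<in> ?R" "y \<in> ?R"
    then obtain q s q' s' where x: "x = q + s * a" "q \<in> Q" "s \<in> sq_sums B"
      and y: "y = q' + s' * a" "q' \<in> Q" "s' \<in> sq_sums B" by blast
    have "x + y = (q + q') + (s + s') * a" unfolding x(1) y(1) by (simp add: algebra_simps)
    also have "\<dots> \<in> ?R" by (intro RI QD(3) sq_sums_add x y)
    finally show "x + y \<in> ?R" .
  next
    fix b x assume b: "b \<in> B" and "x \<in> ?R"
    then obtain q s where x: "x = q + s * a" "q \<in> Q" "s \<in> sq_sums B" by blast
    have "b * b * x = b * b * q + (b * b * s) * a" unfolding x(1) by (simp add: algebra_simps)
    also have "\<dots> \<in> ?R" by (intro RI QD(4) sq_sums_mult_square b B x)
    finally show "b * b * x \<in> ?R" .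
  qed
qed

lemma maximal_qmod_exists:
  assumes Q0: "qmod_on B Q0" "- 1 \<notin> Q0"
  shows "\<exists>Q. Q0 \<subseteq> Q \<and> qmod_on B Q \<and> - 1 \<notin> Q \<and> (\<forall>W. qmod_on B W \<longrightarrow> - 1 \<notin> W \<longrightarrow> Q \<subseteq> W \<longrightarrow> W = Q)"
proof -
  define A where "A = {Q. Q0 \<subseteq> Q \<and> qmod_on B Q \<and> - 1 \<notin> Q}"
  have "\<exists>M\<in>A. \<forall>W\<in>A. M \<subseteq> W \<longrightarrow> W = M"
  proof (rule subset_Zorn_nonempty)
    show "A \<noteq> {}" using assms by (auto simp: A_def)
    fix C assume C: "C \<noteq> {}" "subset.chain A C"
    have CA: "W \<in> A" if "W \<in> C" for W using C that by (auto simp: subset.chain_def)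
    then have q: "qmod_on B W" if "W \<in> C" for W using that by (auto simp: A_def)
    obtain W0 where W0: "W0 \<in> C" using C by blast
    have "qmod_on B (\<Union>C)" unfolding qmod_on_def
    proof (intro conjI ballI)
      show "\<Union>C \<subseteq> B" using qmod_onD(1)[OF q] by blast
      show "1 \<in> \<Union>C" using qmod_onD(2)[OF q[OF W0]] W0 by blast
      fix x assume x: "x \<in> \<Union>C"
      then show "b * b * x \<in> \<Union>C" if "b \<in> B" for b using qmod_onD(4)[OF q that] by blast
      fix y assume y: "y \<in> \<Union>C"
      have "\<exists>W\<in>C. x \<in> W \<and> y \<in> W" using x y C unfolding subset.chain_def by blast
      then show "x + y \<in> \<Union>C" using qmod_onD(3)[OF q] by blast
    qed
    then show "\<Union>C \<in> A" using CA W0 unfolding A_def by blast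
  qed
  then obtain Q where Q: "Q \<in> A" "\<And>W. W \<in> A \<Longrightarrow> Q \<subseteq> W \<Longrightarrow> W = Q" by blast
  then show ?thesis by (intro exI[of _ Q]) (auto simp: A_def)
qed

context
  fixes N :: nat and Q :: "rpoly set"
  assumes Q: "qmod_on (polys N) Q"
begin

lemmas QD = qmod_onD[OF Q]

lemma numeral_Const: "(numeral n :: rpoly) = Const (numeral n)"
  by (simp add: Const_def)

lemma qmod_Const: "0 \<le> c \<Longrightarrow> Const c \<in> Q"
  using QD(5)[of "Const (sqrt c)"] by (simp flip: Const_mult)

lemma qmod_scale: "0 \<le> c \<Longrightarrow> q \<in> Q \<Longrightarrow> Const c * q \<in> Q"
  using QD(4)[of "Const (sqrt c)" q] by (simp flip: Const_mult)

lemma qmod_0: "0 \<in> Q"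
  using qmod_Const[of 0] by simp

text \<open>Write \<open>p\<close> as \<open>((p + 1)^2 - (p - 1)^2) / 4\<close> and use
  \<open>s\<close> with the first square and \<open>- s\<close> with the second.\<close>

lemma qmod_supp_ideal:
  assumes "s \<in> Q" "- s \<in> Q" "p \<in> polys N"
  shows "p * s \<in> Q"
proof -
  have p: "p + 1 \<in> polys N" "p - 1 \<in> polys N" using assms(3) by (auto intro: polysD)
  have "Const (1 / 4) * ((p + 1) * (p + 1) * s + (p - 1) * (p - 1) * (- s)) \<in> Q"
    by (intro qmod_scale QD(3) QD(4) p assms) simp
  also have "Const (1 / 4) * ((p + 1) * (p + 1) * s + (p - 1) * (p - 1) * (- s)) = (Const (1 / 4) * 4) * (p * s)"
    by (simp add: algebra_simps)
  also have "Const (1 / 4) * 4 = 1" unfolding numeral_Const Const_mult[symmetric] by simp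
  finally show ?thesis by simp
qed

text \<open>The bound is first proved for squares, where it passes to sums by
  \<open>2 p^2 + 2 q^2 - (p + q)^2 = (p - q)^2\<close> and to products by bounding one factor at a
  time.\<close>

lemma qmod_archimedean:
  assumes "\<And>i. i < N \<Longrightarrow> \<exists>C. Const C - Var i * Var i \<in> Q" "p \<in> polys N"
  shows "\<exists>C. Const C - p \<in> Q"
proof -
  have "\<exists>C\<ge>0. Const C - p * p \<in> Q" using assms(2)
  proof (induction rule: polys_induct)
    case (Const c)
    have "Const (c * c) - Const c * Const c \<in> Q" by (simp add: Const_mult qmod_0)
    then show ?case by (intro exI[of _ "c * c"]) simp
  next
    case (Var i)
    then obtain C where C: "Const C - Var i * Var i \<in> Q" using assms(1) by blast
    have "Const (\<bar>C\<bar> - C) + (Const C - Var i * Var i) \<in> Q" by (intro QD(3) C qmod_Const) simp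
    then show ?case by (intro exI[of _ "\<bar>C\<bar>"]) (simp add: Const_diff)
  next
    case (add p q)
    then obtain C D where CD: "C \<ge> 0" "Const C - p * p \<in> Q" "D \<ge> 0" "Const D - q * q \<in> Q" by blast
    have "Const 2 * (Const C - p * p) + Const 2 * (Const D - q * q) + (p - q) * (p - q) \<in> Q"
      using add(1,2) by (intro QD(3) qmod_scale CD QD(5) polysD(6)) simp_all
    moreover have "Const (2 * C + 2 * D) - (p + q) * (p + q) =
        Const 2 * (Const C - p * p) + Const 2 * (Const D - q * q) + (p - q) * (p - q)"
    proof -
      have "Const 2 = 2" by (simp add: Const_def)
      then show ?thesis by (simp add: Const_add Const_mult algebra_simps)
    qed
    ultimately show ?case using CD by (intro exI[of _ "2 * C + 2 * D"]) simp
  next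
    case (mult p q)
    then obtain C D where CD: "C \<ge> 0" "Const C - p * p \<in> Q" "D \<ge> 0" "Const D - q * q \<in> Q" by blast
    have "Const C * (Const D - q * q) + q * q * (Const C - p * p) \<in> Q"
      using mult(1,2) by (intro QD(3) qmod_scale CD QD(4))
    moreover have "Const (C * D) - (p * q) * (p * q) = Const C * (Const D - q * q) + q * q * (Const C - p * p)"
      by (simp add: Const_mult algebra_simps)
    ultimately show ?case using CD by (intro exI[of _ "C * D"]) simp
  qed
  then obtain C where C: "Const C - p * p \<in> Q" by blast
  \<comment> \<open>As \<open>p^2 - p + 1/4\<close> is a square, a bound \<open>C\<close> for
    \<open>p^2\<close> gives the bound \<open>C + 1/4\<close> for \<open>p\<close>.\<close>
  have "(Const C - p * p) + (p - Const (1 / 2)) * (p - Const (1 / 2)) \<in> Q"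
    by (intro QD(3) QD(5) C polysD(6) assms(2) Const_in_polys)
  moreover have "(Const C - p * p) + (p - Const (1 / 2)) * (p - Const (1 / 2)) = Const (C + 1 / 4) - (Const (1 / 2) + Const (1 / 2)) * p"
    by (simp add: Const_add algebra_simps flip: Const_mult)
  moreover have "Const (1 / 2) + Const (1 / 2) = 1" by (simp flip: Const_add)
  ultimately show ?thesis by auto
qed

text \<open>So \<open>p - r\<close> is infinitesimal for \<open>Q\<close>. The margin
  \<open>e\<close> is present because \<open>Q\<close> need not be closed under limits.\<close>

definition has_value :: "rpoly \<Rightarrow> real \<Rightarrow> bool" where
  "has_value p r \<longleftrightarrow> (\<forall>e>0. p - Const r + Const e \<in> Q \<and> Const r - p + Const e \<in> Q)"

lemma has_value_Const: "has_value (Const c) c"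
  by (simp add: has_value_def qmod_Const)

lemma has_value_add:
  assumes "has_value p r" "has_value q s"
  shows "has_value (p + q) (r + s)"
  unfolding has_value_def
proof (intro allI impI)
  fix e :: real assume "e > 0"
  then have h: "e / 2 > 0" by simp
  note P = assms(1)[unfolded has_value_def, rule_format, OF h] and R = assms(2)[unfolded has_value_def, rule_format, OF h]
  have "(p - Const r + Const (e / 2)) + (q - Const s + Const (e / 2)) \<in> Q"
    by (rule QD(3)[OF conjunct1[OF P] conjunct1[OF R]])
  moreover have "(Const r - p + Const (e / 2)) + (Const s - q + Const (e / 2)) \<in> Q"
    by (rule QD(3)[OF conjunct2[OF P] conjunct2[OF R]])
  moreover have "Const e = Const (e / 2) + Const (e / 2)" by (simp flip: Const_add)
  ultimately show "p + q - Const (r + s) + Const e \<in> Q \<and> Const (r + s) - (p + q) + Const e \<in> Q"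
    by (simp add: Const_add algebra_simps)
qed

lemma has_value_scale:
  assumes "has_value p r"
  shows "has_value (Const c * p) (c * r)"
proof -
  have pos: "has_value (Const c * p) (c * r)" if "c > 0" and h: "has_value p r" for c p r
    unfolding has_value_def
  proof (intro allI impI)
    fix e :: real assume "e > 0"
    then have "e / c > 0" using that by simp
    then have "Const c * (p - Const r + Const (e / c)) \<in> Q" "Const c * (Const r - p + Const (e / c)) \<in> Q"
      using h that unfolding has_value_def by (auto intro!: qmod_scale)
    moreover have "Const c * Const (e / c) = Const e" using that by (simp flip: Const_mult)
    ultimately show "Const c * p - Const (c * r) + Const e \<in> Q \<and> Const (c * r) - Const c * p + Const e \<in> Q"
      by (simp add: Const_mult algebra_simps)
  qed
  have neg: "has_value (- p) (- r)"
    using assms unfolding has_value_def by (simp add: Const_uminus algebra_simps)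
  show ?thesis
  proof (cases c "0 :: real" rule: linorder_cases)
    case less
    then show ?thesis using pos[OF _ neg, of "- c"] by (simp add: Const_uminus)
  next
    case equal
    then show ?thesis using has_value_Const[of 0] by simp
  next
    case greater
    then show ?thesis using pos[OF _ assms] by blast
  qed
qed

text \<open>With \<open>d^2 = e\<close>, use
  \<open>(d + u)^2 (d - u) + (d - u)^2 (d + u) = 2 d (d^2 - u^2)\<close>; the summands lie in
  \<open>Q\<close> because \<open>d + u\<close> and \<open>d - u\<close> do.\<close>

lemma has_value_square_0:
  assumes "has_value u 0" "u \<in> polys N"
  shows "has_value (u * u) 0"
  unfolding has_value_def
proof (intro allI impI conjI)
  fix e :: real assume e: "e > 0"
  show "u * u - Const 0 + Const e \<in> Q"
    using QD(3)[OF QD(5)[OF assms(2)] qmod_Const[of e]] e by simp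
  define d where "d = sqrt e"
  have d: "d > 0" "d * d = e" using e by (simp_all add: d_def)
  have "u + Const d \<in> Q" "Const d - u \<in> Q" using assms(1) d unfolding has_value_def by auto
  note m = this
  have "(u + Const d) * (u + Const d) * (Const d - u) \<in> Q"
    by (rule QD(4)[OF _ m(2)]) (intro polysD(3) assms(2) Const_in_polys)
  moreover have "(Const d - u) * (Const d - u) * (u + Const d) \<in> Q"
    by (rule QD(4)[OF _ m(1)]) (intro polysD(6) assms(2) Const_in_polys)
  ultimately have "Const (1 / (2 * d)) * ((u + Const d) * (u + Const d) * (Const d - u) + (Const d - u) * (Const d - u) * (u + Const d)) \<in> Q"
    using d by (intro qmod_scale QD(3)) auto
  also have "Const (1 / (2 * d)) * ((u + Const d) * (u + Const d) * (Const d - u) + (Const d - u) * (Const d - u) * (u + Const d))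
     = (Const (1 / (2 * d)) * (Const d + Const d)) * (Const d * Const d - u * u)"
    by (simp add: algebra_simps)
  also have "Const (1 / (2 * d)) * (Const d + Const d) = 1"
    unfolding Const_add[symmetric] Const_mult[symmetric] using d(1) by simp
  also have "Const d * Const d = Const e" by (simp only: d(2) flip: Const_mult)
  finally show "Const 0 - u * u + Const e \<in> Q" by simp
qed

text \<open>Both factors are shifted to value 0. A quadratic module controls squares rather than
  products, so the product of the shifts is written as a difference of squares.\<close>

lemma has_value_mult:
  assumes "has_value p r" "has_value q s" "p \<in> polys N" "q \<in> polys N"
  shows "has_value (p * q) (r * s)"
proof -
  define u v where "u = p - Const r" and "v = q - Const s"
  have uv: "u \<in> polys N" "v \<in> polys N" using assms by (auto simp: u_def v_def intro: polysD)
  have hu: "has_value u 0" and hv: "has_value v 0"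
    using assms(1,2) by (simp_all add: has_value_def u_def v_def)
  have "has_value (Const (- 1) * v) (- 1 * 0)" by (rule has_value_scale[OF hv])
  then have "has_value (u + Const (- 1) * v) 0" using has_value_add[OF hu] by fastforce
  then have s1: "has_value ((u - v) * (u - v)) 0" using uv by (intro has_value_square_0) (auto simp: Const_uminus intro: polysD)
  have "has_value (u + v) 0" using has_value_add[OF hu hv] by simp
  then have s2: "has_value ((u + v) * (u + v)) 0" using uv by (intro has_value_square_0) (auto intro: polysD)
  have "has_value (Const (1 / 4) * ((u + v) * (u + v)) + Const (- 1 / 4) * ((u - v) * (u - v)) + Const r * v + Const s * u + Const (r * s)) (1 / 4 * 0 + - 1 / 4 * 0 + r * 0 + s * 0 + r * s)"
    by (intro has_value_add has_value_scale s1 s2 hu hv has_value_Const)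
  moreover have "Const (1 / 4) * ((u + v) * (u + v)) + Const (- 1 / 4) * ((u - v) * (u - v)) + Const r * v + Const s * u + Const (r * s) = p * q"
  proof -
    have "Const (1 / 4) * ((u + v) * (u + v)) + Const (- 1 / 4) * ((u - v) * (u - v)) = (Const (1 / 4) * 4) * (u * v)"
      by (simp add: Const_uminus algebra_simps)
    moreover have "Const (1 / 4) * 4 = (1 :: rpoly)" unfolding numeral_Const Const_mult[symmetric] by simp
    moreover have "u * v + Const r * v + Const s * u + Const (r * s) = p * q"
      by (simp add: u_def v_def Const_mult algebra_simps)
    ultimately show ?thesis by simp
  qed
  ultimately show ?thesis by simp
qed

end

text \<open>A quadratic module that is maximal without \<open>- 1\<close> is total. By the
  Archimedean property every polynomial then has a value, the supremum of its lower bounds, and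
  values respect sums and products; the values of the variables are the coordinates of the
  point.\<close>

theorem qmod_point:
  assumes Q0: "qmod_on (polys N) Q0" "- 1 \<notin> Q0"
    and arch: "\<And>p. p \<in> polys N \<Longrightarrow> \<exists>C. Const C - p \<in> Q0"
  shows "\<exists>x. \<forall>q\<in>Q0. 0 \<le> reval x q"
proof -
  obtain Q where sub: "Q0 \<subseteq> Q" and Q: "qmod_on (polys N) Q" and m1: "- 1 \<notin> Q"
    and max: "\<And>W. qmod_on (polys N) W \<Longrightarrow> - 1 \<notin> W \<Longrightarrow> Q \<subseteq> W \<Longrightarrow> W = Q"
    using maximal_qmod_exists[OF Q0] by blast
  note QD = qmod_onD[OF Q] and B = subring_on_polys[of N] and 0 = qmod_0[OF Q]
  have sq_Q: "s \<in> Q" if "s \<in> sq_sums (polys N)" for s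
    using qmod_sq_sums_mult[OF B Q 0 that QD(2)] by simp
  have ideal: "s * a \<in> Q" if "s \<in> sq_sums (polys N)" "- s \<in> Q" "a \<in> polys N" for s a
    using that
  proof (induction rule: sq_sums.induct)
    case (2 b s)
    have "- (b * b + s) + s \<in> Q" "- (b * b + s) + b * b \<in> Q"
      using 2 sq_Q by (intro QD(3) QD(5); simp)+
    then have m: "- (b * b) \<in> Q" "- s \<in> Q" by simp_all
    have "a * (b * b) \<in> Q" by (rule qmod_supp_ideal[OF Q QD(5)[OF 2(1)] m(1) 2(5)])
    moreover have "s * a \<in> Q" using 2 m by simp
    ultimately have "a * (b * b) + s * a \<in> Q" by (rule QD(3))
    moreover have "(b * b + s) * a = a * (b * b) + s * a" by (simp add: algebra_simps)
    ultimately show ?case by simp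
  qed (simp add: 0)
  have ext: "\<exists>q\<in>Q. \<exists>s\<in>sq_sums (polys N). - 1 = q + s * a" if "a \<in> polys N" "a \<notin> Q" for a
  proof (rule ccontr)
    assume n: "\<not> ?thesis"
    define R where "R = {q + s * a |q s. q \<in> Q \<and> s \<in> sq_sums (polys N)}"
    note adj = qmod_adjoin[OF B Q that(1) 0, folded R_def]
    have "- 1 \<notin> R"
    proof
      assume "- 1 \<in> R"
      then obtain q s where "- 1 = q + s * a" "q \<in> Q" "s \<in> sq_sums (polys N)" unfolding R_def by blast
      then show False using n by blast
    qed
    then have "R = Q" by (rule max[OF adj(1) _ adj(2)])
    then show False using adj(3) that(2) by simp
  qed
  \<comment> \<open>From \<open>- 1 = q + s a\<close> and \<open>- 1 = q' - s' a\<close> follows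
    \<open>- (s + s') = s' q + s q'\<close>. Hence \<open>- s\<close> lies in \<open>Q\<close>, then
    \<open>s a\<close> does, and with it \<open>- 1\<close>.\<close>
  have total: "a \<in> Q \<or> - a \<in> Q" if a: "a \<in> polys N" for a
  proof (rule ccontr)
    assume n: "\<not> ?thesis"
    then obtain q s where s: "q \<in> Q" "s \<in> sq_sums (polys N)" "- 1 = q + s * a" using ext a by blast
    have "- a \<in> polys N" using a by (rule polysD)
    then obtain q' s' where s': "q' \<in> Q" "s' \<in> sq_sums (polys N)" "- 1 = q' + s' * (- a)" using ext n by blast
    have "- (s + s') = s' * q + s * q'"
    proof -
      have "q = - 1 - s * a" "q' = - 1 + s' * a" using s s' by (simp_all add: algebra_simps)
      then show ?thesis by (simp only:) (simp add: algebra_simps)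
    qed
    also have "\<dots> \<in> Q" by (intro QD(3) qmod_sq_sums_mult[OF B Q 0] s s')
    finally have "- (s + s') + s' \<in> Q" by (rule QD(3)[OF _ sq_Q[OF s'(2)]])
    then have "- s \<in> Q" by simp
    then have "s * a \<in> Q" by (rule ideal[OF s(2) _ a])
    then have "- 1 \<in> Q" using s QD(3) by simp
    then show False using m1 by simp
  qed
  have Const_Q: "0 \<le> c" if "Const c \<in> Q" for c
  proof (rule ccontr)
    assume "\<not> 0 \<le> c"
    then have "Const (1 / - c) * Const c \<in> Q" by (intro qmod_scale[OF Q] that) simp
    then show False using m1 \<open>\<not> 0 \<le> c\<close> by (simp add: Const_uminus flip: Const_mult)
  qed
  have "\<exists>r. has_value Q p r" if p: "p \<in> polys N" for p
  proof -
    define S where "S = {r. p - Const r \<in> Q}"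
    obtain C where C: "Const C - p \<in> Q" using arch[OF p] sub by blast
    obtain D where D: "Const D - (- p) \<in> Q" using arch[OF polysD(5)[OF p]] sub by blast
    have "p - Const (- D) \<in> Q" using D by (simp add: Const_uminus add.commute)
    then have ne: "S \<noteq> {}" by (auto simp: S_def)
    have "r \<le> C" if "r \<in> S" for r
    proof -
      have "(p - Const r) + (Const C - p) \<in> Q" using that by (intro QD(3) C) (simp add: S_def)
      then have "Const (C - r) \<in> Q" by (simp add: Const_diff)
      from Const_Q[OF this] show ?thesis by simp
    qed
    then have bdd: "bdd_above S" by (auto simp: bdd_above_def)
    have "p - Const (Sup S) + Const e \<in> Q \<and> Const (Sup S) - p + Const e \<in> Q" if e: "e > 0" for e
    proof
      have "Sup S - e < Sup S" using e by simp
      then obtain r where r: "r \<in> S" "Sup S - e < r" using less_cSup_iff[OF ne bdd] by blast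
      have "(p - Const r) + Const (r - (Sup S - e)) \<in> Q"
        using r by (intro QD(3) qmod_Const[OF Q]) (auto simp: S_def)
      also have "(p - Const r) + Const (r - (Sup S - e)) = p - Const (Sup S) + Const e" by (simp add: Const_diff)
      finally show "p - Const (Sup S) + Const e \<in> Q" .
      have "Sup S + e \<notin> S" using cSup_upper[OF _ bdd, of "Sup S + e"] e by auto
      then have "p - Const (Sup S + e) \<notin> Q" by (simp add: S_def)
      then have "- (p - Const (Sup S + e)) \<in> Q" using total[OF polysD(6)[OF p Const_in_polys]] by blast
      also have "- (p - Const (Sup S + e)) = Const (Sup S) - p + Const e" by (simp add: Const_add)
      finally show "Const (Sup S) - p + Const e \<in> Q" .
    qed
    then show ?thesis unfolding has_value_def[OF Q] by blast
  qed
  then obtain v where v: "\<And>p. p \<in> polys N \<Longrightarrow> has_value Q p (v p)" by metis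
  define x where "x i = v (Var i)" for i
  interpret x: idom_hom "reval x" by (rule idom_hom_insertion_real)
  have hv: "has_value Q p (reval x p)" if "p \<in> polys N" for p
    using that
  proof (induction rule: polys_induct)
    case (Const c)
    show ?case using has_value_Const[OF Q] by (simp add: insertion_Const[OF comm_ring_hom_real_id])
  next
    case (Var i)
    then show ?case using v[OF Var_in_polys] by (simp add: insertion_Var[OF comm_ring_hom_real_id] x_def)
  qed (simp_all add: x.hom_add x.hom_mult has_value_add[OF Q] has_value_mult[OF Q])
  have "0 \<le> reval x q" if "q \<in> Q0" for q
  proof (rule ccontr)
    assume n: "\<not> 0 \<le> reval x q"
    define e where "e = - reval x q / 2"
    have e: "e > 0" "reval x q + e < 0" using n by (simp_all add: e_def)
    have qQ: "q \<in> Q" using that sub by blast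
    then have "Const (reval x q) - q + Const e \<in> Q" using hv[OF QD(1)] e unfolding has_value_def[OF Q] by blast
    then have "q + (Const (reval x q) - q + Const e) \<in> Q" using qQ by (rule QD(3)[rotated])
    then have "Const (reval x q + e) \<in> Q" by (simp add: Const_add)
    from Const_Q[OF this] e show False by simp
  qed
  then show ?thesis by blast
qed

section \<open>Sums of squares in one variable\<close>

lemma nonneg_poly_attains_min:
  fixes p :: "real poly"
  assumes nn: "\<And>x. 0 \<le> poly p x" and deg: "degree p > 0"
  shows "\<exists>a. \<forall>x. poly p a \<le> poly p x"
proof -
  \<comment> \<open>Subtracting the value at 0 preserves the degree and the leading coefficient.
    Therefore \<open>q\<close> is positive outside an interval, and the minimum of \<open>p\<close>
    over that interval is global.\<close>
  define q where "q = p + [:- poly p 0:]"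
  have dq: "degree q = degree p" unfolding q_def using deg by (intro degree_add_eq_left) auto
  have lq: "lead_coeff q = lead_coeff p" unfolding dq unfolding q_def using deg by (simp add: coeff_eq_0)
  have nz: "p \<noteq> 0" "q \<noteq> 0" using deg dq by auto
  obtain M1 where M1: "\<forall>x\<ge>M1. sgn (poly p x) = sgn (lead_coeff p)" using poly_eventually_sgn[OF nz(1)] by blast
  obtain M2 where M2: "\<forall>x\<ge>M2. sgn (poly q x) = sgn (lead_coeff q)" using poly_eventually_sgn[OF nz(2)] by blast
  obtain K1 where K1: "\<forall>x\<le>K1. sgn (poly p x) = sgn (lead_coeff p * (- 1) ^ degree p)"
    using poly_eventually_sgn_bot[OF nz(1)] by blast
  obtain K2 where K2: "\<forall>x\<le>K2. sgn (poly q x) = sgn (lead_coeff q * (- 1) ^ degree q)"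
    using poly_eventually_sgn_bot[OF nz(2)] by blast
  have "sgn (lead_coeff p) \<ge> 0" using M1[rule_format, of M1] nn[of M1] by (simp add: sgn_if split: if_splits)
  then have "lead_coeff p > 0" using nz by (simp add: sgn_if split: if_splits)
  then have hi: "poly q x > 0" if "x \<ge> M2" for x using M2[rule_format, OF that] lq by (simp add: sgn_if split: if_splits)
  have "sgn (lead_coeff p * (- 1) ^ degree p) \<ge> 0" using K1[rule_format, of K1] nn[of K1] by (simp add: sgn_if split: if_splits)
  moreover have "lead_coeff p * (- 1) ^ degree p \<noteq> 0" using nz by simp
  ultimately have "lead_coeff p * (- 1) ^ degree p > 0" by (simp add: sgn_if split: if_splits)
  then have lo: "poly q x > 0" if "x \<le> K2" for x using K2[rule_format, OF that] lq dq by (simp add: sgn_if split: if_splits)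
  have q0: "poly q 0 = 0" by (simp add: q_def)
  have K2: "K2 < 0" by (rule ccontr) (use lo[of 0] q0 in simp)
  have M2: "0 < M2" by (rule ccontr) (use hi[of 0] q0 in simp)
  have ne: "{K2..M2} \<noteq> {}" using K2 M2 by simp
  have "continuous_on {K2..M2} (poly p)" by (intro continuous_intros)
  then obtain a where a: "a \<in> {K2..M2}" "\<And>x. x \<in> {K2..M2} \<Longrightarrow> poly p a \<le> poly p x"
    using continuous_attains_inf[OF compact_Icc ne] by blast
  have "poly p a \<le> poly p x" for x
  proof (cases "x \<in> {K2..M2}")
    case False
    then have "poly q x > 0" using lo[of x] hi[of x] by (cases "x \<le> K2") auto
    then have "poly p 0 < poly p x" by (simp add: q_def)
    moreover have "poly p a \<le> poly p 0" using a(2)[of 0] K2 M2 by simp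
    ultimately show ?thesis by simp
  qed (use a in simp)
  then show ?thesis by blast
qed

text \<open>After subtraction of the minimum \<open>\<mu>\<close>, taken at \<open>a\<close>, the
  point \<open>a\<close> is a double root, and the quotient by \<open>(x - a)^2\<close> is
  nonnegative of smaller degree. The degree bound on the squares later keeps \<open>k\<close>
  independent of \<open>\<epsilon>\<close>.\<close>

lemma nonneg_poly_sum_of_squares:
  fixes p :: "real poly"
  assumes "\<And>x. 0 \<le> poly p x"
  shows "\<exists>us. p = (\<Sum>u\<leftarrow>us. u * u) \<and> (\<forall>u\<in>set us. 2 * degree u \<le> degree p)"
  using assms
proof (induction "degree p" arbitrary: p rule: less_induct)
  case less
  show ?case
  proof (cases "degree p = 0")
    case True
    then obtain c where c: "p = [:c:]" using degree_eq_zeroE by blast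
    then have "p = [:sqrt c:] * [:sqrt c:]" using less.prems[of 0] by simp
    then show ?thesis by (intro exI[of _ "[[:sqrt c:]]"]) simp
  next
    case False
    then obtain a where a: "\<And>x. poly p a \<le> poly p x" using nonneg_poly_attains_min[OF less.prems] by blast
    define \<mu> where "\<mu> = poly p a"
    have \<mu>: "\<mu> \<ge> 0" unfolding \<mu>_def by (rule less.prems)
    have "poly (p - [:\<mu>:]) a = 0" by (simp add: \<mu>_def)
    then obtain r where r: "p - [:\<mu>:] = [:- a, 1:] * r" by (metis poly_eq_0_iff_dvd dvdE)
    have "poly (pderiv p) a = 0"
      by (rule DERIV_local_min[OF poly_DERIV, of 1]) (use a in auto)
    moreover have "pderiv p = pderiv (p - [:\<mu>:])" by (simp add: pderiv_diff pderiv_pCons)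
    then have "poly (pderiv p) a = poly r a" unfolding r by (simp only: pderiv_mult poly_add poly_mult) (simp add: pderiv_pCons)
    ultimately obtain q where q: "r = [:- a, 1:] * q" by (metis poly_eq_0_iff_dvd dvdE)
    have pq: "p = [:\<mu>:] + [:- a, 1:] * [:- a, 1:] * q"
      using r unfolding q diff_eq_eq by (simp only: mult.assoc add.commute)
    have ev: "poly p x = \<mu> + (x - a) * (x - a) * poly q x" for x unfolding pq by (simp add: algebra_simps)
    have off: "poly q x \<ge> 0" if "x \<noteq> a" for x
    proof -
      have "0 \<le> (x - a) * (x - a) * poly q x" using a[of x] ev[of x] by (simp add: \<mu>_def)
      moreover have "(x - a) * (x - a) > 0" using that by (simp add: zero_less_mult_iff not_less_iff_gr_or_eq) linarith
      ultimately show ?thesis by (simp add: zero_le_mult_iff)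
    qed
    \<comment> \<open>The factor \<open>(x - a)^2\<close> vanishes at \<open>a\<close>, so the sign
      of \<open>q\<close> there is obtained as a limit.\<close>
    have "isCont (poly q) a" by simp
    then have "(poly q \<longlongrightarrow> poly q a) (at a)" by (simp only: isCont_def)
    then have "poly q a \<ge> 0"
      by (rule tendsto_lowerbound) (auto simp: eventually_at intro!: exI[of _ 1] off)
    then have nn: "poly q x \<ge> 0" for x using off by (cases "x = a") auto
    have "q \<noteq> 0" using False pq by auto
    then have "degree ([:- a, 1:] * [:- a, 1:] * q) = degree q + 2"
      by (subst degree_mult_eq) (auto simp del: mult_pCons_left mult_pCons_right simp: degree_mult_eq)
    then have dp: "degree p = degree q + 2" unfolding pq by (subst degree_add_eq_right) auto
    then obtain us where us: "q = (\<Sum>u\<leftarrow>us. u * u)" "\<forall>u\<in>set us. 2 * degree u \<le> degree q"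
      using less.hyps[of q] nn by auto
    define L where "L = [:- a, 1:]"
    define vs where "vs = [:sqrt \<mu>:] # map (\<lambda>u. L * u) us"
    have "(\<Sum>u\<leftarrow>map (\<lambda>u. L * u) us. u * u) = L * L * (\<Sum>u\<leftarrow>us. u * u)"
      by (induction us) (simp_all add: algebra_simps)
    moreover have "p = [:\<mu>:] + L * L * (\<Sum>u\<leftarrow>us. u * u)" unfolding L_def us(1)[symmetric] by (rule pq)
    moreover have "[:sqrt \<mu>:] * [:sqrt \<mu>:] = [:\<mu>:]" using \<mu> by simp
    ultimately have "p = (\<Sum>u\<leftarrow>vs. u * u)" unfolding vs_def list.map sum_list.Cons by (simp only:)
    moreover have "2 * degree u \<le> degree p" if "u \<in> set vs" for u
    proof -
      have "u = [:sqrt \<mu>:] \<or> (\<exists>w\<in>set us. u = L * w)" using that by (auto simp: vs_def)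
      moreover have "2 * degree (L * w) \<le> degree p" if "w \<in> set us" for w
        using degree_mult_le[of L w] us(2) that dp by (fastforce simp: L_def)
      ultimately show ?thesis by auto
    qed
    ultimately show ?thesis by blast
  qed
qed

text \<open>The multiplier of \<open>U\<^sup>2\<close> makes up for the negative values of \<open>y - s + e\<close>, because all roots of
  \<open>U\<close> are at least \<open>s\<close>.\<close>

lemma shifted_line_plus_square_nonneg:
  fixes s e :: real
  assumes ts: "\<And>t. t \<in> set ts \<Longrightarrow> s \<le> t" "ts \<noteq> []" and e: "e > 0"
  shows "0 \<le> y - s + e + (1 / e ^ (2 * length ts - 1)) * (\<Prod>t\<leftarrow>ts. y - t)\<^sup>2"
proof (cases "- e \<le> y - s")
  case True
  then show ?thesis using e by (simp add: add_nonneg_nonneg)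
next
  case False
  define v where "v = s - y"
  have v: "v > e" using False by (simp add: v_def)
  have "v ^ length us \<le> \<bar>\<Prod>t\<leftarrow>us. y - t\<bar>" if "set us \<subseteq> set ts" for us
    using that
  proof (induction us)
    case (Cons t us)
    then have "v \<le> \<bar>y - t\<bar>" using ts(1)[of t] by (simp add: v_def abs_if)
    then show ?case using Cons v e by (auto simp: abs_mult intro!: mult_mono)
  qed simp
  then have "v ^ length ts \<le> \<bar>\<Prod>t\<leftarrow>ts. y - t\<bar>" by blast
  then have "(v ^ length ts)\<^sup>2 \<le> (\<Prod>t\<leftarrow>ts. y - t)\<^sup>2" using v e by (subst (2) power2_abs[symmetric]) (intro power_mono, auto)
  moreover have "(v ^ length ts)\<^sup>2 = v * v ^ (2 * length ts - 1)"
  proof -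
    obtain k where k: "length ts = Suc k" using ts(2) by (cases ts) auto
    show ?thesis unfolding k by (simp add: power2_eq_square power_add mult_2)
  qed
  \<comment> \<open>This is the origin of the exponent: for \<open>l\<close> factors the square is
    at least \<open>v^(2 l)\<close>, and one factor \<open>v\<close> must remain after
    \<open>v > e\<close> has been applied to the others.\<close>
  moreover have "e ^ (2 * length ts - 1) \<le> v ^ (2 * length ts - 1)" using v e by (intro power_mono) auto
  then have "v * e ^ (2 * length ts - 1) \<le> v * v ^ (2 * length ts - 1)" using v e by (intro mult_left_mono) auto
  ultimately have "v * e ^ (2 * length ts - 1) \<le> (\<Prod>t\<leftarrow>ts. y - t)\<^sup>2" by linarith
  then have "v \<le> (1 / e ^ (2 * length ts - 1)) * (\<Prod>t\<leftarrow>ts. y - t)\<^sup>2" using e by (simp add: field_simps)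
  then show ?thesis using e by (simp add: v_def)
qed

section \<open>Truncated quadratic modules\<close>

lemma deg_le_iff: "deg p \<le> d \<longleftrightarrow> (\<forall>t\<in>Poly_Mapping.keys p. mono_deg t \<le> d)"
  unfolding Defs.deg_def by (subst Max_le_iff) auto

lemma mono_deg_superset:
  assumes "finite A" "Poly_Mapping.keys t \<subseteq> A"
  shows "mono_deg t = (\<Sum>i\<in>A. Poly_Mapping.lookup t i)"
  unfolding mono_deg_def using assms by (intro sum.mono_neutral_left) (auto simp: in_keys_iff)

lemma mono_deg_add: "mono_deg (s + t) = mono_deg s + mono_deg t"
proof -
  let ?A = "Poly_Mapping.keys s \<union> Poly_Mapping.keys t"
  have "mono_deg (s + t) = (\<Sum>i\<in>?A. Poly_Mapping.lookup (s + t) i)"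
    by (rule mono_deg_superset) (auto simp: Poly_Mapping.keys_add)
  then show ?thesis by (simp add: mono_deg_superset[of ?A] lookup_add sum.distrib)
qed

lemma deg_add: "deg p \<le> d \<Longrightarrow> deg q \<le> d \<Longrightarrow> deg (p + q) \<le> d"
  using Poly_Mapping.keys_add[of p q] unfolding deg_le_iff by blast

lemma deg_mult: "deg (p * q) \<le> deg p + deg q"
  unfolding deg_le_iff
proof
  fix u assume "u \<in> Poly_Mapping.keys (p * q)"
  then obtain s t where "u = s + t" "s \<in> Poly_Mapping.keys p" "t \<in> Poly_Mapping.keys q"
    using Poly_Mapping.keys_mult[of p q] by blast
  moreover from this have "mono_deg s \<le> deg p" "mono_deg t \<le> deg q" using deg_le_iff by blast+
  ultimately show "mono_deg u \<le> deg p + deg q" by (simp add: mono_deg_add)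
qed

lemma deg_Const [simp]: "deg (Const c) = 0"
proof -
  have "deg (Const c) \<le> 0" unfolding deg_le_iff by (auto simp: Const_def mono_deg_def)
  then show ?thesis by simp
qed

lemma deg_0 [simp]: "deg 0 = 0" and deg_1 [simp]: "deg 1 = 0"
  using deg_Const[of 0] deg_Const[of 1] by simp_all

lemma deg_uminus [simp]: "deg (- p) = deg p"
proof -
  have "Poly_Mapping.keys (- p) = Poly_Mapping.keys p" by (auto simp: in_keys_iff)
  then show ?thesis by (simp add: Defs.deg_def)
qed

lemma deg_diff: "deg p \<le> d \<Longrightarrow> deg q \<le> d \<Longrightarrow> deg (p - q) \<le> d"
  using deg_add[of p d "- q"] by simp

lemma deg_sum: "(\<And>i. i \<in> A \<Longrightarrow> deg (p i) \<le> d) \<Longrightarrow> deg (sum p A) \<le> d"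
  by (induction A rule: infinite_finite_induct) (auto intro: deg_add)

lemma deg_Const_mult: "deg (Const c * p) \<le> deg p"
  using deg_mult[of "Const c" p] by simp

lemma deg_poly_subst: "deg (poly (map_poly Const u) f) \<le> degree u * deg f"
proof (induction u)
  case (pCons a u)
  show ?case
  proof (cases "u = 0")
    case False
    have "deg (f * poly (map_poly Const u) f) \<le> deg f + degree u * deg f"
      using deg_mult[of f "poly (map_poly Const u) f"] pCons by linarith
    then show ?thesis using False pCons(1) by (auto simp: map_poly_pCons intro!: deg_add)
  next
    case True
    have "map_poly Const [:a:] = [:Const a:]"
      by (simp add: poly_eq_iff coeff_map_poly coeff_pCons split: nat.splits)
    then show ?thesis using True by simp
  qed
qed simp

section \<open>Sums of squares and the truncated cones\<close>

lemma SOS_0: "0 \<in> SOS N"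
proof -
  have "(0 :: rpoly) = (\<Sum>p\<leftarrow>[]. p\<^sup>2) \<and> set [] \<subseteq> polys N" by simp
  then show ?thesis unfolding SOS_def by blast
qed

lemma SOS_square: "p \<in> polys N \<Longrightarrow> p * p \<in> SOS N"
proof -
  assume "p \<in> polys N"
  then have "p * p = (\<Sum>p\<leftarrow>[p]. p\<^sup>2) \<and> set [p] \<subseteq> polys N" by (simp add: power2_eq_square)
  then show ?thesis unfolding SOS_def by blast
qed

lemma SOS_add:
  assumes "s \<in> SOS N" "t \<in> SOS N"
  shows "s + t \<in> SOS N"
proof -
  obtain ps qs where "s = (\<Sum>p\<leftarrow>ps. p\<^sup>2)" "set ps \<subseteq> polys N" "t = (\<Sum>p\<leftarrow>qs. p\<^sup>2)" "set qs \<subseteq> polys N"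
    using assms unfolding SOS_def by blast
  then have "s + t = (\<Sum>p\<leftarrow>ps @ qs. p\<^sup>2) \<and> set (ps @ qs) \<subseteq> polys N" by simp
  then show ?thesis unfolding SOS_def by blast
qed

lemma SOS_induct [consumes 1, case_names zero add]:
  assumes "s \<in> SOS N" "P 0" "\<And>p s. p \<in> polys N \<Longrightarrow> s \<in> SOS N \<Longrightarrow> P s \<Longrightarrow> P (p * p + s)"
  shows "P s"
proof -
  obtain ps where s: "s = (\<Sum>p\<leftarrow>ps. p\<^sup>2)" "set ps \<subseteq> polys N" using assms(1) unfolding SOS_def by blast
  have "P (\<Sum>p\<leftarrow>ps. p\<^sup>2) \<and> (\<Sum>p\<leftarrow>ps. p\<^sup>2) \<in> SOS N" using s(2)
  proof (induction ps)
    case (Cons p ps)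
    then show ?case using assms(3)[of p "\<Sum>p\<leftarrow>ps. p\<^sup>2"] SOS_add[OF SOS_square]
      by (simp add: power2_eq_square)
  qed (simp add: assms(2) SOS_0)
  then show ?thesis using s by simp
qed

lemma SOS_scale: "s \<in> SOS N \<Longrightarrow> 0 \<le> c \<Longrightarrow> Const c * s \<in> SOS N"
proof (induction rule: SOS_induct)
  case (add p s)
  have "Const c * (p * p + s) = (Const (sqrt c) * p) * (Const (sqrt c) * p) + Const c * s"
  proof -
    have "Const c = Const (sqrt c) * Const (sqrt c)" using add.prems by (simp flip: Const_mult)
    then show ?thesis by (simp add: algebra_simps)
  qed
  then show ?case using add by (auto intro!: SOS_add SOS_square polysD)
qed (simp add: SOS_0)

definition qt :: "nat \<Rightarrow> rpoly list \<Rightarrow> rpoly list \<Rightarrow> nat \<Rightarrow> rpoly set" where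
  "qt N G h k = {q + r | q r. q \<in> qmodule N k G \<and> r \<in> tideal N k h}"

lemma zero_in_qmodule: "0 \<in> qmodule N k G"
  unfolding qmodule_def using SOS_0 by (auto intro!: exI[of _ 0] exI[of _ "\<lambda>_. 0"])

lemma zero_in_tideal: "0 \<in> tideal N k h"
  unfolding tideal_def by (auto simp: polysD intro!: exI[of _ "\<lambda>_. 0"])

lemma qmodule_add:
  assumes "p \<in> qmodule N k G" "q \<in> qmodule N k G"
  shows "p + q \<in> qmodule N k G"
proof -
  obtain s0 s where p: "p = s0 + (\<Sum>j<length G. s j * G ! j)" "s0 \<in> SOS N" "deg s0 \<le> 2 * k"
    "\<And>j. j < length G \<Longrightarrow> s j \<in> SOS N \<and> deg (s j * G ! j) \<le> 2 * k"
    using assms(1) unfolding qmodule_def by blast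
  obtain t0 t where q: "q = t0 + (\<Sum>j<length G. t j * G ! j)" "t0 \<in> SOS N" "deg t0 \<le> 2 * k"
    "\<And>j. j < length G \<Longrightarrow> t j \<in> SOS N \<and> deg (t j * G ! j) \<le> 2 * k"
    using assms(2) unfolding qmodule_def by blast
  have "p + q = (s0 + t0) + (\<Sum>j<length G. (s j + t j) * G ! j)"
    unfolding p(1) q(1) by (simp add: distrib_right sum.distrib)
  moreover have "s0 + t0 \<in> SOS N" "deg (s0 + t0) \<le> 2 * k" using p q by (auto intro: SOS_add deg_add)
  moreover have "s j + t j \<in> SOS N \<and> deg ((s j + t j) * G ! j) \<le> 2 * k" if "j < length G" for j
    using p(4)[OF that] q(4)[OF that] by (auto simp: distrib_right intro: SOS_add deg_add)
  ultimately show ?thesis unfolding qmodule_def mem_Collect_eq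
    by (intro exI[of _ "s0 + t0"] exI[of _ "\<lambda>j. s j + t j"] conjI allI impI) simp_all
qed

lemma tideal_add:
  assumes "p \<in> tideal N k h" "q \<in> tideal N k h"
  shows "p + q \<in> tideal N k h"
proof -
  obtain s where p: "p = (\<Sum>j<length h. s j * h ! j)"
    "\<And>j. j < length h \<Longrightarrow> s j \<in> polys N \<and> deg (s j * h ! j) \<le> 2 * k"
    using assms(1) unfolding tideal_def by blast
  obtain t where q: "q = (\<Sum>j<length h. t j * h ! j)"
    "\<And>j. j < length h \<Longrightarrow> t j \<in> polys N \<and> deg (t j * h ! j) \<le> 2 * k"
    using assms(2) unfolding tideal_def by blast
  have "p + q = (\<Sum>j<length h. (s j + t j) * h ! j)"
    unfolding p(1) q(1) by (simp add: distrib_right sum.distrib)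
  moreover have "s j + t j \<in> polys N \<and> deg ((s j + t j) * h ! j) \<le> 2 * k" if "j < length h" for j
    using p(2)[OF that] q(2)[OF that] by (auto simp: distrib_right intro: polysD deg_add)
  ultimately show ?thesis unfolding tideal_def mem_Collect_eq
    by (intro exI[of _ "\<lambda>j. s j + t j"] conjI allI impI) simp_all
qed

lemma qt_add:
  assumes "p \<in> qt N G h k" "q \<in> qt N G h k"
  shows "p + q \<in> qt N G h k"
proof -
  obtain a b c d where "p = a + b" "q = c + d" "a \<in> qmodule N k G" "c \<in> qmodule N k G"
    "b \<in> tideal N k h" "d \<in> tideal N k h" using assms unfolding qt_def by blast
  moreover from this have "p + q = (a + c) + (b + d)" by simp
  ultimately show ?thesis unfolding qt_def using qmodule_add tideal_add by blast
qed

lemma qmodule_scale: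
  assumes "p \<in> qmodule N k G" "0 \<le> c"
  shows "Const c * p \<in> qmodule N k G"
proof -
  obtain s0 s where p: "p = s0 + (\<Sum>j<length G. s j * G ! j)" "s0 \<in> SOS N" "deg s0 \<le> 2 * k"
    "\<And>j. j < length G \<Longrightarrow> s j \<in> SOS N \<and> deg (s j * G ! j) \<le> 2 * k"
    using assms(1) unfolding qmodule_def by blast
  have "Const c * p = Const c * s0 + (\<Sum>j<length G. (Const c * s j) * G ! j)"
    unfolding p(1) by (simp add: distrib_left sum_distrib_left mult.assoc)
  moreover have "deg (Const c * s0) \<le> 2 * k" using deg_Const_mult[of c s0] p(3) by simp
  moreover have "deg ((Const c * s j) * G ! j) \<le> 2 * k" if "j < length G" for j
    using deg_Const_mult[of c "s j * G ! j"] p(4)[OF that] by (simp add: mult.assoc)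
  ultimately show ?thesis unfolding qmodule_def mem_Collect_eq
    using p assms(2)
    by (intro exI[of _ "Const c * s0"] exI[of _ "\<lambda>j. Const c * s j"] conjI allI impI SOS_scale) auto
qed

lemma tideal_scale:
  assumes "p \<in> tideal N k h"
  shows "Const c * p \<in> tideal N k h"
proof -
  obtain s where p: "p = (\<Sum>j<length h. s j * h ! j)"
    "\<And>j. j < length h \<Longrightarrow> s j \<in> polys N \<and> deg (s j * h ! j) \<le> 2 * k"
    using assms(1) unfolding tideal_def by blast
  have "Const c * p = (\<Sum>j<length h. (Const c * s j) * h ! j)"
    unfolding p(1) by (simp add: sum_distrib_left mult.assoc)
  moreover have "deg ((Const c * s j) * h ! j) \<le> 2 * k" if "j < length h" for j
    using deg_Const_mult[of c "s j * h ! j"] p(2)[OF that] by (simp add: mult.assoc)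
  ultimately show ?thesis unfolding tideal_def mem_Collect_eq using p
    by (intro exI[of _ "\<lambda>j. Const c * s j"] conjI allI impI polysD) auto
qed

lemma qt_scale:
  assumes "p \<in> qt N G h k" "0 \<le> c"
  shows "Const c * p \<in> qt N G h k"
proof -
  obtain a b where "p = a + b" "a \<in> qmodule N k G" "b \<in> tideal N k h" using assms unfolding qt_def by blast
  moreover from this have "Const c * p = Const c * a + Const c * b" by (simp add: distrib_left)
  ultimately show ?thesis unfolding qt_def using qmodule_scale[OF _ assms(2)] tideal_scale by blast
qed

lemma qt_mono: "k \<le> l \<Longrightarrow> qt N G h k \<subseteq> qt N G h l"
proof -
  assume k: "k \<le> l"
  have d: "deg p \<le> 2 * l" if "deg p \<le> 2 * k" for p using that k by linarith
  have "qmodule N k G \<subseteq> qmodule N l G"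
  proof
    fix p assume "p \<in> qmodule N k G"
    then obtain s0 s where "p = s0 + (\<Sum>j<length G. s j * G ! j) \<and> s0 \<in> SOS N \<and> deg s0 \<le> 2 * k \<and>
      (\<forall>j<length G. s j \<in> SOS N \<and> deg (s j * G ! j) \<le> 2 * k)" unfolding qmodule_def mem_Collect_eq by auto
    then have "p = s0 + (\<Sum>j<length G. s j * G ! j) \<and> s0 \<in> SOS N \<and> deg s0 \<le> 2 * l \<and>
      (\<forall>j<length G. s j \<in> SOS N \<and> deg (s j * G ! j) \<le> 2 * l)" using d by simp
    then show "p \<in> qmodule N l G" unfolding qmodule_def mem_Collect_eq by (intro exI)
  qed
  moreover have "tideal N k h \<subseteq> tideal N l h"
  proof
    fix p assume "p \<in> tideal N k h"
    then obtain s where "p = (\<Sum>j<length h. s j * h ! j) \<and>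
      (\<forall>j<length h. s j \<in> polys N \<and> deg (s j * h ! j) \<le> 2 * k)" unfolding tideal_def mem_Collect_eq by auto
    then have "p = (\<Sum>j<length h. s j * h ! j) \<and>
      (\<forall>j<length h. s j \<in> polys N \<and> deg (s j * h ! j) \<le> 2 * l)" using d by simp
    then show "p \<in> tideal N l h" unfolding tideal_def mem_Collect_eq by (intro exI)
  qed
  ultimately show ?thesis unfolding qt_def by blast
qed

lemma qt_qmodule: "q \<in> qmodule N k G \<Longrightarrow> q \<in> qt N G h k"
  unfolding qt_def using zero_in_tideal by force

lemma qt_tideal: "q \<in> tideal N k h \<Longrightarrow> q \<in> qt N G h k"
  unfolding qt_def using zero_in_qmodule by force

lemma qt_SOS: "s \<in> SOS N \<Longrightarrow> deg s \<le> 2 * k \<Longrightarrow> s \<in> qt N G h k"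
  by (rule qt_qmodule) (auto simp: qmodule_def SOS_0 intro!: exI[of _ s] exI[of _ "\<lambda>_. 0"])

lemma qt_generator:
  assumes "j < length G" "s \<in> SOS N" "deg (s * G ! j) \<le> 2 * k"
  shows "s * G ! j \<in> qt N G h k"
proof -
  have "(\<Sum>i<length G. (if i = j then s else 0) * G ! i) = s * G ! j"
    using assms(1) by (subst sum.remove[of _ j]) auto
  then have "s * G ! j \<in> qmodule N k G" unfolding qmodule_def mem_Collect_eq
    using assms SOS_0 by (intro exI[of _ 0] exI[of _ "\<lambda>i. if i = j then s else 0"]) auto
  then show ?thesis by (rule qt_qmodule)
qed

lemma qt_ideal:
  assumes "j < length h" "p \<in> polys N" "deg (p * h ! j) \<le> 2 * k"
  shows "p * h ! j \<in> qt N G h k"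
proof -
  have "(\<Sum>i<length h. (if i = j then p else 0) * h ! i) = p * h ! j"
    using assms(1) by (subst sum.remove[of _ j]) auto
  then have "p * h ! j \<in> tideal N k h" unfolding tideal_def mem_Collect_eq
    using assms polysD(1) by (intro exI[of _ "\<lambda>i. if i = j then p else 0"]) auto
  then show ?thesis by (rule qt_tideal)
qed

text \<open>Degrees are left out: memberships are derived freely, and \<open>gmod_qt\<close>
  supplies an order \<open>k\<close> at the end.\<close>

inductive_set gmod :: "nat \<Rightarrow> rpoly list \<Rightarrow> rpoly list \<Rightarrow> rpoly set" for N G h where
  square: "p \<in> polys N \<Longrightarrow> p * p \<in> gmod N G h"
| generator: "p \<in> polys N \<Longrightarrow> j < length G \<Longrightarrow> p * p * G ! j \<in> gmod N G h"
| ideal: "p \<in> polys N \<Longrightarrow> j < length h \<Longrightarrow> p * h ! j \<in> gmod N G h"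
| add: "x \<in> gmod N G h \<Longrightarrow> y \<in> gmod N G h \<Longrightarrow> x + y \<in> gmod N G h"

lemma gmod_qt: "x \<in> gmod N G h \<Longrightarrow> \<exists>k. x \<in> qt N G h k"
proof (induction rule: gmod.induct)
  case (square p)
  then show ?case by (intro exI[of _ "deg (p * p)"] qt_SOS SOS_square) auto
next
  case (generator p j)
  then show ?case by (intro exI[of _ "deg (p * p * G ! j)"] qt_generator SOS_square) auto
next
  case (ideal p j)
  then show ?case by (intro exI[of _ "deg (p * h ! j)"] qt_ideal) auto
next
  case (add x y)
  then obtain k l where "x \<in> qt N G h k" "y \<in> qt N G h l" by blast
  then have "x \<in> qt N G h (max k l)" "y \<in> qt N G h (max k l)"
    using qt_mono[OF max.cobounded1[of k l], of N G h] qt_mono[OF max.cobounded2[of l k], of N G h]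
    by blast+
  then show ?case using qt_add by blast
qed

lemma gmod_square_mult: "x \<in> gmod N G h \<Longrightarrow> a \<in> polys N \<Longrightarrow> a * a * x \<in> gmod N G h"
proof (induction rule: gmod.induct)
  case (square p)
  then show ?case using gmod.square[of "a * p" N G h] polysD(4) by (simp add: mult_ac)
next
  case (generator p j)
  then show ?case using gmod.generator[of "a * p" N j G h] polysD(4) by (simp add: mult_ac)
next
  case (ideal p j)
  then show ?case using gmod.ideal[of "a * a * p" N j h G] polysD(4) by (simp add: mult_ac)
qed (simp add: distrib_left gmod.add)

lemma gmod_polys:
  assumes "set G \<subseteq> polys N" "set h \<subseteq> polys N"
  shows "x \<in> gmod N G h \<Longrightarrow> x \<in> polys N"
proof (induction rule: gmod.induct)
  case (generator p j)
  then show ?case using assms nth_mem[of j G] by (intro polysD) auto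
next
  case (ideal p j)
  then show ?case using assms nth_mem[of j h] by (intro polysD) auto
qed (auto intro: polysD)

text \<open>The preorder generated by \<open>g\<close>, plus the ideal of \<open>h\<close>. Only
  squarefree products are generators, which matches \<open>products\<close>.\<close>

inductive_set gpre :: "nat \<Rightarrow> rpoly list \<Rightarrow> rpoly list \<Rightarrow> rpoly set" for N g h where
  generator: "p \<in> polys N \<Longrightarrow> A \<subseteq> {..<length g} \<Longrightarrow> p * p * (\<Prod>j\<in>A. g ! j) \<in> gpre N g h"
| ideal: "p \<in> polys N \<Longrightarrow> j < length h \<Longrightarrow> p * h ! j \<in> gpre N g h"
| add: "x \<in> gpre N g h \<Longrightarrow> y \<in> gpre N g h \<Longrightarrow> x + y \<in> gpre N g h"

text \<open>Common factors of two squarefree products form a square and the symmetric difference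
  remains; this makes \<open>gpre\<close> closed under multiplication.\<close>

lemma prod_sets_mult:
  fixes g :: "'i \<Rightarrow> 'a::comm_ring_1"
  assumes "finite A" "finite B"
  shows "prod g A * prod g B = prod g (A \<inter> B) * prod g (A \<inter> B) * prod g ((A - B) \<union> (B - A))"
proof -
  have "prod g A = prod g (A \<inter> B) * prod g (A - B)" "prod g B = prod g (A \<inter> B) * prod g (B - A)"
    using assms by (subst prod.union_disjoint[symmetric]; auto intro!: arg_cong[where f = "prod g"])+
  moreover have "prod g ((A - B) \<union> (B - A)) = prod g (A - B) * prod g (B - A)"
    using assms by (intro prod.union_disjoint) auto
  ultimately show ?thesis by (simp add: mult_ac)
qed

lemma gpre_polys:
  assumes "set g \<subseteq> polys N" "set h \<subseteq> polys N"
  shows "x \<in> gpre N g h \<Longrightarrow> x \<in> polys N"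
proof (induction rule: gpre.induct)
  case (generator p A)
  then have "g ! j \<in> polys N" if "j \<in> A" for j using that assms(1) nth_mem[of j g] by blast
  then show ?case using generator by (intro polysD subring_on_prod[OF subring_on_polys]) simp_all
next
  case (ideal p j)
  then show ?case using assms nth_mem[of j h] by (intro polysD) auto
qed (auto intro: polysD)

lemma gpre_ideal_mult:
  assumes "set g \<subseteq> polys N" "set h \<subseteq> polys N" "j < length h" "p \<in> polys N"
  shows "x \<in> gpre N g h \<Longrightarrow> x * (p * h ! j) \<in> gpre N g h"
  using gpre.ideal[of "x * p" N j h g] gpre_polys[OF assms(1,2), of x] assms polysD(4)
  by (simp add: mult_ac)

lemma gpre_mult:
  assumes "set g \<subseteq> polys N" "set h \<subseteq> polys N" and "x \<in> gpre N g h" and y: "y \<in> gpre N g h"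
  shows "x * y \<in> gpre N g h"
  using assms(3)
proof (induction rule: gpre.induct)
  case x: (generator p A)
  show ?case using y
  proof (induction rule: gpre.induct)
    case (generator q B)
    have fin: "finite A" "finite B" using x generator finite_subset by blast+
    define r where "r = p * q * (\<Prod>j\<in>A \<inter> B. g ! j)"
    have "g ! j \<in> polys N" if "j \<in> A" for j using that x(2) assms(1) nth_mem[of j g] by blast
    then have r: "r \<in> polys N" unfolding r_def using x generator
      by (intro polysD subring_on_prod[OF subring_on_polys]) simp_all
    have "(p * p * (\<Prod>j\<in>A. g ! j)) * (q * q * (\<Prod>j\<in>B. g ! j)) = p * p * (q * q) * ((\<Prod>j\<in>A. g ! j) * (\<Prod>j\<in>B. g ! j))"
      by (simp add: mult_ac)
    also have "\<dots> = r * r * (\<Prod>j\<in>(A - B) \<union> (B - A). g ! j)"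
      unfolding prod_sets_mult[OF fin] r_def by (simp add: mult_ac)
    also have "\<dots> \<in> gpre N g h" using x generator by (intro gpre.generator r) auto
    finally show ?case .
  next
    case (ideal q j)
    show ?case using gpre_ideal_mult[OF assms(1,2) ideal(2,1) gpre.generator[OF x]] .
  qed (simp add: distrib_left gpre.add)
next
  case (ideal p j)
  show ?case using gpre_ideal_mult[OF assms(1,2) ideal(2,1) y] by (simp add: mult.commute)
qed (simp add: distrib_right gpre.add)

lemma preorder_on_gpre:
  assumes "set g \<subseteq> polys N" "set h \<subseteq> polys N"
  shows "preorder_on (polys N) (gpre N g h)"
  unfolding preorder_on_def
proof (intro conjI ballI)
  show "gpre N g h \<subseteq> polys N" using gpre_polys[OF assms] by blast
  show "a * a \<in> gpre N g h" if "a \<in> polys N" for a using gpre.generator[OF that, of "{}"] by simp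
qed (auto intro: gpre.add gpre_mult[OF assms])

lemma products_contains:
  assumes "A \<subseteq> {..<length g}" "A \<noteq> {}"
  shows "(\<Prod>j\<in>A. g ! j) \<in> set (products g)"
proof -
  define \<alpha> where "\<alpha> = map (\<lambda>j. if j \<in> A then 1 else 0 :: nat) [0..<length g]"
  have "\<alpha> \<in> set (List.n_lists (length g) [0, 1])" by (auto simp: set_n_lists \<alpha>_def)
  moreover obtain i where "i \<in> A" "i < length g" using assms by blast
  then have "\<alpha> ! i \<noteq> replicate (length g) 0 ! i" by (simp add: \<alpha>_def)
  then have "\<alpha> \<noteq> replicate (length g) 0" by metis
  moreover have "(\<Prod>j<length g. (g ! j) ^ (\<alpha> ! j)) = (\<Prod>j<length g. if j \<in> A then g ! j else 1)"
    by (rule prod.cong) (auto simp: \<alpha>_def)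
  then have "(\<Prod>j<length g. (g ! j) ^ (\<alpha> ! j)) = (\<Prod>j\<in>A. g ! j)"
    using assms(1) by (simp add: prod.If_cases Int_absorb2 Int_commute[of "{..<length g}" A])
  ultimately show ?thesis unfolding products_def by force
qed

lemma gpre_gmod_products: "x \<in> gpre N g h \<Longrightarrow> x \<in> gmod N (products g) h"
proof (induction rule: gpre.induct)
  case (generator p A)
  show ?case
  proof (cases "A = {}")
    case False
    then obtain i where "i < length (products g)" "products g ! i = (\<Prod>j\<in>A. g ! j)"
      using products_contains[OF generator(2)] by (metis in_set_conv_nth)
    then show ?thesis using gmod.generator[OF generator(1), of i "products g" h] by simp
  next
    case True
    then show ?thesis using gmod.square[OF generator(1), of "products g" h] by simp
  qed
qed (auto intro: gmod.intros)

text \<open>Without inequalities the preorder consists of sums of squares plus the ideal, hence lies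
  in every quadratic module that contains this ideal.\<close>

lemma gpre_Nil_gmod: "x \<in> gpre N [] h \<Longrightarrow> x \<in> gmod N g h"
proof (induction rule: gpre.induct)
  case (generator p A)
  then show ?case using gmod.square by simp
qed (auto intro: gmod.intros)

lemma products_nonneg:
  assumes "\<And>j. j < length g \<Longrightarrow> 0 \<le> peval (g ! j) x" "p \<in> set (products g)"
  shows "0 \<le> peval p x"
proof -
  interpret e: idom_hom "\<lambda>p. peval p x" by (rule idom_hom_peval)
  obtain \<alpha> where "p = (\<Prod>j<length g. (g ! j) ^ (\<alpha> ! j))" using assms(2) by (auto simp: products_def)
  then have "peval p x = (\<Prod>j<length g. peval (g ! j) x ^ (\<alpha> ! j))" by (simp add: e.hom_prod e.hom_power)
  then show ?thesis using assms(1) by (auto intro!: prod_nonneg)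
qed

lemma qt_nonneg:
  assumes "p \<in> qt N G h k" "\<And>q. q \<in> set G \<Longrightarrow> 0 \<le> peval q x" "\<And>q. q \<in> set h \<Longrightarrow> peval q x = 0"
  shows "0 \<le> peval p x"
proof -
  interpret e: idom_hom "\<lambda>p. peval p x" by (rule idom_hom_peval)
  have S: "0 \<le> peval s x" if "s \<in> SOS N" for s
    using that by (induction rule: SOS_induct) (simp_all add: e.hom_add e.hom_mult)
  obtain s0 s t where p: "p = s0 + (\<Sum>j<length G. s j * G ! j) + (\<Sum>j<length h. t j * h ! j)"
    "s0 \<in> SOS N" "\<And>j. j < length G \<Longrightarrow> s j \<in> SOS N"
    using assms(1) unfolding qt_def qmodule_def tideal_def by blast
  have "(\<Sum>j<length h. peval (t j) x * peval (h ! j) x) = 0" using assms(3) by (intro sum.neutral) simp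
  moreover have "0 \<le> (\<Sum>j<length G. peval (s j) x * peval (G ! j) x)"
    using assms(2) p(3) S by (intro sum_nonneg) simp
  ultimately show ?thesis using S[OF p(2)] by (simp add: p(1) e.hom_add e.hom_sum e.hom_mult)
qed

section \<open>Critical points and the Fritz John theorem\<close>

lemma reval_simps [simp]: "reval a (Const c) = c" "reval a (Var i) = a i"
  by (rule insertion_Const[OF comm_ring_hom_real_id] insertion_Var[OF comm_ring_hom_real_id])+

lemma partial_in_polys: "p \<in> polys N \<Longrightarrow> partial i p \<in> polys N"
proof (induction rule: polys_induct)
  case (Const c)
  then show ?case by (simp add: partial_Const polysD(1))
next
  case (Var j)
  then show ?case by (auto simp: partial_Var polysD(1,2))
next
  case (add p q)
  then show ?case by (auto simp: partial_add intro: polysD)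
next
  case (mult p q)
  then show ?case by (auto simp: partial_mult intro: polysD)
qed

lemma peval_vec: "p \<in> polys n \<Longrightarrow> peval p (vec n a) = reval a p"
  unfolding peval_eq_insertion by (rule insertion_cong) auto

lemma peval_cong: "p \<in> polys n \<Longrightarrow> (\<And>i. i < n \<Longrightarrow> x $ i = y $ i) \<Longrightarrow> peval p x = peval p y"
  unfolding peval_eq_insertion by (rule insertion_cong)

text \<open>Pull back along the retraction that sends every variable beyond the first
  \<open>N\<close> to 0. Certificates have to stay in \<open>polys N\<close>, whereas the results on
  prime cones concern the whole ring.\<close>

lemma prime_cone_extend:
  assumes P: "prime_cone_on (polys N) P"
  shows "\<exists>P'. prime_cone P' \<and> P' \<inter> polys N = P"
proof -
  define \<sigma> where "\<sigma> = insertion Const (\<lambda>i. if i < N then Var i else 0)"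
  interpret C: idom_hom Const by (rule idom_hom_Const)
  have CH: "comm_ring_hom Const" ..
  then interpret \<sigma>: comm_ring_hom \<sigma> unfolding \<sigma>_def by (rule comm_ring_hom_insertion)
  have \<sigma>: "\<sigma> (Const c) = Const c" "\<sigma> (Var i) = (if i < N then Var i else 0)" for c i
    by (simp_all add: \<sigma>_def insertion_Const[OF CH] insertion_Var[OF CH])
  have id: "\<sigma> p = p" if "p \<in> polys N" for p
    using that
  proof (induction rule: polys_induct)
    case (add p q)
    then show ?case by (simp add: \<sigma>.hom_add)
  next
    case (mult p q)
    then show ?case by (simp add: \<sigma>.hom_mult)
  qed (simp_all add: \<sigma>)
  have ran: "\<sigma> p \<in> polys N" for p
  proof -
    obtain M where "p \<in> polys M" using in_polys by blast
    then show ?thesis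
    proof (induction rule: polys_induct)
      case (add p q)
      then show ?case by (simp add: \<sigma>.hom_add polysD)
    next
      case (mult p q)
      then show ?case by (simp add: \<sigma>.hom_mult polysD)
    qed (simp_all add: \<sigma> Const_in_polys Var_in_polys polysD)
  qed
  define P' where "P' = {p. \<sigma> p \<in> P}"
  have pre: "preorder_on (polys N) P" and m1: "- 1 \<notin> P"
    and tot: "\<And>a. a \<in> polys N \<Longrightarrow> a \<in> P \<or> - a \<in> P"
    and prime: "\<And>a b. a \<in> polys N \<Longrightarrow> b \<in> polys N \<Longrightarrow> a * b \<in> P \<Longrightarrow> - (a * b) \<in> P \<Longrightarrow>
      (a \<in> P \<and> - a \<in> P) \<or> (b \<in> P \<and> - b \<in> P)"
    using P unfolding prime_cone_on_def by blast+
  have "prime_cone P'"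
    unfolding prime_cone_on_def preorder_on_def P'_def mem_Collect_eq
      \<sigma>.hom_add \<sigma>.hom_mult \<sigma>.hom_uminus \<sigma>.hom_one
    using preorder_onD[OF pre] ran m1 tot prime by (intro conjI ballI impI) simp_all
  moreover have "P' \<inter> polys N = P" unfolding P'_def using id preorder_onD(1)[OF pre] by auto
  ultimately show ?thesis by (intro exI[of _ P'] conjI)
qed

text \<open>The rank is read off from the set of columns, so repeated columns count once and form a
  case of their own; distinct columns are dependent because of the kernel vector.\<close>

lemma (in vec_space) rank_less_if_kernel:
  assumes A: "A \<in> carrier_mat n nc" and v: "v \<in> carrier_vec nc" "v \<noteq> 0\<^sub>v nc" "A *\<^sub>v v = 0\<^sub>v n"
  shows "rank A < nc"
proof -
  obtain S where S: "maximal S (\<lambda>T. T \<subseteq> set (cols A) \<and> lin_indpt T)"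
    using maximal_exists[of "(\<lambda>T. T \<subseteq> set (cols A) \<and> lin_indpt T)" "card (set (cols A))" "{}"]
    by (meson List.finite_set card_mono empty_iff empty_subsetI finite_lin_indpt2 rev_finite_subset)
  then have "S \<subseteq> set (cols A)" by (simp add: maximal_def)
  then have le: "rank A \<le> card (set (cols A))"
    using rank_card_indpt[OF A S] by (simp add: card_mono)
  have len: "length (cols A) = nc" using A by simp
  show ?thesis
  proof (cases "distinct (cols A)")
    case True
    then have "rank A \<noteq> nc" using lin_depI[OF A v] full_rank_lin_indpt[OF A] by blast
    then show ?thesis using le card_length[of "cols A"] len by linarith
  next
    case False
    then have "card (set (cols A)) \<noteq> nc" using card_distinct[of "cols A"] len by metis
    then show ?thesis using le card_length[of "cols A"] len by linarith
  qed
qed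

lemma h_FJ_members:
  shows "i < n \<Longrightarrow> Var n * partial i f - (\<Sum>j<length g. Var (n + (j + 1)) * partial i (g ! j)) \<in> set (h_FJ n f g)"
    and "j < length g \<Longrightarrow> Var (n + (j + 1)) * g ! j \<in> set (h_FJ n f g)"
    and "1 - (\<Sum>j\<le>length g. (Var (n + j))\<^sup>2) \<in> set (h_FJ n f g)"
  by (auto simp: h_FJ_def)

lemma h_FJ_polys:
  assumes "f \<in> polys n" "set g \<subseteq> polys n"
  shows "set (h_FJ n f g) \<subseteq> polys (n + length g + 1)"
proof -
  define M where "M = n + length g + 1"
  have sub: "p \<in> polys M" if "p \<in> polys n" for p using that polys_subset[of n M] by (auto simp: M_def)
  have V: "Var (n + k) \<in> polys M" if "k \<le> length g" for k using that by (intro Var_in_polys) (simp add: M_def)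
  have g: "g ! j \<in> polys n" if "j < length g" for j using assms(2) nth_mem[OF that] by blast
  show ?thesis unfolding h_FJ_def M_def[symmetric]
    using sub[OF partial_in_polys[OF assms(1)]] sub[OF partial_in_polys[OF g]] sub[OF g] V[of 0] V
    by (auto simp del: add_Suc_right intro!: polysD subring_on_sum[OF subring_on_polys])
qed

text \<open>With \<open>a n = 0\<close> the equations say that the remaining multipliers form a
  kernel vector of \<open>phi\<close>: the first \<open>n\<close> rows are the gradient equations,
  the other rows are complementarity. The sphere equation makes the vector nonzero.\<close>

lemma critical_set_if_singular:
  assumes f: "f \<in> polys n" and g: "set g \<subseteq> polys n"
    and a: "\<And>q. q \<in> set (h_FJ n f g) \<Longrightarrow> reval a q = 0" and 0: "a n = 0"
  shows "vec n a \<in> critical_set n g"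
proof -
  interpret e: idom_hom "reval a" by (rule idom_hom_insertion_real)
  let ?m = "length g"
  define v where "v = vec ?m (\<lambda>j. a (n + (j + 1)))"
  define A where "A = phi n g (vec n a)"
  have gj: "g ! j \<in> polys n" if "j < ?m" for j using g nth_mem[OF that] by blast
  have A: "A \<in> carrier_mat (n + ?m) ?m" by (simp add: A_def phi_def)
  have v: "v \<in> carrier_vec ?m" by (simp add: v_def)
  have "v \<noteq> 0\<^sub>v ?m"
  proof
    assume "v = 0\<^sub>v ?m"
    then have z: "a (n + (j + 1)) = 0" if "j < ?m" for j
      using that by (simp add: v_def) (metis index_vec index_zero_vec(1))
    have "a (n + j) = 0" if "j \<le> ?m" for j using that z[of "j - 1"] 0 by (cases j) auto
    then have "(\<Sum>j\<le>?m. (a (n + j))\<^sup>2) = 0" by simp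
    then show False using a[OF h_FJ_members(3)] by (simp add: e.hom_minus e.hom_sum e.hom_power)
  qed
  moreover have "A *\<^sub>v v = 0\<^sub>v (n + ?m)"
  proof (rule eq_vecI)
    fix i assume "i < dim_vec (0\<^sub>v (n + ?m))"
    then have i: "i < n + ?m" by simp
    have "(A *\<^sub>v v) $ i = (\<Sum>j<?m. A $$ (i, j) * a (n + (j + 1)))"
      using A i by (simp add: v_def scalar_prod_def lessThan_atLeast0)
    also have "\<dots> = 0"
    proof (cases "i < n")
      case True
      have "(\<Sum>j<?m. A $$ (i, j) * a (n + (j + 1))) = (\<Sum>j<?m. a (n + (j + 1)) * reval a (partial i (g ! j)))"
        using True by (intro sum.cong) (simp_all add: A_def phi_def peval_vec[OF partial_in_polys[OF gj]])
      then show ?thesis using a[OF h_FJ_members(1)[OF True]] 0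
        by (simp add: e.hom_minus e.hom_sum e.hom_mult)
    next
      case False
      then obtain k where k: "i = n + k" "k < ?m" using i by (intro that[of "i - n"]) auto
      have "A $$ (i, j) * a (n + (j + 1)) = 0" if "j < ?m" for j
      proof (cases "j = k")
        case True
        have "A $$ (i, j) = reval a (g ! j)" using True k by (simp add: A_def phi_def peval_vec[OF gj])
        then show ?thesis using a[OF h_FJ_members(2)[OF that]] by (auto simp: e.hom_mult)
      next
        case False
        then show ?thesis using k that by (simp add: A_def phi_def)
      qed
      then show ?thesis by (intro sum.neutral) blast
    qed
    finally show "(A *\<^sub>v v) $ i = 0\<^sub>v (n + ?m) $ i" using i by simp
  qed (use A in simp)
  ultimately have "vec_space.rank (n + ?m) A < ?m" by (rule vec_space.rank_less_if_kernel[OF A v])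
  then show ?thesis by (simp add: critical_set_def A_def)
qed

lemma realizable_pointE:
  assumes "prime_cone P" "finite F" "F \<subseteq> polys N"
  obtains a where "\<forall>p\<in>F. (0 \<le> reval a p \<longleftrightarrow> p \<in> P) \<and> (reval a p \<le> 0 \<longleftrightarrow> - p \<in> P)"
  using prime_cone_realizable[OF assms(1), unfolded realizable_def, rule_format, OF assms(2,3)] by blast

theorem real_value_of_objective:
  assumes P: "prime_cone P" and f: "f \<in> polys n" and g: "set g \<subseteq> polys n"
    and fin: "finite (peval f ` critical_set n g)" and h: "set (h_FJ n f g) \<subseteq> supp P"
  shows "\<exists>t. f - Const t \<in> supp P"
proof (cases "Var n \<in> supp P")
  case False
  have "\<forall>j<length g. g ! j \<in> polys n" using g nth_mem by blast
  then show ?thesis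
    using prime_cone_critical_values_real[OF P, unfolded critical_values_real_def, rule_format,
      of f n "length g" "\<lambda>j. g ! j" "\<lambda>k. Var (n + k)"] f False h h_FJ_members by force
next
  case True
  show ?thesis
  proof (rule ccontr)
    assume no: "\<not> ?thesis"
    \<comment> \<open>Only finitely many polynomials are realised at a time; the finiteness of
      \<open>f(C(g))\<close> allows all \<open>f - c\<close> with a critical value \<open>c\<close>
      to be among them.\<close>
    define F where "F = set (h_FJ n f g) \<union> {Var n} \<union> (\<lambda>c. f - Const c) ` peval f ` critical_set n g"
    have F: "finite F" using fin by (simp add: F_def)
    have "F \<subseteq> polys (n + length g + 1)"
      unfolding F_def using h_FJ_polys[OF f g] polys_subset[of n "n + length g + 1"] f
      by (auto intro!: polysD(6) Const_in_polys Var_in_polys)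
    then obtain a where a: "\<forall>p\<in>F. (0 \<le> reval a p \<longleftrightarrow> p \<in> P) \<and> (reval a p \<le> 0 \<longleftrightarrow> - p \<in> P)"
      by (rule realizable_pointE[OF P F])
    have iff: "reval a p = 0 \<longleftrightarrow> p \<in> supp P" if "p \<in> F" for p
      using bspec[OF a that] unfolding supp_def mem_Collect_eq by linarith
    have "reval a q = 0" if "q \<in> set (h_FJ n f g)" for q using iff[of q] that h by (auto simp: F_def)
    moreover have "a n = 0" using iff[of "Var n"] True by (simp add: F_def)
    ultimately have c: "vec n a \<in> critical_set n g" by (rule critical_set_if_singular[OF f g])
    interpret e: idom_hom "reval a" by (rule idom_hom_insertion_real)
    have "reval a (f - Const (peval f (vec n a))) = 0" by (simp add: e.hom_minus peval_vec[OF f])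
    moreover have "f - Const (peval f (vec n a)) \<in> F" using c by (simp add: F_def)
    ultimately show False using iff no by blast
  qed
qed

lemma objective_value_bound:
  assumes P: "prime_cone P" and f: "f \<in> polys n" and g: "set g \<subseteq> polys n" "set g \<subseteq> P"
    and min: "\<And>y. y \<in> feasible_set n g \<Longrightarrow> c \<le> peval f y" and t: "f - Const t \<in> supp P"
  shows "c \<le> t"
proof -
  define F where "F = insert (f - Const t) (set g)"
  have F: "finite F" by (simp add: F_def)
  have "F \<subseteq> polys n" using f g by (auto simp: F_def intro!: polysD(6) Const_in_polys)
  then obtain a where a: "\<forall>p\<in>F. (0 \<le> reval a p \<longleftrightarrow> p \<in> P) \<and> (reval a p \<le> 0 \<longleftrightarrow> - p \<in> P)"
    by (rule realizable_pointE[OF P F])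
  interpret e: idom_hom "reval a" by (rule idom_hom_insertion_real)
  have "reval a (f - Const t) = 0" using bspec[OF a, of "f - Const t"] t unfolding supp_def F_def by force
  then have "reval a f = t" by (simp add: e.hom_minus)
  moreover have "vec n a \<in> feasible_set n g"
  proof -
    have "0 \<le> peval (g ! j) (vec n a)" if "j < length g" for j
    proof -
      have *: "g ! j \<in> set g" using that by simp
      then have "0 \<le> reval a (g ! j)" using bspec[OF a, of "g ! j"] g(2) by (auto simp: F_def)
      then show ?thesis using g(1) * by (simp add: peval_vec subsetD)
    qed
    then show ?thesis by (simp add: feasible_set_def)
  qed
  ultimately show ?thesis using min peval_vec[OF f] by metis
qed

text \<open>Induction on the number of vectors. With \<open>d k\<close> dual to the old vectors,
  \<open>u\<close> is \<open>w l\<close> minus the combination of them that \<open>d\<close>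
  prescribes. If \<open>u\<close> is zero, it is a dependence; otherwise correcting \<open>u\<close>
  by the \<open>d k\<close> gives a direction \<open>e\<close> that all old vectors annihilate and
  on which \<open>w l\<close> takes the value \<open>ip u u\<close>.\<close>

lemma dependent_or_jointly_surjective:
  fixes w :: "'k \<Rightarrow> 'i \<Rightarrow> real"
  assumes "finite K" "finite I"
  shows "(\<exists>c. (\<exists>k\<in>K. c k \<noteq> 0) \<and> (\<forall>i\<in>I. (\<Sum>k\<in>K. c k * w k i) = 0)) \<or>
    (\<forall>b. \<exists>d. \<forall>k\<in>K. (\<Sum>i\<in>I. w k i * d i) = b k)"
  using assms(1)
proof (induction K)
  case empty
  then show ?case by simp
next
  case (insert l K)
  show ?case
  proof (cases "\<exists>c. (\<exists>k\<in>K. c k \<noteq> 0) \<and> (\<forall>i\<in>I. (\<Sum>k\<in>K. c k * w k i) = 0)")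
    case True
    then obtain c where c: "\<exists>k\<in>K. c k \<noteq> 0" "\<forall>i\<in>I. (\<Sum>k\<in>K. c k * w k i) = 0" by blast
    have "(\<Sum>k\<in>insert l K. (c(l := 0)) k * w k i) = (\<Sum>k\<in>K. c k * w k i)" for i
      using insert.hyps by (simp, intro sum.cong) auto
    moreover have "\<exists>k\<in>insert l K. (c(l := 0)) k \<noteq> 0" using c(1) insert.hyps by auto
    ultimately show ?thesis using c(2) by metis
  next
    case False
    then have surj: "\<forall>b. \<exists>d. \<forall>k\<in>K. (\<Sum>i\<in>I. w k i * d i) = b k" using insert.IH by blast
    define ip where "ip = (\<lambda>a b. \<Sum>i\<in>I. a i * b i :: real)"
    have ip_add: "ip a (\<lambda>i. b i + c i) = ip a b + ip a c" for a b c
      by (simp add: ip_def distrib_left sum.distrib)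
    have ip_scale: "ip a (\<lambda>i. s * b i) = s * ip a b" for a b s
      by (simp add: ip_def sum_distrib_left mult_ac)
    have ip_diff: "ip a (\<lambda>i. b i - c i) = ip a b - ip a c" for a b c
      by (simp add: ip_def right_diff_distrib sum_subtractf)
    have ip_sum: "ip a (\<lambda>i. \<Sum>k\<in>K. s k * b k i) = (\<Sum>k\<in>K. s k * ip a (b k))" for a b s
      unfolding ip_def sum_distrib_left by (subst sum.swap) (simp add: mult_ac)
    have ip_commute: "ip a b = ip b a" for a b by (simp add: ip_def mult.commute)
    have "\<forall>k. \<exists>d. \<forall>j\<in>K. ip (w j) d = (if j = k then 1 else 0)"
    proof
      fix k
      show "\<exists>d. \<forall>j\<in>K. ip (w j) d = (if j = k then 1 else 0)"
        using spec[OF surj, of "\<lambda>j. if j = k then 1 else 0"] by (simp add: ip_def)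
    qed
    then obtain d where d: "\<And>k j. j \<in> K \<Longrightarrow> ip (w j) (d k) = (if j = k then 1 else 0)" by metis
    define u where "u = (\<lambda>i. w l i - (\<Sum>k\<in>K. ip (w l) (d k) * w k i))"
    show ?thesis
    proof (cases "\<forall>i\<in>I. u i = 0")
      case True
      define c where "c = (\<lambda>k. if k = l then 1 else - ip (w l) (d k))"
      have "(\<Sum>k\<in>insert l K. c k * w k i) = u i" for i
      proof -
        have "(\<Sum>k\<in>K. c k * w k i) = (\<Sum>k\<in>K. - (ip (w l) (d k) * w k i))"
          using insert.hyps by (intro sum.cong) (auto simp: c_def)
        then show ?thesis using insert.hyps by (simp add: u_def c_def sum_negf)
      qed
      then have "(\<exists>k\<in>insert l K. c k \<noteq> 0) \<and> (\<forall>i\<in>I. (\<Sum>k\<in>insert l K. c k * w k i) = 0)"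
        using True by (auto simp: c_def)
      then show ?thesis by blast
    next
      case False
      then have uu: "ip u u \<noteq> 0"
        using assms(2) by (auto simp: ip_def sum_nonneg_eq_0_iff)
      define e where "e = (\<lambda>i. u i - (\<Sum>k\<in>K. ip (w k) u * d k i))"
      have e0: "ip (w j) e = 0" if "j \<in> K" for j
      proof -
        have "(\<Sum>k\<in>K. ip (w k) u * ip (w j) (d k)) = (\<Sum>k\<in>K. if k = j then ip (w j) u else 0)"
          using d[OF that] by (intro sum.cong) auto
        then show ?thesis using that insert.hyps unfolding e_def ip_diff ip_sum by simp
      qed
      have "ip u u = ip u (w l) - (\<Sum>k\<in>K. ip (w l) (d k) * ip u (w k))"
        unfolding ip_sum[symmetric] ip_diff[symmetric] by (simp add: u_def)
      then have e1: "ip (w l) e = ip u u"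
        unfolding e_def ip_diff ip_sum by (simp add: ip_commute mult.commute)
      have "\<exists>x. \<forall>k\<in>insert l K. ip (w k) x = b k" for b
      proof -
        obtain y where y: "\<forall>k\<in>K. ip (w k) y = b k" using surj unfolding ip_def by blast
        define s where "s = (b l - ip (w l) y) / ip u u"
        have "ip (w k) (\<lambda>i. y i + s * e i) = ip (w k) y + s * ip (w k) e" for k by (simp add: ip_add ip_scale)
        then have "\<forall>k\<in>insert l K. ip (w k) (\<lambda>i. y i + s * e i) = b k"
          using y e0 e1 uu by (simp add: s_def)
        then show ?thesis by blast
      qed
      then show ?thesis unfolding ip_def by blast
    qed
  qed
qed

text \<open>Evaluation in the ring of real polynomials in the parameter \<open>t\<close>;
  differentiation there is a derivation along this evaluation, so the chain rule applies.\<close>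

lemma line_restriction:
  fixes x d :: "nat \<Rightarrow> real"
  assumes p: "p \<in> polys n"
  shows "\<exists>q. (\<forall>t. poly q t = reval (\<lambda>i. x i + t * d i) p) \<and>
    poly (pderiv q) 0 = (\<Sum>i<n. reval x (partial i p) * d i)"
proof -
  define \<psi> where "\<psi> = insertion (\<lambda>c. [:c:]) (\<lambda>i. [:x i, d i:])"
  have "comm_ring_hom (\<lambda>c :: real. [:c:])" by unfold_locales auto
  note CH = this
  then have hom: "comm_ring_hom \<psi>" unfolding \<psi>_def by (rule comm_ring_hom_insertion)
  have \<psi>: "\<psi> (Const c) = [:c:]" "\<psi> (Var i) = [:x i, d i:]" for c i
    by (simp_all add: \<psi>_def insertion_Const[OF CH] insertion_Var[OF CH])
  interpret \<psi>: comm_ring_hom \<psi> by (rule hom)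
  have ev: "poly (\<psi> q) t = reval (\<lambda>i. x i + t * d i) q" for q t
  proof -
    interpret e: idom_hom "reval (\<lambda>i. x i + t * d i)" by (rule idom_hom_insertion_real)
    obtain M where "q \<in> polys M" using in_polys by blast
    then show ?thesis
    proof (induction rule: polys_induct)
      case (add p q)
      then show ?case by (simp add: \<psi>.hom_add e.hom_add)
    next
      case (mult p q)
      then show ?case by (simp add: \<psi>.hom_mult e.hom_mult)
    qed (simp_all add: \<psi>)
  qed
  have "pderiv (\<psi> p) = (\<Sum>i<n. \<psi> (partial i p) * pderiv (\<psi> (Var i)))"
    by (rule derivation_chain_rule[OF hom, of "\<lambda>p. pderiv (\<psi> p)"])
       (simp_all add: \<psi>.hom_add \<psi>.hom_mult pderiv_add pderiv_mult p mult.commute \<psi> pderiv_pCons)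
  also have "\<dots> = (\<Sum>i<n. \<psi> (partial i p) * [:d i:])"
    by (simp add: \<psi> pderiv_pCons)
  finally have "poly (pderiv (\<psi> p)) 0 = (\<Sum>i<n. reval x (partial i p) * d i)"
    by (simp only: poly_sum poly_mult ev) simp
  then show ?thesis using ev by blast
qed

lemma poly_pos_at_right:
  fixes q :: "real poly"
  assumes "poly q 0 > 0 \<or> poly q 0 = 0 \<and> poly (pderiv q) 0 > 0"
  shows "\<forall>\<^sub>F t in at_right 0. poly q t > 0"
  using assms
proof
  assume "poly q 0 > 0"
  moreover have "(poly q \<longlongrightarrow> poly q 0) (at_right 0)"
    using poly_isCont[of 0 q] unfolding isCont_def by (rule tendsto_within_subset) auto
  ultimately show ?thesis by (rule order_tendstoD(1)[rotated])
next
  assume *: "poly q 0 = 0 \<and> poly (pderiv q) 0 > 0"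
  obtain e where "e > 0" "\<forall>h>0. h < e \<longrightarrow> poly q 0 < poly q (0 + h)"
    using DERIV_pos_inc_right[OF poly_DERIV, of q 0] * by auto
  then show ?thesis using * unfolding eventually_at_right_field by auto
qed

text \<open>The equations in \<open>h_FJ\<close> carry no sign conditions, so a linear dependence
  between the gradients of \<open>f\<close> and of the active constraints is enough. If these were
  independent, some direction would increase \<open>- f\<close> and all active constraints to first
  order and lead to feasible points with smaller values of \<open>f\<close>.\<close>

theorem fritz_john:
  fixes x :: "real vec"
  assumes f: "f \<in> polys n" and g: "set g \<subseteq> polys n"
    and x: "x \<in> feasible_set n g" and min: "\<And>y. y \<in> feasible_set n g \<Longrightarrow> peval f x \<le> peval f y"
  shows "\<exists>z :: real vec. (\<forall>i<n. z $ i = x $ i) \<and> (\<forall>q\<in>set (h_FJ n f g). peval q z = 0)"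
proof -
  let ?m = "length g" and ?a = "\<lambda>i. x $ i"
  have gj: "g ! j \<in> polys n" if "j < ?m" for j using g nth_mem[OF that] by blast
  have xf: "x \<in> carrier_vec n" "\<And>j. j < ?m \<Longrightarrow> 0 \<le> reval ?a (g ! j)"
    using x by (auto simp: feasible_set_def peval_eq_insertion)
  \<comment> \<open>Index 0 stands for \<open>- f\<close> and index \<open>Suc j\<close> for an
    active constraint \<open>g ! j\<close>. Owing to the sign of \<open>- f\<close>, a dependence
    has the shape of the gradient equations up to an overall sign.\<close>
  define K where "K = insert 0 (Suc ` {j. j < ?m \<and> reval ?a (g ! j) = 0})"
  define F where "F = case_nat (- f) (\<lambda>j. g ! j)"
  define w where "w = (\<lambda>k i. reval ?a (partial i (F k)))"
  have K: "finite K" by (simp add: K_def)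
  have F: "F k \<in> polys n" if "k \<in> K" for k using that f gj by (auto simp: K_def F_def intro: polysD(5))
  have "\<not> (\<forall>b. \<exists>d. \<forall>k\<in>K. (\<Sum>i<n. w k i * d i) = b k)"
  proof
    assume "\<forall>b. \<exists>d. \<forall>k\<in>K. (\<Sum>i<n. w k i * d i) = b k"
    \<comment> \<open>The value 1 for all indices makes every first-order change strictly
      positive.\<close>
    from spec[OF this, of "\<lambda>_. 1"]
    obtain d where d1: "\<forall>k\<in>K. (\<Sum>i<n. w k i * d i) = 1" ..
    note d = bspec[OF d1]
    define y where "y = (\<lambda>t i. ?a i + t * d i)"
    have G: "\<forall>\<^sub>F t in at_right 0. reval (y t) (g ! j) > 0" if j: "j < ?m" for j
    proof -
      obtain q where q: "\<And>t. poly q t = reval (y t) (g ! j)"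
        "poly (pderiv q) 0 = (\<Sum>i<n. reval ?a (partial i (g ! j)) * d i)"
        using line_restriction[OF gj[OF j], of ?a d] unfolding y_def by blast
      have "poly q 0 = reval ?a (g ! j)" by (simp add: q(1) y_def)
      moreover have "poly (pderiv q) 0 = 1" if "reval ?a (g ! j) = 0"
        using d[of "Suc j"] that j unfolding q(2) by (simp add: K_def w_def F_def)
      ultimately have "poly q 0 > 0 \<or> poly q 0 = 0 \<and> poly (pderiv q) 0 > 0" using xf(2)[OF j] by force
      then show ?thesis unfolding q(1)[symmetric] by (rule poly_pos_at_right)
    qed
    have "\<forall>\<^sub>F t in at_right 0. reval (y t) f < reval ?a f"
    proof -
      define f0 where "f0 = Const (reval ?a f) - f"
      have "f0 \<in> polys n" unfolding f0_def using f by (intro polysD Const_in_polys)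
      then obtain q where q: "\<And>t. poly q t = reval (y t) f0"
        "poly (pderiv q) 0 = (\<Sum>i<n. reval ?a (partial i f0) * d i)"
        using line_restriction[of f0 n ?a d] unfolding y_def by blast
      have ev: "poly q t = reval ?a f - reval (y t) f" for t
      proof -
        interpret e: idom_hom "reval (y t)" by (rule idom_hom_insertion_real)
        show ?thesis unfolding q(1) f0_def by (simp add: e.hom_minus)
      qed
      have "partial i f0 = partial i (- f)" for i
        using partial_add[of i "Const (reval ?a f)" "- f"] by (simp add: f0_def partial_Const)
      then have "poly (pderiv q) 0 = 1" unfolding q(2) using d[of 0] by (simp add: K_def w_def F_def)
      moreover have "poly q 0 = 0" by (simp add: ev y_def)
      ultimately have "\<forall>\<^sub>F t in at_right 0. poly q t > 0" by (intro poly_pos_at_right) simp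
      then show ?thesis by (simp add: ev)
    qed
    moreover have "\<forall>\<^sub>F t in at_right 0. \<forall>j\<in>{..<?m}. reval (y t) (g ! j) > 0"
      using G by (intro eventually_ball_finite) auto
    ultimately have "\<forall>\<^sub>F t in at_right (0::real). reval (y t) f < reval ?a f \<and> (\<forall>j\<in>{..<?m}. reval (y t) (g ! j) > 0)"
      by (rule eventually_conj)
    from eventually_happens'[OF trivial_limit_at_right_real this]
    obtain t where t0: "reval (y t) f < reval ?a f \<and> (\<forall>j\<in>{..<?m}. reval (y t) (g ! j) > 0)" ..
    then have t: "reval (y t) f < reval ?a f" "\<And>j. j < ?m \<Longrightarrow> reval (y t) (g ! j) > 0" by simp_all
    have "vec n (y t) \<in> feasible_set n g"
      using t(2) gj by (auto simp: feasible_set_def peval_vec less_imp_le)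
    then show False using min[of "vec n (y t)"] t(1) f by (simp add: peval_vec peval_eq_insertion[of f x])
  qed
  then obtain c k0 where c: "k0 \<in> K" "c k0 \<noteq> 0" "\<And>i. i < n \<Longrightarrow> (\<Sum>k\<in>K. c k * w k i) = 0"
    using dependent_or_jointly_surjective[OF K, of "{..<n}" w] by blast
  \<comment> \<open>The multiplier 0 for inactive constraints gives complementarity; division by
    \<open>sqrt L\<close> below gives the sphere equation.\<close>
  define l0 where "l0 = (\<lambda>k. if k \<in> K then c k else 0)"
  define L where "L = (\<Sum>k\<le>?m. (l0 k)\<^sup>2)"
  have K_le: "k \<le> ?m" if "k \<in> K" for k using that by (auto simp: K_def)
  have "L > 0" unfolding L_def using c(1,2) K_le[OF c(1)]
    by (intro sum_pos2[of _ k0]) (auto simp: l0_def)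
  define z where "z = vec (n + ?m + 1) (\<lambda>i. if i < n then x $ i else l0 (i - n) / sqrt L)"
  have z: "z $ i = x $ i" if "i < n" for i using that by (simp add: z_def)
  have zl: "z $ (n + k) = l0 k / sqrt L" if "k \<le> ?m" for k using that by (simp add: z_def)
  interpret e: idom_hom "\<lambda>p. peval p z" by (rule idom_hom_peval)
  have pz: "peval p z = reval ?a p" if "p \<in> polys n" for p
    unfolding peval_eq_insertion by (rule insertion_cong[OF that z])
  have eV: "peval (Var i) z = z $ i" for i by (simp add: peval_eq_insertion)
  have "peval q z = 0" if h: "q \<in> set (h_FJ n f g)" for q
  proof -
    consider i where "i < n" "q = Var n * partial i f - (\<Sum>j<?m. Var (n + (j + 1)) * partial i (g ! j))"
      | j where "j < ?m" "q = Var (n + (j + 1)) * g ! j" | "q = 1 - (\<Sum>j\<le>?m. (Var (n + j))\<^sup>2)"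
      using h by (auto simp: h_FJ_def)
    then show ?thesis
    proof cases
      case (1 i)
      have pf: "peval (partial i f) z = - w 0 i"
      proof -
        interpret r: idom_hom "reval ?a" by (rule idom_hom_insertion_real)
        have "partial i f + partial i (- f) = 0" using partial_add[of i f "- f"] partial_Const[of i 0] by simp
        then have "reval ?a (partial i f) + reval ?a (partial i (- f)) = 0" by (metis r.hom_add r.hom_zero)
        then show ?thesis by (simp add: pz[OF partial_in_polys[OF f]] w_def F_def)
      qed
      have "(\<Sum>j<?m. l0 (j + 1) * reval ?a (partial i (g ! j))) = (\<Sum>k\<in>Suc ` {..<?m}. l0 k * w k i)"
        by (simp add: sum.reindex w_def F_def)
      also have "\<dots> = (\<Sum>k\<in>K - {0}. c k * w k i)"
        by (rule sum.mono_neutral_cong_right) (auto simp: K_def l0_def)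
      also have "\<dots> = - (c 0 * w 0 i)" using c(3)[OF 1(1)] sum.remove[OF K, of 0 "\<lambda>k. c k * w k i"]
        unfolding K_def by simp
      finally have s: "(\<Sum>j<?m. l0 (j + 1) * reval ?a (partial i (g ! j))) = - (c 0 * w 0 i)" .
      have "(\<Sum>j<?m. z $ (n + (j + 1)) * peval (partial i (g ! j)) z)
          = (\<Sum>j<?m. l0 (j + 1) * reval ?a (partial i (g ! j))) / sqrt L"
        unfolding sum_divide_distrib
      proof (rule sum.cong)
        fix j assume "j \<in> {..<?m}"
        then show "z $ (n + (j + 1)) * peval (partial i (g ! j)) z
            = (l0 (j + 1) * reval ?a (partial i (g ! j))) / sqrt L"
          using zl[of "j + 1"] pz[OF partial_in_polys[OF gj, of j]] by simp
      qed simp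
      moreover have "z $ n = c 0 / sqrt L" using zl[of 0] by (simp add: l0_def K_def)
      ultimately show ?thesis unfolding 1(2) using s by (simp add: e.hom_minus e.hom_mult e.hom_sum eV pf)
    next
      case (2 j)
      have "l0 (j + 1) = 0 \<or> reval ?a (g ! j) = 0" using 2(1) by (auto simp: l0_def K_def)
      then show ?thesis unfolding 2(2) using zl[of "j + 1"] 2(1) pz[OF gj[OF 2(1)]] by (auto simp: e.hom_mult eV)
    next
      case 3
      have "(\<Sum>k\<le>?m. (z $ (n + k))\<^sup>2) = (\<Sum>k\<le>?m. (l0 k)\<^sup>2 / L)"
        using \<open>L > 0\<close> by (intro sum.cong) (auto simp: zl power_divide)
      also have "\<dots> = 1" using \<open>L > 0\<close> by (simp add: L_def flip: sum_divide_distrib)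
      finally show ?thesis unfolding 3 by (simp add: e.hom_minus e.hom_sum e.hom_power eV)
    qed
  qed
  then show ?thesis using z by blast
qed

section \<open>Finite convergence\<close>

lemma shifts_product_in_polys: "f \<in> polys N \<Longrightarrow> (\<Prod>t\<leftarrow>ts. f - Const t) \<in> polys N"
  by (induction ts) (auto intro!: polysD Const_in_polys)

text \<open>The products over lists form a multiplicative set: lists can be concatenated and the
  empty list gives 1. Without a certificate, a prime cone above \<open>T\<close> would have no
  admissible \<open>f - t\<close> in its support, contrary to \<open>val\<close>.\<close>

lemma values_product_in_preorder:
  assumes T: "preorder_on (polys N) T" and f: "f \<in> polys N"
    and val: "\<And>P. prime_cone P \<Longrightarrow> T \<subseteq> P \<Longrightarrow> \<exists>t. ok t \<and> f - Const t \<in> supp P"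
  shows "\<exists>ts. (\<forall>t\<in>set ts. ok t) \<and> - ((\<Prod>t\<leftarrow>ts. f - Const t) * (\<Prod>t\<leftarrow>ts. f - Const t)) \<in> T"
proof (rule ccontr)
  assume no: "\<not> ?thesis"
  define F where "F = (\<lambda>ts. \<Prod>t\<leftarrow>ts. f - Const t)"
  define S where "S = F ` {ts. \<forall>t\<in>set ts. ok t}"
  have F: "F ts \<in> polys N" for ts unfolding F_def by (rule shifts_product_in_polys[OF f])
  have "\<exists>P. T \<subseteq> P \<and> prime_cone_on (polys N) P \<and> (\<forall>s\<in>S. \<not> (s \<in> P \<and> - s \<in> P))"
  proof (rule abstract_positivstellensatz[OF subring_on_polys T])
    show "S \<subseteq> polys N" using F by (auto simp: S_def)
    show "1 \<in> S" unfolding S_def by (rule image_eqI[of _ _ "[]"]) (simp_all add: F_def)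
    show "s * t \<in> S" if st: "s \<in> S" "t \<in> S" for s t
    proof -
      obtain u v where "s = F u" "t = F v" "\<forall>t\<in>set u. ok t" "\<forall>t\<in>set v. ok t" using st by (auto simp: S_def)
      then show ?thesis unfolding S_def by (intro image_eqI[of _ _ "u @ v"]) (auto simp: F_def)
    qed
    show "- (s * s) \<notin> T" if "s \<in> S" for s using that no by (auto simp: S_def F_def)
  qed
  then obtain P where P: "T \<subseteq> P" "prime_cone_on (polys N) P" "\<forall>s\<in>S. \<not> (s \<in> P \<and> - s \<in> P)" by blast
  obtain P' where P': "prime_cone P'" "P' \<inter> polys N = P" using prime_cone_extend[OF P(2)] by blast
  obtain t where t: "ok t" "f - Const t \<in> supp P'" using val[OF P'(1)] P(1) P'(2) by blast
  have "f - Const t \<in> polys N" "- (f - Const t) \<in> polys N" by (intro polysD Const_in_polys f)+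
  then have "f - Const t \<in> P \<and> - (f - Const t) \<in> P" using t(2) P'(2) by (auto simp: supp_def)
  moreover have "f - Const t \<in> S" unfolding S_def using t(1) by (intro image_eqI[of _ _ "[t]"]) (simp_all add: F_def)
  ultimately show False using P(3) by blast
qed

lemma poly_map_Const:
  "poly (map_poly Const (p + q)) x = poly (map_poly Const p) x + poly (map_poly Const q) x"
  "poly (map_poly Const (p * q)) x = poly (map_poly Const p) x * poly (map_poly Const q) x"
  "poly (map_poly Const (smult c p)) x = Const c * poly (map_poly Const p) x"
  "poly (map_poly Const [:c:]) x = Const c" "poly (map_poly Const [:c, 1:]) x = x + Const c"
proof -
  note * = idom_hom_map_poly[OF idom_hom_Const]
  show "poly (map_poly Const (p + q)) x = poly (map_poly Const p) x + poly (map_poly Const q) x"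
    "poly (map_poly Const (p * q)) x = poly (map_poly Const p) x * poly (map_poly Const q) x"
    "poly (map_poly Const (smult c p)) x = Const c * poly (map_poly Const p) x"
    by (rule *)+
  show "poly (map_poly Const [:c:]) x = Const c" by (simp add: *(8))
  have "[:c, 1:] = [:c:] + monom 1 1" by (simp add: monom_altdef)
  then have "poly (map_poly Const [:c, 1:]) x = Const c + poly (map_poly Const (monom 1 1)) x"
    using *(1)[of "[:c:]" "monom 1 1" x] by (simp add: *(8))
  also have "map_poly Const (monom 1 1) = monom 1 1" by (subst map_poly_monom) simp_all
  finally show "poly (map_poly Const [:c, 1:]) x = x + Const c" by (simp add: poly_monom add.commute)
qed

lemma poly_subst_in_polys:
  assumes f: "f \<in> polys N"
  shows "poly (map_poly Const u) f \<in> polys N"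
proof (induction u)
  case (pCons a u)
  have "pCons a u = [:a:] + [:0, 1:] * u" by simp
  then have "poly (map_poly Const (pCons a u)) f = Const a + (f + Const 0) * poly (map_poly Const u) f"
    by (simp only: poly_map_Const)
  also have "\<dots> \<in> polys N" using pCons by (intro polysD Const_in_polys f)
  finally show ?case .
qed (simp add: polysD)

lemma objective_gap_in_qt:
  assumes f: "f \<in> polys N" and ts: "\<And>t. t \<in> set ts \<Longrightarrow> s \<le> t"
    and cert: "- ((\<Prod>t\<leftarrow>ts. f - Const t) * (\<Prod>t\<leftarrow>ts. f - Const t)) \<in> gmod N G h"
  shows "\<exists>k. \<forall>e>0. f - Const (s - e) \<in> qt N G h k"
proof -
  \<comment> \<open>The additional factor \<open>f - s\<close> makes the list nonempty, as the
    estimate for the shifted line demands.\<close>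
  define ts' where "ts' = s # ts"
  define F where "F = (\<Prod>t\<leftarrow>ts'. f - Const t)"
  have "(f - Const s) * (f - Const s) * - ((\<Prod>t\<leftarrow>ts. f - Const t) * (\<Prod>t\<leftarrow>ts. f - Const t)) \<in> gmod N G h"
    by (rule gmod_square_mult[OF cert]) (intro polysD Const_in_polys f)
  then have "- (F * F) \<in> gmod N G h" by (simp add: F_def ts'_def mult_ac)
  then obtain k1 where k1: "- (F * F) \<in> qt N G h k1" using gmod_qt by blast
  \<comment> \<open>The order \<open>k1\<close> pays for the certificate; the other bound pays for
    the squares of \<open>u(f)\<close>, where \<open>u\<close> has degree at most the number of
    factors. Neither involves \<open>e\<close>.\<close>
  define k where "k = max k1 (length ts' * deg f)"
  define U where "U = (\<Prod>t\<leftarrow>ts'. [:- t, 1:])"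
  have U: "poly (map_poly Const U) f = F" "degree U \<le> length ts'" "\<And>y. poly U y = (\<Prod>t\<leftarrow>ts'. y - t)"
  proof -
    show "poly (map_poly Const U) f = F" unfolding U_def F_def
      by (induction ts') (simp_all add: poly_map_Const one_pCons Const_uminus del: mult_pCons_left)
    show "degree U \<le> length ts'" unfolding U_def
    proof (induction ts')
      case (Cons a ts')
      have "degree ([:- a, 1:] * (\<Prod>t\<leftarrow>ts'. [:- t, 1:])) \<le> 1 + degree (\<Prod>t\<leftarrow>ts'. [:- t, 1:])"
        by (rule order_trans[OF degree_mult_le]) simp
      then show ?case using Cons by (simp del: mult_pCons_left)
    qed simp
    show "poly U y = (\<Prod>t\<leftarrow>ts'. y - t)" for y unfolding U_def by (induction ts') (simp_all add: algebra_simps)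
  qed
  have "f - Const (s - e) \<in> qt N G h k" if e: "e > 0" for e :: real
  proof -
    \<comment> \<open>This grows without bound as \<open>e\<close> tends to 0, but being a constant
      it does not affect degrees.\<close>
    define c where "c = 1 / e ^ (2 * length ts' - 1)"
    have c: "0 \<le> c" using e by (simp add: c_def)
    define q where "q = [:e - s, 1:] + smult c (U * U)"
    have "0 \<le> poly q y" for y
    proof -
      have "0 \<le> y - s + e + c * (\<Prod>t\<leftarrow>ts'. y - t)\<^sup>2"
        unfolding c_def by (rule shifted_line_plus_square_nonneg) (use e ts in \<open>auto simp: ts'_def\<close>)
      also have "\<dots> = poly q y" by (simp add: q_def U power2_eq_square)
      finally show ?thesis .
    qed
    then obtain us where us: "q = (\<Sum>u\<leftarrow>us. u * u)" "\<And>u. u \<in> set us \<Longrightarrow> 2 * degree u \<le> degree q"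
      using nonneg_poly_sum_of_squares by blast
    have "degree (U * U) \<le> 2 * length ts'" using degree_mult_le[of U U] U(2) by linarith
    moreover have "degree [:e - s, 1:] \<le> 2 * length ts'" by (simp add: ts'_def)
    ultimately have dq: "degree q \<le> 2 * length ts'"
      unfolding q_def by (intro degree_add_le order_trans[OF degree_smult_le])
    have "\<forall>u\<in>set us. degree u \<le> length ts'" using us(2) dq by fastforce
    then have "poly (map_poly Const (\<Sum>u\<leftarrow>us. u * u)) f \<in> qt N G h k"
    proof (induction us)
      case Nil
      show ?case using qt_SOS[OF SOS_0, of k N G h] by simp
    next
      case (Cons u us)
      let ?u = "poly (map_poly Const u) f"
      have "deg ?u \<le> length ts' * deg f"
        using Cons.prems by (intro order_trans[OF deg_poly_subst] mult_le_mono1) simp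
      then have "deg ?u \<le> k" by (simp add: k_def)
      then have "deg (?u * ?u) \<le> 2 * k" using deg_mult[of ?u ?u] by linarith
      then have "?u * ?u \<in> qt N G h k" by (intro qt_SOS SOS_square poly_subst_in_polys f)
      then show ?case using qt_add Cons by (simp add: poly_map_Const)
    qed
    then have "poly (map_poly Const q) f \<in> qt N G h k" by (simp add: us(1))
    moreover have "Const c * - (F * F) \<in> qt N G h k"
      using qt_mono[of k1 k N G h] k1 by (intro qt_scale c) (auto simp: k_def)
    ultimately have "poly (map_poly Const q) f + Const c * - (F * F) \<in> qt N G h k" by (rule qt_add)
    also have "poly (map_poly Const q) f + Const c * - (F * F) = f - Const (s - e)"
      by (simp add: q_def poly_map_Const U Const_diff)
    finally show ?thesis .
  qed
  then show ?thesis by (intro exI[of _ k] allI impI)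
qed

text \<open>Evaluation at \<open>z\<close> bounds the relaxation from above. From below it is
  approached by \<open>s - e\<close>, so the supremum equals \<open>s\<close> even where
  \<open>f - s\<close> has no representation.\<close>

lemma rho_eq_if_gap_in_qt:
  assumes "\<exists>k. \<forall>e>0. f - Const (s - e) \<in> qt N G h k"
    and z: "\<And>q. q \<in> set G \<Longrightarrow> 0 \<le> peval q z" "\<And>q. q \<in> set h \<Longrightarrow> peval q z = 0" "peval f z = s"
  shows "\<exists>k. rho N k f G h = ereal s"
proof -
  obtain k where k: "\<And>e. e > 0 \<Longrightarrow> f - Const (s - e) \<in> qt N G h k" using assms(1) by blast
  have qt: "f - Const \<xi> \<in> qt N G h k \<longleftrightarrow> (\<exists>q\<in>qmodule N k G. \<exists>p\<in>tideal N k h. f - Const \<xi> = q + p)" for \<xi>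
    unfolding qt_def by blast
  have "rho N k f G h \<le> ereal s" unfolding rho_def qt[symmetric]
  proof (rule SUP_least)
    fix \<xi> assume "\<xi> \<in> {\<xi>. f - Const \<xi> \<in> qt N G h k}"
    then have "0 \<le> peval (f - Const \<xi>) z" using qt_nonneg z(1,2) by blast
    moreover interpret e: idom_hom "\<lambda>p. peval p z" by (rule idom_hom_peval)
    have "peval (Const \<xi>) z = \<xi>" by (simp add: peval_eq_insertion)
    ultimately show "ereal \<xi> \<le> ereal s" using z(3) by (simp add: e.hom_minus)
  qed
  moreover have "ereal s \<le> rho N k f G h"
  proof (rule ereal_le_epsilon2)
    fix e :: real assume "0 < e"
    then have "ereal (s - e) \<le> rho N k f G h"
      unfolding rho_def qt[symmetric] using k by (intro SUP_upper) simp
    then have "ereal (s - e) + ereal e \<le> rho N k f G h + ereal e" by (rule add_right_mono)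
    then show "ereal s \<le> rho N k f G h + ereal e" by simp
  qed
  ultimately show ?thesis by (auto intro: antisym)
qed

section \<open>Removal of factors in the Archimedean case\<close>

lemma SOS_mult_generator_gmod:
  assumes "s \<in> SOS n" "n \<le> N"
  shows "s \<in> gmod N G h" "j < length G \<Longrightarrow> s * G ! j \<in> gmod N G h"
proof -
  have 0: "0 \<in> gmod N G h" using gmod.square[of 0 N G h] polysD(1) by simp
  have P: "p \<in> polys N" if "p \<in> polys n" for p using that polys_subset[OF assms(2)] by blast
  show "s \<in> gmod N G h" using assms(1)
    by (induction rule: SOS_induct) (simp_all add: 0 gmod.add gmod.square P)
  show "s * G ! j \<in> gmod N G h" if "j < length G" using assms(1)
    by (induction rule: SOS_induct) (simp_all add: 0 distrib_right gmod.add gmod.generator P that)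
qed

lemma qmod_on_gmod:
  assumes "set G \<subseteq> polys N" "set h \<subseteq> polys N"
  shows "qmod_on (polys N) (gmod N G h)"
  unfolding qmod_on_def
  using gmod_polys[OF assms] gmod.square[of 1 N G h] gmod.add gmod_square_mult polysD(2) by auto

text \<open>For the variables \<open>x\<close> the Archimedean certificate provides the bound, for
  the multipliers the sphere equation; the squares of the remaining variables are added
  back.\<close>

lemma gmod_archimedean:
  assumes "archimedean n g" "i < n + length g + 1"
  shows "\<exists>C. Const C - Var i * Var i \<in> gmod (n + length g + 1) g (h_FJ n f g)"
proof -
  let ?N = "n + length g + 1" and ?h = "h_FJ n f g"
  define M where "M = gmod ?N g ?h"
  have add: "p + q \<in> M" if "p \<in> M" "q \<in> M" for p q using that unfolding M_def by (rule gmod.add)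
  have sum: "(\<Sum>i\<in>A. p i) \<in> M" if "\<And>i. i \<in> A \<Longrightarrow> p i \<in> M" for A :: "nat set" and p
    using that gmod.square[of 0 ?N g ?h] polysD(1)
    by (induction A rule: infinite_finite_induct) (auto simp: M_def gmod.add)
  have sq: "(Var k)\<^sup>2 \<in> M" if "k < ?N" for k
    using gmod.square[OF Var_in_polys[OF that]] by (simp add: power2_eq_square M_def)
  show ?thesis
  proof (cases "i < n")
    case True
    obtain R \<sigma>0 \<sigma> where R: "\<sigma>0 \<in> SOS n" "\<And>j. j < length g \<Longrightarrow> \<sigma> j \<in> SOS n"
      "Const R - (\<Sum>i<n. (Var i)\<^sup>2) = \<sigma>0 + (\<Sum>j<length g. g ! j * \<sigma> j)"
      using assms(1) unfolding archimedean_def by blast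
    have "Const R - (\<Sum>i<n. (Var i)\<^sup>2) \<in> M" unfolding R(3)
    proof (intro add sum)
      show "\<sigma>0 \<in> M" unfolding M_def by (rule SOS_mult_generator_gmod(1)[OF R(1)]) simp
      fix j assume j: "j \<in> {..<length g}"
      then have "\<sigma> j * g ! j \<in> M" unfolding M_def by (intro SOS_mult_generator_gmod(2)[OF R(2)]) simp_all
      then show "g ! j * \<sigma> j \<in> M" by (simp add: mult.commute)
    qed
    then have "(Const R - (\<Sum>i<n. (Var i)\<^sup>2)) + (\<Sum>k\<in>{..<n} - {i}. (Var k)\<^sup>2) \<in> M"
      by (intro add sum sq) auto
    also have "(Const R - (\<Sum>i<n. (Var i)\<^sup>2)) + (\<Sum>k\<in>{..<n} - {i}. (Var k)\<^sup>2) = Const R - Var i * Var i"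
      using True sum.remove[of "{..<n}" i "\<lambda>k. (Var k)\<^sup>2"] by (simp add: power2_eq_square)
    finally show ?thesis unfolding M_def by blast
  next
    case False
    define j where "j = i - n"
    have j: "i = n + j" "j \<le> length g" using False assms(2) by (auto simp: j_def)
    obtain l where "l < length ?h" "?h ! l = 1 - (\<Sum>j\<le>length g. (Var (n + j))\<^sup>2)"
      using h_FJ_members(3)[of n g f] unfolding in_set_conv_nth by blast
    then have "1 - (\<Sum>j\<le>length g. (Var (n + j))\<^sup>2) \<in> M"
      using gmod.ideal[of 1 ?N l ?h g] polysD(2) by (simp add: M_def)
    then have "(1 - (\<Sum>j\<le>length g. (Var (n + j))\<^sup>2)) + (\<Sum>k\<in>{..length g} - {j}. (Var (n + k))\<^sup>2) \<in> M"
      by (intro add sum sq) auto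
    also have "(1 - (\<Sum>j\<le>length g. (Var (n + j))\<^sup>2)) + (\<Sum>k\<in>{..length g} - {j}. (Var (n + k))\<^sup>2) = Const 1 - Var i * Var i"
      using j sum.remove[of "{..length g}" j "\<lambda>k. (Var (n + k))\<^sup>2"] by (simp add: power2_eq_square)
    finally show ?thesis unfolding M_def by blast
  qed
qed

text \<open>Putinar's theorem gives \<open>- 1 = q + a w\<close> with \<open>q \<in> Q\<close>. Multiply by \<open>b\<^sup>2\<close> and absorb \<open>a b\<^sup>2 w\<close>
  into the square of \<open>C a b + b w\<close>, whose remaining terms are covered by \<open>C - w\<^sup>2 \<in> Q\<close> and the
  certificate.\<close>

lemma remove_positive_factor:
  assumes Q: "qmod_on (polys N) Q" and arch: "\<And>i. i < N \<Longrightarrow> \<exists>C. Const C - Var i * Var i \<in> Q"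
    and a: "a \<in> polys N" and b: "b \<in> polys N"
    and nz: "\<And>x. (\<And>q. q \<in> Q \<Longrightarrow> 0 \<le> reval x q) \<Longrightarrow> reval x a \<noteq> 0"
    and cert: "- (a * b * (a * b)) \<in> Q"
  shows "- (b * b) \<in> Q"
proof -
  note QD = qmod_onD[OF Q]
  \<comment> \<open>This contains both \<open>a\<close> and \<open>- a\<close>, so a point at which
    \<open>Q0\<close> is nonnegative would be a zero of \<open>a\<close>, which \<open>nz\<close>
    excludes; hence \<open>- 1\<close> belongs to it.\<close>
  define Q0 where "Q0 = {q + a * w | q w. q \<in> Q \<and> w \<in> polys N}"
  have Q0I: "q + a * w \<in> Q0" if "q \<in> Q" "w \<in> polys N" for q w using that unfolding Q0_def by blast
  have sub: "q \<in> Q0" if "q \<in> Q" for q using Q0I[OF that polysD(1)] by simp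
  have Q0: "qmod_on (polys N) Q0" unfolding qmod_on_def
  proof (intro conjI ballI)
    show "Q0 \<subseteq> polys N" unfolding Q0_def using QD(1) a by (auto intro!: polysD)
    show "1 \<in> Q0" by (rule sub[OF QD(2)])
    fix x assume "x \<in> Q0"
    then obtain q w where x: "x = q + a * w" "q \<in> Q" "w \<in> polys N" unfolding Q0_def by blast
    show "x + y \<in> Q0" if y: "y \<in> Q0" for y
    proof -
      obtain q' w' where "y = q' + a * w'" "q' \<in> Q" "w' \<in> polys N" using y unfolding Q0_def by blast
      then show ?thesis using Q0I[of "q + q'" "w + w'"] x QD(3) polysD(3) by (simp add: algebra_simps)
    qed
    show "c * c * x \<in> Q0" if "c \<in> polys N" for c
      using Q0I[of "c * c * q" "c * c * w"] x that QD(4) polysD(4) by (simp add: algebra_simps)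
  qed
  have "- 1 \<in> Q0"
  proof (rule ccontr)
    assume m1: "- 1 \<notin> Q0"
    have "\<exists>C. Const C - p \<in> Q0" if p: "p \<in> polys N" for p
    proof -
      obtain C where "Const C - p \<in> Q" using qmod_archimedean[OF Q arch p] ..
      then show ?thesis using sub by blast
    qed
    from qmod_point[OF Q0 m1 this] obtain x where "\<forall>q\<in>Q0. 0 \<le> reval x q" ..
    note x = bspec[OF this]
    interpret e: idom_hom "reval x" by (rule idom_hom_insertion_real)
    have "0 \<le> reval x (0 + a * 1)" "0 \<le> reval x (0 + a * (- 1))"
      by (intro x Q0I qmod_0[OF Q] polysD)+
    then have "reval x a = 0" by (simp add: e.hom_mult e.hom_uminus)
    then show False using nz x sub by blast
  qed
  then obtain q w where q: "- 1 = q + a * w" "q \<in> Q" "w \<in> polys N" unfolding Q0_def by blast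
  obtain C0 where C0: "Const C0 - w * w \<in> Q" using qmod_archimedean[OF Q arch polysD(4)[OF q(3,3)]] by blast
  \<comment> \<open>The maximum ensures \<open>C > 0\<close>, because \<open>1 / C\<close> occurs as
    a weight.\<close>
  define C where "C = max C0 1"
  have C: "C > 0" by (simp add: C_def)
  have "(Const C0 - w * w) + Const (C - C0) \<in> Q"
    by (intro QD(3)[OF C0] qmod_Const[OF Q]) (simp add: C_def)
  then have Cw: "Const C - w * w \<in> Q" by (simp add: Const_diff)
  have E1: "b * b * q \<in> Q" by (rule QD(4)[OF b q(2)])
  have E2: "(Const C * (a * b) + b * w) * (Const C * (a * b) + b * w) \<in> Q"
    by (intro QD(5) polysD Const_in_polys a b q)
  have E3: "b * b * (Const C - w * w) \<in> Q" by (rule QD(4)[OF b Cw])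
  \<comment> \<open>Since \<open>q = - 1 - a w\<close>, the cross term \<open>2 a b^2 w\<close> of
    the square cancels against \<open>2 b^2 q\<close>. The terms \<open>C a^2 b^2\<close> and
    \<open>b^2 w^2 / C\<close> cancel as well, and \<open>- 2 b^2 + b^2\<close> remains.\<close>
  have "Const 2 * (b * b * q) + Const (1 / C) * ((Const C * (a * b) + b * w) * (Const C * (a * b) + b * w))
      + Const C * (- (a * b * (a * b))) + Const (1 / C) * (b * b * (Const C - w * w)) \<in> Q"
    using C by (intro QD(3) qmod_scale[OF Q] E1 E2 E3 cert) simp_all
  also have "Const 2 * (b * b * q) + Const (1 / C) * ((Const C * (a * b) + b * w) * (Const C * (a * b) + b * w))
      + Const C * (- (a * b * (a * b))) + Const (1 / C) * (b * b * (Const C - w * w)) = - (b * b)"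
  proof -
    define D where "D = Const (1 / C)"
    define c where "c = Const C"
    have D: "D * c = 1" using C by (simp add: D_def c_def flip: Const_mult)
    have q': "q = - 1 - a * w" using q(1) by (simp add: algebra_simps)
    have 2: "Const 2 = 2" by (rule numeral_Const[OF Q, symmetric])
    have "2 * (b * b * q) + D * ((c * (a * b) + b * w) * (c * (a * b) + b * w)) + c * (- (a * b * (a * b))) + D * (b * b * (c - w * w))
      = 2 * (b * b * q) + (D * c) * (c * a * a * b * b + 2 * a * b * b * w + b * b) - c * a * a * b * b"
      by (simp add: algebra_simps)
    also have "\<dots> = - (b * b)" unfolding D q' by (simp add: algebra_simps)
    finally show ?thesis unfolding D_def[symmetric] c_def[symmetric] 2 .
  qed
  finally show ?thesis .
qed

section \<open>Exactness of the two relaxations\<close>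

lemma gpre_h_supp:
  assumes "q \<in> set h" "gpre N g h \<subseteq> P"
  shows "q \<in> supp P"
proof -
  obtain l where "l < length h" "q = h ! l" using assms(1) in_set_conv_nth by metis
  then have "q \<in> gpre N g h" "- q \<in> gpre N g h"
    using gpre.ideal[of 1 N l h g] gpre.ideal[of "- 1" N l h g] polysD(2,5) by simp_all
  then show ?thesis using assms(2) by (auto simp: supp_def)
qed

lemma gpre_contains:
  assumes "q \<in> set g"
  shows "q \<in> gpre N g h"
proof -
  obtain l where "l < length g" "q = g ! l" using assms in_set_conv_nth by metis
  then show ?thesis using gpre.generator[of 1 N "{l}" g h] polysD(2) by simp
qed

lemma prod_list_filter:
  fixes F :: "'b \<Rightarrow> 'a::comm_monoid_mult"
  shows "(\<Prod>t\<leftarrow>ts. F t) = (\<Prod>t\<leftarrow>filter P ts. F t) * (\<Prod>t\<leftarrow>filter (\<lambda>t. \<not> P t) ts. F t)"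
  by (induction ts) (simp_all add: mult_ac)

lemma exact_products_relaxation:
  assumes f: "f \<in> polys n" and g: "set g \<subseteq> polys n" and fin: "finite (peval f ` critical_set n g)"
    and min: "\<And>y. y \<in> feasible_set n g \<Longrightarrow> s \<le> peval f y"
  shows "\<exists>k. \<forall>e>0. f - Const (s - e) \<in> qt (n + length g + 1) (products g) (h_FJ n f g) k"
proof -
  let ?N = "n + length g + 1" and ?h = "h_FJ n f g"
  have f': "f \<in> polys ?N" and g': "set g \<subseteq> polys ?N" using f g polys_subset[of n ?N] by auto
  note h = h_FJ_polys[OF f g]
  have "\<exists>ts. (\<forall>t\<in>set ts. s \<le> t) \<and> - ((\<Prod>t\<leftarrow>ts. f - Const t) * (\<Prod>t\<leftarrow>ts. f - Const t)) \<in> gpre ?N g ?h"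
  proof (rule values_product_in_preorder[OF preorder_on_gpre[OF g' h] f'])
    fix P assume P: "prime_cone P" "gpre ?N g ?h \<subseteq> P"
    then have "set ?h \<subseteq> supp P" using gpre_h_supp by blast
    then obtain t where t: "f - Const t \<in> supp P" using real_value_of_objective[OF P(1) f g fin] by blast
    have "set g \<subseteq> P" using gpre_contains P(2) by blast
    then have "s \<le> t" using objective_value_bound[OF P(1) f g _ min t] by blast
    then show "\<exists>t. s \<le> t \<and> f - Const t \<in> supp P" using t by blast
  qed
  then obtain ts where ts: "\<forall>t\<in>set ts. s \<le> t"
    "- ((\<Prod>t\<leftarrow>ts. f - Const t) * (\<Prod>t\<leftarrow>ts. f - Const t)) \<in> gpre ?N g ?h" by blast
  show ?thesis
    by (rule objective_gap_in_qt[OF f' _ gpre_gmod_products[OF ts(2)]]) (use ts(1) in simp)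
qed

lemma exact_archimedean_relaxation:
  assumes f: "f \<in> polys n" and g: "set g \<subseteq> polys n" and fin: "finite (peval f ` critical_set n g)"
    and min: "\<And>y. y \<in> feasible_set n g \<Longrightarrow> s \<le> peval f y" and arch: "archimedean n g"
  shows "\<exists>k. \<forall>e>0. f - Const (s - e) \<in> qt (n + length g + 1) g (h_FJ n f g) k"
proof -
  let ?N = "n + length g + 1" and ?h = "h_FJ n f g"
  define M where "M = gmod ?N g ?h"
  have f': "f \<in> polys ?N" and g': "set g \<subseteq> polys ?N" using f g polys_subset[of n ?N] by auto
  note h = h_FJ_polys[OF f g]
  have "\<exists>ts. (\<forall>t\<in>set ts. True) \<and> - ((\<Prod>t\<leftarrow>ts. f - Const t) * (\<Prod>t\<leftarrow>ts. f - Const t)) \<in> gpre ?N [] ?h"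
  proof (rule values_product_in_preorder[OF preorder_on_gpre[OF _ h] f'])
    fix P assume P: "prime_cone P" "gpre ?N [] ?h \<subseteq> P"
    then have "set ?h \<subseteq> supp P" using gpre_h_supp by blast
    then show "\<exists>t. True \<and> f - Const t \<in> supp P" using real_value_of_objective[OF P(1) f g fin] by blast
  qed simp
  then obtain ts where ts: "- ((\<Prod>t\<leftarrow>ts. f - Const t) * (\<Prod>t\<leftarrow>ts. f - Const t)) \<in> gpre ?N [] ?h" by blast
  define us where "us = filter (\<lambda>t. \<not> t < s) ts"
  define a where "a = (\<Prod>t\<leftarrow>filter (\<lambda>t. t < s) ts. f - Const t)"
  define b where "b = (\<Prod>t\<leftarrow>us. f - Const t)"
  have "(\<Prod>t\<leftarrow>ts. f - Const t) = a * b" unfolding a_def b_def us_def by (rule prod_list_filter)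
  then have cert: "- (a * b * (a * b)) \<in> M" using gpre_Nil_gmod[OF ts] by (simp add: M_def)
  have "- (b * b) \<in> M" unfolding M_def
  proof (rule remove_positive_factor[OF qmod_on_gmod[OF g' h] gmod_archimedean[OF arch] _ _ _ cert[unfolded M_def]])
    show "a \<in> polys ?N" "b \<in> polys ?N" unfolding a_def b_def by (rule shifts_product_in_polys[OF f'])+
    fix x assume x: "\<And>q. q \<in> gmod ?N g ?h \<Longrightarrow> 0 \<le> reval x q"
    have "vec n x \<in> feasible_set n g"
    proof -
      have "0 \<le> peval (g ! j) (vec n x)" if j: "j < length g" for j
      proof -
        have "g ! j \<in> polys n" using g nth_mem[OF j] by blast
        then show ?thesis using x[OF gmod.generator[of 1 ?N j g ?h]] j polysD(2) by (simp add: peval_vec)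
      qed
      then show ?thesis by (simp add: feasible_set_def)
    qed
    then have "s \<le> reval x f" using min peval_vec[OF f] by metis
    moreover interpret e: idom_hom "reval x" by (rule idom_hom_insertion_real)
    have "reval x (\<Prod>t\<leftarrow>us. f - Const t) = (\<Prod>t\<leftarrow>us. reval x f - t)" for us
      by (induction us) (simp_all add: e.hom_mult e.hom_minus)
    ultimately show "reval x a \<noteq> 0" unfolding a_def by (auto simp: prod_list_zero_iff)
  qed
  then have "- ((\<Prod>t\<leftarrow>us. f - Const t) * (\<Prod>t\<leftarrow>us. f - Const t)) \<in> gmod ?N g ?h" by (simp add: b_def M_def)
  then show ?thesis by (rule objective_gap_in_qt[OF f', rotated]) (simp add: us_def)
qed

text \<open>The point \<open>z\<close> extends the minimizer by Fritz John multipliers. It satisfies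
  all equations and inequalities, so no relaxation value exceeds the minimum.\<close>

theorem exact_relaxations:
  assumes f: "f \<in> polys n" and g: "set g \<subseteq> polys n" and fin: "finite (peval f ` critical_set n g)"
    and x: "x \<in> feasible_set n g" and min: "\<And>y. y \<in> feasible_set n g \<Longrightarrow> peval f x \<le> peval f y"
  shows "\<exists>k. rho (n + length g + 1) k f (products g) (h_FJ n f g) = opt_value n f g"
    and "archimedean n g \<Longrightarrow> \<exists>k. rho (n + length g + 1) k f g (h_FJ n f g) = opt_value n f g"
proof -
  obtain z :: "real vec" where z: "\<And>i. i < n \<Longrightarrow> z $ i = x $ i" "\<And>q. q \<in> set (h_FJ n f g) \<Longrightarrow> peval q z = 0"
    using fritz_john[OF f g x min] by blast
  have fz: "peval f z = peval f x" by (rule peval_cong[OF f z(1)])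
  have gz: "0 \<le> peval (g ! j) z" if j: "j < length g" for j
  proof -
    have "peval (g ! j) z = peval (g ! j) x" using g nth_mem[OF j] by (intro peval_cong[of _ n] z(1)) auto
    then show ?thesis using x j by (simp add: feasible_set_def)
  qed
  have opt: "opt_value n f g = ereal (peval f x)" unfolding opt_value_def
    using min by (intro antisym INF_lower x INF_greatest) simp
  show "\<exists>k. rho (n + length g + 1) k f (products g) (h_FJ n f g) = opt_value n f g"
    unfolding opt by (rule rho_eq_if_gap_in_qt[OF exact_products_relaxation[OF f g fin min] products_nonneg[OF gz] z(2) fz])
  show "\<exists>k. rho (n + length g + 1) k f g (h_FJ n f g) = opt_value n f g" if a: "archimedean n g"
    unfolding opt
  proof (rule rho_eq_if_gap_in_qt[OF exact_archimedean_relaxation[OF f g fin min a] _ z(2) fz])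
    show "0 \<le> peval q z" if "q \<in> set g" for q using that gz unfolding in_set_conv_nth by blast
  qed
qed

section \<open>The Slater condition\<close>

lemma quadratic_form_sum:
  assumes "A \<in> carrier_mat d d" "v \<in> carrier_vec d"
  shows "v \<bullet> (A *\<^sub>v v) = (\<Sum>i<d. \<Sum>j<d. A $$ (i, j) * (v $ i * v $ j :: 'a::comm_ring_1))"
proof -
  have "v \<bullet> (A *\<^sub>v v) = (\<Sum>i<d. v $ i * (\<Sum>j<d. A $$ (i, j) * v $ j))"
    using assms by (simp add: scalar_prod_def lessThan_atLeast0)
  then show ?thesis by (simp add: sum_distrib_left mult_ac)
qed

lemma gram_poly_sum:
  assumes "A \<in> carrier_mat (dim_vec v) (dim_vec v)"
  shows "gram_poly v A = (\<Sum>i<dim_vec v. \<Sum>j<dim_vec v. Const (A $$ (i, j)) * (v $ i * v $ j))"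
proof -
  have "map_mat Const A \<in> carrier_mat (dim_vec v) (dim_vec v)" using assms by simp
  then have "gram_poly v A = (\<Sum>i<dim_vec v. \<Sum>j<dim_vec v. map_mat Const A $$ (i, j) * (v $ i * v $ j))"
    unfolding gram_poly_def by (rule quadratic_form_sum) auto
  also have "\<dots> = (\<Sum>i<dim_vec v. \<Sum>j<dim_vec v. Const (A $$ (i, j)) * (v $ i * v $ j))"
    using assms by (intro sum.cong) auto
  finally show ?thesis .
qed

lemma psd_carrier: "psd d A \<Longrightarrow> A \<in> carrier_mat d d"
  by (simp add: psd_def sym_mat_def)

lemma psd_alt:
  "psd d A \<longleftrightarrow> A \<in> carrier_mat d d \<and> (\<forall>i<d. \<forall>j<d. A $$ (i, j) = A $$ (j, i)) \<and>
     (\<forall>v. 0 \<le> (\<Sum>i<d. \<Sum>j<d. A $$ (i, j) * (v i * v j)))"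
proof -
  have "(\<forall>v\<in>carrier_vec d. 0 \<le> v \<bullet> (A *\<^sub>v v)) \<longleftrightarrow> (\<forall>v. 0 \<le> (\<Sum>i<d. \<Sum>j<d. A $$ (i, j) * (v i * v j)))"
    if A: "A \<in> carrier_mat d d"
  proof (intro iffI allI ballI)
    fix v assume *: "\<forall>v\<in>carrier_vec d. 0 \<le> v \<bullet> (A *\<^sub>v v)"
    show "0 \<le> (\<Sum>i<d. \<Sum>j<d. A $$ (i, j) * (v i * v j))"
      using *[rule_format, of "vec d v"] quadratic_form_sum[OF A, of "vec d v"] by simp
  next
    fix v :: "real vec"
    assume *: "\<forall>v. 0 \<le> (\<Sum>i<d. \<Sum>j<d. A $$ (i, j) * (v i * v j))" and v: "v \<in> carrier_vec d"
    show "0 \<le> v \<bullet> (A *\<^sub>v v)" using spec[OF *, of "\<lambda>i. v $ i"] quadratic_form_sum[OF A v] by simp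
  qed
  moreover have "transpose_mat A = A \<longleftrightarrow> (\<forall>i<d. \<forall>j<d. A $$ (i, j) = A $$ (j, i))" if "A \<in> carrier_mat d d"
    using that by (auto simp: mat_eq_iff)
  ultimately show ?thesis unfolding psd_def sym_mat_def by blast
qed

lemma psd_add: "psd d A \<Longrightarrow> psd d B \<Longrightarrow> psd d (A + B)"
  unfolding psd_alt by (auto simp: distrib_right sum.distrib add_nonneg_nonneg)

lemma psd_smult: "psd d A \<Longrightarrow> 0 \<le> c \<Longrightarrow> psd d (c \<cdot>\<^sub>m A)"
  unfolding psd_alt by (auto simp: mult.assoc sum_distrib_left[symmetric])

lemma psd_rank_one: "psd d (mat d d (\<lambda>(i, j). c i * c j))"
proof -
  have "(\<Sum>i<d. \<Sum>j<d. (c i * c j) * (v i * v j)) = (\<Sum>i<d. c i * v i) * (\<Sum>i<d. c i * v i)" for v :: "nat \<Rightarrow> real"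
    unfolding sum_product by (intro sum.cong) (auto simp: mult_ac)
  then show ?thesis unfolding psd_alt by simp
qed

lemma pos_def_one_add:
  assumes "psd d B"
  shows "pos_def d (1\<^sub>m d + B)"
proof -
  have B: "B \<in> carrier_mat d d" by (rule psd_carrier[OF assms])
  have "sym_mat d (1\<^sub>m d + B)"
    using assms by (auto simp: psd_alt sym_mat_def mat_eq_iff)
  moreover have "0 < v \<bullet> ((1\<^sub>m d + B) *\<^sub>v v)" if v: "v \<in> carrier_vec d" "v \<noteq> 0\<^sub>v d" for v
  proof -
    have "v \<bullet> ((1\<^sub>m d + B) *\<^sub>v v) = v \<bullet> v + v \<bullet> (B *\<^sub>v v)"
      using B v(1) by (simp add: add_mult_distrib_mat_vec[of _ d d] scalar_prod_add_distrib[of _ d])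
    moreover have "0 \<le> v \<bullet> (B *\<^sub>v v)" using assms v(1) by (simp add: psd_def)
    moreover have "0 < v \<bullet> v"
    proof -
      obtain i where "i < d" "v $ i \<noteq> 0" using v by (metis carrier_vecD eq_vecI index_zero_vec)
      then have "0 < (\<Sum>i<d. v $ i * v $ i)" by (intro sum_pos2[of _ i]) (auto simp: zero_less_mult_iff)
      then show ?thesis using v(1) by (simp add: scalar_prod_def lessThan_atLeast0)
    qed
    ultimately show ?thesis by linarith
  qed
  ultimately show ?thesis by (simp add: pos_def_def)
qed

lemma pos_def_psd: "pos_def d A \<Longrightarrow> psd d A"
  unfolding pos_def_def psd_def sym_mat_def
  by (metis less_imp_le mult_mat_vec_carrier order_refl scalar_prod_left_zero)

section \<open>Polynomials represented by Gram matrices\<close>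

definition grams :: "rpoly vec \<Rightarrow> rpoly set" where
  "grams v = gram_poly v ` {A. psd (dim_vec v) A}"

definition linear_combs :: "rpoly vec \<Rightarrow> rpoly set" where
  "linear_combs v = (\<lambda>u. map_vec Const u \<bullet> v) ` carrier_vec (dim_vec v)"

lemma gram_poly_add:
  "A \<in> carrier_mat (dim_vec v) (dim_vec v) \<Longrightarrow> B \<in> carrier_mat (dim_vec v) (dim_vec v) \<Longrightarrow>
    gram_poly v (A + B) = gram_poly v A + gram_poly v B"
  by (simp add: gram_poly_sum Const_add distrib_right sum.distrib)

lemma grams_add:
  assumes "p \<in> grams v" "q \<in> grams v"
  shows "p + q \<in> grams v"
proof -
  obtain A B where A: "psd (dim_vec v) A" "p = gram_poly v A" and B: "psd (dim_vec v) B" "q = gram_poly v B"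
    using assms unfolding grams_def by blast
  then have "p + q = gram_poly v (A + B)" using psd_carrier by (simp add: gram_poly_add)
  then show ?thesis unfolding grams_def using psd_add[OF A(1) B(1)] by blast
qed

lemma grams_scale:
  assumes "p \<in> grams v" "0 \<le> c"
  shows "Const c * p \<in> grams v"
proof -
  obtain A where A: "psd (dim_vec v) A" "p = gram_poly v A" using assms unfolding grams_def by blast
  then have "Const c * p = gram_poly v (c \<cdot>\<^sub>m A)"
    using psd_carrier[OF A(1)] by (simp add: gram_poly_sum Const_mult sum_distrib_left mult_ac)
  then show ?thesis unfolding grams_def using psd_smult[OF A(1) assms(2)] by blast
qed

lemma grams_square: "(\<Sum>i<dim_vec v. Const (c i) * v $ i) * (\<Sum>i<dim_vec v. Const (c i) * v $ i) \<in> grams v"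
proof -
  let ?d = "dim_vec v"
  have "gram_poly v (mat ?d ?d (\<lambda>(i, j). c i * c j)) =
    (\<Sum>i<?d. Const (c i) * v $ i) * (\<Sum>i<?d. Const (c i) * v $ i)"
    unfolding sum_product by (subst gram_poly_sum) (auto simp: Const_mult mult_ac intro!: sum.cong)
  then show ?thesis unfolding grams_def using psd_rank_one by (metis (mono_tags) image_eqI mem_Collect_eq)
qed

lemma linear_combs_sum: "(\<Sum>i<dim_vec v. Const (c i) * v $ i) \<in> linear_combs v"
proof -
  have "map_vec Const (vec (dim_vec v) c) \<bullet> v = (\<Sum>i<dim_vec v. Const (c i) * v $ i)"
    by (simp add: scalar_prod_def lessThan_atLeast0)
  then show ?thesis unfolding linear_combs_def
    by (intro image_eqI[of _ _ "vec (dim_vec v) c"]) simp_all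
qed

lemma linear_combsE:
  assumes "p \<in> linear_combs v"
  obtains c where "p = (\<Sum>i<dim_vec v. Const (c i) * v $ i)"
proof -
  obtain u where u: "u \<in> carrier_vec (dim_vec v)" "p = map_vec Const u \<bullet> v"
    using assms unfolding linear_combs_def by blast
  have "p = (\<Sum>i<dim_vec v. Const (u $ i) * v $ i)"
    using u by (auto simp: scalar_prod_def lessThan_atLeast0 intro!: sum.cong)
  then show thesis by (rule that)
qed

lemma linear_combs_add: "p \<in> linear_combs v \<Longrightarrow> q \<in> linear_combs v \<Longrightarrow> p + q \<in> linear_combs v"
proof (elim linear_combsE)
  fix c e assume *: "p = (\<Sum>i<dim_vec v. Const (c i) * v $ i)" "q = (\<Sum>i<dim_vec v. Const (e i) * v $ i)"
  show ?thesis using linear_combs_sum[of "\<lambda>i. c i + e i" v] by (simp add: * Const_add distrib_right sum.distrib)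
qed

lemma linear_combs_scale: "p \<in> linear_combs v \<Longrightarrow> Const s * p \<in> linear_combs v"
proof (elim linear_combsE)
  fix c assume *: "p = (\<Sum>i<dim_vec v. Const (c i) * v $ i)"
  show ?thesis using linear_combs_sum[of "\<lambda>i. s * c i" v] by (simp add: * Const_mult sum_distrib_left mult.assoc)
qed

lemma mono_vec_entry:
  assumes "i < dim_vec (mono_vec N d)"
  obtains t where "t \<in> monomials N d" "mono_vec N d $ i = Poly_Mapping.single t 1"
proof -
  define xs where "xs = sorted_list_of_set (monomials N d)"
  have i: "i < length xs" using assms by (simp add: mono_vec_def xs_def)
  have "mono_vec N d $ i = Poly_Mapping.single (xs ! i) 1"
    using i by (simp add: mono_vec_def xs_def vec_of_list_index)
  moreover have "xs ! i \<in> monomials N d" using nth_mem[OF i] finite_monomials by (simp add: xs_def)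
  ultimately show thesis using that by blast
qed

lemma poly_eq_mono_vec_comb:
  assumes p: "p \<in> polys N" "int (deg p) \<le> d"
  shows "\<exists>c. p = (\<Sum>i<dim_vec (mono_vec N d). Const (c i) * mono_vec N d $ i)"
proof -
  define xs where "xs = sorted_list_of_set (monomials N d)"
  have set: "set xs = monomials N d" "distinct xs" using finite_monomials by (simp_all add: xs_def)
  have "t \<in> monomials N d" if t: "t \<in> Poly_Mapping.keys p" for t
  proof -
    have "mono_deg t \<le> deg p" using deg_le_iff[of p "deg p"] t by simp
    then show ?thesis using p t by (auto simp: monomials_def polys_def)
  qed
  then have sub: "Poly_Mapping.keys p \<subseteq> monomials N d" by blast
  have "p = (\<Sum>t\<in>Poly_Mapping.keys p. Poly_Mapping.single t (Poly_Mapping.lookup p t))"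
    by (rule poly_mapping_sum_monomials[symmetric])
  also have "\<dots> = (\<Sum>t\<in>monomials N d. Poly_Mapping.single t (Poly_Mapping.lookup p t))"
    using sub finite_monomials by (intro sum.mono_neutral_left) (auto simp: in_keys_iff)
  also have "\<dots> = (\<Sum>t\<leftarrow>xs. Poly_Mapping.single t (Poly_Mapping.lookup p t))"
    using set by (metis sum_list_distinct_conv_sum_set)
  also have "\<dots> = (\<Sum>i<length xs. Poly_Mapping.single (xs ! i) (Poly_Mapping.lookup p (xs ! i)))"
    by (simp add: sum_list_sum_nth lessThan_atLeast0)
  also have "\<dots> = (\<Sum>i<dim_vec (mono_vec N d). Const (Poly_Mapping.lookup p (xs ! i)) * mono_vec N d $ i)"
    by (intro sum.cong) (simp_all add: mono_vec_def xs_def vec_of_list_index Const_def mult_single)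
  finally show ?thesis by (rule exI[of _ "\<lambda>i. Poly_Mapping.lookup p (xs ! i)"])
qed

lemma square_in_grams:
  assumes "p \<in> polys N" "int (deg p) \<le> d"
  shows "p * p \<in> grams (mono_vec N d)"
proof -
  obtain c where "p = (\<Sum>i<dim_vec (mono_vec N d). Const (c i) * mono_vec N d $ i)"
    using poly_eq_mono_vec_comb[OF assms] ..
  then show ?thesis using grams_square[of c "mono_vec N d"] by simp
qed

lemma poly_in_linear_combs:
  assumes "p \<in> polys N" "int (deg p) \<le> d"
  shows "p \<in> linear_combs (mono_vec N d)"
proof -
  obtain c where "p = (\<Sum>i<dim_vec (mono_vec N d). Const (c i) * mono_vec N d $ i)"
    using poly_eq_mono_vec_comb[OF assms] ..
  then show ?thesis using linear_combs_sum[of c "mono_vec N d"] by simp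
qed

text \<open>What the program can represent, with its own degree bounds; for equations of odd degree
  these are smaller than in \<open>tideal\<close>.\<close>

definition sdp_cone :: "nat \<Rightarrow> nat \<Rightarrow> rpoly list \<Rightarrow> rpoly list \<Rightarrow> rpoly set" where
  "sdp_cone N k G h = {s0 + (\<Sum>j<length G. G ! j * s j) + (\<Sum>t<length h. h ! t * p t) | s0 s p.
     s0 \<in> grams (mono_vec N (int k)) \<and>
     (\<forall>j<length G. s j \<in> grams (mono_vec N (int k - half_deg (G ! j)))) \<and>
     (\<forall>t<length h. p t \<in> linear_combs (mono_vec N (2 * (int k - half_deg (h ! t)))))}"

lemma sdp_coneI:
  assumes "q = s0 + (\<Sum>j<length G. G ! j * s j) + (\<Sum>t<length h. h ! t * p t)"
    "s0 \<in> grams (mono_vec N (int k))"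
    "\<And>j. j < length G \<Longrightarrow> s j \<in> grams (mono_vec N (int k - half_deg (G ! j)))"
    "\<And>t. t < length h \<Longrightarrow> p t \<in> linear_combs (mono_vec N (2 * (int k - half_deg (h ! t))))"
  shows "q \<in> sdp_cone N k G h"
  unfolding sdp_cone_def mem_Collect_eq using assms by (intro exI conjI allI impI)

lemma sdp_coneE:
  assumes "q \<in> sdp_cone N k G h"
  obtains s0 s p where "q = s0 + (\<Sum>j<length G. G ! j * s j) + (\<Sum>t<length h. h ! t * p t)"
    "s0 \<in> grams (mono_vec N (int k))"
    "\<forall>j<length G. s j \<in> grams (mono_vec N (int k - half_deg (G ! j)))"
    "\<forall>t<length h. p t \<in> linear_combs (mono_vec N (2 * (int k - half_deg (h ! t))))"
  using assms unfolding sdp_cone_def mem_Collect_eq by (elim exE conjE) (rule that)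

lemma sdp_cone_add:
  assumes "q \<in> sdp_cone N k G h" "r \<in> sdp_cone N k G h"
  shows "q + r \<in> sdp_cone N k G h"
proof -
  from assms(1) obtain s0 s p where q: "q = s0 + (\<Sum>j<length G. G ! j * s j) + (\<Sum>t<length h. h ! t * p t)"
    "s0 \<in> grams (mono_vec N (int k))"
    "\<forall>j<length G. s j \<in> grams (mono_vec N (int k - half_deg (G ! j)))"
    "\<forall>t<length h. p t \<in> linear_combs (mono_vec N (2 * (int k - half_deg (h ! t))))"
    by (rule sdp_coneE)
  from assms(2) obtain s0' s' p' where r: "r = s0' + (\<Sum>j<length G. G ! j * s' j) + (\<Sum>t<length h. h ! t * p' t)"
    "s0' \<in> grams (mono_vec N (int k))"
    "\<forall>j<length G. s' j \<in> grams (mono_vec N (int k - half_deg (G ! j)))"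
    "\<forall>t<length h. p' t \<in> linear_combs (mono_vec N (2 * (int k - half_deg (h ! t))))"
    by (rule sdp_coneE)
  show ?thesis
    by (rule sdp_coneI[of _ "s0 + s0'" G "\<lambda>j. s j + s' j" h "\<lambda>t. p t + p' t"])
       (simp_all add: q(1) r(1) distrib_left sum.distrib grams_add linear_combs_add q r del: right_diff_distrib_numeral)
qed

lemma sdp_cone_scale:
  assumes "q \<in> sdp_cone N k G h" "0 \<le> c"
  shows "Const c * q \<in> sdp_cone N k G h"
proof -
  from assms(1) obtain s0 s p where q: "q = s0 + (\<Sum>j<length G. G ! j * s j) + (\<Sum>t<length h. h ! t * p t)"
    "s0 \<in> grams (mono_vec N (int k))"
    "\<forall>j<length G. s j \<in> grams (mono_vec N (int k - half_deg (G ! j)))"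
    "\<forall>t<length h. p t \<in> linear_combs (mono_vec N (2 * (int k - half_deg (h ! t))))"
    by (rule sdp_coneE)
  show ?thesis
    by (rule sdp_coneI[of _ "Const c * s0" G "\<lambda>j. Const c * s j" h "\<lambda>t. Const c * p t"])
       (simp_all add: q(1) distrib_left sum_distrib_left mult.left_commute grams_scale linear_combs_scale q assms(2) del: right_diff_distrib_numeral)
qed

lemma zero_in_grams: "0 \<in> grams v"
  using grams_square[of "\<lambda>_. 0" v] by simp

lemma zero_in_linear_combs: "0 \<in> linear_combs v"
  using linear_combs_sum[of "\<lambda>_. 0" v] by simp

lemma sdp_cone_square:
  assumes "p \<in> polys N" "deg p \<le> k"
  shows "p * p \<in> sdp_cone N k G h"
  by (rule sdp_coneI[of _ "p * p" G "\<lambda>_. 0" h "\<lambda>_. 0"])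
     (simp_all add: square_in_grams assms zero_in_grams zero_in_linear_combs)

lemma sdp_cone_generator:
  assumes p: "p \<in> polys N" "int (deg p) \<le> int k - half_deg (G ! l)" and l: "l < length G"
  shows "p * p * G ! l \<in> sdp_cone N k G h"
proof (rule sdp_coneI[of _ 0 G "\<lambda>j. if j = l then p * p else 0" h "\<lambda>_. 0"])
  have "(\<Sum>j<length G. G ! j * (if j = l then p * p else 0)) = G ! l * (p * p)"
    using l by (subst sum.remove[of _ l]) auto
  then show "p * p * G ! l = 0 + (\<Sum>j<length G. G ! j * (if j = l then p * p else 0)) + (\<Sum>t<length h. h ! t * 0)"
    by (simp add: mult.commute)
qed (simp_all add: zero_in_grams zero_in_linear_combs square_in_grams p)

lemma sdp_cone_ideal:
  assumes p: "p \<in> polys N" "int (deg p) \<le> 2 * (int k - half_deg (h ! l))" and l: "l < length h"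
  shows "p * h ! l \<in> sdp_cone N k G h"
proof (rule sdp_coneI[of _ 0 G "\<lambda>_. 0" h "\<lambda>t. if t = l then p else 0"])
  have "(\<Sum>t<length h. h ! t * (if t = l then p else 0)) = h ! l * p"
    using l by (subst sum.remove[of _ l]) auto
  then show "p * h ! l = 0 + (\<Sum>j<length G. G ! j * 0) + (\<Sum>t<length h. h ! t * (if t = l then p else 0))"
    by (simp add: mult.commute)
qed (simp_all add: zero_in_grams zero_in_linear_combs poly_in_linear_combs p del: right_diff_distrib_numeral)

lemma gram_poly_one: "gram_poly v (1\<^sub>m (dim_vec v)) = (\<Sum>i<dim_vec v. v $ i * v $ i)"
proof -
  have "gram_poly v (1\<^sub>m (dim_vec v)) = (\<Sum>i<dim_vec v. \<Sum>j<dim_vec v. if j = i then v $ i * v $ j else 0)"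
    by (subst gram_poly_sum, simp, intro sum.cong refl) auto
  then show ?thesis by simp
qed

text \<open>One identity matrix per Gram matrix is set aside, and the rest is represented, up to the
  constant \<open>C\<close>, with positive semidefinite matrices. Adding the identities back makes
  them positive definite; the feasible value is \<open>- C\<close>.\<close>

lemma slater_if_bounded:
  assumes f: "f - gram_poly (mono_vec N (int k)) (1\<^sub>m (dim_vec (mono_vec N (int k))))
      - (\<Sum>j<length G. G ! j * gram_poly (mono_vec N (int k - half_deg (G ! j)))
          (1\<^sub>m (dim_vec (mono_vec N (int k - half_deg (G ! j)))))) + Const C \<in> sdp_cone N k G h"
  shows "slater N k f G h"
proof -
  let ?v = "mono_vec N (int k)" and ?w = "\<lambda>j. mono_vec N (int k - half_deg (G ! j))"
    and ?x = "\<lambda>t. mono_vec N (2 * (int k - half_deg (h ! t)))"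
  from f obtain s0 s p where q: "f - gram_poly ?v (1\<^sub>m (dim_vec ?v))
      - (\<Sum>j<length G. G ! j * gram_poly (?w j) (1\<^sub>m (dim_vec (?w j)))) + Const C
      = s0 + (\<Sum>j<length G. G ! j * s j) + (\<Sum>t<length h. h ! t * p t)"
    "s0 \<in> grams ?v" "\<forall>j<length G. s j \<in> grams (?w j)"
    "\<forall>t<length h. p t \<in> linear_combs (?x t)"
    by (rule sdp_coneE)
  obtain B0 where B0: "psd (dim_vec ?v) B0" "s0 = gram_poly ?v B0" using q(2) unfolding grams_def by blast
  have "\<forall>j\<in>{..<length G}. \<exists>B. psd (dim_vec (?w j)) B \<and> s j = gram_poly (?w j) B"
  proof
    fix j assume "j \<in> {..<length G}"
    then have "s j \<in> grams (?w j)" using q(3) by simp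
    then show "\<exists>B. psd (dim_vec (?w j)) B \<and> s j = gram_poly (?w j) B" by (auto simp: grams_def)
  qed
  from bchoice[OF this] obtain B
    where B: "\<And>j. j < length G \<Longrightarrow> psd (dim_vec (?w j)) (B j) \<and> s j = gram_poly (?w j) (B j)" by auto
  have "\<forall>t\<in>{..<length h}. \<exists>u. u \<in> carrier_vec (dim_vec (?x t)) \<and> p t = map_vec Const u \<bullet> ?x t"
  proof
    fix t assume "t \<in> {..<length h}"
    then have "p t \<in> linear_combs (?x t)" using q(4) by simp
    then show "\<exists>u. u \<in> carrier_vec (dim_vec (?x t)) \<and> p t = map_vec Const u \<bullet> ?x t"
      by (auto simp: linear_combs_def)
  qed
  from bchoice[OF this] obtain u
    where u: "\<And>t. t < length h \<Longrightarrow> u t \<in> carrier_vec (dim_vec (?x t)) \<and> p t = map_vec Const (u t) \<bullet> ?x t" by auto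
  define A0 where "A0 = 1\<^sub>m (dim_vec ?v) + B0"
  define A where "A = (\<lambda>j. 1\<^sub>m (dim_vec (?w j)) + B j)"
  have A0: "pos_def (dim_vec ?v) A0" unfolding A0_def by (rule pos_def_one_add[OF B0(1)])
  have A: "pos_def (dim_vec (?w j)) (A j)" if "j < length G" for j
    unfolding A_def using pos_def_one_add B[OF that] by blast
  have "gram_poly ?v A0 = gram_poly ?v (1\<^sub>m (dim_vec ?v)) + s0"
    unfolding A0_def B0(2) by (rule gram_poly_add) (simp_all add: psd_carrier[OF B0(1)])
  moreover have "G ! j * gram_poly (?w j) (A j) = G ! j * gram_poly (?w j) (1\<^sub>m (dim_vec (?w j))) + G ! j * s j"
    if "j < length G" for j
  proof -
    have "gram_poly (?w j) (A j) = gram_poly (?w j) (1\<^sub>m (dim_vec (?w j))) + gram_poly (?w j) (B j)"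
      unfolding A_def using B[OF that] psd_carrier by (intro gram_poly_add) auto
    then show ?thesis using B[OF that] by (simp add: distrib_left)
  qed
  then have "(\<Sum>j<length G. G ! j * gram_poly (?w j) (A j))
      = (\<Sum>j<length G. G ! j * gram_poly (?w j) (1\<^sub>m (dim_vec (?w j)))) + (\<Sum>j<length G. G ! j * s j)"
    by (simp add: sum.distrib)
  moreover have "(\<Sum>t<length h. h ! t * (map_vec Const (u t) \<bullet> ?x t)) = (\<Sum>t<length h. h ! t * p t)"
    using u by (intro sum.cong) auto
  moreover have "Const (- C) = - Const C" by (rule Const_uminus)
  ultimately have "f - Const (- C) = gram_poly ?v A0 + (\<Sum>j<length G. G ! j * gram_poly (?w j) (A j))
      + (\<Sum>t<length h. h ! t * (map_vec Const (u t) \<bullet> ?x t))"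
    using q(1) by (simp add: algebra_simps)
  then have "sos_feasible N k f G h (- C) A0 A u"
    unfolding sos_feasible_def using A0 A u pos_def_psd by simp
  then show ?thesis unfolding slater_def using A0 A by blast
qed

section \<open>Bounding monomials within the cone of the program\<close>

lemma mono_deg_SucE:
  assumes "mono_deg t = Suc d"
  obtains i s where "t = Poly_Mapping.single i 1 + s" "mono_deg s = d" "Poly_Mapping.keys t = insert i (Poly_Mapping.keys s)"
proof -
  obtain i where i: "Poly_Mapping.lookup t i \<noteq> 0"
    using assms by (metis mono_deg_def in_keys_iff nat.simps(3) sum.neutral)
  define s where "s = t - Poly_Mapping.single i 1"
  have t: "t = Poly_Mapping.single i 1 + s"
    using i by (intro poly_mapping_eqI) (auto simp: s_def lookup_add lookup_minus lookup_single when_def)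
  have "mono_deg (Poly_Mapping.single i (1 :: nat)) = 1" by (simp add: mono_deg_def)
  then have "mono_deg s = d" using assms mono_deg_add[of "Poly_Mapping.single i 1" s] t by simp
  moreover have "Poly_Mapping.keys t = insert i (Poly_Mapping.keys s)"
    unfolding t by (auto simp: in_keys_iff lookup_add lookup_single when_def split: if_splits)
  ultimately show thesis using t that by blast
qed

text \<open>Applied with \<open>a = b = k\<close>, this reduces monomials of degree up to
  \<open>2 k\<close> to squares of monomials of degree up to \<open>k\<close>.\<close>

lemma mono_deg_split:
  "mono_deg t \<le> a + b \<Longrightarrow> \<exists>r s. t = r + s \<and> mono_deg r \<le> a \<and> mono_deg s \<le> b \<and> Poly_Mapping.keys t = Poly_Mapping.keys r \<union> Poly_Mapping.keys s"
proof (induction a arbitrary: t)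
  case 0
  then show ?case by (intro exI[of _ 0] exI[of _ t]) (simp add: mono_deg_def)
next
  case (Suc a)
  show ?case
  proof (cases "mono_deg t")
    case 0
    then show ?thesis by (intro exI[of _ 0] exI[of _ t]) (simp add: mono_deg_def)
  next
    case (Suc d)
    then obtain i t' where t: "t = Poly_Mapping.single i 1 + t'" "mono_deg t' = d"
      "Poly_Mapping.keys t = insert i (Poly_Mapping.keys t')" by (rule mono_deg_SucE)
    obtain r s where rs: "t' = r + s" "mono_deg r \<le> a" "mono_deg s \<le> b"
      "Poly_Mapping.keys t' = Poly_Mapping.keys r \<union> Poly_Mapping.keys s"
      using Suc.IH[of t'] Suc.prems Suc t(2) by auto
    define r' where "r' = Poly_Mapping.single i 1 + r"
    have "mono_deg (Poly_Mapping.single i (1 :: nat)) = 1" by (simp add: mono_deg_def)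
    then have "mono_deg r' \<le> Suc a" using rs(2) by (simp add: r'_def mono_deg_add)
    moreover have "Poly_Mapping.keys r' = insert i (Poly_Mapping.keys r)"
      by (auto simp: r'_def in_keys_iff lookup_add lookup_single when_def split: if_splits)
    moreover have "t = r' + s" using t(1) rs(1) by (simp add: r'_def add.assoc)
    ultimately show ?thesis using rs(3,4) t(3) by (intro exI[of _ r'] exI[of _ s]) auto
  qed
qed

text \<open>The bound on a variable is assumed for all multiples by \<open>p * p\<close>, since the
  truncated cone is not closed under such multiplication; \<open>Suc (deg p) \<le> k\<close> leaves
  room for one more variable.\<close>

context
  fixes N k :: nat and G h :: "rpoly list"
  assumes variables_bounded: "\<And>i p. i < N \<Longrightarrow> p \<in> polys N \<Longrightarrow> Suc (deg p) \<le> k \<Longrightarrow>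
    \<exists>C\<ge>0. Const C * (p * p) - (Var i * p) * (Var i * p) \<in> sdp_cone N k G h"
begin

abbreviation "monomial t \<equiv> Poly_Mapping.single t (1 :: real)"

lemma monomial_in_polys: "Poly_Mapping.keys t \<subseteq> {..<N} \<Longrightarrow> monomial t \<in> polys N"
  by (simp add: polys_def)

lemma deg_monomial: "deg (monomial t) = mono_deg t"
  by (simp add: Defs.deg_def)

lemma sdp_cone_Const: "0 \<le> c \<Longrightarrow> Const c \<in> sdp_cone N k G h"
  using sdp_cone_square[of "Const (sqrt c)" N k G h] by (simp add: Const_in_polys flip: Const_mult)

text \<open>Induction on the degree: for \<open>t = x s\<close> with a variable \<open>x\<close>,
  \<open>R C - t^2 = R (C - s^2) + (R s^2 - x^2 s^2)\<close>.\<close>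

lemma monomial_square_bounded:
  "Poly_Mapping.keys t \<subseteq> {..<N} \<Longrightarrow> mono_deg t \<le> k \<Longrightarrow> \<exists>C. Const C - monomial t * monomial t \<in> sdp_cone N k G h"
proof (induction "mono_deg t" arbitrary: t)
  case 0
  then have "t = 0" by (auto simp: mono_deg_def in_keys_iff intro!: poly_mapping_eqI)
  then have "monomial t = Const 1" by (simp add: Const_def)
  then have "Const 1 - monomial t * monomial t = Const 0" by simp
  then show ?case using sdp_cone_Const[of 0] by (intro exI[of _ 1]) simp
next
  case (Suc d)
  obtain i s where t: "t = Poly_Mapping.single i 1 + s" "mono_deg s = d"
    "Poly_Mapping.keys t = insert i (Poly_Mapping.keys s)" using Suc(2)[symmetric] by (rule mono_deg_SucE)
  have m: "monomial t = Var i * monomial s" by (simp add: t(1) Var_def mult_single)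
  have s: "Poly_Mapping.keys s \<subseteq> {..<N}" "i < N" using t(3) Suc.prems by auto
  obtain C where C: "Const C - monomial s * monomial s \<in> sdp_cone N k G h"
    using Suc(1)[OF t(2)[symmetric] s(1)] t(2) Suc by auto
  obtain R where R: "R \<ge> 0" "Const R * (monomial s * monomial s) - (Var i * monomial s) * (Var i * monomial s) \<in> sdp_cone N k G h"
    using variables_bounded[OF s(2) monomial_in_polys[OF s(1)]] Suc t(2) by (auto simp: deg_monomial)
  have "Const R * (Const C - monomial s * monomial s)
      + (Const R * (monomial s * monomial s) - (Var i * monomial s) * (Var i * monomial s)) \<in> sdp_cone N k G h"
    by (intro sdp_cone_add sdp_cone_scale C R)
  also have "Const R * (Const C - monomial s * monomial s)
      + (Const R * (monomial s * monomial s) - (Var i * monomial s) * (Var i * monomial s))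
      = Const (R * C) - monomial t * monomial t"
    unfolding m by (simp add: Const_mult algebra_simps)
  finally show ?case by blast
qed

text \<open>For \<open>t = r s\<close> and \<open>e = sgn c\<close>, the product of
  \<open>\<bar>c\<bar> / 2\<close> with \<open>(r + e s)^2 + (C - r^2) + (D - s^2)\<close> is
  \<open>c t\<close> plus a constant.\<close>

lemma monomial_bounded:
  assumes t: "Poly_Mapping.keys t \<subseteq> {..<N}" "mono_deg t \<le> 2 * k"
  shows "\<exists>C. Const C + Const c * monomial t \<in> sdp_cone N k G h"
proof -
  obtain r s where rs: "t = r + s" "mono_deg r \<le> k" "mono_deg s \<le> k"
    "Poly_Mapping.keys t = Poly_Mapping.keys r \<union> Poly_Mapping.keys s"
    using mono_deg_split[of t k k] t(2) by auto
  have k: "Poly_Mapping.keys r \<subseteq> {..<N}" "Poly_Mapping.keys s \<subseteq> {..<N}" using t(1) rs(4) by auto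
  obtain C D where CD: "Const C - monomial r * monomial r \<in> sdp_cone N k G h"
    "Const D - monomial s * monomial s \<in> sdp_cone N k G h"
    using monomial_square_bounded[OF k(1) rs(2)] monomial_square_bounded[OF k(2) rs(3)] by blast
  have m: "monomial t = monomial r * monomial s" by (simp add: rs(1) mult_single)
  define e where "e = sgn c"
  define q where "q = monomial r + Const e * monomial s"
  have "deg q \<le> k" unfolding q_def using rs deg_Const_mult[of e "monomial s"]
    by (intro deg_add) (auto simp: deg_monomial)
  moreover have "q \<in> polys N" unfolding q_def by (intro polysD Const_in_polys monomial_in_polys k)
  ultimately have q: "q * q \<in> sdp_cone N k G h" by (intro sdp_cone_square)
  have e: "c = \<bar>c\<bar> * e" "\<bar>c\<bar> / 2 * e * e = \<bar>c\<bar> / 2" by (auto simp: e_def sgn_if)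
  have "Const (\<bar>c\<bar> / 2) * (q * q + ((Const C - monomial r * monomial r) + (Const D - monomial s * monomial s))) \<in> sdp_cone N k G h"
    by (intro sdp_cone_scale sdp_cone_add q CD) simp
  also have "Const (\<bar>c\<bar> / 2) * (q * q + ((Const C - monomial r * monomial r) + (Const D - monomial s * monomial s)))
    = Const (\<bar>c\<bar> / 2 * (C + D)) + Const c * monomial t"
  proof -
    define H where "H = Const (\<bar>c\<bar> / 2)"
    define E where "E = Const e"
    have HE: "H * E * E = H" by (simp only: H_def E_def Const_mult[symmetric] e(2))
    have cE: "Const c = 2 * H * E"
    proof -
      have "2 * H = Const \<bar>c\<bar>" unfolding H_def by (simp add: mult_2 flip: Const_add)
      then show ?thesis unfolding E_def using trans[OF arg_cong[OF e(1), of Const] Const_mult] by simp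
    qed
    have CDe: "Const (\<bar>c\<bar> / 2 * (C + D)) = H * (Const C + Const D)" by (simp only: H_def Const_mult Const_add)
    have "H * (q * q + ((Const C - monomial r * monomial r) + (Const D - monomial s * monomial s)))
      = H * (Const C + Const D) + 2 * H * E * (monomial r * monomial s) + (H * E * E - H) * (monomial s * monomial s)"
      unfolding q_def E_def[symmetric] by (simp add: algebra_simps)
    then show ?thesis unfolding H_def[symmetric] cE CDe m HE by simp
  qed
  finally show ?thesis by blast
qed

lemma poly_bounded:
  assumes p: "p \<in> polys N" "deg p \<le> 2 * k"
  shows "\<exists>C. p + Const C \<in> sdp_cone N k G h"
proof -
  have key: "Poly_Mapping.keys t \<subseteq> {..<N}" "mono_deg t \<le> 2 * k" if "t \<in> Poly_Mapping.keys p" for t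
    using that p deg_le_iff[of p "2 * k"] by (auto simp: polys_def)
  have "\<exists>C. (\<Sum>t\<in>T. Const (Poly_Mapping.lookup p t) * monomial t) + Const C \<in> sdp_cone N k G h"
    if "T \<subseteq> Poly_Mapping.keys p" "finite T" for T
    using that(2,1)
  proof (induction T)
    case empty
    then show ?case using sdp_cone_Const[of 0] by (intro exI[of _ 0]) simp
  next
    case (insert t T)
    then have T: "t \<in> Poly_Mapping.keys p" "T \<subseteq> Poly_Mapping.keys p" by simp_all
    obtain C where C: "(\<Sum>t\<in>T. Const (Poly_Mapping.lookup p t) * monomial t) + Const C \<in> sdp_cone N k G h"
      using insert.IH[OF T(2)] ..
    obtain D where "Const D + Const (Poly_Mapping.lookup p t) * monomial t \<in> sdp_cone N k G h"
      using monomial_bounded[OF key[OF T(1)]] ..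
    with C have "((\<Sum>t\<in>T. Const (Poly_Mapping.lookup p t) * monomial t) + Const C)
      + (Const D + Const (Poly_Mapping.lookup p t) * monomial t) \<in> sdp_cone N k G h" by (rule sdp_cone_add)
    then show ?case using insert.hyps by (intro exI[of _ "C + D"]) (simp add: Const_add add_ac)
  qed
  from this[OF order_refl] show ?thesis using poly_mapping_sum_monomials[of p] by (simp add: Const_def mult_single)
qed

end

lemma half_deg_le_1: "deg p \<le> 2 \<Longrightarrow> half_deg p \<le> 1"
  by (simp add: half_deg_def ceiling_le_iff)

lemma deg_le_half_deg: "int (deg p) \<le> 2 * half_deg p"
  unfolding half_deg_def by linarith

lemma deg_Var_square: "deg ((Var i)\<^sup>2) \<le> 2"
proof -
  have "deg (Var i) \<le> 1" unfolding deg_le_iff by (simp add: Var_def mono_deg_def)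
  then show ?thesis using deg_mult[of "Var i" "Var i"] by (simp add: power2_eq_square)
qed

text \<open>If \<open>d\<close> is negative, the vector of monomials is empty and the product is 0;
  so constraints of degree larger than \<open>2 k\<close> cause no exception.\<close>

lemma gram_one_polys:
  assumes "p \<in> polys N" "d + half_deg p \<le> int k"
  shows "p * gram_poly (mono_vec N d) (1\<^sub>m (dim_vec (mono_vec N d))) \<in> polys N"
    and "deg (p * gram_poly (mono_vec N d) (1\<^sub>m (dim_vec (mono_vec N d)))) \<le> 2 * k"
proof -
  let ?v = "mono_vec N d"
  have *: "p * (?v $ i * ?v $ i) \<in> polys N \<and> deg (p * (?v $ i * ?v $ i)) \<le> 2 * k" if i: "i < dim_vec ?v" for i
  proof -
    obtain t where t: "t \<in> monomials N d" "?v $ i = Poly_Mapping.single t 1" using i by (rule mono_vec_entry)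
    have "?v $ i \<in> polys N" using t by (simp add: polys_def monomials_def)
    moreover have "int (deg (?v $ i)) \<le> d" using t by (simp add: monomials_def Defs.deg_def)
    then have "int (deg p) + 2 * int (deg (?v $ i)) \<le> 2 * int k" using deg_le_half_deg[of p] assms(2) by linarith
    then have "deg (p * (?v $ i * ?v $ i)) \<le> 2 * k"
      using deg_mult[of p "?v $ i * ?v $ i"] deg_mult[of "?v $ i" "?v $ i"] by linarith
    ultimately show ?thesis using assms(1) polysD(4) by simp
  qed
  show "p * gram_poly ?v (1\<^sub>m (dim_vec ?v)) \<in> polys N"
    unfolding gram_poly_one sum_distrib_left using * by (intro subring_on_sum[OF subring_on_polys]) simp
  show "deg (p * gram_poly ?v (1\<^sub>m (dim_vec ?v))) \<le> 2 * k"
    unfolding gram_poly_one sum_distrib_left using * by (intro deg_sum) simp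
qed

text \<open>The ball constraint and the sphere equation have degree at most 2, so
  \<open>half_deg\<close> is at most 1 and their multiples by \<open>p * p\<close> with
  \<open>Suc (deg p) \<le> k\<close> are admissible. After subtraction of the identity Gram matrices
  the objective still has degree at most \<open>2 k\<close>, hence is bounded within the
  cone.\<close>

theorem slater_holds:
  assumes f: "f \<in> polys n" and g: "set g \<subseteq> polys n" and l: "l < length g"
    and ball: "0 < R" "g ! l = Const R - (\<Sum>i<n. (Var i)\<^sup>2)" and k: "1 \<le> k" "deg f \<le> 2 * k"
  shows "slater (n + length g + 1) k f g (h_FJ n f g)"
proof -
  define N where "N = n + length g + 1"
  define h where "h = h_FJ n f g"
  define K where "K = sdp_cone N k g h"
  have f': "f \<in> polys N" and g': "set g \<subseteq> polys N" using f g polys_subset[of n N] by (auto simp: N_def)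
  have dl: "half_deg (g ! l) \<le> 1" unfolding ball(2)
    by (intro half_deg_le_1 deg_diff deg_sum deg_Var_square) simp
  obtain r where r: "r < length h" "h ! r = 1 - (\<Sum>j\<le>length g. (Var (n + j))\<^sup>2)"
    using h_FJ_members(3)[of n g f] unfolding in_set_conv_nth h_def by blast
  have dr: "half_deg (h ! r) \<le> 1" unfolding r(2)
    by (intro half_deg_le_1 deg_diff deg_sum deg_Var_square) simp
  have bound: "\<exists>C\<ge>0. Const C * (p * p) - (Var i * p) * (Var i * p) \<in> sdp_cone N k g h"
    if i: "i < N" and p: "p \<in> polys N" "Suc (deg p) \<le> k" for i p
  proof -
    have add: "a + b \<in> K" if "a \<in> K" "b \<in> K" for a b using that unfolding K_def by (rule sdp_cone_add)
    have 0: "0 \<in> K" using sdp_cone_square[of 0 N k g h] polysD(1) by (simp add: K_def)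
    have sum: "(\<Sum>i\<in>A. q i) \<in> K" if "\<And>i. i \<in> A \<Longrightarrow> q i \<in> K" for A :: "nat set" and q
      using that by (induction A rule: infinite_finite_induct) (auto simp: 0 add)
    have sq: "(Var j)\<^sup>2 * (p * p) \<in> K" if j: "j < N" for j
    proof -
      have "deg (Var j) \<le> 1" unfolding deg_le_iff by (simp add: Var_def mono_deg_def)
      then have "deg (Var j * p) \<le> k" using deg_mult[of "Var j" p] p(2) by linarith
      then have "(Var j * p) * (Var j * p) \<in> K"
        unfolding K_def by (intro sdp_cone_square polysD Var_in_polys j p)
      then show ?thesis by (simp add: power2_eq_square mult_ac)
    qed
    show ?thesis
    proof (cases "i < n")
      case True
      have "p * p * g ! l \<in> K" unfolding K_def using p dl by (intro sdp_cone_generator l) auto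
      then have "p * p * g ! l + (\<Sum>j\<in>{..<n} - {i}. (Var j)\<^sup>2 * (p * p)) \<in> K"
        by (intro add sum sq) (auto simp: N_def)
      also have "p * p * g ! l + (\<Sum>j\<in>{..<n} - {i}. (Var j)\<^sup>2 * (p * p)) = Const R * (p * p) - (Var i * p) * (Var i * p)"
        unfolding ball(2) sum_distrib_right[symmetric]
        using True sum.remove[of "{..<n}" i "\<lambda>j. (Var j)\<^sup>2"] by (simp add: power2_eq_square algebra_simps)
      finally show ?thesis using ball(1) by (intro exI[of _ R]) (simp add: K_def)
    next
      case False
      define j where "j = i - n"
      have j: "i = n + j" "j \<le> length g" using False i by (auto simp: j_def N_def)
      have "deg (p * p) + 2 \<le> 2 * k" using deg_mult[of p p] p(2) by linarith
      then have "int (deg (p * p)) + 2 \<le> 2 * int k" by linarith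
      then have "int (deg (p * p)) \<le> 2 * (int k - half_deg (h ! r))" using dr by (simp add: algebra_simps)
      then have "p * p * h ! r \<in> K" unfolding K_def by (intro sdp_cone_ideal polysD p r)
      then have "p * p * h ! r + (\<Sum>k\<in>{..length g} - {j}. (Var (n + k))\<^sup>2 * (p * p)) \<in> K"
        by (intro add sum sq) (auto simp: N_def)
      also have "p * p * h ! r + (\<Sum>k\<in>{..length g} - {j}. (Var (n + k))\<^sup>2 * (p * p)) = Const 1 * (p * p) - (Var i * p) * (Var i * p)"
        unfolding r(2) sum_distrib_right[symmetric]
        using j sum.remove[of "{..length g}" j "\<lambda>k. (Var (n + k))\<^sup>2"] by (simp add: power2_eq_square algebra_simps)
      finally show ?thesis by (intro exI[of _ 1]) (simp add: K_def)
    qed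
  qed
  let ?w = "\<lambda>j. mono_vec N (int k - half_deg (g ! j))"
  define P where "P = f - gram_poly (mono_vec N (int k)) (1\<^sub>m (dim_vec (mono_vec N (int k))))
      - (\<Sum>j<length g. g ! j * gram_poly (?w j) (1\<^sub>m (dim_vec (?w j))))"
  have one: "half_deg 1 = 0" by (simp add: half_deg_def)
  have g0: "gram_poly (mono_vec N (int k)) (1\<^sub>m (dim_vec (mono_vec N (int k)))) \<in> polys N"
    "deg (gram_poly (mono_vec N (int k)) (1\<^sub>m (dim_vec (mono_vec N (int k))))) \<le> 2 * k"
    using gram_one_polys[OF polysD(2), of "int k" k N] by (simp_all add: one)
  have gj: "g ! j * gram_poly (?w j) (1\<^sub>m (dim_vec (?w j))) \<in> polys N"
    "deg (g ! j * gram_poly (?w j) (1\<^sub>m (dim_vec (?w j)))) \<le> 2 * k" if j: "j < length g" for j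
  proof -
    have "g ! j \<in> polys N" using g' nth_mem[OF j] by blast
    then show "g ! j * gram_poly (?w j) (1\<^sub>m (dim_vec (?w j))) \<in> polys N"
      "deg (g ! j * gram_poly (?w j) (1\<^sub>m (dim_vec (?w j)))) \<le> 2 * k"
      using gram_one_polys[of "g ! j" N "int k - half_deg (g ! j)" k] by simp_all
  qed
  have "P \<in> polys N" unfolding P_def by (intro polysD(6) subring_on_sum[OF subring_on_polys] f' g0 gj) simp
  moreover have "deg P \<le> 2 * k" unfolding P_def by (intro deg_diff deg_sum k g0 gj) simp
  ultimately obtain C where "P + Const C \<in> sdp_cone N k g h" using poly_bounded[OF bound] by blast
  then have "slater N k f g h" unfolding P_def by (rule slater_if_bounded)
  then show ?thesis by (simp add: N_def h_def)
qed

theorem theorem3: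
  fixes n m :: nat and f :: rpoly and g :: "rpoly list"
  assumes "n \<ge> 1" and "m \<ge> 1"
    and "f \<in> polys n" and "length g = m" and "\<forall>j<m. g ! j \<in> polys n"
    and "\<exists>x\<in>feasible_set n g. \<forall>y\<in>feasible_set n g. peval f x \<le> peval f y"
    and "finite (peval f ` critical_set n g)"
  shows "(\<exists>k. rho (n + m + 1) k f (products g) (h_FJ n f g) = opt_value n f g)
       \<and> (archimedean n g \<longrightarrow>
            (\<exists>k. rho (n + m + 1) k f g (h_FJ n f g) = opt_value n f g))
       \<and> ((\<exists>R>0. g ! (m - 1) = Const R - (\<Sum>i<n. (Var i)\<^sup>2)) \<longrightarrow>
            (\<forall>\<^sub>F k in sequentially. slater (n + m + 1) k f g (h_FJ n f g)))"
proof -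
  have g: "set g \<subseteq> polys n" using assms(4,5) by (auto simp: in_set_conv_nth)
  obtain x where x: "x \<in> feasible_set n g" "\<And>y. y \<in> feasible_set n g \<Longrightarrow> peval f x \<le> peval f y"
    using assms(6) by blast
  note exact = exact_relaxations[OF assms(3) g assms(7) x, unfolded assms(4)]
  have "\<forall>\<^sub>F k in sequentially. slater (n + m + 1) k f g (h_FJ n f g)"
    if ball: "\<exists>R>0. g ! (m - 1) = Const R - (\<Sum>i<n. (Var i)\<^sup>2)"
  proof -
    obtain R where R: "0 < R" "g ! (m - 1) = Const R - (\<Sum>i<n. (Var i)\<^sup>2)" using ball by blast
    have "m - 1 < length g" using assms(2,4) by simp
    from slater_holds[OF assms(3) g this R, unfolded assms(4)] show ?thesis
      by (intro eventually_sequentiallyI[of "max 1 (deg f)"]) simp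
  qed
  with exact show ?thesis by blast
qed

end
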